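(* Let $M$ be a Riemannian manifold, $f:M\to M$ a $C^1$ map and $\Lambda\subset M$ an isolated repeller such that $f|_\Lambda$ is topologically mixing. Let $\Phi=\{\varphi_n\}$ be an almost additive sequence of potentials (for $f|_\Lambda$) satisfying the bounded distortion condition and let $\mu_\Phi$ be the unique equilibrium state for $f|_\Lambda$ with respect to $\Phi$. If $\Psi=\{\psi_n\}$ is an almost additive sequence of potentials satisfying the bounded distortion condition, then the following large deviations principle holds: for every closed set $F\subset\mathbb{R}$, $$\limsup_{n\to\infty}\frac1n\log\mu_\Phi\Big(\Big\{x\in \Lambda:\frac1n\psi_n(x)\in F\Big\}\Big)\le-\inf_{s\in F}I_{f,\Phi,\Psi}(s),$$ and for every open set $E\subset\mathbb{R}$, $$\liminf_{n\to\infty}\frac1n\log\mu_\Phi\Big(\Big\{x\in \Lambda:\frac1n\psi_n(x)\in E\Big\}\Big)\ge-\inf_{s\in E}I_{f,\Phi,\Psi}(s).$$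
   Context: Isolated repeller: $\Lambda\subset M$ is compact, $f(\Lambda)=\Lambda$, there are $C>0$, $\lambda>1$ with $\|Df^n(x)v\|\ge C\lambda^n\|v\|$ for all $x\in\Lambda$, $v\in T_xM$, $n\ge1$, and $\Lambda=\bigcap_{n\ge0}f^{-n}(U)$ for some open neighborhood $U$ of $\Lambda$. $f$ also denotes $f|_\Lambda$, $\mathcal{M}_1(f)$ is the set of $f|_\Lambda$-invariant Borel probabilities on $\Lambda$, $h_\eta(f)$ is metric entropy, $S_n g=\sum_{j=0}^{n-1}g\circ f^j$. A sequence $\Phi=\{\varphi_n\}\subset C(\Lambda,\mathbb{R})$ is almost additive if there is $C>0$ with $\varphi_m+\varphi_n\circ f^m-C\le\varphi_{m+n}\le\varphi_m+\varphi_n\circ f^m+C$ for all $m,n\ge1$. With $B(x,n,\delta)=\{y: d(f^j(y),f^j(x))\le\delta,\ 0\le j\le n\}$ and $\gamma_n(\Phi,\delta)=\sup\{|\varphi_n(y)-\varphi_n(z)|: y,z\in B(x,n,\delta),\ x\in\Lambda\}$, $\Phi$ satisfies the bounded distortion condition if there are $A,\delta>0$ with $\sup_n\gamma_n(\Phi,\delta)\le A$. For $\eta\in\mathcal{M}_1(f)$, $\mathcal{F}_*(\Phi,\eta)=\lim_n\frac1n\int\varphi_n\,d\eta$; $P_{\mathrm{top}}(f,\Phi)=\sup_{\eta\in\mathcal{M}_1(f)}\{h_\eta(f)+\mathcal{F}_*(\Phi,\eta)\}$; an equilibrium state attains this supremum; for almost additive $\Phi$ with bounded distortion it is known to be unique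 and denoted $\mu_\Phi$. $\Phi+t\Psi$ is the termwise combination. Rate function. Fix $\alpha\in(0,1)$. An admissible family for $\Psi$ is a family $\{g_\varepsilon\}_{\varepsilon\in(0,1)}$ of $\alpha$-Hölder functions on $\Lambda$ with $\limsup_n\frac1n\|\psi_n-S_ng_\varepsilon\|_\infty<\varepsilon$ for all $\varepsilon$; $\Psi$ is cohomologous to a constant if it has an admissible family with each $g_\varepsilon$ ($\varepsilon$ small) of the form $u_\varepsilon\circ f-u_\varepsilon+c_\varepsilon$, $u_\varepsilon$ continuous, $c_\varepsilon$ constant. If $\Psi$ is not cohomologous to a constant, admissible families for $\Psi$ are taken with $g_\varepsilon$ not of this form for all small $\varepsilon$. For functions $\varphi,g$ let $\mathcal{E}_{f,\varphi,g}(t)=P_{\mathrm{top}}(f,\varphi+tg)-P_{\mathrm{top}}(f,\varphi)$ (usual pressures) and $I_{f,\varphi,g}(s)=\sup_{t\in\mathbb{R}}(st-\mathcal{E}_{f,\varphi,g}(t))$. Let $J_{\Phi,\Psi}$ be the (possibly empty) open interval $\big(\inf_{t\in\mathbb{R}}\mathcal{F}_*(\Psi,\mu_{\Phi+t\Psi}),\sup_{t\in\mathbb{R}}\mathcal{F}_*(\Psi,\mu_{\Phi+t\Psi})\big)$; it is empty exactly when $\Psi$ is cohomologous to a constant. For $s\in J_{\Phi,\Psi}$, $I_{f,\Phi,\Psi}(s)=\lim_{\varepsilon\to0}I_{f,\varphi_\varepsilon,g_\varepsilon}(s)$, with $\{\varphi_\varepsilon\}$, $\{g_\varepsilon\}$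 admissible for $\Phi$, $\Psi$ (the limit exists and is independent of the families), and on $J_{\Phi,\Psi}$ it is known that $$I_{f,\Phi,\Psi}(s)=\inf\{P_{\mathrm{top}}(f,\Phi)-h_\eta(f)-\mathcal{F}_*(\Phi,\eta):\eta\in\mathcal{M}_1(f),\ \mathcal{F}_*(\Psi,\eta)=s\}.$$ For $s\in\mathbb{R}\setminus J_{\Phi,\Psi}$, $I_{f,\Phi,\Psi}(s)$ is defined by this same formula, with $\inf\emptyset=+\infty$. *)

theory Defs
  imports "HOL-Probability.Probability_Measure"
begin

section \<open>Riemannian manifolds in local coordinates\<close>

text \<open>
  The manifold is the whole type \<open>'m\<close>, modelled on a Euclidean space \<open>'e\<close>. A chart is a pair of
  its domain and its coordinate map; the values of the coordinate map outside the domain are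
  irrelevant. A tangent vector at \<open>x\<close> is given by its coordinate vector in a chart around \<open>x\<close>.
\<close>

type_synonym ('m, 'e) chart = "'m set \<times> ('m \<Rightarrow> 'e)"

definition chart_inv :: "('m, 'e) chart \<Rightarrow> 'e \<Rightarrow> 'm" where
  "chart_inv c = inv_into (fst c) (snd c)"

text \<open>The class \<open>C\<^sup>k\<close> on an open set \<open>S\<close>.\<close>

primrec Ck_on :: "nat \<Rightarrow> 'a::real_normed_vector set \<Rightarrow> ('a \<Rightarrow> 'b::real_normed_vector) \<Rightarrow> bool" where
  "Ck_on 0 S h \<longleftrightarrow> continuous_on S h"
| "Ck_on (Suc k) S h \<longleftrightarrow>
     (\<forall>p\<in>S. h differentiable (at p)) \<and> (\<forall>v. Ck_on k S (\<lambda>p. frechet_derivative h (at p) v))"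

definition smooth_on :: "'a::real_normed_vector set \<Rightarrow> ('a \<Rightarrow> 'b::real_normed_vector) \<Rightarrow> bool" where
  "smooth_on S h \<longleftrightarrow> (\<forall>k. Ck_on k S h)"

text \<open>The differential of \<open>f\<close> at \<open>x\<close>, read in a chart \<open>c\<close> around \<open>x\<close> and a chart \<open>c'\<close> around \<open>f x\<close>.\<close>

definition local_deriv ::
  "('m, 'e::euclidean_space) chart \<Rightarrow> ('m, 'e) chart \<Rightarrow> ('m \<Rightarrow> 'm) \<Rightarrow> 'm \<Rightarrow> 'e \<Rightarrow> 'e" where
  "local_deriv c c' f x = frechet_derivative (snd c' \<circ> f \<circ> chart_inv c) (at (snd c x))"

locale riemannian_manifold =
  fixes A :: "('m::{t2_space, second_countable_topology}, 'e::euclidean_space) chart set"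
    and g :: "('m, 'e) chart \<Rightarrow> 'm \<Rightarrow> 'e \<Rightarrow> 'e \<Rightarrow> real"
  assumes cover: "(\<Union>c\<in>A. fst c) = UNIV"
    and chart_open: "c \<in> A \<Longrightarrow> open (fst c)" "c \<in> A \<Longrightarrow> open (snd c ` fst c)"
    and chart_homeomorphism:
      "c \<in> A \<Longrightarrow> homeomorphism (fst c) (snd c ` fst c) (snd c) (chart_inv c)"
    and transition_smooth:
      "c \<in> A \<Longrightarrow> c' \<in> A \<Longrightarrow> smooth_on (snd c ` (fst c \<inter> fst c')) (snd c' \<circ> chart_inv c)"
    and metric_bilinear: "c \<in> A \<Longrightarrow> x \<in> fst c \<Longrightarrow> bilinear (g c x)"
    and metric_sym: "c \<in> A \<Longrightarrow> x \<in> fst c \<Longrightarrow> g c x v w = g c x w v"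
    and metric_pos: "c \<in> A \<Longrightarrow> x \<in> fst c \<Longrightarrow> v \<noteq> 0 \<Longrightarrow> g c x v v > 0"
    and metric_smooth: "c \<in> A \<Longrightarrow> smooth_on (snd c ` fst c) (\<lambda>p. g c (chart_inv c p) v w)"
    and metric_transform:
      "c \<in> A \<Longrightarrow> c' \<in> A \<Longrightarrow> x \<in> fst c \<Longrightarrow> x \<in> fst c' \<Longrightarrow>
         g c x v w = g c' x (local_deriv c c' id x v) (local_deriv c c' id x w)"

definition tangent_norm ::
  "(('m, 'e) chart \<Rightarrow> 'm \<Rightarrow> 'e \<Rightarrow> 'e \<Rightarrow> real) \<Rightarrow> ('m, 'e) chart \<Rightarrow> 'm \<Rightarrow> 'e \<Rightarrow> real" where
  "tangent_norm g c x v = sqrt (g c x v v)"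

definition C1_map ::
  "('m::topological_space, 'e::euclidean_space) chart set \<Rightarrow> ('m \<Rightarrow> 'm) \<Rightarrow> bool" where
  "C1_map A f \<longleftrightarrow> continuous_on UNIV f \<and>
     (\<forall>c\<in>A. \<forall>c'\<in>A. Ck_on 1 (snd c ` (fst c \<inter> f -` fst c')) (snd c' \<circ> f \<circ> chart_inv c))"

text \<open>
  As in \<open>piecewise_C1_differentiable_on\<close>, the curve is continuous and \<open>C\<^sup>1\<close> off a finite set of
  parameters. No one-sided derivatives are required there, which does not change the infimum of
  the lengths.
\<close>

definition piecewise_C1_curve ::
  "('m::topological_space, 'e::euclidean_space) chart set \<Rightarrow> (real \<Rightarrow> 'm) \<Rightarrow> bool" where
  "piecewise_C1_curve A \<gamma> \<longleftrightarrow> path \<gamma> \<and>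
     (\<exists>S. finite S \<and> (\<forall>c\<in>A. (snd c \<circ> \<gamma>) C1_differentiable_on ({t\<in>{0..1}. \<gamma> t \<in> fst c} - S)))"

definition speed ::
  "('m, 'e::euclidean_space) chart set \<Rightarrow> (('m, 'e) chart \<Rightarrow> 'm \<Rightarrow> 'e \<Rightarrow> 'e \<Rightarrow> real)
     \<Rightarrow> (real \<Rightarrow> 'm) \<Rightarrow> real \<Rightarrow> real" where
  "speed A g \<gamma> t = (let c = (SOME c. c \<in> A \<and> \<gamma> t \<in> fst c)
     in tangent_norm g c (\<gamma> t) (vector_derivative (snd c \<circ> \<gamma>) (at t)))"

definition curve_length ::
  "('m, 'e::euclidean_space) chart set \<Rightarrow> (('m, 'e) chart \<Rightarrow> 'm \<Rightarrow> 'e \<Rightarrow> 'e \<Rightarrow> real)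
     \<Rightarrow> (real \<Rightarrow> 'm) \<Rightarrow> ennreal" where
  "curve_length A g \<gamma> = (\<integral>\<^sup>+t\<in>{0..1}. ennreal (speed A g \<gamma> t) \<partial>lborel)"

text \<open>The manifold need not be connected; points in different components have distance \<open>\<infinity>\<close>.\<close>

definition riemannian_dist ::
  "('m::topological_space, 'e::euclidean_space) chart set
     \<Rightarrow> (('m, 'e) chart \<Rightarrow> 'm \<Rightarrow> 'e \<Rightarrow> 'e \<Rightarrow> real) \<Rightarrow> 'm \<Rightarrow> 'm \<Rightarrow> ennreal" where
  "riemannian_dist A g x y =
     Inf {curve_length A g \<gamma> | \<gamma>. piecewise_C1_curve A \<gamma> \<and> pathstart \<gamma> = x \<and> pathfinish \<gamma> = y}"


section \<open>Repellers and mixing\<close>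

definition isolated_repeller ::
  "('m::topological_space, 'e::euclidean_space) chart set
     \<Rightarrow> (('m, 'e) chart \<Rightarrow> 'm \<Rightarrow> 'e \<Rightarrow> 'e \<Rightarrow> real) \<Rightarrow> ('m \<Rightarrow> 'm) \<Rightarrow> 'm set \<Rightarrow> bool" where
  "isolated_repeller A g f \<Lambda> \<longleftrightarrow>
     \<Lambda> \<noteq> {} \<and> compact \<Lambda> \<and> f ` \<Lambda> = \<Lambda> \<and>
     (\<exists>C>0. \<exists>l>1. \<forall>x\<in>\<Lambda>. \<forall>n\<ge>1. \<forall>c\<in>A. \<forall>c'\<in>A. x \<in> fst c \<longrightarrow> (f ^^ n) x \<in> fst c' \<longrightarrow>
        (\<forall>v. tangent_norm g c' ((f ^^ n) x) (local_deriv c c' (f ^^ n) x v)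
               \<ge> C * l ^ n * tangent_norm g c x v)) \<and>
     (\<exists>U. open U \<and> \<Lambda> \<subseteq> U \<and> \<Lambda> = (\<Inter>n. (f ^^ n) -` U))"

definition topologically_mixing_on :: "'m::topological_space set \<Rightarrow> ('m \<Rightarrow> 'm) \<Rightarrow> bool" where
  "topologically_mixing_on \<Lambda> f \<longleftrightarrow>
     (\<forall>U V. openin (top_of_set \<Lambda>) U \<and> U \<noteq> {} \<and> openin (top_of_set \<Lambda>) V \<and> V \<noteq> {} \<longrightarrow>
        (\<exists>N. \<forall>n\<ge>N. (f ^^ n) ` U \<inter> V \<noteq> {}))"


section \<open>Invariant measures and metric entropy\<close>

definition invariant_measures :: "('m::topological_space \<Rightarrow> 'm) \<Rightarrow> 'm set \<Rightarrow> 'm measure set" where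
  "invariant_measures f \<Lambda> =
     {\<eta>. prob_space \<eta> \<and> space \<eta> = \<Lambda> \<and> sets \<eta> = sets (restrict_space borel \<Lambda>) \<and>
         f \<in> measurable \<eta> \<eta> \<and> distr \<eta> \<eta> f = \<eta>}"

definition finite_partition :: "'m measure \<Rightarrow> 'm set set \<Rightarrow> bool" where
  "finite_partition \<eta> P \<longleftrightarrow> finite P \<and> P \<subseteq> sets \<eta> \<and> partition_on (space \<eta>) P"

text \<open>The join of \<open>f\<^sup>-\<^sup>j P\<close> for \<open>j < n\<close>; it may contain the empty set, which carries no entropy.\<close>

definition iterated_join :: "('m \<Rightarrow> 'm) \<Rightarrow> 'm measure \<Rightarrow> 'm set set \<Rightarrow> nat \<Rightarrow> 'm set set" where
  "iterated_join f \<eta> P n = {{x \<in> space \<eta>. \<forall>j<n. (f ^^ j) x \<in> a j} | a. \<forall>j<n. a j \<in> P}"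

definition partition_entropy :: "'m measure \<Rightarrow> 'm set set \<Rightarrow> real" where
  "partition_entropy \<eta> P = (\<Sum>B\<in>P. - measure \<eta> B * ln (measure \<eta> B))"

definition metric_entropy :: "('m \<Rightarrow> 'm) \<Rightarrow> 'm measure \<Rightarrow> ereal" where
  "metric_entropy f \<eta> = (SUP P\<in>{P. finite_partition \<eta> P}.
     ereal (lim (\<lambda>n. partition_entropy \<eta> (iterated_join f \<eta> P n) / real n)))"


section \<open>Almost additive sequences\<close>

text \<open>Sequences of potentials are indexed by \<open>n \<ge> 1\<close>; the term of index \<open>0\<close> is never used.\<close>

definition birkhoff_sum :: "('m \<Rightarrow> 'm) \<Rightarrow> nat \<Rightarrow> ('m \<Rightarrow> real) \<Rightarrow> 'm \<Rightarrow> real" where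
  "birkhoff_sum f n \<phi> x = (\<Sum>j<n. \<phi> ((f ^^ j) x))"

definition almost_additive ::
  "('m::topological_space \<Rightarrow> 'm) \<Rightarrow> 'm set \<Rightarrow> (nat \<Rightarrow> 'm \<Rightarrow> real) \<Rightarrow> bool" where
  "almost_additive f \<Lambda> \<Phi> \<longleftrightarrow>
     (\<forall>n\<ge>1. continuous_on \<Lambda> (\<Phi> n)) \<and>
     (\<exists>C>0. \<forall>m\<ge>1. \<forall>n\<ge>1. \<forall>x\<in>\<Lambda>.
        \<Phi> m x + \<Phi> n ((f ^^ m) x) - C \<le> \<Phi> (m + n) x \<and>
        \<Phi> (m + n) x \<le> \<Phi> m x + \<Phi> n ((f ^^ m) x) + C)"

definition bowen_ball ::
  "('m \<Rightarrow> 'm \<Rightarrow> ennreal) \<Rightarrow> ('m \<Rightarrow> 'm) \<Rightarrow> 'm set \<Rightarrow> 'm \<Rightarrow> nat \<Rightarrow> real \<Rightarrow> 'm set" where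
  "bowen_ball d f \<Lambda> x n \<delta> = {y\<in>\<Lambda>. \<forall>j\<le>n. d ((f ^^ j) y) ((f ^^ j) x) \<le> ennreal \<delta>}"

definition distortion ::
  "('m \<Rightarrow> 'm \<Rightarrow> ennreal) \<Rightarrow> ('m \<Rightarrow> 'm) \<Rightarrow> 'm set \<Rightarrow> (nat \<Rightarrow> 'm \<Rightarrow> real) \<Rightarrow> nat \<Rightarrow> real \<Rightarrow> ereal"
where
  "distortion d f \<Lambda> \<Phi> n \<delta> =
     Sup {ereal \<bar>\<Phi> n y - \<Phi> n z\<bar> | x y z.
            x \<in> \<Lambda> \<and> y \<in> bowen_ball d f \<Lambda> x n \<delta> \<and> z \<in> bowen_ball d f \<Lambda> x n \<delta>}"

definition bounded_distortion ::
  "('m \<Rightarrow> 'm \<Rightarrow> ennreal) \<Rightarrow> ('m \<Rightarrow> 'm) \<Rightarrow> 'm set \<Rightarrow> (nat \<Rightarrow> 'm \<Rightarrow> real) \<Rightarrow> bool" where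
  "bounded_distortion d f \<Lambda> \<Phi> \<longleftrightarrow>
     (\<exists>K>0. \<exists>\<delta>>0. (SUP n\<in>{1..}. distortion d f \<Lambda> \<Phi> n \<delta>) \<le> ereal K)"

definition mean_value :: "(nat \<Rightarrow> 'm \<Rightarrow> real) \<Rightarrow> 'm measure \<Rightarrow> real" where
  "mean_value \<Phi> \<eta> = lim (\<lambda>n. (\<integral>x. \<Phi> n x \<partial>\<eta>) / real n)"

definition Ptop ::
  "('m::topological_space \<Rightarrow> 'm) \<Rightarrow> 'm set \<Rightarrow> (nat \<Rightarrow> 'm \<Rightarrow> real) \<Rightarrow> ereal" where
  "Ptop f \<Lambda> \<Phi> = (SUP \<eta>\<in>invariant_measures f \<Lambda>. metric_entropy f \<eta> + ereal (mean_value \<Phi> \<eta>))"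

definition equilibrium_state ::
  "('m::topological_space \<Rightarrow> 'm) \<Rightarrow> 'm set \<Rightarrow> (nat \<Rightarrow> 'm \<Rightarrow> real) \<Rightarrow> 'm measure \<Rightarrow> bool" where
  "equilibrium_state f \<Lambda> \<Phi> \<eta> \<longleftrightarrow> \<eta> \<in> invariant_measures f \<Lambda> \<and>
     metric_entropy f \<eta> + ereal (mean_value \<Phi> \<eta>) = Ptop f \<Lambda> \<Phi>"

definition the_equilibrium_state ::
  "('m::topological_space \<Rightarrow> 'm) \<Rightarrow> 'm set \<Rightarrow> (nat \<Rightarrow> 'm \<Rightarrow> real) \<Rightarrow> 'm measure" where
  "the_equilibrium_state f \<Lambda> \<Phi> = (THE \<eta>. equilibrium_state f \<Lambda> \<Phi> \<eta>)"

definition seq_comb ::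
  "(nat \<Rightarrow> 'm \<Rightarrow> real) \<Rightarrow> real \<Rightarrow> (nat \<Rightarrow> 'm \<Rightarrow> real) \<Rightarrow> nat \<Rightarrow> 'm \<Rightarrow> real" where
  "seq_comb \<Phi> t \<Psi> = (\<lambda>n x. \<Phi> n x + t * \<Psi> n x)"


section \<open>Admissible families and the rate function\<close>

text \<open>
  \<open>\<Lambda>\<close> may meet several components of the manifold, but by compactness only finitely many, so that
  for continuous functions nothing is lost by comparing only points at finite distance.
\<close>

definition holder_on ::
  "('m \<Rightarrow> 'm \<Rightarrow> ennreal) \<Rightarrow> real \<Rightarrow> 'm set \<Rightarrow> ('m \<Rightarrow> real) \<Rightarrow> bool" where
  "holder_on d \<alpha> \<Lambda> u \<longleftrightarrow>
     (\<exists>K. \<forall>x\<in>\<Lambda>. \<forall>y\<in>\<Lambda>. d x y < \<infinity> \<longrightarrow> \<bar>u x - u y\<bar> \<le> K * enn2real (d x y) powr \<alpha>)"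

definition approximating_family ::
  "real \<Rightarrow> ('m \<Rightarrow> 'm \<Rightarrow> ennreal) \<Rightarrow> ('m \<Rightarrow> 'm) \<Rightarrow> 'm set \<Rightarrow> (nat \<Rightarrow> 'm \<Rightarrow> real)
     \<Rightarrow> (real \<Rightarrow> 'm \<Rightarrow> real) \<Rightarrow> bool" where
  "approximating_family \<alpha> d f \<Lambda> \<Psi> G \<longleftrightarrow>
     (\<forall>\<epsilon>\<in>{0<..<1}. holder_on d \<alpha> \<Lambda> (G \<epsilon>) \<and>
        limsup (\<lambda>n. ereal (1 / real n) * (SUP x\<in>\<Lambda>. ereal \<bar>\<Psi> n x - birkhoff_sum f n (G \<epsilon>) x\<bar>))
          < ereal \<epsilon>)"

definition coboundary_plus_constant ::
  "('m::topological_space \<Rightarrow> 'm) \<Rightarrow> 'm set \<Rightarrow> ('m \<Rightarrow> real) \<Rightarrow> bool" where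
  "coboundary_plus_constant f \<Lambda> h \<longleftrightarrow>
     (\<exists>u k. continuous_on \<Lambda> u \<and> (\<forall>x\<in>\<Lambda>. h x = u (f x) - u x + k))"

definition cohomologous_to_constant ::
  "real \<Rightarrow> ('m::topological_space \<Rightarrow> 'm \<Rightarrow> ennreal) \<Rightarrow> ('m \<Rightarrow> 'm) \<Rightarrow> 'm set
     \<Rightarrow> (nat \<Rightarrow> 'm \<Rightarrow> real) \<Rightarrow> bool" where
  "cohomologous_to_constant \<alpha> d f \<Lambda> \<Psi> \<longleftrightarrow>
     (\<exists>G. approximating_family \<alpha> d f \<Lambda> \<Psi> G \<and>
          (\<forall>\<^sub>F \<epsilon> in at_right 0. coboundary_plus_constant f \<Lambda> (G \<epsilon>)))"

definition admissible_family ::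
  "real \<Rightarrow> ('m::topological_space \<Rightarrow> 'm \<Rightarrow> ennreal) \<Rightarrow> ('m \<Rightarrow> 'm) \<Rightarrow> 'm set
     \<Rightarrow> (nat \<Rightarrow> 'm \<Rightarrow> real) \<Rightarrow> (real \<Rightarrow> 'm \<Rightarrow> real) \<Rightarrow> bool" where
  "admissible_family \<alpha> d f \<Lambda> \<Psi> G \<longleftrightarrow>
     approximating_family \<alpha> d f \<Lambda> \<Psi> G \<and>
     (\<not> cohomologous_to_constant \<alpha> d f \<Lambda> \<Psi> \<longrightarrow>
        (\<forall>\<^sub>F \<epsilon> in at_right 0. \<not> coboundary_plus_constant f \<Lambda> (G \<epsilon>)))"

text \<open>The usual pressure of a single function, in its variational form.\<close>

definition pressure ::
  "('m::topological_space \<Rightarrow> 'm) \<Rightarrow> 'm set \<Rightarrow> ('m \<Rightarrow> real) \<Rightarrow> ereal" where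
  "pressure f \<Lambda> \<phi> = (SUP \<eta>\<in>invariant_measures f \<Lambda>. metric_entropy f \<eta> + ereal (\<integral>x. \<phi> x \<partial>\<eta>))"

definition free_energy ::
  "('m::topological_space \<Rightarrow> 'm) \<Rightarrow> 'm set \<Rightarrow> ('m \<Rightarrow> real) \<Rightarrow> ('m \<Rightarrow> real) \<Rightarrow> real \<Rightarrow> ereal" where
  "free_energy f \<Lambda> \<phi> h t = pressure f \<Lambda> (\<lambda>x. \<phi> x + t * h x) - pressure f \<Lambda> \<phi>"

definition function_rate ::
  "('m::topological_space \<Rightarrow> 'm) \<Rightarrow> 'm set \<Rightarrow> ('m \<Rightarrow> real) \<Rightarrow> ('m \<Rightarrow> real) \<Rightarrow> real \<Rightarrow> ereal" where
  "function_rate f \<Lambda> \<phi> h s = (SUP t. ereal (s * t) - free_energy f \<Lambda> \<phi> h t)"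

definition rate_interval ::
  "('m::topological_space \<Rightarrow> 'm) \<Rightarrow> 'm set \<Rightarrow> (nat \<Rightarrow> 'm \<Rightarrow> real) \<Rightarrow> (nat \<Rightarrow> 'm \<Rightarrow> real)
     \<Rightarrow> real set" where
  "rate_interval f \<Lambda> \<Phi> \<Psi> =
     {s. (INF t. ereal (mean_value \<Psi> (the_equilibrium_state f \<Lambda> (seq_comb \<Phi> t \<Psi>)))) < ereal s \<and>
         ereal s < (SUP t. ereal (mean_value \<Psi> (the_equilibrium_state f \<Lambda> (seq_comb \<Phi> t \<Psi>))))}"

definition rate_function ::
  "real \<Rightarrow> ('m::topological_space \<Rightarrow> 'm \<Rightarrow> ennreal) \<Rightarrow> ('m \<Rightarrow> 'm) \<Rightarrow> 'm set
     \<Rightarrow> (nat \<Rightarrow> 'm \<Rightarrow> real) \<Rightarrow> (nat \<Rightarrow> 'm \<Rightarrow> real) \<Rightarrow> real \<Rightarrow> ereal" where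
  "rate_function \<alpha> d f \<Lambda> \<Phi> \<Psi> s =
     (if s \<in> rate_interval f \<Lambda> \<Phi> \<Psi>
      then (THE L. \<forall>F G. admissible_family \<alpha> d f \<Lambda> \<Phi> F \<and> admissible_family \<alpha> d f \<Lambda> \<Psi> G \<longrightarrow>
              ((\<lambda>\<epsilon>. function_rate f \<Lambda> (F \<epsilon>) (G \<epsilon>) s) \<longlongrightarrow> L) (at_right 0))
      else (INF \<eta>\<in>{\<eta> \<in> invariant_measures f \<Lambda>. mean_value \<Psi> \<eta> = s}.
              Ptop f \<Lambda> \<Phi> - metric_entropy f \<eta> - ereal (mean_value \<Phi> \<eta>)))"

definition log_ereal :: "real \<Rightarrow> ereal" where
  "log_ereal p = (if p = 0 then - \<infinity> else ereal (ln p))"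

end

theory Submission
 imports Defs "HOL-Probability.Probability" "HOL-Real_Asymp.Real_Asymp"
begin

text \<open>
  Finitely many Lipschitz functions built from charts separate the points of \<open>\<Lambda>\<close> and give a metric
  for which \<open>f\<close> is open (by isolation and the inverse function argument), mixing and positively
  expansive (coordinate differences of nearby points grow in finitely many charts). Instead of
  Markov partitions, Bowen balls are used throughout: the entropy of an invariant measure is at most
  \<open>1/n\<close> times the entropy of any partition into pieces of \<open>n\<close>-Bowen balls, and the equilibrium states
  \<open>\<mu>\<^sub>t\<close> of \<open>\<Phi> + t\<Psi>\<close> are weak limits of orbit averages of weighted preimages of a point. They are
  ergodic Gibbs measures, which gives the variational principle and uniqueness.

  Comparing \<open>\<mu>\<^sub>t\<close> with \<open>\<mu>\<^sub>0\<close> on Bowen balls yields the exponential Chebyshev upper bound and, with the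
  ergodicity of \<open>\<mu>\<^sub>t\<close>, the lower bound at the slope of the pressure at \<open>t\<close>, both in terms of the Legendre
  transform of the pressure. Between two slopes this transform is the limit of the Legendre
  transforms of the Hoelder approximations; at an endpoint of the interval of slopes it is attained
  by a limit of the \<open>\<mu>\<^sub>t\<close>, because the entropy is upper semicontinuous, and beyond it is infinite.
\<close>

section \<open>Entropy of simple functions\<close>

text \<open>Every estimate on Bowen balls holds only up to a factor independent of \<open>n\<close>;
  logarithms are divided by \<open>n\<close> in the end, so almost additivity, distortion and the
  gaps of specification cost nothing in the limit. Uniqueness of equilibrium states does the work of
  differentiability of the pressure: a limit of the measures at parameters tending to
  \<open>t\<close> is an equilibrium state at \<open>t\<close>, so the slopes have no jumps and
  every number strictly between two slopes is a slope. The Riemannian distance may be infinite and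
  enters the hypotheses only through small neighbourhoods and Hoelder conditions; a continuous
  metric \<open>rh\<close> on the compact set replaces it, and a Lebesgue number carries the
  distortion hypothesis over. Between two slopes the rate function is a definite description over
  all admissible families, so besides computing the limit one has to produce such families, with
  members that are not coboundaries plus constants.\<close>

definition shannon :: "'a measure => ('a => 'b) => real" where
 "shannon M X = (\<Sum>v\<in>X ` space M. - measure M (X -` {v} \<inter> space M) * ln (measure M (X -` {v} \<inter> space M)))"

text \<open>A partition is recorded by a simple function naming the piece of each point. Joining the
  first \<open>n\<close> preimages then means listing the names along the orbit, and coarsening
  means composing with a function.\<close>

definition itinerary :: "('a => 'a) => ('a => 'b) => nat => 'a => 'b list" where
 "itinerary f X n x = map (%j. X ((f ^^ j) x)) [0..<n]"

context prob_space
begin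

lemma expectation_simple:
 fixes g :: "'b => real"
 assumes X: "simple_function M X"
 shows "expectation (%x. g (X x)) = (\<Sum>v\<in>X ` space M. prob (X -` {v} \<inter> space M) * g v)"
  and "integrable M (%x. g (X x))"
proof -
 have fin: "finite (X ` space M)" and ev: "!!v. X -` {v} \<inter> space M \<in> events"
  using simple_functionD[OF X] by auto
 have eq: "g (X x) = (\<Sum>v\<in>X ` space M. indicat_real (X -` {v} \<inter> space M) x * g v)"
  if "x \<in> space M" for x
 proof -
  have "(\<Sum>v\<in>X ` space M. indicat_real (X -` {v} \<inter> space M) x * g v)
    = (\<Sum>v\<in>X ` space M. if v = X x then g v else 0)"
   using that by (intro sum.cong) (auto simp: indicator_def)
  then show ?thesis using that fin by simp
 qed
 have int: "integrable M (%x. \<Sum>v\<in>X ` space M. indicat_real (X -` {v} \<inter> space M) x * g v)"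
  using ev by (intro Bochner_Integration.integrable_sum integrable_mult_left integrable_real_indicator)
   (auto simp: emeasure_eq_measure)
 show "integrable M (%x. g (X x))"
  using int by (subst Bochner_Integration.integrable_cong[OF refl eq])
 have "expectation (%x. g (X x))
   = expectation (%x. \<Sum>v\<in>X ` space M. indicat_real (X -` {v} \<inter> space M) x * g v)"
  using eq by (intro Bochner_Integration.integral_cong) auto
 also have "\<dots> = (\<Sum>v\<in>X ` space M. prob (X -` {v} \<inter> space M) * g v)"
  using ev by (subst Bochner_Integration.integral_sum)
   (auto simp: emeasure_eq_measure intro!: integrable_mult_left integrable_real_indicator sum.cong)
 finally show "expectation (%x. g (X x)) = \<dots>" .
qed

lemma sum_prob_simple:
 assumes X: "simple_function M X"
 shows "(\<Sum>v\<in>X ` space M. prob (X -` {v} \<inter> space M)) = 1"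
 using expectation_simple(1)[OF X, of "%_. 1"] by (simp add: prob_space)

lemma shannon_eq_expectation:
 assumes X: "simple_function M X"
 shows "shannon M X = expectation (%x. - ln (prob (X -` {X x} \<inter> space M)))"
 using expectation_simple(1)[OF X, of "%v. - ln (prob (X -` {v} \<inter> space M))"]
 by (simp add: shannon_def)

text \<open>Nonnegativity of relative entropy, from \<open>ln z <= z - 1\<close> at
  \<open>z = q v / p v\<close>. The total weight of \<open>q\<close> is left free and its excess
  over 1 stays on the right, because \<open>entropy_deficit\<close> reweights a probability by a
  set-dependent factor.\<close>

lemma shannon_gibbs_weighted:
 assumes X: "simple_function M X" and pos: "!!v. v \<in> X ` space M ==> 0 < q v"
 shows "shannon M X + (\<Sum>v\<in>X ` space M. prob (X -` {v} \<inter> space M) * ln (q v))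
  <= (\<Sum>v\<in>X ` space M. q v) - 1"
proof -
 let ?p = "%v. prob (X -` {v} \<inter> space M)"
 have le: "- ?p v * ln (?p v) + ?p v * ln (q v) <= q v - ?p v" if v: "v \<in> X ` space M" for v
 proof (cases "?p v = 0")
  case True then show ?thesis using pos[OF v] by simp
 next
  case False
  then have p: "?p v > 0" by (simp add: zero_less_measure_iff)
  have "ln (q v / ?p v) <= q v / ?p v - 1"
   using p pos[OF v] by (intro ln_le_minus_one) auto
  then have "?p v * ln (q v / ?p v) <= ?p v * (q v / ?p v - 1)"
   using p by (intro mult_left_mono) auto
  then show ?thesis using p pos[OF v] by (simp add: ln_div algebra_simps)
 qed
 have "shannon M X + (\<Sum>v\<in>X ` space M. ?p v * ln (q v))
   <= (\<Sum>v\<in>X ` space M. q v - ?p v)"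
  unfolding shannon_def sum.distrib[symmetric] using le by (intro sum_mono)
 then show ?thesis by (simp add: sum_subtractf sum_prob_simple[OF X])
qed

lemma shannon_gibbs:
 assumes X: "simple_function M X" and pos: "!!v. v \<in> X ` space M ==> 0 < q v"
  and le1: "(\<Sum>v\<in>X ` space M. q v) <= 1"
 shows "shannon M X <= expectation (%x. - ln (q (X x)))"
proof -
 have "shannon M X + (\<Sum>v\<in>X ` space M. prob (X -` {v} \<inter> space M) * ln (q v))
   <= (\<Sum>v\<in>X ` space M. q v) - 1"
  using pos by (rule shannon_gibbs_weighted[OF X])
 then show ?thesis
  using le1 expectation_simple(1)[OF X, of "%v. - ln (q v)"] by (simp add: sum_negf)
qed

lemma shannon_nonneg: "0 <= shannon M X"
proof -
 have "0 <= - p * ln p" if "0 <= p" "p <= 1" for p :: real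
  using that by (cases "p = 0") (auto simp: mult_nonneg_nonpos)
 then show ?thesis unfolding shannon_def by (intro sum_nonneg) auto
qed

text \<open>At each point the level set of \<open>X\<close> contains that of \<open>W\<close>, so
  \<open>- ln\<close> of its mass is no larger; integrating over the level sets of \<open>W\<close>
  compares the entropies.\<close>

lemma shannon_mono:
 assumes W: "simple_function M W" and X: "!!x. x \<in> space M ==> X x = h (W x)"
 shows "shannon M X <= shannon M W"
proof -
 have "simple_function M (%x. h (W x))" using simple_function_compose1[OF W] .
 then have sX: "simple_function M X" by (subst simple_function_cong[OF X])
 let ?pX = "%v. prob (X -` {v} \<inter> space M)" and ?pW = "%v. prob (W -` {v} \<inter> space M)"
 have "shannon M X = expectation (%x. - ln (?pX (X x)))" by (rule shannon_eq_expectation[OF sX])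
 also have "\<dots> = expectation (%x. - ln (?pX (h (W x))))"
  using X by (intro Bochner_Integration.integral_cong) auto
 also have "\<dots> = (\<Sum>v\<in>W ` space M. ?pW v * - ln (?pX (h v)))"
  by (rule expectation_simple(1)[OF W])
 also have "\<dots> <= (\<Sum>v\<in>W ` space M. ?pW v * - ln (?pW v))"
 proof (rule sum_mono)
  fix v assume v: "v \<in> W ` space M"
  have le: "?pW v <= ?pX (h v)"
   using X simple_functionD(2)[OF sX] by (intro finite_measure_mono) auto
  show "?pW v * - ln (?pX (h v)) <= ?pW v * - ln (?pW v)"
  proof (cases "?pW v = 0")
   case False
   then have "?pW v > 0" by (simp add: zero_less_measure_iff)
   then show ?thesis using le by (intro mult_left_mono) auto
  qed simp
 qed
 also have "\<dots> = shannon M W" by (simp add: shannon_def)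
 finally show ?thesis .
qed

lemma shannon_le_ln_card:
 assumes X: "simple_function M X" and V: "finite V" "X ` space M \<subseteq> V"
 shows "shannon M X <= ln (card V)"
proof -
 have "V \<noteq> {}" using V not_empty by auto
 then have c: "card V > 0" using V by (simp add: card_gt_0_iff)
 have "(\<Sum>v\<in>X ` space M. 1 / real (card V)) <= 1"
  using c card_mono[OF V] by (simp add: field_simps)
 then have "shannon M X <= expectation (%x. - ln (1 / real (card V)))"
  using c by (intro shannon_gibbs[OF X]) auto
 then show ?thesis using c by (simp add: prob_space ln_div)
qed

lemma prob_pair_pos:
 assumes "simple_function M W" "simple_function M X"
 shows "prob ((%x. (W x, X x)) -` {v} \<inter> space M) <= prob (W -` {fst v} \<inter> space M)"
  and "prob ((%x. (W x, X x)) -` {v} \<inter> space M) <= prob (X -` {snd v} \<inter> space M)"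
 using simple_functionD(2)[OF assms(1)] simple_functionD(2)[OF assms(2)]
 by (auto intro!: finite_measure_mono)

text \<open>The kernel \<open>q w v\<close> is a guess for the conditional probability of
  \<open>v\<close> given \<open>w\<close>. Relative entropy against the product of the law of
  \<open>W\<close> with this kernel shows that coding \<open>X\<close> by the guess costs at least
  its conditional entropy. Suitable choices of \<open>q\<close> give subadditivity and the
  prediction bound below.\<close>

lemma shannon_pair_kernel:
 fixes q :: "'b => 'c => real"
 assumes W: "simple_function M W" and X: "simple_function M X"
  and V: "finite V" "X ` space M \<subseteq> V"
  and pos: "!!w v. w \<in> W ` space M ==> v \<in> V ==> 0 <= q w v"
  and pos': "!!x. x \<in> space M ==> prob ((%x. (W x, X x)) -` {(W x, X x)} \<inter> space M) > 0 ==> 0 < q (W x) (X x)"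
  and le1: "!!w. w \<in> W ` space M ==> (\<Sum>v\<in>V. q w v) <= 1"
 shows "shannon M (%x. (W x, X x)) <= shannon M W + expectation (%x. - ln (q (W x) (X x)))"
proof -
 let ?Y = "%x. (W x, X x)"
 have Y: "simple_function M ?Y" using W X by (rule simple_function_Pair)
 let ?p = "%v. prob (?Y -` {v} \<inter> space M)" and ?pW = "%w. prob (W -` {w} \<inter> space M)"
 let ?R = "?Y ` space M"
 have fin: "finite ?R" "finite (W ` space M)" using simple_functionD(1) Y W by auto
 have le: "- ?p v * ln (?p v) <= ?p v * (- ln (?pW (fst v)) - ln (q (fst v) (snd v)))
   + ?pW (fst v) * q (fst v) (snd v) - ?p v" if v: "v \<in> ?R" for v
 proof (cases "?p v = 0")
  case True then show ?thesis using v pos V by auto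
 next
  case False
  then have p: "?p v > 0" by (simp add: zero_less_measure_iff)
  have pW: "?pW (fst v) > 0" using prob_pair_pos(1)[OF W X, of v] p by linarith
  obtain x where x: "x \<in> space M" "v = (W x, X x)" using v by auto
  have q: "q (fst v) (snd v) > 0" using pos'[OF x(1)] p x(2) by simp
  let ?r = "?pW (fst v) * q (fst v) (snd v)"
  have r: "?r > 0" using pW q by simp
  have "ln (?r / ?p v) <= ?r / ?p v - 1"
   using p r by (intro ln_le_minus_one) auto
  then have "?p v * ln (?r / ?p v) <= ?p v * (?r / ?p v - 1)"
   using p by (intro mult_left_mono) auto
  then show ?thesis using p r pW q by (simp add: ln_div ln_mult algebra_simps)
 qed
 have sumle: "(\<Sum>v\<in>?R. ?pW (fst v) * q (fst v) (snd v)) <= 1"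
 proof -
  have "(\<Sum>v\<in>?R. ?pW (fst v) * q (fst v) (snd v))
    <= (\<Sum>v\<in>W ` space M \<times> V. ?pW (fst v) * q (fst v) (snd v))"
   using fin V pos by (intro sum_mono2) auto
  also have "\<dots> = (\<Sum>w\<in>W ` space M. \<Sum>v\<in>V. ?pW w * q w v)"
   by (simp add: sum.cartesian_product case_prod_beta)
  also have "\<dots> <= (\<Sum>w\<in>W ` space M. ?pW w)"
   using le1 by (intro sum_mono) (simp add: sum_distrib_left[symmetric] mult_left_le)
  finally show ?thesis by (simp add: sum_prob_simple[OF W])
 qed
 have "shannon M ?Y = (\<Sum>v\<in>?R. - ?p v * ln (?p v))" by (simp add: shannon_def)
 also have "\<dots> <= (\<Sum>v\<in>?R. ?p v * (- ln (?pW (fst v)) - ln (q (fst v) (snd v)))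
   + ?pW (fst v) * q (fst v) (snd v) - ?p v)" using le by (rule sum_mono)
 also have "\<dots> <= (\<Sum>v\<in>?R. ?p v * (- ln (?pW (fst v)) - ln (q (fst v) (snd v))))"
  using sumle by (simp add: sum.distrib sum_subtractf sum_prob_simple[OF Y])
 also have "\<dots> = expectation (%x. - ln (?pW (W x)) - ln (q (W x) (X x)))"
  using expectation_simple(1)[OF Y, of "%v. - ln (?pW (fst v)) - ln (q (fst v) (snd v))"] by simp
 also have "\<dots> = expectation (%x. - ln (?pW (W x)) + - ln (q (W x) (X x)))" by simp
 also have "\<dots> = expectation (%x. - ln (?pW (W x))) + expectation (%x. - ln (q (W x) (X x)))"
  using expectation_simple(2)[OF W, of "%w. - ln (?pW w)"]
   expectation_simple(2)[OF Y, of "%v. - ln (q (fst v) (snd v))"]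
  by (intro Bochner_Integration.integral_add) auto
 finally show ?thesis by (simp add: shannon_eq_expectation[OF W])
qed

text \<open>The kernel is the law of \<open>X\<close>, which ignores \<open>W\<close>.\<close>

lemma shannon_pair_le:
 assumes W: "simple_function M W" and X: "simple_function M X"
 shows "shannon M (%x. (W x, X x)) <= shannon M W + shannon M X"
proof -
 have "shannon M (%x. (W x, X x))
   <= shannon M W + expectation (%x. - ln (prob (X -` {X x} \<inter> space M)))"
 proof (rule shannon_pair_kernel[OF W X _ order.refl, where q = "%w v. prob (X -` {v} \<inter> space M)"])
  fix x assume "0 < prob ((%x. (W x, X x)) -` {(W x, X x)} \<inter> space M)"
  then show "0 < prob (X -` {X x} \<inter> space M)"
   using prob_pair_pos(2)[OF W X, of "(W x, X x)"] by simp
 qed (use simple_functionD[OF X] sum_prob_simple[OF X] in auto)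
 then show ?thesis by (simp add: shannon_eq_expectation[OF X])
qed

text \<open>Fano's inequality. The kernel puts mass \<open>1 - dl\<close> on the predicted value and
  \<open>dl / card V\<close> on every other one; for fixed \<open>V\<close> the price of adding
  \<open>X\<close> tends to 0 with the error bound \<open>dl\<close>.\<close>

lemma shannon_pair_predict:
 assumes W: "simple_function M W" and X: "simple_function M X"
  and V: "finite V" "X ` space M \<subseteq> V"
  and d: "0 < dl" "dl < 1"
  and err: "prob {x \<in> space M. X x \<noteq> pp (W x)} <= dl"
 shows "shannon M (%x. (W x, X x))
  <= shannon M W + (- ln (1 - dl) + dl * (ln (card V) - ln dl))"
proof -
 have "V \<noteq> {}" using V not_empty by auto
 then have c: "card V > 0" using V by (simp add: card_gt_0_iff)
 then have c1: "real (card V) >= 1" by linarith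
 define q where "q w v = (if v = pp w then 1 - dl else dl / card V)" for w v
 have le1: "(\<Sum>v\<in>V. q w v) <= 1" for w
 proof -
  have "(\<Sum>v\<in>V. q w v) <= (\<Sum>v\<in>V. (if v = pp w then 1 - dl else 0) + dl / card V)"
   using d by (intro sum_mono) (auto simp: q_def)
  also have "\<dots> = (if pp w \<in> V then 1 - dl else 0) + dl"
   using V c \<open>V \<noteq> {}\<close> by (simp add: sum.distrib)
  finally show ?thesis using d by (auto split: if_splits)
 qed
 have Y: "simple_function M (%x. (W x, X x))" using W X by (rule simple_function_Pair)
 let ?E = "{x \<in> space M. X x \<noteq> pp (W x)}"
 have E: "?E \<in> events"
 proof -
  have "?E = (%x. (W x, X x)) -` {v. snd v \<noteq> pp (fst v)} \<inter> space M" by auto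
  then show ?thesis using simple_functionD(2)[OF Y, of "{v. snd v \<noteq> pp (fst v)}"] by (simp only:)
 qed
 have "shannon M (%x. (W x, X x)) <= shannon M W + expectation (%x. - ln (q (W x) (X x)))"
  using d c le1 by (intro shannon_pair_kernel[OF W X V]) (auto simp: q_def)
 also have "expectation (%x. - ln (q (W x) (X x)))
   <= expectation (%x. - ln (1 - dl) + indicator ?E x * (ln (card V) - ln dl))"
 proof (rule integral_mono)
  show "integrable M (%x. - ln (q (W x) (X x)))"
   using expectation_simple(2)[OF Y, of "%v. - ln (q (fst v) (snd v))"] by simp
  show "integrable M (%x. - ln (1 - dl) + indicator ?E x * (ln (card V) - ln dl))"
   using E by (intro Bochner_Integration.integrable_add integrable_mult_left integrable_real_indicator)
    (auto simp: emeasure_eq_measure)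
  fix x assume x: "x \<in> space M"
  have "ln (1 - dl) <= 0" using d by simp
  then show "- ln (q (W x) (X x)) <= - ln (1 - dl) + indicator ?E x * (ln (card V) - ln dl)"
   using x d c by (auto simp: q_def ln_div)
 qed
 also have "\<dots> = - ln (1 - dl) + prob ?E * (ln (card V) - ln dl)"
  using E by (subst Bochner_Integration.integral_add)
   (auto simp: emeasure_eq_measure prob_space intro!: integrable_mult_left integrable_real_indicator)
 also have "prob ?E * (ln (card V) - ln dl) <= dl * (ln (card V) - ln dl)"
 proof (intro mult_right_mono err)
  have "ln (card V) >= 0" "ln dl <= 0" using c1 d by simp_all
  then show "0 <= ln (card V) - ln dl" by simp
 qed
 finally show ?thesis by simp
qed

end

lemma prediction_error_small:
 fixes \<omega> c :: real
 assumes "\<omega> > 0"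
 obtains dl where "0 < dl" "dl < 1" "- ln (1 - dl) + dl * (c - ln dl) < \<omega>"
proof -
 have "((%dl::real. - ln (1 - dl) + dl * (c - ln dl)) \<longlongrightarrow> 0) (at_right 0)"
  by real_asymp
 then have "eventually (%dl::real. - ln (1 - dl) + dl * (c - ln dl) < \<omega>) (at_right 0)"
  using assms by (rule order_tendstoD)
 moreover have "eventually (%dl::real. dl < 1) (at_right 0)"
  by (auto simp: eventually_at_right_field intro: exI[of _ 1])
 moreover have "eventually (%dl::real. 0 < dl) (at_right 0)" by (rule eventually_at_right_less)
 ultimately have "eventually (%dl::real. 0 < dl \<and> dl < 1 \<and> - ln (1 - dl) + dl * (c - ln dl) < \<omega>) (at_right 0)"
  by eventually_elim auto
 then have "\<exists>dl::real. 0 < dl \<and> dl < 1 \<and> - ln (1 - dl) + dl * (c - ln dl) < \<omega>"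
  by (rule eventually_happens'[rotated]) simp
 then show ?thesis using that by blast
qed

text \<open>Fekete's lemma; nonnegativity keeps the infimum \<open>L\<close> of the quotients over
  \<open>n >= 1\<close> finite.\<close>

lemma subadditive_converges:
 fixes a :: "nat => real"
 assumes sub: "!!m n. a (m + n) <= a m + a n" and nonneg: "!!n. 0 <= a n"
 shows "convergent (%n. a n / n)"
  and "n >= 1 ==> lim (%n. a n / n) <= a n / n"
proof -
 define L where "L = (INF n\<in>{1..}. a n / real n)"
 have bdd: "bdd_below ((%n. a n / real n) ` {1..})"
  using nonneg by (intro bdd_belowI[of _ 0]) auto
 have L_le: "L <= a n / n" if "n >= 1" for n
  unfolding L_def using bdd that by (intro cINF_lower) auto
 have mult: "a (k * n + r) <= k * a n + a r" for k n r
 proof (induction k)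
  case (Suc k)
  have "a (Suc k * n + r) = a (n + (k * n + r))" by (simp add: algebra_simps)
  also have "\<dots> <= a n + a (k * n + r)" by (rule sub)
  finally show ?case using Suc by (simp add: algebra_simps)
 qed simp
 have "(%n. a n / n) \<longlonglongrightarrow> L"
 proof (rule LIMSEQ_I)
  fix e :: real assume e: "e > 0"
  have "\<exists>n\<in>{1..}. a n / real n < L + e / 2"
   using cINF_less_iff[of "{1..}" "%n. a n / real n" "L + e / 2"] bdd e unfolding L_def by auto
  then obtain N where N: "N >= 1" "a N / N < L + e / 2" by auto
  define C where "C = (\<Sum>r<N. a r)"
  have C: "a r <= C" if "r < N" for r
   unfolding C_def using that nonneg by (intro member_le_sum) auto
  obtain n0 :: nat where n0: "n0 > 2 * C / e" using reals_Archimedean2 by blast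
  have C0: "C >= 0" unfolding C_def using nonneg by (simp add: sum_nonneg)
  show "\<exists>no. \<forall>n\<ge>no. norm (a n / n - L) < e"
  proof (intro exI[of _ "max n0 1"] allI impI)
   fix n assume "n >= max n0 1"
   then have n: "n >= 1" "real n >= n0" by auto
   \<comment> \<open>Division with remainder: the quotient contributes at most \<open>n / N\<close>
     copies of \<open>a N\<close>, the remainder at most the constant \<open>C\<close>.\<close>
   have "a n = a ((n div N) * N + n mod N)" by simp
   also have "\<dots> <= (n div N) * a N + a (n mod N)" by (rule mult)
   also have "\<dots> <= (n div N) * a N + C" using C[of "n mod N"] N by simp
   also have "(n div N) * a N <= (n / N) * a N"
    using nonneg[of N] of_nat_div_le_of_nat[where ?'a = real, of n N] by (intro mult_right_mono) auto
   finally have "a n / n <= (n / N * a N + C) / n"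
    by (simp add: divide_right_mono)
   also have "\<dots> = a N / N + C / n" using n N by (simp add: field_simps)
   also have "C / n < e / 2"
   proof -
    have "real n > 2 * C / e" using n n0 by linarith
    then show ?thesis using n e by (simp add: field_simps)
   qed
   finally have "a n / n < L + e" using N by linarith
   moreover have "a n / n >= L" using L_le[OF n(1)] .
   ultimately show "norm (a n / n - L) < e" by simp
  qed
 qed
 then show "convergent (%n. a n / n)" and "n >= 1 ==> lim (%n. a n / n) <= a n / n"
  using L_le limI by (auto simp: convergent_def)
qed

section \<open>Entropy of measure-preserving maps\<close>

locale invariant_prob = prob_space M for M :: "'a measure" +
 fixes f :: "'a => 'a"
 assumes f_meas: "f \<in> measurable M M" and f_inv: "distr M M f = M"
begin

lemma funpow_meas: "f ^^ n \<in> measurable M M"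
proof (induction n)
 case 0 show ?case using measurable_id[of M] by simp
next
 case (Suc n)
 show ?case unfolding funpow.simps using Suc f_meas by (rule measurable_comp)
qed

lemma funpow_inv: "distr M M (f ^^ n) = M"
proof (induction n)
 case 0 show ?case using distr_id[of M] by simp
next
 case (Suc n)
 have "distr M M (f ^^ Suc n) = distr (distr M M (f ^^ n)) M f"
  unfolding funpow.simps using distr_distr[OF f_meas funpow_meas[of n]] by (rule sym)
 then show ?case using Suc f_inv by (simp only:)
qed

lemma funpow_space: "x \<in> space M ==> (f ^^ n) x \<in> space M"
 by (rule measurable_space[OF funpow_meas])

lemma prob_funpow_vimage:
 assumes "A \<in> events"
 shows "prob ((f ^^ n) -` A \<inter> space M) = prob A"
 using measure_distr[OF funpow_meas assms, of n] funpow_inv[of n] by simp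

lemma integral_funpow:
 fixes h :: "'a => real"
 assumes "h \<in> borel_measurable M"
 shows "expectation (%x. h ((f ^^ n) x)) = expectation h"
 using integral_distr[OF funpow_meas assms, of n] funpow_inv[of n] by simp

lemma integrable_funpow:
 fixes h :: "'a => real"
 assumes "integrable M h"
 shows "integrable M (%x. h ((f ^^ n) x))"
 using integrable_distr[OF funpow_meas, of n h] funpow_inv[of n] assms by simp

lemma simple_funpow:
 assumes "simple_function M X"
 shows "simple_function M (%x. X ((f ^^ n) x))"
 unfolding simple_function_def
proof (intro conjI ballI)
 show "finite ((%x. X ((f ^^ n) x)) ` space M)"
  by (rule finite_subset[OF _ simple_functionD(1)[OF assms]]) (auto intro: funpow_space)
 fix v
 have "(%x. X ((f ^^ n) x)) -` {v} \<inter> space M = (f ^^ n) -` (X -` {v} \<inter> space M) \<inter> space M"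
  using funpow_space by auto
 also have "\<dots> \<in> events"
  using funpow_meas simple_functionD(2)[OF assms] by (rule measurable_sets)
 finally show "(%x. X ((f ^^ n) x)) -` {v} \<inter> space M \<in> events" .
qed

lemma shannon_funpow:
 assumes X: "simple_function M X"
 shows "shannon M (%x. X ((f ^^ n) x)) = shannon M X"
proof -
 let ?g = "%x. - ln (prob (X -` {X x} \<inter> space M))"
 have "prob ((%x. X ((f ^^ n) x)) -` {v} \<inter> space M) = prob (X -` {v} \<inter> space M)" for v
 proof -
  have "(%x. X ((f ^^ n) x)) -` {v} \<inter> space M = (f ^^ n) -` (X -` {v} \<inter> space M) \<inter> space M"
   using funpow_space by auto
  then show ?thesis using prob_funpow_vimage[OF simple_functionD(2)[OF X]] by simp
 qed
 then have "shannon M (%x. X ((f ^^ n) x)) = expectation (%x. ?g ((f ^^ n) x))"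
  by (simp add: shannon_eq_expectation[OF simple_funpow[OF X]])
 also have "\<dots> = expectation ?g"
  using expectation_simple(2)[OF X, of "%v. - ln (prob (X -` {v} \<inter> space M))"]
  by (intro integral_funpow) auto
 finally show ?thesis by (simp add: shannon_eq_expectation[OF X])
qed

lemma simple_itinerary:
 assumes X: "simple_function M X"
 shows "simple_function M (itinerary f X n)"
proof (induction n)
 case 0 show ?case by (simp add: itinerary_def)
next
 case (Suc n)
 have "simple_function M (%x. (%(l, v). l @ [v]) (itinerary f X n x, X ((f ^^ n) x)))"
  by (rule simple_function_compose1) (intro simple_function_Pair Suc simple_funpow X)
 then show ?case by (simp add: itinerary_def)
qed

lemma itinerary_add:
 "itinerary f X (m + n) x = itinerary f X m x @ itinerary f X n ((f ^^ m) x)"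
proof -
 have "[0..<m + n] = [0..<m] @ map (%j. j + m) [0..<n]"
  using upt_add_eq_append[of 0 m n] map_add_upt[of m n] by (simp add: add.commute)
 then show ?thesis by (simp add: itinerary_def funpow_add)
qed

lemma shannon_itinerary_add:
 assumes X: "simple_function M X"
 shows "shannon M (itinerary f X (m + n)) <= shannon M (itinerary f X m) + shannon M (itinerary f X n)"
proof -
 have "shannon M (itinerary f X (m + n))
   <= shannon M (%x. (itinerary f X m x, itinerary f X n ((f ^^ m) x)))"
  by (rule shannon_mono[where h = "%(l, l'). l @ l'"])
   (auto intro!: simple_function_Pair simple_itinerary simple_funpow X simp: itinerary_add)
 also have "\<dots> <= shannon M (itinerary f X m) + shannon M (%x. itinerary f X n ((f ^^ m) x))"
  by (intro shannon_pair_le simple_itinerary simple_funpow X)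
 finally show ?thesis by (simp add: shannon_funpow simple_itinerary X)
qed

lemma shannon_itinerary_mult:
 assumes X: "simple_function M X"
 shows "shannon M (itinerary f X n) <= n * shannon M X"
proof (induction n)
 case 0
 have "shannon M (itinerary f X 0) <= ln (card {[] :: 'b list})"
  by (intro shannon_le_ln_card simple_itinerary X) (auto simp: itinerary_def)
 then show ?case by simp
next
 case (Suc n)
 have "shannon M (itinerary f X 1) <= shannon M X"
  by (rule shannon_mono[OF X, where h = "%v. [v]"]) (simp add: itinerary_def)
 then show ?case using shannon_itinerary_add[OF X, of n 1] Suc by (simp add: algebra_simps)
qed

text \<open>Entropy of \<open>f\<close> relative to the partition into the level sets of
  \<open>X\<close>; for simple \<open>X\<close> the limit exists by subadditivity.\<close>

definition ks_rate :: "('a => 'b) => real" where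
 "ks_rate X = lim (%n. shannon M (itinerary f X n) / n)"

lemma ks_rate_tendsto:
 assumes "simple_function M X"
 shows "(%n. shannon M (itinerary f X n) / n) \<longlonglongrightarrow> ks_rate X"
 unfolding ks_rate_def
 using subadditive_converges(1)[OF shannon_itinerary_add[OF assms] shannon_nonneg]
 by (simp add: convergent_LIMSEQ_iff)

lemma ks_rate_le:
 assumes "simple_function M X" "n >= 1"
 shows "ks_rate X <= shannon M (itinerary f X n) / n"
 unfolding ks_rate_def
 using subadditive_converges(2)[OF shannon_itinerary_add[OF assms(1)] shannon_nonneg assms(2)] .

text \<open>Naming the piece of a point turns \<open>P\<close> into a simple function
  \<open>X\<close>. The join consists of the nonempty level sets of the itinerary, different for
  different itineraries, and possibly the empty set, whose entropy term is 0. This links the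
  definition of metric entropy by sets with the calculus of simple functions.\<close>

lemma partition_entropy_join:
 assumes P: "finite_partition M P"
 defines "X \<equiv> %x. THE B. B \<in> P \<and> x \<in> B"
 shows "simple_function M X"
  and "partition_entropy M (iterated_join f M P n) = shannon M (itinerary f X n)"
proof -
 have P': "finite P" "P \<subseteq> events" "\<Union>P = space M" "disjoint P"
  using P unfolding finite_partition_def partition_on_def by blast+
 have X_eq: "X x = B" if "B \<in> P" "x \<in> B" for x B
  unfolding X_def
 proof (rule the_equality)
  fix B' assume "B' \<in> P \<and> x \<in> B'"
  then show "B' = B" using disjointD[OF P'(4), of B' B] that by blast
 qed (use that in simp)
 have X: "X x \<in> P \<and> x \<in> X x" if "x \<in> space M" for x
 proof -
  have "x \<in> \<Union>P" unfolding P'(3) by (rule that)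
  then obtain B where B: "B \<in> P" "x \<in> B" by (rule UnionE)
  show ?thesis unfolding X_eq[OF B] using B by (rule conjI)
 qed
 have vim: "X -` {B} \<inter> space M = B" if B: "B \<in> P" for B
 proof (intro equalityI subsetI)
  fix x assume "x \<in> X -` {B} \<inter> space M"
  then show "x \<in> B" using X[of x] by simp
 next
  fix x assume "x \<in> B"
  then have "X x = B" "x \<in> \<Union>P" using X_eq[OF B] B by auto
  then show "x \<in> X -` {B} \<inter> space M" using P'(3) by simp
 qed
 show simp: "simple_function M X"
  unfolding simple_function_def
 proof (intro conjI ballI)
  have sub: "X ` space M \<subseteq> P" using X by blast
  show "finite (X ` space M)" by (rule finite_subset[OF sub P'(1)])
  show "X -` {v} \<inter> space M \<in> events" if "v \<in> X ` space M" for v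
  proof -
   have "v \<in> P" using that sub by blast
   then show ?thesis using vim[of v] P'(2) by auto
  qed
 qed
 let ?I = "itinerary f X n"
 let ?atom = "%l. ?I -` {l} \<inter> space M"
 have join: "{x \<in> space M. \<forall>j<n. (f ^^ j) x \<in> a j} = ?atom (map a [0..<n])"
  if a: "\<forall>j<n. a j \<in> P" for a
 proof -
  have "(\<forall>j<n. (f ^^ j) x \<in> a j) \<longleftrightarrow> ?I x = map a [0..<n]" if x: "x \<in> space M" for x
  proof -
   have "(f ^^ j) x \<in> a j \<longleftrightarrow> X ((f ^^ j) x) = a j" if "j < n" for j
    using X[OF funpow_space[OF x, of j]] X_eq[of "a j" "(f ^^ j) x"] a that by metis
   then have "(\<forall>j<n. (f ^^ j) x \<in> a j) \<longleftrightarrow> (\<forall>j<n. X ((f ^^ j) x) = a j)" by blast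
   also have "\<dots> \<longleftrightarrow> ?I x = map a [0..<n]"
    unfolding itinerary_def map_eq_conv set_upt Ball_def atLeastLessThan_iff by blast
   finally show ?thesis .
  qed
  then show ?thesis by blast
 qed
 have sub: "?atom ` (?I ` space M) \<subseteq> iterated_join f M P n"
 proof clarify
  fix x assume x: "x \<in> space M"
  let ?a = "%j. X ((f ^^ j) x)"
  have a: "\<forall>j<n. ?a j \<in> P" using X[OF funpow_space[OF x]] by simp
  have "?atom (?I x) = {y \<in> space M. \<forall>j<n. (f ^^ j) y \<in> ?a j}"
   unfolding join[OF a] by (simp only: itinerary_def)
  then show "?atom (?I x) \<in> iterated_join f M P n"
   unfolding iterated_join_def mem_Collect_eq using a by (intro exI[of _ ?a] conjI)
 qed
 have fin: "finite (iterated_join f M P n)"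
 proof (rule finite_subset)
  show "iterated_join f M P n \<subseteq> ?atom ` {l. set l \<subseteq> P \<and> length l = n}"
  proof
   fix B assume "B \<in> iterated_join f M P n"
   then obtain a where "\<forall>j<n. a j \<in> P" "B = {x \<in> space M. \<forall>j<n. (f ^^ j) x \<in> a j}"
    by (auto simp: iterated_join_def)
   then have "B = ?atom (map a [0..<n])" using join[of a] by (simp only:)
   moreover have "map a [0..<n] \<in> {l. set l \<subseteq> P \<and> length l = n}"
    using \<open>\<forall>j<n. a j \<in> P\<close> by auto
   ultimately show "B \<in> ?atom ` {l. set l \<subseteq> P \<and> length l = n}" by (rule image_eqI)
  qed
  show "finite (?atom ` {l. set l \<subseteq> P \<and> length l = n})"
   using P'(1) by (intro finite_imageI finite_lists_length_eq)
 qed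
 have rest: "B = {}" if B: "B \<in> iterated_join f M P n" "B \<notin> ?atom ` (?I ` space M)" for B
 proof (rule ccontr)
  obtain a where a: "\<forall>j<n. a j \<in> P" "B = {x \<in> space M. \<forall>j<n. (f ^^ j) x \<in> a j}"
   using B by (auto simp: iterated_join_def)
  assume "B \<noteq> {}"
  then obtain x where "x \<in> B" by auto
  have eq: "B = ?atom (map a [0..<n])" using a(2) join[OF a(1)] by (rule trans)
  with \<open>x \<in> B\<close> have x: "x \<in> space M" "?I x = map a [0..<n]" by blast+
  then have "B = ?atom (?I x)" using eq by (simp only:)
  then show False using B(2) x(1) by blast
 qed
 have inj: "inj_on ?atom (?I ` space M)"
 proof (rule inj_onI)
  fix l l' assume "l \<in> ?I ` space M" "?atom l = ?atom l'"
  then obtain x where "x \<in> space M" "l = ?I x" "x \<in> ?atom l'" by blast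
  then show "l = l'" by simp
 qed
 have "partition_entropy M (iterated_join f M P n)
   = (\<Sum>B\<in>?atom ` (?I ` space M). - prob B * ln (prob B))"
  unfolding partition_entropy_def
 proof (intro sum.mono_neutral_right fin sub ballI)
  fix B assume "B \<in> iterated_join f M P n - ?atom ` (?I ` space M)"
  then have "B = {}" using rest by blast
  then show "- prob B * ln (prob B) = 0" by simp
 qed
 also have "\<dots> = shannon M ?I" unfolding shannon_def by (subst sum.reindex[OF inj]) (simp only: comp_def)
 finally show "partition_entropy M (iterated_join f M P n) = shannon M (itinerary f X n)" .
qed

lemma metric_entropy_leI:
 assumes "!!X :: 'a => 'a set. simple_function M X ==> ereal (ks_rate X) <= c"
 shows "metric_entropy f M <= c"
 unfolding metric_entropy_def
proof (rule SUP_least)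
 fix P assume "P \<in> {P. finite_partition M P}"
 then have P: "finite_partition M P" by simp
 show "ereal (lim (%n. partition_entropy M (iterated_join f M P n) / real n)) <= c"
  using assms[OF partition_entropy_join(1)[OF P]]
  by (simp add: partition_entropy_join(2)[OF P] ks_rate_def)
qed

text \<open>The values of \<open>X\<close> have an arbitrary type, whereas the supremum runs over
  partitions into sets. The name \<open>Y x\<close> is the level set itself, from which the value of
  \<open>X\<close> is recovered, so the itineraries of \<open>Y\<close> determine those of
  \<open>X\<close>.\<close>

lemma ks_rate_le_metric_entropy:
 assumes X: "simple_function M X"
 shows "ereal (ks_rate X) <= metric_entropy f M"
proof -
 let ?atom = "%v. X -` {v} \<inter> space M"
 define P where "P = ?atom ` (X ` space M)"
 have P: "finite_partition M P"
  using simple_functionD[OF X]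
  by (auto simp: finite_partition_def P_def partition_on_def disjoint_def)
 define Y where "Y x = (THE B. B \<in> P \<and> x \<in> B)" for x
 note Y = partition_entropy_join[OF P, folded Y_def]
 have Y_eq: "Y x = ?atom (X x)" if "x \<in> space M" for x
  unfolding Y_def using that by (intro the_equality) (auto simp: P_def)
 have X_eq: "X x = (THE v. v \<in> X ` space M \<and> ?atom v = Y x)" if "x \<in> space M" for x
  using that Y_eq[OF that] by (intro the_equality[symmetric]) auto
 have "shannon M (itinerary f X n) <= shannon M (itinerary f Y n)" for n
 proof (rule shannon_mono[where h = "map (%B. THE v. v \<in> X ` space M \<and> ?atom v = B)"])
  show "simple_function M (itinerary f Y n)" using Y(1) by (rule simple_itinerary)
  show "itinerary f X n x = map (%B. THE v. v \<in> X ` space M \<and> ?atom v = B) (itinerary f Y n x)"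
   if "x \<in> space M" for x
   using X_eq[OF funpow_space[OF that]] by (auto simp: itinerary_def)
 qed
 then have "ks_rate X <= ks_rate Y"
  using ks_rate_tendsto[OF X] ks_rate_tendsto[OF Y(1)]
  by (intro LIMSEQ_le) (auto intro!: exI[of _ 0] divide_right_mono)
 also have "ereal (ks_rate Y) <= metric_entropy f M"
  unfolding metric_entropy_def ks_rate_def
  using P by (intro SUP_upper2[of P]) (auto simp: Y(2))
 finally show ?thesis by simp
qed

lemma metric_entropy_nonneg: "0 <= metric_entropy f M"
proof -
 have X: "simple_function M (%_. ())" by simp
 have "0 <= ks_rate (%_. ())"
  by (rule LIMSEQ_le_const[OF ks_rate_tendsto[OF X]]) (intro exI allI impI divide_nonneg_nonneg shannon_nonneg of_nat_0_le_iff)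
 then show ?thesis using ks_rate_le_metric_entropy[OF X] by (metis ereal_less_eq(5) order_trans)
qed

end

section \<open>Weak convergence of probabilities on a compact metric set\<close>

text \<open>The points already carry the topology of the manifold, so the metric is an explicit
  function that is only required to be continuous; on a compact set it then induces the topology,
  see \<open>ball_openin\<close> and \<open>openin_contains_ball\<close>.\<close>

locale compact_metric =
 fixes X :: "'m::{t2_space, second_countable_topology} set" and rh :: "'m => 'm => real"
 assumes compact_X: "compact X" and X_nonempty: "X \<noteq> {}"
  and rho_cont: "continuous_on (X \<times> X) (%(x, y). rh x y)"
  and rho_zero: "x \<in> X ==> y \<in> X ==> rh x y = 0 \<longleftrightarrow> x = y"
  and rho_nonneg: "x \<in> X ==> y \<in> X ==> 0 <= rh x y"
  and rho_sym: "x \<in> X ==> y \<in> X ==> rh x y = rh y x"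
  and rho_tri: "x \<in> X ==> y \<in> X ==> z \<in> X ==> rh x z <= rh x y + rh y z"
begin

lemma closed_X: "closed X"
 using compact_X by (rule compact_imp_closed)

lemma rho_refl [simp]: "x \<in> X ==> rh x x = 0"
 by (simp add: rho_zero)

lemma continuous_rho: "x \<in> X ==> continuous_on X (rh x)"
proof -
 assume x: "x \<in> X"
 have "continuous_on X ((%(x, y). rh x y) \<circ> (%y. (x, y)))"
  using x by (intro continuous_on_compose continuous_intros continuous_on_subset[OF rho_cont]) auto
 then show ?thesis by (simp add: comp_def)
qed

lemma lipschitz_continuous:
 fixes g :: "'m => real"
 assumes "!!x y. x \<in> X ==> y \<in> X ==> \<bar>g x - g y\<bar> <= rh x y"
 shows "continuous_on X g"
 unfolding continuous_on_def
proof
 fix x assume x: "x \<in> X"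
 have "(rh x \<longlongrightarrow> rh x x) (at x within X)"
  using continuous_rho[OF x] x unfolding continuous_on_def by blast
 then have "((%y. rh x y) \<longlongrightarrow> 0) (at x within X)" using x by simp
 then have "((%y. g y - g x) \<longlongrightarrow> 0) (at x within X)"
 proof (rule Lim_null_comparison[rotated])
  show "\<forall>\<^sub>F y in at x within X. norm (g y - g x) <= rh x y"
   using assms[OF x] by (auto simp: eventually_at_filter abs_minus_commute)
 qed
 then show "(g \<longlongrightarrow> g x) (at x within X)" by (simp add: LIM_zero_iff)
qed

definition dist_set :: "'m set => 'm => real" where
 "dist_set C x = (INF c\<in>C. rh x c)"

lemma dist_set_bdd: "C \<subseteq> X ==> x \<in> X ==> bdd_below (rh x ` C)"
 using rho_nonneg by (intro bdd_belowI[of _ 0]) auto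

lemma dist_set_nonneg: "C \<subseteq> X ==> C \<noteq> {} ==> x \<in> X ==> 0 <= dist_set C x"
 unfolding dist_set_def using rho_nonneg by (intro cINF_greatest) auto

lemma dist_set_le: "C \<subseteq> X ==> x \<in> X ==> c \<in> C ==> dist_set C x <= rh x c"
 unfolding dist_set_def by (intro cINF_lower dist_set_bdd) auto

lemma continuous_dist_set:
 assumes C: "C \<subseteq> X" "C \<noteq> {}"
 shows "continuous_on X (dist_set C)"
proof (rule lipschitz_continuous)
 have *: "dist_set C x <= dist_set C y + rh x y" if "x \<in> X" "y \<in> X" for x y
 proof -
  have "dist_set C x - rh x y <= rh y c" if "c \<in> C" for c
   using dist_set_le[OF C(1) \<open>x \<in> X\<close> that] rho_tri[of x y c] that \<open>x \<in> X\<close> \<open>y \<in> X\<close> C by auto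
  then have "dist_set C x - rh x y <= dist_set C y"
   unfolding dist_set_def[of C y] using C by (intro cINF_greatest) auto
  then show ?thesis by simp
 qed
 show "\<bar>dist_set C x - dist_set C y\<bar> <= rh x y" if "x \<in> X" "y \<in> X" for x y
  using *[OF that] *[OF that(2,1)] rho_sym[OF that] by auto
qed

lemma dist_set_zero_iff:
 assumes C: "C \<subseteq> X" "C \<noteq> {}" "closed C" and x: "x \<in> X"
 shows "dist_set C x = 0 \<longleftrightarrow> x \<in> C"
proof
 assume "x \<in> C"
 then show "dist_set C x = 0"
  using dist_set_le[OF C(1) x] dist_set_nonneg[OF C(1,2) x] x by fastforce
next
 assume 0: "dist_set C x = 0"
 have "compact C" using compact_X C by (metis compact_Int_closed inf.absorb_iff2)
 moreover have "continuous_on C (rh x)" using continuous_rho[OF x] C(1) by (rule continuous_on_subset)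
 ultimately obtain c where c: "c \<in> C" "!!c'. c' \<in> C ==> rh x c <= rh x c'"
  using continuous_attains_inf[of C "rh x"] C(2) by blast
 then have "rh x c <= dist_set C x" unfolding dist_set_def using C(2) by (intro cINF_greatest) auto
 then show "x \<in> C" using 0 c x C rho_nonneg[of x c] rho_zero[of x c] by force
qed

section \<open>Borel probabilities on \<open>X\<close> and their regularity\<close>

definition prob_on :: "'m measure => bool" where
 "prob_on nu \<longleftrightarrow> prob_space nu \<and> space nu = X \<and> sets nu = sets (restrict_space borel X)"

lemma prob_onD:
 assumes "prob_on nu"
 shows "prob_space nu" "space nu = X" "sets nu = sets (restrict_space borel X)"
 using assms by (auto simp: prob_on_def)

lemma sets_prob_on:
 assumes "prob_on nu"
 shows "A \<in> sets nu \<longleftrightarrow> A \<in> sets borel \<and> A \<subseteq> X"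
 using closed_X by (auto simp: prob_onD(3)[OF assms] sets_restrict_space_iff)

lemma continuous_measurable:
 fixes h :: "'m => 'b::topological_space"
 assumes "prob_on nu" "continuous_on X h"
 shows "h \<in> borel_measurable nu"
 using borel_measurable_continuous_on_restrict[OF assms(2)] prob_onD(3)[OF assms(1)]
 by (simp cong: measurable_cong_sets)

lemma continuous_bounded:
 fixes h :: "'m => real"
 assumes "continuous_on X h"
 obtains B where "B > 0" "!!x. x \<in> X ==> \<bar>h x\<bar> <= B"
proof -
 have "bounded (h ` X)" using compact_continuous_image[OF assms compact_X] by (rule compact_imp_bounded)
 then show ?thesis using that unfolding bounded_pos by auto
qed

lemma continuous_integrable:
 fixes h :: "'m => real"
 assumes "prob_on nu" "continuous_on X h"
 shows "integrable nu h"
proof -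
 interpret prob_space nu using prob_onD(1)[OF assms(1)] .
 obtain B where "!!x. x \<in> X ==> \<bar>h x\<bar> <= B" using continuous_bounded[OF assms(2)] by blast
 then show ?thesis
  using continuous_measurable[OF assms] prob_onD(2)[OF assms(1)]
  by (intro integrable_const_bound[of _ B]) auto
qed

lemma borel_X_generated:
 "sets (restrict_space borel X) = sigma_sets X {C. closed C \<and> C \<subseteq> X}"
proof -
 have "sets (restrict_space borel X) = (\<inter>) X ` sigma_sets UNIV (Collect closed)"
  by (simp add: sets_restrict_space borel_eq_closed)
 also have "\<dots> = sigma_sets X ((\<inter>) X ` Collect closed)"
  using closed_X by (intro sigma_sets_Int) (auto intro: sigma_sets.Basic)
 also have "(\<inter>) X ` Collect closed = {C. closed C \<and> C \<subseteq> X}"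
  using closed_X by (auto intro!: image_eqI)
 finally show ?thesis .
qed

definition bump :: "'m set => nat => 'm => real" where
 "bump C k x = max 0 (1 - real k * dist_set C x)"

lemma bump:
 assumes C: "C \<subseteq> X" "C \<noteq> {}" "closed C"
 shows "continuous_on X (bump C k)"
  and "x \<in> X ==> indicator C x <= bump C k x" and "x \<in> X ==> bump C k x <= 1"
  and "x \<in> X ==> (%k. bump C k x) \<longlonglongrightarrow> indicator C x"
proof -
 show "continuous_on X (bump C k)"
  unfolding bump_def by (intro continuous_intros continuous_dist_set C)
 show "indicator C x <= bump C k x" if "x \<in> X"
  using dist_set_zero_iff[OF C that] by (auto simp: bump_def indicator_def)
 show "bump C k x <= 1" if "x \<in> X"
  using dist_set_nonneg[OF C(1,2) that] by (auto simp: bump_def)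
 show "(%k. bump C k x) \<longlonglongrightarrow> indicator C x" if x: "x \<in> X"
 proof (cases "x \<in> C")
  case True
  then show ?thesis using dist_set_zero_iff[OF C x] by (simp add: bump_def)
 next
  case False
  then have d: "dist_set C x > 0"
   using dist_set_zero_iff[OF C x] dist_set_nonneg[OF C(1,2) x] by simp
  obtain n where n: "real n > 1 / dist_set C x" using reals_Archimedean2 by blast
  have "bump C k x = 0" if "k >= n" for k
  proof -
   have "real k > 1 / dist_set C x" using n that by linarith
   then show ?thesis using d by (simp add: bump_def field_simps)
  qed
  then have "\<forall>\<^sub>F k in sequentially. bump C k x = 0" unfolding eventually_sequentially by blast
  then show ?thesis using False by (simp add: tendsto_eventually)
 qed
qed

lemma bump_integral_tendsto:
 assumes nu: "prob_on nu" and C: "C \<subseteq> X" "C \<noteq> {}" "closed C"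
 shows "(%k. \<integral>x. bump C k x \<partial>nu) \<longlonglongrightarrow> measure nu C"
proof -
 interpret prob_space nu using prob_onD(1)[OF nu] .
 have Cs: "C \<in> sets nu" using C sets_prob_on[OF nu] by auto
 have "(%k. \<integral>x. bump C k x \<partial>nu) \<longlonglongrightarrow> (\<integral>x. indicator C x \<partial>nu)"
 proof (rule integral_dominated_convergence[where w = "%_. 1"])
  show "(%x. indicat_real C x) \<in> borel_measurable nu" using Cs by simp
  show "bump C k \<in> borel_measurable nu" for k using continuous_measurable[OF nu bump(1)[OF C]] .
  show "AE x in nu. (%k. bump C k x) \<longlonglongrightarrow> indicator C x"
   using bump(4)[OF C] prob_onD(2)[OF nu] by auto
  show "AE x in nu. norm (bump C k x) <= 1" for k
   using bump(2,3)[OF C] prob_onD(2)[OF nu] by (auto simp: bump_def)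
 qed simp
 then show ?thesis using Cs by simp
qed

text \<open>Bump functions recover the masses of closed sets, an intersection-stable generator of
  the Borel sets.\<close>

lemma prob_on_eqI:
 assumes nu: "prob_on nu" and mu: "prob_on mu"
  and eq: "!!h :: 'm => real. continuous_on X h ==> (\<integral>x. h x \<partial>nu) = (\<integral>x. h x \<partial>mu)"
 shows "nu = mu"
proof (rule measure_eqI_generator_eq[where E = "{C. closed C \<and> C \<subseteq> X}" and \<Omega> = X and A = "%_. X"])
 interpret nu: prob_space nu using prob_onD(1)[OF nu] .
 interpret mu: prob_space mu using prob_onD(1)[OF mu] .
 show "emeasure nu C = emeasure mu C" if "C \<in> {C. closed C \<and> C \<subseteq> X}" for C
 proof (cases "C = {}")
  case False
  then have C: "C \<subseteq> X" "C \<noteq> {}" "closed C" using that by auto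
  have "(%k. \<integral>x. bump C k x \<partial>mu) \<longlonglongrightarrow> measure nu C"
   using bump_integral_tendsto[OF nu C] eq[OF bump(1)[OF C]] by simp
  then have "measure nu C = measure mu C"
   using bump_integral_tendsto[OF mu C] by (rule LIMSEQ_unique)
  then show ?thesis by (simp add: nu.emeasure_eq_measure mu.emeasure_eq_measure)
 qed simp
 show "sets nu = sigma_sets X {C. closed C \<and> C \<subseteq> X}" "sets mu = sigma_sets X {C. closed C \<and> C \<subseteq> X}"
  using prob_onD(3) nu mu borel_X_generated by auto
 show "Int_stable {C. closed C \<and> C \<subseteq> X}" by (auto simp: Int_stable_def)
 show "emeasure nu X \<noteq> \<infinity>" by (simp add: nu.emeasure_eq_measure)
qed (use closed_X in auto)

text \<open>Inner regularity of \<open>A\<close> and of its complement are proved together: this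
  symmetric statement is invariant under complements and passes to countable unions, hence from
  closed sets to all Borel sets.\<close>

lemma regular_sandwich:
 assumes nu: "prob_on nu" and A: "A \<in> sets nu" and e: "(e::real) > 0"
 obtains C D where "closed C" "closed D" "C \<subseteq> A" "D \<subseteq> X - A" "measure nu (X - (C \<union> D)) < e"
proof -
 interpret prob_space nu using prob_onD(1)[OF nu] .
 note sp = prob_onD(2)[OF nu] and S = sets_prob_on[OF nu]
 let ?P = "%A. \<forall>e>0. \<exists>C D. closed C \<and> closed D \<and> C \<subseteq> A \<and> D \<subseteq> X - A \<and> measure nu (X - (C \<union> D)) < e"
 have "A \<in> sigma_sets X {C. closed C \<and> C \<subseteq> X}"
  using A prob_onD(3)[OF nu] borel_X_generated by simp
 then have "?P A \<and> A \<subseteq> X"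
 proof induction
  case (Basic A)
  then have A: "closed A" "A \<subseteq> X" by auto
  have "?P A"
  proof (cases "A = {}")
   case True
   show ?thesis unfolding True
    by (intro allI impI, rule exI[of _ "{}"], rule exI[of _ X]) (simp add: closed_X)
  next
   case False
   note C = A(2) False A(1)
   show ?thesis
   proof (intro allI impI)
    fix e :: real assume e: "e > 0"
    define D where "D k = {x \<in> X. dist_set A x >= 1 / Suc k}" for k :: nat
    have D: "closed (D k)" for k
     using continuous_on_closed_Collect_le[OF continuous_on_const continuous_dist_set[OF C(1,2)] closed_X]
     by (simp add: D_def)
    have "(%k. prob (X - (A \<union> D k))) \<longlonglongrightarrow> prob (\<Inter>k. X - (A \<union> D k))"
    proof (rule finite_Lim_measure_decseq)
     have "X - (A \<union> D k) \<in> sets borel" for k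
      using A D[of k] closed_X by (intro sets.Diff sets.Un borel_closed)
     then show "range (%k. X - (A \<union> D k)) \<subseteq> events" using S by auto
     have "1 / real (Suc n) <= 1 / real (Suc m)" if "m <= n" for m n
      using that by (intro divide_left_mono) auto
     then show "decseq (%k. X - (A \<union> D k))" unfolding decseq_def D_def by (auto intro: order_trans)
    qed
    also have "(\<Inter>k. X - (A \<union> D k)) = {}"
    proof -
     have "\<exists>k. x \<in> D k" if "x \<in> X" "x \<notin> A" for x
     proof -
      have "dist_set A x > 0"
       using dist_set_zero_iff[OF C that(1)] dist_set_nonneg[OF C(1,2) that(1)] that by simp
      then obtain k where "1 / real (Suc k) < dist_set A x" using nat_approx_posE by blast
      then show ?thesis using that by (auto simp: D_def intro!: exI[of _ k])
     qed
     then show ?thesis by auto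
    qed
    finally have "(%k. prob (X - (A \<union> D k))) \<longlonglongrightarrow> 0" by simp
    then have "\<forall>\<^sub>F k in sequentially. prob (X - (A \<union> D k)) < e" using e by (rule order_tendstoD)
    then obtain k where "prob (X - (A \<union> D k)) < e" by (auto simp: eventually_sequentially)
    moreover have "D k \<subseteq> X - A"
    proof -
     have False if "x \<in> A" "dist_set A x >= 1 / real (Suc k)" for x
     proof -
      have "dist_set A x = 0" using dist_set_zero_iff[OF C] that(1) A(2) by auto
      then show False using that(2) by (simp add: divide_le_0_iff)
     qed
     then show ?thesis by (auto simp: D_def)
    qed
    ultimately show "\<exists>C D. closed C \<and> closed D \<and> C \<subseteq> A \<and> D \<subseteq> X - A \<and> prob (X - (C \<union> D)) < e"
     using A D by blast
   qed
  qed
  then show ?case using A by simp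
 next
  case Empty
  have "?P {}"
   by (intro allI impI, rule exI[of _ "{}"], rule exI[of _ X]) (simp add: closed_X)
  then show ?case by simp
 next
  case (Compl A)
  have "?P (X - A)"
  proof (intro allI impI)
   fix e :: real assume "e > 0"
   then obtain C D where "closed C" "closed D" "C \<subseteq> A" "D \<subseteq> X - A" "prob (X - (C \<union> D)) < e"
    using Compl by blast
   then show "\<exists>C D. closed C \<and> closed D \<and> C \<subseteq> X - A \<and> D \<subseteq> X - (X - A) \<and> prob (X - (C \<union> D)) < e"
    using Compl by (intro exI[of _ D] exI[of _ C]) (auto simp: Un_commute)
  qed
  then show ?case by auto
 next
  case (Union A)
  have "?P (\<Union>i. A i)"
  proof (intro allI impI)
   fix e :: real assume e: "e > 0"
   have "\<forall>i. \<exists>CD. closed (fst CD) \<and> closed (snd CD) \<and> fst CD \<subseteq> A i \<and> snd CD \<subseteq> X - A i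
     \<and> prob (X - (fst CD \<union> snd CD)) < e / 2 * (1 / 2) ^ Suc i"
   proof
    fix i
    have "e / 2 * (1 / 2) ^ Suc i > 0" using e by simp
    then obtain C D where "closed C" "closed D" "C \<subseteq> A i" "D \<subseteq> X - A i"
     "prob (X - (C \<union> D)) < e / 2 * (1 / 2) ^ Suc i"
     using Union.IH[of i] by blast
    then show "\<exists>CD. closed (fst CD) \<and> closed (snd CD) \<and> fst CD \<subseteq> A i \<and> snd CD \<subseteq> X - A i
      \<and> prob (X - (fst CD \<union> snd CD)) < e / 2 * (1 / 2) ^ Suc i"
     by (intro exI[of _ "(C, D)"]) simp
   qed
   then obtain CD where CD: "!!i. closed (fst (CD i))" "!!i. closed (snd (CD i))"
    "!!i. fst (CD i) \<subseteq> A i" "!!i. snd (CD i) \<subseteq> X - A i"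
    "!!i. prob (X - (fst (CD i) \<union> snd (CD i))) < e / 2 * (1 / 2) ^ Suc i" by metis
   define C D where "C i = fst (CD i)" and "D i = snd (CD i)" for i
   note CD = CD[folded C_def D_def]
   have CX: "C i \<subseteq> X" "D i \<subseteq> X" for i using CD Union by blast+
   have ev: "X - (C i \<union> D i) \<in> events" "C i \<in> events" "D i \<in> events" "X \<in> events" for i
    using S CD CX closed_X by auto
   \<comment> \<open>An infinite union of closed sets need not be closed, so only finitely many
     inner sets are used and the missing mass is controlled by continuity from above; the outer sets
     can all be intersected.\<close>
   define G where "G n = (\<Union>i<n. C i)" for n
   have Gev: "G n \<in> events" for n unfolding G_def using ev by auto
   define Dall where "Dall = (\<Inter>i. D i)"
   have Dev: "Dall \<in> events" unfolding Dall_def using ev by auto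
   have lim0: "(%n. prob (X - (G n \<union> Dall))) \<longlonglongrightarrow> prob (\<Inter>n. X - (G n \<union> Dall))"
   proof (rule finite_Lim_measure_decseq)
    show "range (%n. X - (G n \<union> Dall)) \<subseteq> events" using Gev Dev ev by auto
    show "decseq (%n. X - (G n \<union> Dall))" unfolding decseq_def G_def by force
   qed
   have "prob (\<Inter>n. X - (G n \<union> Dall)) <= prob (\<Union>i. X - (C i \<union> D i))"
   proof (rule finite_measure_mono)
    show "(\<Inter>n. X - (G n \<union> Dall)) \<subseteq> (\<Union>i. X - (C i \<union> D i))"
    proof
     fix x assume x: "x \<in> (\<Inter>n. X - (G n \<union> Dall))"
     then obtain i where i: "x \<notin> D i" unfolding Dall_def by blast
     have "x \<notin> G (Suc i)" using x by blast
     then have "x \<notin> C i" unfolding G_def by blast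
     then show "x \<in> (\<Union>i. X - (C i \<union> D i))" using i x by blast
    qed
   qed (use ev in auto)
   then have lim: "\<exists>L. (%n. prob (X - (G n \<union> Dall))) \<longlonglongrightarrow> L \<and> L <= prob (\<Union>i. X - (C i \<union> D i))"
    using lim0 by blast
   have geo: "(%i. e / 2 * (1 / 2) ^ Suc i) sums (e / 2 * 1)"
    using power_half_series by (intro sums_mult) 
   have sm: "summable (%i. prob (X - (C i \<union> D i)))"
   proof (rule summable_comparison_test'[OF sums_summable[OF geo], of 0])
    show "norm (prob (X - (C i \<union> D i))) <= e / 2 * (1 / 2) ^ Suc i" for i
     using CD(5)[of i] by simp
   qed
   have "prob (\<Union>i. X - (C i \<union> D i)) <= (\<Sum>i. prob (X - (C i \<union> D i)))"
    using ev(1) sm by (intro finite_measure_subadditive_countably) auto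
   also have "\<dots> <= (\<Sum>i. e / 2 * (1 / 2) ^ Suc i)"
    using less_imp_le[OF CD(5)] sm sums_summable[OF geo] by (rule suminf_le)
   also have "\<dots> = e / 2" using sums_unique[OF geo] by simp
   finally obtain L where "(%n. prob (X - (G n \<union> Dall))) \<longlonglongrightarrow> L" "L < e" using lim e by force
   then have "\<forall>\<^sub>F n in sequentially. prob (X - (G n \<union> Dall)) < e" by (rule order_tendstoD)
   then obtain n where n: "prob (X - (G n \<union> Dall)) < e" by (auto simp: eventually_sequentially)
   show "\<exists>C D. closed C \<and> closed D \<and> C \<subseteq> (\<Union>i. A i) \<and> D \<subseteq> X - (\<Union>i. A i) \<and> prob (X - (C \<union> D)) < e"
   proof (intro exI conjI)
    show "closed (G n)" unfolding G_def using CD(1) by (intro closed_UN) auto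
    show "closed Dall" unfolding Dall_def using CD(2) by (intro closed_INT) auto
    show "G n \<subseteq> (\<Union>i. A i)" unfolding G_def using CD(3) by blast
    show "Dall \<subseteq> X - (\<Union>i. A i)" unfolding Dall_def using CD(4) by blast
   qed (rule n)
  qed
  moreover have "(\<Union>i. A i) \<subseteq> X" using Union.IH by blast
  ultimately show ?case by blast
 qed
 then show ?thesis using e that by blast
qed

section \<open>Weak convergence and sequential compactness\<close>

definition wconv :: "(nat => 'm measure) => 'm measure => bool" where
 "wconv nus nu \<longleftrightarrow> (\<forall>h :: 'm => real. continuous_on X h --> (%n. \<integral>x. h x \<partial>nus n) \<longlonglongrightarrow> (\<integral>x. h x \<partial>nu))"

text \<open>The closed half of the portmanteau theorem: a bump function lies above the indicator of
  \<open>C\<close>, and its integral against \<open>nu\<close> is close to the mass of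
  \<open>C\<close>.\<close>

lemma wconv_closed:
 assumes "!!n. prob_on (nus n)" "prob_on nu" "wconv nus nu" and C: "closed C" "C \<subseteq> X" and e: "(e::real) > 0"
 shows "\<forall>\<^sub>F n in sequentially. measure (nus n) C < measure nu C + e"
proof (cases "C = {}")
 case True then show ?thesis using e by simp
next
 case False
 note C' = C(2) False C(1)
 have "\<forall>\<^sub>F k in sequentially. (\<integral>x. bump C k x \<partial>nu) < measure nu C + e"
  using bump_integral_tendsto[OF assms(2) C'] e by (intro order_tendstoD) auto
 then obtain k where k: "(\<integral>x. bump C k x \<partial>nu) < measure nu C + e"
  by (auto simp: eventually_sequentially)
 have "(%n. \<integral>x. bump C k x \<partial>nus n) \<longlonglongrightarrow> (\<integral>x. bump C k x \<partial>nu)"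
  using assms(3) bump(1)[OF C'] unfolding wconv_def by blast
 then have "\<forall>\<^sub>F n in sequentially. (\<integral>x. bump C k x \<partial>nus n) < measure nu C + e"
  using k by (rule order_tendstoD)
 moreover have "measure (nus n) C <= (\<integral>x. bump C k x \<partial>nus n)" for n
 proof -
  interpret prob_space "nus n" using prob_onD(1)[OF assms(1)] .
  have Cs: "C \<in> sets (nus n)" using C sets_prob_on[OF assms(1)] by auto
  have "measure (nus n) C = (\<integral>x. indicator C x \<partial>nus n)" using Cs by simp
  also have "\<dots> <= (\<integral>x. bump C k x \<partial>nus n)"
   using Cs bump(2)[OF C'] prob_onD(2)[OF assms(1)] continuous_integrable[OF assms(1) bump(1)[OF C']]
   by (intro integral_mono) (auto simp: emeasure_eq_measure)
  finally show ?thesis .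
 qed
 ultimately show ?thesis by (auto elim!: eventually_mono intro: le_less_trans)
qed

lemma wconv_open:
 assumes "!!n. prob_on (nus n)" "prob_on nu" "wconv nus nu"
  and G: "closed (X - G)" "G \<subseteq> X" and e: "(e::real) > 0"
 shows "\<forall>\<^sub>F n in sequentially. measure (nus n) G > measure nu G - e"
proof -
 have c: "measure nn G = 1 - measure nn (X - G)" if "prob_on nn" for nn
 proof -
  interpret prob_space nn using prob_onD(1)[OF that] .
  have "X - G \<in> sets nn" using G sets_prob_on[OF that] by auto
  from prob_compl[OF this] show ?thesis using G(2) prob_onD(2)[OF that] by (simp add: double_diff)
 qed
 show ?thesis
  using wconv_closed[OF assms(1-3) G(1) _ e] by (simp add: c assms(1,2) algebra_simps)
qed

text \<open>\<open>G\<close> and \<open>C\<close> stand for the interior and the closure of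
  \<open>A\<close>, and the mass inequality says that the boundary is null. Since they may be chosen
  freely, an application can use explicit sets instead of the actual boundary.\<close>

lemma wconv_null_boundary:
 assumes "!!n. prob_on (nus n)" "prob_on nu" "wconv nus nu"
  and "closed (X - G)" "G \<subseteq> A" "A \<subseteq> C" "closed C" "C \<subseteq> X" "measure nu C <= measure nu G"
  and A: "A \<in> sets borel"
 shows "(%n. measure (nus n) A) \<longlonglongrightarrow> measure nu A"
proof -
 have mono: "measure nn G <= measure nn A" "measure nn A <= measure nn C" if "prob_on nn" for nn
 proof -
  interpret prob_space nn using prob_onD(1)[OF that] .
  have "A \<in> sets nn" "C \<in> sets nn" using sets_prob_on[OF that] A assms by auto
  then show "measure nn G <= measure nn A" "measure nn A <= measure nn C"
   using assms by (auto intro: finite_measure_mono)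
 qed
 show ?thesis
 proof (rule order_tendstoI)
  fix a assume "a < measure nu A"
  then have "measure nu G - a > 0" using mono[OF assms(2)] assms(9) by linarith
  from wconv_open[OF assms(1-4) _ this]
  have "\<forall>\<^sub>F n in sequentially. measure (nus n) G > a" using assms by auto
  then show "\<forall>\<^sub>F n in sequentially. a < measure (nus n) A"
   by eventually_elim (use mono[OF assms(1)] in \<open>auto intro: less_le_trans\<close>)
 next
  fix a assume "measure nu A < a"
  then have "a - measure nu C > 0" using mono[OF assms(2)] assms(9) by linarith
  from wconv_closed[OF assms(1-3) assms(7,8) this]
  have "\<forall>\<^sub>F n in sequentially. measure (nus n) C < a" by auto
  then show "\<forall>\<^sub>F n in sequentially. measure (nus n) A < a"
   by eventually_elim (use mono[OF assms(1)] in \<open>auto intro: le_less_trans\<close>)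
 qed
qed

text \<open>
 Countably many pairs of disjoint open sets separate the points; recording in base 4 which of
 the sets contain a point embeds \<open>X\<close> into the reals. The embedding is only Borel, but continuous
 functions on \<open>X\<close> are restrictions of continuous functions on the line along it, so that the
 selection theorem on the line applies.
\<close>

lemma separating_pairs:
 obtains U V :: "nat => 'm set" where "!!k. open (U k)" "!!k. open (V k)" "!!k. U k \<inter> V k = {}"
  "!!x y. x \<noteq> y ==> \<exists>k. x \<in> U k \<and> y \<in> V k"
proof -
 obtain B :: "'m set set" where B: "countable B" "topological_basis B"
  using ex_countable_basis by blast
 define P where "P = insert ({}, {}) {p \<in> B \<times> B. fst p \<inter> snd p = {}}"
 have cP: "countable P" unfolding P_def using B(1) by (intro countable_insert countable_Collect countable_SIGMA)
 have ne: "P \<noteq> {}" by (simp add: P_def)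
 define U where "U k = fst (from_nat_into P k)" for k
 define V where "V k = snd (from_nat_into P k)" for k
 have mem: "from_nat_into P k \<in> P" for k using ne by (rule from_nat_into)
 show ?thesis
 proof (rule that)
  show "open (U k)" for k
   using mem[of k] topological_basis_open[OF B(2), of "U k"] unfolding P_def U_def by force
  show "open (V k)" for k
   using mem[of k] topological_basis_open[OF B(2), of "V k"] unfolding P_def V_def by force
  show "U k \<inter> V k = {}" for k
   using mem[of k] unfolding P_def U_def V_def by force
  fix x y :: 'm assume "x \<noteq> y"
  then obtain S T where ST: "open S" "open T" "x \<in> S" "y \<in> T" "S \<inter> T = {}"
   by (metis hausdorff)
  obtain S' where S': "S' \<in> B" "x \<in> S'" "S' \<subseteq> S"
   using topological_basisE[OF B(2) ST(1,3)] by blast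
  obtain T' where T': "T' \<in> B" "y \<in> T'" "T' \<subseteq> T"
   using topological_basisE[OF B(2) ST(2,4)] by blast
  have "(S', T') \<in> P" using S' T' ST by (auto simp: P_def)
  then obtain k where "from_nat_into P k = (S', T')"
   using from_nat_into_surj[OF cP] by blast
  then show "\<exists>k. x \<in> U k \<and> y \<in> V k" using S' T' by (auto simp: U_def V_def intro!: exI[of _ k])
 qed
qed

definition code :: "(nat => 'm set) => 'm => real" where
 "code U x = (\<Sum>k. indicator (U k) x * (1 / 4) ^ k)"

lemma code_summable: "summable (%k. indicator (U k) x * (1 / 4 :: real) ^ k)"
 by (rule summable_comparison_test'[where g = "%k. (1 / 4) ^ k" and N = 0])
  (auto simp: indicator_def intro!: summable_geometric)

lemma code_bounds: "0 <= code U x" "code U x <= 4 / 3"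
proof -
 show "0 <= code U x" unfolding code_def by (intro suminf_nonneg code_summable) auto
 have "code U x <= (\<Sum>k. (1 / 4) ^ k)"
  unfolding code_def by (intro suminf_le code_summable summable_geometric) (auto simp: indicator_def)
 then show "code U x <= 4 / 3" by (simp add: suminf_geometric)
qed

lemma code_measurable:
 assumes "prob_on nu" "!!k. open (U k)"
 shows "code U \<in> borel_measurable nu"
proof -
 have "U k \<inter> X \<in> sets nu" for k
  using sets_prob_on[OF assms(1)] assms(2) closed_X by auto
 moreover have "{x \<in> X. x \<in> U k} = U k \<inter> X" for k by blast
 ultimately have "indicat_real (U k) \<in> borel_measurable nu" for k
  by (intro borel_measurable_indicator') (simp only: prob_onD(2)[OF assms(1)])
 then show ?thesis unfolding code_def by (intro borel_measurable_suminf) auto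
qed

text \<open>With digits 0 and 1 in base 4, the tail after digit \<open>k\<close> changes the value
  by at most a third of \<open>(1 / 4) ^ k\<close>. A first difference at \<open>k <= n\<close>
  therefore changes the code by at least two thirds of \<open>(1 / 4) ^ k\<close>, which exceeds the
  assumed bound.\<close>

lemma code_digits:
 assumes "\<bar>code U x - code U y\<bar> < (1 / 4) ^ n / 2" "k <= n"
 shows "x \<in> U k \<longleftrightarrow> y \<in> U k"
 using assms(2)
proof (induction k rule: less_induct)
 case (less k)
 define d where "d j = (indicat_real (U j) x - indicator (U j) y) * (1 / 4) ^ j" for j
 have d: "summable d" "code U x - code U y = suminf d"
  unfolding d_def code_def left_diff_distrib
  by (auto intro!: summable_diff suminf_diff code_summable)
 have "d j = 0" if "j < k" for j using less.IH[OF that] that less.prems by (auto simp: d_def indicator_def)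
 then have "suminf d = d k + (\<Sum>j. d (j + Suc k))"
  using suminf_split_initial_segment[OF d(1), of "Suc k"] by simp
 moreover have "\<bar>\<Sum>j. d (j + Suc k)\<bar> <= (1 / 4) ^ Suc k * (4 / 3)"
 proof -
  have s: "(%j. (1 / 4 :: real) ^ (j + Suc k)) sums ((1 / 4) ^ Suc k * (4 / 3))"
   using sums_mult[OF geometric_sums[of "1 / 4 :: real"], of "(1 / 4) ^ Suc k"]
   by (simp add: power_add mult.commute)
  have le: "norm (d (j + Suc k)) <= (1 / 4) ^ (j + Suc k)" for j
   unfolding d_def norm_mult by (auto simp: indicator_def)
  have "norm (\<Sum>j. d (j + Suc k)) <= (\<Sum>j. (1 / 4) ^ (j + Suc k))"
   using sums_summable[OF s] le by (rule norm_suminf_le[rotated])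
  then show ?thesis using sums_unique[OF s] by simp
 qed
 ultimately have "\<bar>d k\<bar> <= \<bar>suminf d\<bar> + (1 / 4) ^ Suc k * (4 / 3)" by linarith
 also have "\<bar>suminf d\<bar> < (1 / 4) ^ n / 2" using assms(1) d(2) by simp
 also have "(1 / 4 :: real) ^ n <= (1 / 4) ^ k" using less.prems by (intro power_decreasing) auto
 finally have less1: "\<bar>d k\<bar> < (1 / 4) ^ k" by simp
 show ?case
 proof (rule ccontr)
  assume "\<not> ?case"
  then have "\<bar>d k\<bar> = (1 / 4) ^ k" by (auto simp: d_def indicator_def)
  then show False using less1 by simp
 qed
qed

text \<open>The code is not continuous, yet \<open>h\<close> is uniformly continuous as a function
  of it: the pairs at which \<open>h\<close> differs by at least \<open>e\<close> form a compact set
  away from the diagonal, finitely many products of \<open>U k\<close> and \<open>V k\<close> cover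
  it, and so finitely many digits distinguish the points of each pair. The extension goes to the
  closure of the image and from there, by Tietze, to the line.\<close>

lemma code_extension:
 fixes h :: "'m => real"
 assumes UV: "!!k. open (U k)" "!!k. open (V k)" "!!k. U k \<inter> V k = {}"
  "!!x y. x \<noteq> y ==> \<exists>k. x \<in> U k \<and> y \<in> V k"
  and h: "continuous_on X h"
 obtains G B where "continuous_on UNIV (G :: real => real)" "!!t. \<bar>G t\<bar> <= B" "!!x. x \<in> X ==> G (code U x) = h x"
proof -
 have unif: "\<exists>dl>0. \<forall>x\<in>X. \<forall>y\<in>X. \<bar>code U x - code U y\<bar> < dl --> \<bar>h x - h y\<bar> < e" if e: "e > 0" for e
 proof -
  define Q where "Q = {p \<in> X \<times> X. \<bar>h (fst p) - h (snd p)\<bar> >= e}"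
  have "continuous_on (X \<times> X) (%p. \<bar>h (fst p) - h (snd p)\<bar>)"
   by (intro continuous_intros continuous_on_compose2[OF h]) auto
  then have "closed Q"
   using continuous_on_closed_Collect_le[OF continuous_on_const _ closed_Times[OF closed_X closed_X]]
   unfolding Q_def by blast
  then have cQ: "compact Q"
   using compact_Int_closed[OF compact_Times[OF compact_X compact_X], of Q] unfolding Q_def
   by (metis (no_types, lifting) Int_absorb1 mem_Collect_eq subsetI)
  have "\<exists>k. p \<in> U k \<times> V k" if "p \<in> Q" for p
  proof -
   have "fst p \<noteq> snd p" using that e by (auto simp: Q_def)
   then show ?thesis using UV(4) by (metis mem_Times_iff)
  qed
  then have "Q \<subseteq> (\<Union>k. U k \<times> V k)" by blast
  moreover have "open (U k \<times> V k)" for k using UV by (intro open_Times)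
  ultimately obtain K where K: "K \<subseteq> UNIV" "finite K" "Q \<subseteq> (\<Union>k\<in>K. U k \<times> V k)"
   using compactE_image[OF cQ, of UNIV "%k. U k \<times> V k" thesis] by blast
  obtain n where n: "!!k. k \<in> K ==> k <= n" using finite_nat_set_iff_bounded_le K(2) by metis
  show ?thesis
  proof (intro exI[of _ "(1 / 4) ^ n / 2"] conjI ballI impI)
   fix x y assume xy: "x \<in> X" "y \<in> X" "\<bar>code U x - code U y\<bar> < (1 / 4) ^ n / 2"
   show "\<bar>h x - h y\<bar> < e"
   proof (rule ccontr)
    assume "\<not> \<bar>h x - h y\<bar> < e"
    then have "(x, y) \<in> Q" using xy by (simp add: Q_def)
    then obtain k where k: "k \<in> K" "x \<in> U k" "y \<in> V k" using K(3) by auto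
    then have "y \<in> U k" using code_digits[OF xy(3) n] by blast
    then show False using k UV(3) by blast
   qed
  qed simp
 qed
 have inj: "x = y" if "x \<in> X" "y \<in> X" "code U x = code U y" for x y
 proof (rule ccontr)
  assume "x \<noteq> y"
  then obtain k where k: "x \<in> U k" "y \<in> V k" using UV(4) by blast
  then have "y \<in> U k" using code_digits[of U x y k k] that by simp
  then show False using k UV(3) by blast
 qed
 define h' where "h' t = h (the_inv_into X (code U) t)" for t
 have h': "h' (code U x) = h x" if "x \<in> X" for x
  unfolding h'_def using that inj by (subst the_inv_into_f_f) (auto simp: inj_on_def)
 let ?S = "code U ` X"
 have "uniformly_continuous_on ?S h'"
  unfolding uniformly_continuous_on_def
 proof (intro allI impI)
  fix e :: real assume "e > 0"
  then obtain dl where "dl > 0" "!!x y. x \<in> X ==> y \<in> X ==> \<bar>code U x - code U y\<bar> < dl ==> \<bar>h x - h y\<bar> < e"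
   using unif by blast
  then show "\<exists>d>0. \<forall>x\<in>?S. \<forall>x'\<in>?S. dist x' x < d --> dist (h' x') (h' x) < e"
   by (intro exI[of _ dl]) (auto simp: h' dist_real_def)
 qed
 then obtain H where H: "uniformly_continuous_on (closure ?S) H" "!!t. t \<in> ?S ==> h' t = H t"
  using uniformly_continuous_on_extension_on_closure by metis
 have "?S \<subseteq> {0..4 / 3}" using code_bounds by auto
 then have "closure ?S \<subseteq> {0..4 / 3}" by (rule closure_minimal) simp
 then have "compact (closure ?S)"
  by (metis bounded_closed_interval bounded_subset closed_closure compact_eq_bounded_closed)
 moreover have Hc: "continuous_on (closure ?S) H" using H(1) by (rule uniformly_continuous_imp_continuous)
 ultimately have "bounded (H ` closure ?S)"
  using compact_continuous_image compact_imp_bounded by blast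
 then obtain B where B: "B > 0" "!!t. t \<in> closure ?S ==> norm (H t) <= B"
  unfolding bounded_pos by auto
 obtain G where "continuous_on UNIV G" "!!t. t \<in> closure ?S ==> G t = H t" "!!t. t \<in> UNIV ==> norm (G t) <= B"
  using Tietze[OF Hc, of UNIV B] B by auto
 then show ?thesis using that[of G B] H(2) h' closure_subset[of ?S] by (auto simp: subset_iff)
qed

text \<open>The image measures live on a bounded interval and have a weak limit \<open>La\<close> by
  tightness. It may charge points of the closure \<open>K\<close> that are not codes; such a point
  is sent by \<open>pp\<close> to a point of \<open>X\<close> at which every continuous function has
  the value prescribed by its extension, and \<open>La\<close> is transported back along
  \<open>pp\<close>.\<close>

theorem weak_compactness:
 assumes nus: "!!n. prob_on (nus n)"
 obtains r nu where "strict_mono (r :: nat => nat)" "prob_on nu" "wconv (nus \<circ> r) nu"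
proof -
 obtain U V :: "nat => 'm set" where UV: "!!k. open (U k)" "!!k. open (V k)" "!!k. U k \<inter> V k = {}"
  "!!x y. x \<noteq> y ==> \<exists>k. x \<in> U k \<and> y \<in> V k"
  using separating_pairs by metis
 let ?u = "code U"
 have um: "?u \<in> borel_measurable nu" if "prob_on nu" for nu using that UV(1) by (rule code_measurable)
 define Ls where "Ls n = distr (nus n) borel ?u" for n
 have rd: "real_distribution (Ls n)" for n
  unfolding Ls_def using prob_space.real_distribution_distr[OF prob_onD(1) um] nus by blast
 have "tight Ls"
  unfolding tight_def
 proof (intro conjI allI impI rd)
  fix e :: real assume e: "e > 0"
  have "measure (Ls n) {-1<..2} = 1" for n
  proof -
   interpret prob_space "nus n" using prob_onD(1)[OF nus] .
   have "?u -` {-1<..2} \<inter> space (nus n) = space (nus n)"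
   proof -
    have "-1 < ?u x" "?u x <= 2" for x using code_bounds[of U x] by linarith+
    then show ?thesis by auto
   qed
   then show ?thesis unfolding Ls_def by (subst measure_distr[OF um[OF nus]]) (auto simp: prob_space)
  qed
  then show "\<exists>a b. a < b \<and> (\<forall>n. 1 - e < measure (Ls n) {a<..b})"
   using e by (intro exI[of _ "-1"] exI[of _ 2]) auto
 qed
 from tight_imp_convergent_subsubsequence[OF this strict_mono_id]
 obtain r La where r: "strict_mono (r :: nat => nat)" and La: "real_distribution La"
  and wc: "weak_conv_m (Ls \<circ> r) La" by auto
 interpret La: real_distribution La by (rule La)
 have lim: "(%n. \<integral>x. G (?u x) \<partial>nus (r n)) \<longlonglongrightarrow> (\<integral>t. G t \<partial>La)"
  if G: "continuous_on UNIV G" "!!t. \<bar>G t\<bar> <= B" for G :: "real => real" and B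
 proof -
  have "(%n. integral\<^sup>L ((Ls \<circ> r) n) G) \<longlonglongrightarrow> integral\<^sup>L La G"
   using rd La wc G
   by (intro weak_conv_imp_integral_bdd_continuous_conv[where B = B])
    (auto simp: continuous_on_eq_continuous_at comp_def)
  moreover have "integral\<^sup>L ((Ls \<circ> r) n) G = (\<integral>x. G (?u x) \<partial>nus (r n))" for n
   unfolding Ls_def comp_def using um[OF nus] G(1)
   by (intro integral_distr) (auto intro: borel_measurable_continuous_onI)
  ultimately show ?thesis by simp
 qed
 define K where "K = closure (?u ` X)"
 have K: "closed K" "K \<noteq> {}" using X_nonempty by (auto simp: K_def)
 have AEK: "AE t in La. t \<in> K"
 proof -
  define G where "G t = min 1 (infdist t K)" for t
  have Gc: "continuous_on UNIV G" unfolding G_def by (intro continuous_intros)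
  have Gb: "\<bar>G t\<bar> <= 1" "0 <= G t" for t unfolding G_def by (auto simp: infdist_nonneg)
  have "(\<integral>x. G (?u x) \<partial>nus (r n)) = 0" for n
  proof -
   have "G (?u x) = 0" if "x \<in> X" for x
    using that closure_subset[of "?u ` X"] by (auto simp: G_def K_def subset_iff)
   then have "(\<integral>x. G (?u x) \<partial>nus (r n)) = (\<integral>x. 0 \<partial>nus (r n))"
    using prob_onD(2)[OF nus] by (intro Bochner_Integration.integral_cong) auto
   then show ?thesis by simp
  qed
  with lim[OF Gc Gb(1)] have "(\<integral>t. G t \<partial>La) = 0" by (simp add: LIMSEQ_const_iff)
  moreover have "integrable La G"
   using Gb borel_measurable_continuous_onI[OF Gc] by (intro La.integrable_const_bound[of _ 1]) auto
  ultimately have "AE t in La. G t = 0" using integral_nonneg_eq_0_iff_AE Gb by blast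
  then show ?thesis
  proof eventually_elim
   case (elim t)
   then have "infdist t K = 0" by (auto simp: G_def min_def split: if_splits)
   then show ?case using in_closed_iff_infdist_zero[OF K] by simp
  qed
 qed
 \<comment> \<open>A cluster point in \<open>X\<close> of points whose codes tend to
   \<open>t\<close> serves all continuous \<open>h\<close> at once.\<close>
 have "\<exists>x\<in>X. \<forall>h G. continuous_on X h --> continuous_on UNIV G --> (\<forall>y\<in>X. G (?u y) = h y) --> G t = (h x :: real)"
  if "t \<in> K" for t
 proof -
  obtain s where s: "!!n. s n \<in> ?u ` X" "s \<longlonglongrightarrow> t"
   using \<open>t \<in> K\<close> unfolding K_def closure_sequential by blast
  then have "\<forall>n. \<exists>x\<in>X. s n = ?u x" by blast
  then obtain xs where xs: "!!n. xs n \<in> X" "!!n. s n = ?u (xs n)" by metis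
  obtain x q where x: "x \<in> X" "strict_mono (q :: nat => nat)" "(xs \<circ> q) \<longlonglongrightarrow> x"
   using compact_imp_seq_compact[OF compact_X] xs(1) unfolding seq_compact_def by metis
  show ?thesis
  proof (intro bexI[OF _ x(1)] allI impI)
   fix h and G :: "real => real"
   assume h: "continuous_on X h" and G: "continuous_on UNIV G" and eq: "\<forall>y\<in>X. G (?u y) = h y"
   have "(%n. s (q n)) \<longlonglongrightarrow> t" using LIMSEQ_subseq_LIMSEQ[OF s(2) x(2)] by (simp add: comp_def)
   then have "(%n. G (s (q n))) \<longlonglongrightarrow> G t"
    using G by (intro isCont_tendsto_compose[of t G]) (auto simp: continuous_on_eq_continuous_at)
   moreover have "(%n. h (xs (q n))) \<longlonglongrightarrow> h x"
    using continuous_on_tendsto_compose[OF h x(3) x(1)] xs(1) by (simp add: comp_def)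
   ultimately show "G t = h x" using eq xs by (auto intro: LIMSEQ_unique)
  qed
 qed
 then obtain pp0 where pp0: "!!t. t \<in> K ==> pp0 t \<in> X"
  "!!t h G. t \<in> K ==> continuous_on X h ==> continuous_on UNIV G ==> (!!y. y \<in> X ==> G (?u y) = h y) ==> G t = (h (pp0 t) :: real)"
  by metis
 obtain x0 where x0: "x0 \<in> X" using X_nonempty by blast
 define pp where "pp t = (if t \<in> K then pp0 t else x0)" for t
 have ppm: "pp \<in> measurable La (restrict_space borel X)"
 proof (rule measurable_sigma_sets[OF borel_X_generated])
  show "pp \<in> space La \<rightarrow> X" using pp0(1) x0 by (auto simp: pp_def)
  show "pp -` C \<inter> space La \<in> sets La" if "C \<in> {C. closed C \<and> C \<subseteq> X}" for C
  proof (cases "C = {}")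
   case False
   then have C: "C \<subseteq> X" "C \<noteq> {}" "closed C" using that by auto
   obtain G B where G: "continuous_on UNIV (G :: real => real)" "!!t. \<bar>G t\<bar> <= B" "!!x. x \<in> X ==> G (?u x) = dist_set C x"
    using code_extension[OF UV continuous_dist_set[OF C(1,2)]] by metis
   have "pp t \<in> C \<longleftrightarrow> G t = 0" if "t \<in> K" for t
    using pp0(2)[OF that continuous_dist_set[OF C(1,2)] G(1,3)] dist_set_zero_iff[OF C pp0(1)[OF that]] that
    by (simp add: pp_def)
   then have "pp -` C = (K \<inter> {t. G t = 0}) \<union> (if x0 \<in> C then - K else {})"
    by (auto simp: pp_def split: if_splits)
   moreover have "{t. G t = 0} \<in> sets borel"
    using closed_Collect_eq[OF G(1) continuous_on_const] by (rule borel_closed)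
   ultimately show ?thesis using K(1) by auto
  qed simp
 qed (auto)
 define nu where "nu = distr La (restrict_space borel X) pp"
 have nu: "prob_on nu"
  unfolding prob_on_def nu_def using La.prob_space_distr[OF ppm] by (simp add: space_restrict_space)
 have "wconv (nus \<circ> r) nu"
  unfolding wconv_def
 proof (intro allI impI)
  fix h :: "'m => real" assume h: "continuous_on X h"
  obtain G B where G: "continuous_on UNIV (G :: real => real)" "!!t. \<bar>G t\<bar> <= B" "!!x. x \<in> X ==> G (?u x) = h x"
   using code_extension[OF UV h] by metis
  have hm: "h \<in> borel_measurable (restrict_space borel X)"
   using h by (rule borel_measurable_continuous_on_restrict)
  have "(\<integral>x. h x \<partial>nu) = (\<integral>t. h (pp t) \<partial>La)"
   unfolding nu_def using ppm hm by (rule integral_distr)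
  also have "\<dots> = (\<integral>t. G t \<partial>La)"
  proof (rule integral_cong_AE)
   show "AE t in La. h (pp t) = G t"
    using AEK by eventually_elim (simp add: pp_def pp0(2)[OF _ h G(1,3)])
   show "(%t. h (pp t)) \<in> borel_measurable La" using measurable_compose[OF ppm hm] .
   show "G \<in> borel_measurable La" using G(1) by (simp add: borel_measurable_continuous_onI)
  qed
  finally have "(%n. \<integral>x. G (?u x) \<partial>nus (r n)) \<longlonglongrightarrow> (\<integral>x. h x \<partial>nu)"
   using lim[OF G(1,2)] by simp
  moreover have "(\<integral>x. G (?u x) \<partial>nus (r n)) = (\<integral>x. h x \<partial>nus (r n))" for n
   using G(3) prob_onD(2)[OF nus] by (intro Bochner_Integration.integral_cong) auto
  ultimately show "(%n. \<integral>x. h x \<partial>(nus \<circ> r) n) \<longlonglongrightarrow> (\<integral>x. h x \<partial>nu)" by (simp add: comp_def)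
 qed
 with r nu show ?thesis by (rule that)
qed

end

section \<open>Expanding maps\<close>

context compact_metric
begin

text \<open>The set where \<open>F\<close> is at least \<open>e\<close> is compact and misses the
  diagonal, so \<open>rh\<close> is bounded below on it by a positive number.\<close>

lemma rho_gap:
 fixes F :: "'m => 'm => real"
 assumes F: "continuous_on (X \<times> X) (%(x, y). F x y)" and diag: "!!x. x \<in> X ==> F x x < e"
 obtains dl where "dl > 0" "!!x y. x \<in> X ==> y \<in> X ==> rh x y < dl ==> F x y < e"
proof -
 define Q where "Q = {p \<in> X \<times> X. e <= (%(x, y). F x y) p}"
 have "closed Q"
  unfolding Q_def by (intro continuous_on_closed_Collect_le continuous_on_const F closed_Times closed_X)
 then have cQ: "compact Q"
  using compact_Int_closed[OF compact_Times[OF compact_X compact_X], of Q] unfolding Q_def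
  by (metis (no_types, lifting) Int_absorb1 mem_Collect_eq subsetI)
 show ?thesis
 proof (cases "Q = {}")
  case True
  then have "F x y < e" if "x \<in> X" "y \<in> X" for x y using that by (force simp: Q_def)
  then show ?thesis using that[of 1] by simp
 next
  case False
  have "Q \<subseteq> X \<times> X" by (auto simp: Q_def)
  then have "continuous_on Q (%(x, y). rh x y)" using rho_cont continuous_on_subset by blast
  then obtain p where p: "p \<in> Q" "!!q. q \<in> Q ==> (%(x, y). rh x y) p <= (%(x, y). rh x y) q"
   using continuous_attains_inf[OF cQ False] by blast
  obtain a b where ab: "p = (a, b)" by (cases p)
  have "a \<in> X" "b \<in> X" "a \<noteq> b" using p(1) ab diag by (force simp: Q_def)+
  then have "rh a b > 0" using rho_zero[of a b] rho_nonneg[of a b] by simp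
  moreover have "F x y < e" if "x \<in> X" "y \<in> X" "rh x y < rh a b" for x y
  proof (rule ccontr)
   assume "\<not> F x y < e"
   then have "(x, y) \<in> Q" using that by (simp add: Q_def)
   from p(2)[OF this] show False using that ab by simp
  qed
  ultimately show ?thesis by (rule that)
 qed
qed

lemma ball_openin: "x \<in> X ==> openin (top_of_set X) {y \<in> X. rh x y < r}"
proof -
 assume x: "x \<in> X"
 have "openin (top_of_set X) (X \<inter> rh x -` {..<r})"
  using continuous_rho[OF x] open_lessThan by (rule continuous_openin_preimage_gen)
 moreover have "X \<inter> rh x -` {..<r} = {y \<in> X. rh x y < r}" by auto
 ultimately show ?thesis by simp
qed

lemma openin_contains_ball:
 assumes U: "openin (top_of_set X) U" and x: "x \<in> U"
 obtains r where "r > 0" "!!y. y \<in> X ==> rh x y < r ==> y \<in> U"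
proof -
 have UX: "U \<subseteq> X" using openin_imp_subset[OF U] .
 have "closed (X - U)"
  using U closed_X by (metis closedin_closed_eq closedin_diff closedin_topspace topspace_euclidean_subtopology)
 then have c: "compact (X - U)" using compact_X by (metis Diff_subset compact_Int_closed inf.absorb_iff2)
 show ?thesis
 proof (cases "X - U = {}")
  case True then show ?thesis using that[of 1] by auto
 next
  case False
  have xX: "x \<in> X" using x UX by blast
  have "continuous_on (X - U) (rh x)" using continuous_rho[OF xX] Diff_subset by (rule continuous_on_subset)
  then obtain z where z: "z \<in> X - U" "!!y. y \<in> X - U ==> rh x z <= rh x y"
   using continuous_attains_inf[OF c False] by blast
  have "x \<noteq> z" using z(1) x by blast
  then have "rh x z > 0" using rho_zero[of x z] rho_nonneg[of x z] z(1) xX by force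
  moreover have "y \<in> U" if "y \<in> X" "rh x y < rh x z" for y using z(2)[of y] that by force
  ultimately show ?thesis by (rule that)
 qed
qed

lemma ball_cover:
 fixes s :: "'m => real"
 assumes s: "!!x. x \<in> X ==> s x > 0"
 obtains C where "finite C" "C \<subseteq> X" "!!x. x \<in> X ==> \<exists>c\<in>C. rh c x < s c"
proof -
 have "\<exists>T. open T \<and> {y \<in> X. rh c y < s c} = X \<inter> T" if "c \<in> X" for c
  using ball_openin[OF that, of "s c"] unfolding openin_open by blast
 then obtain T where T: "!!c. c \<in> X ==> open (T c)" "!!c. c \<in> X ==> {y \<in> X. rh c y < s c} = X \<inter> T c" by metis
 have "X \<subseteq> (\<Union>c\<in>X. T c)"
 proof
  fix x assume x: "x \<in> X"
  then have "x \<in> {y \<in> X. rh x y < s x}" using s by simp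
  then show "x \<in> (\<Union>c\<in>X. T c)" using T(2)[OF x] x by blast
 qed
 then obtain C where C: "C \<subseteq> X" "finite C" "X \<subseteq> (\<Union>c\<in>C. T c)"
  by (rule compactE_image[OF compact_X, of X T, rotated]) (use T(1) in blast)+
 show ?thesis
 proof (rule that[OF C(2,1)])
  fix x assume x: "x \<in> X"
  then obtain c where c: "c \<in> C" "x \<in> T c" using C(3) by blast
  then have "x \<in> {y \<in> X. rh c y < s c}" using T(2)[of c] C(1) x by blast
  then show "\<exists>c\<in>C. rh c x < s c" using c by blast
 qed
qed

end

text \<open>A purely topological form of expansion: inverse branches are not assumed to contract.
  Openness supplies preimages near a given orbit and expansiveness keeps them close for all times,
  which together give \<open>lift\<close>.\<close>

locale expanding_map = compact_metric X rh
 for X :: "'m::{t2_space, second_countable_topology} set" and rh +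
 fixes f :: "'m => 'm" and e0 :: real
 assumes f_cont: "continuous_on X f" and f_onto: "f ` X = X"
  and f_open: "openin (top_of_set X) U ==> openin (top_of_set X) (f ` U)"
  and e0_pos: "e0 > 0"
  and expansive: "x \<in> X ==> y \<in> X ==> (!!n. rh ((f ^^ n) x) ((f ^^ n) y) <= e0) ==> x = y"
  and mixing: "topologically_mixing_on X f"
begin

lemma funpow_X: "x \<in> X ==> (f ^^ n) x \<in> X"
 by (induction n) (use f_onto in auto)

lemma f_X: "x \<in> X ==> f x \<in> X"
 using f_onto by blast

lemma funpow_cont: "continuous_on X (f ^^ n)"
proof (induction n)
 case 0 show ?case by (simp add: id_def)
next
 case (Suc n)
 have "continuous_on X (f \<circ> f ^^ n)"
  using Suc funpow_X by (intro continuous_on_compose continuous_on_subset[OF f_cont]) auto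
 then show ?case by simp
qed

lemma rho_funpow_cont: "continuous_on (X \<times> X) (%(x, y). rh ((f ^^ n) x) ((f ^^ n) y))"
proof -
 have c: "continuous_on (X \<times> X) (%p. ((f ^^ n) (fst p), (f ^^ n) (snd p)))"
  by (intro continuous_intros continuous_on_compose2[OF funpow_cont]) auto
 have "continuous_on (X \<times> X) (%p. (%(x, y). rh x y) ((f ^^ n) (fst p), (f ^^ n) (snd p)))"
  by (rule continuous_on_compose2[OF rho_cont c]) (auto simp: funpow_X)
 then show ?thesis by (simp add: case_prod_beta)
qed

lemma bowen_unif:
 assumes "(r::real) > 0"
 shows "\<exists>dl>0. \<forall>x\<in>X. \<forall>y\<in>X. rh x y < dl --> (\<forall>j\<le>n. rh ((f ^^ j) x) ((f ^^ j) y) < r)"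
proof (induction n)
 case 0 show ?case using assms by auto
next
 case (Suc n)
 then obtain dl where dl: "dl > 0" "\<forall>x\<in>X. \<forall>y\<in>X. rh x y < dl --> (\<forall>j\<le>n. rh ((f ^^ j) x) ((f ^^ j) y) < r)"
  by blast
 have "rh ((f ^^ Suc n) x) ((f ^^ Suc n) x) < r" if "x \<in> X" for x
  using rho_refl[OF funpow_X[OF that, of "Suc n"]] assms by (simp only:)
 then obtain dl' where dl': "dl' > 0" "!!x y. x \<in> X ==> y \<in> X ==> rh x y < dl' ==> rh ((f ^^ Suc n) x) ((f ^^ Suc n) y) < r"
  using rho_gap[OF rho_funpow_cont] by metis
 show ?case
 proof (intro exI[of _ "min dl dl'"] conjI ballI impI allI)
  fix x y j assume "x \<in> X" "y \<in> X" "rh x y < min dl dl'" "j <= Suc n"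
  then show "rh ((f ^^ j) x) ((f ^^ j) y) < r" using dl(2) dl'(2) by (cases "j = Suc n") auto
 qed (use dl dl' in auto)
qed

text \<open>Otherwise pairs at distance at least \<open>th\<close> that stay close for longer and
  longer times would accumulate at two distinct points that stay \<open>e0\<close>-close
  forever.\<close>

lemma uniform_expansive:
 assumes th: "th > 0"
 obtains M where "!!x y. x \<in> X ==> y \<in> X ==> (!!j. j <= M ==> rh ((f ^^ j) x) ((f ^^ j) y) <= e0) ==> rh x y < th"
proof (rule ccontr)
 assume "\<not> thesis"
 then have "\<forall>M. \<exists>p. p \<in> X \<times> X \<and> (\<forall>j\<le>M. rh ((f ^^ j) (fst p)) ((f ^^ j) (snd p)) <= e0) \<and> th <= rh (fst p) (snd p)"
  using that by (metis fst_conv linorder_not_less mem_Times_iff snd_conv)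
 then obtain p where p: "!!M. p M \<in> X \<times> X" "!!M j. j <= M ==> rh ((f ^^ j) (fst (p M))) ((f ^^ j) (snd (p M))) <= e0"
  "!!M. th <= rh (fst (p M)) (snd (p M))" by metis
 obtain q r where q: "q \<in> X \<times> X" "strict_mono (r :: nat => nat)" "(p \<circ> r) \<longlonglongrightarrow> q"
  using compact_imp_seq_compact[OF compact_Times[OF compact_X compact_X]] p(1) unfolding seq_compact_def by metis
 have lim: "(%M. rh ((f ^^ j) (fst (p (r M)))) ((f ^^ j) (snd (p (r M))))) \<longlonglongrightarrow> rh ((f ^^ j) (fst q)) ((f ^^ j) (snd q))" for j
  using continuous_on_tendsto_compose[OF rho_funpow_cont[of j] q(3,1)] p(1) by (simp add: case_prod_beta comp_def)
 have "fst q = snd q"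
 proof (rule expansive)
  fix j
  have "rh ((f ^^ j) (fst (p (r M)))) ((f ^^ j) (snd (p (r M)))) <= e0" if "M >= j" for M
   using p(2)[of j "r M"] seq_suble[OF q(2), of M] that by linarith
  then show "rh ((f ^^ j) (fst q)) ((f ^^ j) (snd q)) <= e0"
   by (intro LIMSEQ_le_const2[OF lim[of j]]) blast
 qed (use q(1) in auto)
 moreover have "th <= rh (fst q) (snd q)" using p(3) by (intro LIMSEQ_le_const[OF lim[of 0, simplified]]) auto
 ultimately show False using th q(1) by auto
qed

lemma eq_if_funpow_eq:
 assumes "x \<in> X" "y \<in> X" "(f ^^ n) x = (f ^^ n) y" "!!j. j <= n ==> rh ((f ^^ j) x) ((f ^^ j) y) <= e0"
 shows "x = y"
proof (rule expansive[OF assms(1,2)])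
 fix m show "rh ((f ^^ m) x) ((f ^^ m) y) <= e0"
 proof (cases "m <= n")
  case False
  then have "(f ^^ m) z = (f ^^ (m - n)) ((f ^^ n) z)" for z
   by (metis add_diff_inverse_nat comp_apply funpow_add add.commute not_less_iff_gr_or_eq nat_le_linear not_le)
  then have "rh ((f ^^ m) x) ((f ^^ m) y) = 0" using assms funpow_X by simp
  then show ?thesis using e0_pos by simp
 qed (use assms in auto)
qed

section \<open>Inverse branches along orbits and specification\<close>

lemma uniform_open:
 assumes e: "ep > 0"
 obtains dl where "dl > 0" "!!x y. x \<in> X ==> y \<in> X ==> rh (f x) y < dl ==> \<exists>z\<in>X. f z = y \<and> rh x z < ep"
proof -
 have loc: "\<exists>dl>0. \<forall>y\<in>X. rh (f x) y < dl --> (\<exists>z\<in>X. f z = y \<and> rh x z < ep / 2)" if x: "x \<in> X" for x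
 proof -
  have "f x \<in> f ` {z \<in> X. rh x z < ep / 2}" using x e by auto
  from openin_contains_ball[OF f_open[OF ball_openin[OF x, of "ep / 2"]] this]
  obtain r where "r > 0" "!!y. y \<in> X ==> rh (f x) y < r ==> y \<in> f ` {z \<in> X. rh x z < ep / 2}" by blast
  then show ?thesis by (intro exI[of _ r]) blast
 qed
 then obtain d where d: "!!x. x \<in> X ==> d x > 0"
  "!!x y. x \<in> X ==> y \<in> X ==> rh (f x) y < d x ==> \<exists>z\<in>X. f z = y \<and> rh x z < ep / 2" by metis
 have "\<exists>s>0. \<forall>x'\<in>X. rh x x' < s --> rh x x' < ep / 2 \<and> rh (f x) (f x') < d x / 2" if x: "x \<in> X" for x
 proof -
  obtain dl where dl: "dl > 0" "\<forall>u\<in>X. \<forall>y\<in>X. rh u y < dl --> (\<forall>j\<le>1. rh ((f ^^ j) u) ((f ^^ j) y) < min (ep / 2) (d x / 2))"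
   using bowen_unif[of "min (ep / 2) (d x / 2)" 1] d(1)[OF x] e by auto
  show ?thesis
  proof (intro exI[of _ dl] conjI ballI impI dl(1))
   fix x' assume "x' \<in> X" "rh x x' < dl"
   then have "\<forall>j\<le>1. rh ((f ^^ j) x) ((f ^^ j) x') < min (ep / 2) (d x / 2)" using dl(2) x by blast
   from this[rule_format, of 0] this[rule_format, of 1]
   show "rh x x' < ep / 2" "rh (f x) (f x') < d x / 2" by auto
  qed
 qed
 then obtain s where s: "!!x. x \<in> X ==> s x > 0"
  "!!x x'. x \<in> X ==> x' \<in> X ==> rh x x' < s x ==> rh x x' < ep / 2"
  "!!x x'. x \<in> X ==> x' \<in> X ==> rh x x' < s x ==> rh (f x) (f x') < d x / 2" by metis
 obtain C where C: "finite C" "C \<subseteq> X" "!!x. x \<in> X ==> \<exists>c\<in>C. rh c x < s c"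
  using ball_cover[of s, OF s(1)] by blast
 have Cne: "C \<noteq> {}" using C(3) X_nonempty by blast
 define dl where "dl = Min ((%c. d c / 2) ` C)"
 have dpos: "dl > 0" unfolding dl_def using C(1,2) Cne d(1) by (subst Min_gr_iff) auto
 have dle: "dl <= d c / 2" if "c \<in> C" for c unfolding dl_def using C(1) that by (intro Min_le) auto
 show ?thesis
 proof (rule that[OF dpos])
  fix x y assume xy: "x \<in> X" "y \<in> X" "rh (f x) y < dl"
  then obtain c where c: "c \<in> C" "rh c x < s c" using C(3) by blast
  then have cX: "c \<in> X" "rh c x < s c" using C(2) by blast+
  have "rh (f c) y <= rh (f c) (f x) + rh (f x) y" using cX xy f_X by (intro rho_tri) auto
  also have "\<dots> < d c" using s(3)[OF cX(1) xy(1) cX(2)] xy(3) dle[OF c(1)] by linarith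
  finally obtain z where z: "z \<in> X" "f z = y" "rh c z < ep / 2" using d(2)[OF cX(1) xy(2)] by blast
  have "rh x z <= rh x c + rh c z" using xy cX z by (intro rho_tri) auto
  also have "\<dots> < ep" using s(2)[OF cX(1) xy(1) cX(2)] rho_sym[OF xy(1) cX(1)] z(3) by linarith
  finally show "\<exists>z\<in>X. f z = y \<and> rh x z < ep" using z by blast
 qed
qed

lemma lift_finite:
 assumes c: "c > 0"
 shows "\<exists>dl>0. \<forall>n\<le>k. \<forall>x\<in>X. \<forall>y\<in>X. rh ((f ^^ n) x) y < dl -->
  (\<exists>z\<in>X. (f ^^ n) z = y \<and> (\<forall>j\<le>n. rh ((f ^^ j) x) ((f ^^ j) z) < c))"
proof (induction k)
 case 0 then show ?case using c by (intro exI[of _ c]) auto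
next
 case (Suc k)
 then obtain d where d: "d > 0" "!!n x y. n <= k ==> x \<in> X ==> y \<in> X ==> rh ((f ^^ n) x) y < d ==>
  \<exists>z\<in>X. (f ^^ n) z = y \<and> (\<forall>j\<le>n. rh ((f ^^ j) x) ((f ^^ j) z) < c)" by blast
 obtain e where e: "e > 0" "!!x y. x \<in> X ==> y \<in> X ==> rh (f x) y < e ==> \<exists>z\<in>X. f z = y \<and> rh x z < d"
  using uniform_open[OF d(1)] by blast
 let ?d = "min (min e d) c"
 have "\<exists>z\<in>X. (f ^^ n) z = y \<and> (\<forall>j\<le>n. rh ((f ^^ j) x) ((f ^^ j) z) < c)"
  if A: "n <= Suc k" "x \<in> X" "y \<in> X" "rh ((f ^^ n) x) y < ?d" for n x y
 proof (cases "n = Suc k")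
  case False then show ?thesis using d(2)[of n x y] A by auto
 next
  case True
  have "rh (f ((f ^^ k) x)) y < e" using A True by simp
  then obtain w where w: "w \<in> X" "f w = y" "rh ((f ^^ k) x) w < d"
   using e(2)[of "(f ^^ k) x" y] A funpow_X by blast
  then obtain z where z: "z \<in> X" "(f ^^ k) z = w" "\<forall>j\<le>k. rh ((f ^^ j) x) ((f ^^ j) z) < c"
   using d(2)[of k x w] A by blast
  have "(f ^^ n) z = y" using z w True by simp
  moreover have "rh ((f ^^ j) x) ((f ^^ j) z) < c" if "j <= n" for j
   using z(3) that True A(4) \<open>(f ^^ n) z = y\<close> by (cases "j = n") auto
  ultimately show ?thesis using z(1) by blast
 qed
 then show ?case using e(1) d(1) c by (intro exI[of _ ?d]) auto
qed

text \<open>The tolerance must not deteriorate with \<open>n\<close>. Once an orbit is longer than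
  \<open>M\<close>, the lift along the orbit of \<open>f x\<close> has been \<open>e0\<close>-close
  to it for \<open>M\<close> steps, so by expansiveness it starts so close to \<open>f x\<close>
  that one further preimage within the same tolerance \<open>c\<close> exists; only times up to
  \<open>M\<close> use the induction of \<open>lift_finite\<close>.\<close>

lemma lift:
 assumes ep: "ep > 0"
 obtains dl where "dl > 0" "!!n x y. x \<in> X ==> y \<in> X ==> rh ((f ^^ n) x) y < dl ==>
  \<exists>z\<in>X. (f ^^ n) z = y \<and> (\<forall>j\<le>n. rh ((f ^^ j) x) ((f ^^ j) z) < ep)"
proof -
 define c where "c = min ep e0"
 have c: "c > 0" "c <= ep" "c <= e0" using ep e0_pos by (auto simp: c_def)
 obtain d1 where d1: "d1 > 0" "!!x y. x \<in> X ==> y \<in> X ==> rh (f x) y < d1 ==> \<exists>z\<in>X. f z = y \<and> rh x z < c"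
  using uniform_open[OF c(1)] by blast
 obtain M where M: "!!x y. x \<in> X ==> y \<in> X ==> (!!j. j <= M ==> rh ((f ^^ j) x) ((f ^^ j) y) <= e0) ==> rh x y < d1"
  using uniform_expansive[OF d1(1)] by blast
 obtain dl where dl: "dl > 0" "!!n x y. n <= M ==> x \<in> X ==> y \<in> X ==> rh ((f ^^ n) x) y < dl ==>
  \<exists>z\<in>X. (f ^^ n) z = y \<and> (\<forall>j\<le>n. rh ((f ^^ j) x) ((f ^^ j) z) < c)" using lift_finite[OF c(1), of M] by blast
 have lifts: "\<exists>z\<in>X. (f ^^ n) z = y \<and> (\<forall>j\<le>n. rh ((f ^^ j) x) ((f ^^ j) z) < c)"
  if "x \<in> X" "y \<in> X" "rh ((f ^^ n) x) y < dl" for n x y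
  using that
 proof (induction n arbitrary: x)
  case 0 then show ?case using dl(2)[of 0 x y] by simp
 next
  case (Suc n)
  show ?case
  proof (cases "Suc n <= M")
   case True then show ?thesis using dl(2) Suc.prems by blast
  next
   case False
   have "rh ((f ^^ n) (f x)) y < dl" using Suc.prems by (simp add: funpow_swap1)
   then obtain w where w: "w \<in> X" "(f ^^ n) w = y" "\<forall>j\<le>n. rh ((f ^^ j) (f x)) ((f ^^ j) w) < c"
    using Suc.IH[of "f x"] Suc.prems f_X by blast
   have "rh (f x) w < d1"
   proof (rule M)
    show "rh ((f ^^ j) (f x)) ((f ^^ j) w) <= e0" if "j <= M" for j
     using w(3)[rule_format, of j] False that c(3) by linarith
   qed (use Suc.prems w f_X in auto)
   then obtain z where z: "z \<in> X" "f z = w" "rh x z < c"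
    using d1(2)[of x w] Suc.prems w by blast
   have "rh ((f ^^ j) x) ((f ^^ j) z) < c" if "j <= Suc n" for j
   proof (cases j)
    case (Suc i)
    then show ?thesis using w(3)[rule_format, of i] that z(2) by (simp add: funpow_swap1)
   qed (use z in simp)
   moreover have "(f ^^ Suc n) z = y" using z w by (simp add: funpow_swap1)
   ultimately show ?thesis using z(1) by blast
  qed
 qed
 show ?thesis
 proof (rule that[OF dl(1)])
  fix n x y assume "x \<in> X" "y \<in> X" "rh ((f ^^ n) x) y < dl"
  then obtain z where "z \<in> X" "(f ^^ n) z = y" "\<forall>j\<le>n. rh ((f ^^ j) x) ((f ^^ j) z) < c"
   using lifts by blast
  moreover have "\<forall>j\<le>n. rh ((f ^^ j) x) ((f ^^ j) z) < ep"
   using calculation(3) c(2) by (meson less_le_trans)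
  ultimately show "\<exists>z\<in>X. (f ^^ n) z = y \<and> (\<forall>j\<le>n. rh ((f ^^ j) x) ((f ^^ j) z) < ep)" by blast
 qed
qed

text \<open>Mixing yields a common time \<open>g\<close> at which the image of each of finitely many
  small balls meets all of them; \<open>lift\<close> turns the near hit into an exact preimage of
  \<open>y\<close>.\<close>

lemma uniform_onto:
 assumes dl: "dl > 0"
 obtains g where "!!x y. x \<in> X ==> y \<in> X ==> \<exists>z\<in>X. rh x z < dl \<and> (f ^^ g) z = y"
proof -
 have d3: "dl / 3 > 0" using dl by simp
 obtain d where d: "d > 0" "!!n x y. x \<in> X ==> y \<in> X ==> rh ((f ^^ n) x) y < d ==>
  \<exists>z\<in>X. (f ^^ n) z = y \<and> (\<forall>j\<le>n. rh ((f ^^ j) x) ((f ^^ j) z) < dl / 3)"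
  using lift[OF d3] by blast
 define r where "r = min (dl / 3) (d / 2)"
 have r: "r > 0" "r <= dl / 3" "2 * r <= d" using dl d(1) by (auto simp: r_def)
 obtain C where C: "finite C" "C \<subseteq> X" "!!x. x \<in> X ==> \<exists>c\<in>C. rh c x < r" using ball_cover[of "%_. r"] r(1) by blast
 let ?B = "%c. {y \<in> X. rh c y < r}"
 have "\<exists>N. \<forall>n\<ge>N. (f ^^ n) ` ?B (fst p) \<inter> ?B (snd p) \<noteq> {}" if "p \<in> C \<times> C" for p
 proof -
  have a: "fst p \<in> X" "snd p \<in> X" using that C(2) by auto
  then have "fst p \<in> ?B (fst p)" "snd p \<in> ?B (snd p)" using r(1) by auto
  then have ne: "?B (fst p) \<noteq> {}" "?B (snd p) \<noteq> {}" by blast+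
  show ?thesis
   by (rule mixing[unfolded topologically_mixing_on_def, THEN spec, THEN spec, THEN mp])
    (intro conjI ball_openin[OF a(1)] ball_openin[OF a(2)] ne)
 qed
 then have "\<forall>p\<in>C \<times> C. \<exists>N. \<forall>n\<ge>N. (f ^^ n) ` ?B (fst p) \<inter> ?B (snd p) \<noteq> {}" by (intro ballI)
 from bchoice[OF this] obtain N where
  N0: "\<forall>p\<in>C \<times> C. \<forall>n\<ge>N p. (f ^^ n) ` ?B (fst p) \<inter> ?B (snd p) \<noteq> {}" by (rule exE)
 note N = N0[rule_format]
 define g where "g = Max (insert 0 (N ` (C \<times> C)))"
 have g: "N p <= g" if "p \<in> C \<times> C" for p unfolding g_def using C(1) that by (intro Max_ge) auto
 show ?thesis
 proof (rule that)
  fix x y assume xy: "x \<in> X" "y \<in> X"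
  obtain a b where ab: "a \<in> C" "rh a x < r" "b \<in> C" "rh b y < r" using C(3) xy by blast
  then have abX: "a \<in> X" "b \<in> X" using C(2) by auto
  obtain u where u: "u \<in> X" "rh a u < r" "rh b ((f ^^ g) u) < r"
   using N[of "(a, b)" g] g[of "(a, b)"] ab by auto
  have fu: "(f ^^ g) u \<in> X" using u funpow_X by blast
  have "rh ((f ^^ g) u) y <= rh ((f ^^ g) u) b + rh b y" using fu abX xy by (intro rho_tri) auto
  also have "\<dots> < d" using u(3) ab(4) rho_sym[OF fu abX(2)] r(3) by linarith
  finally obtain z where z: "z \<in> X" "(f ^^ g) z = y" "\<forall>j\<le>g. rh ((f ^^ j) u) ((f ^^ j) z) < dl / 3"
   using d(2)[OF u(1) xy(2)] by blast
  have "rh u z < dl / 3" using z(3)[rule_format, of 0] by simp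
  moreover have "rh x z <= rh x a + rh a z" using xy abX z by (intro rho_tri) auto
  moreover have "rh a z <= rh a u + rh u z" using xy abX z u by (intro rho_tri) auto
  ultimately have "rh x z < dl" using ab(2) u(2) rho_sym[OF xy(1) abX(1)] r(2) by linarith
  then show "\<exists>z\<in>X. rh x z < dl \<and> (f ^^ g) z = y" using z by blast
 qed
qed

text \<open>The point \<open>(f ^^ n) x\<close> is moved slightly to a preimage of \<open>y\<close>
  by \<open>uniform_onto\<close>, and the move is pulled back along the orbit by
  \<open>lift\<close>. The gap \<open>g\<close> depends on the accuracy \<open>ep\<close> but not on
  \<open>n\<close>.\<close>

lemma orbit_specification:
 assumes ep: "ep > 0"
 obtains g where "!!x y n. x \<in> X ==> y \<in> X ==>
  \<exists>z\<in>X. (f ^^ (n + g)) z = y \<and> (\<forall>j\<le>n. rh ((f ^^ j) x) ((f ^^ j) z) < ep)"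
proof -
 obtain d where d: "d > 0" "!!n x y. x \<in> X ==> y \<in> X ==> rh ((f ^^ n) x) y < d ==>
  \<exists>z\<in>X. (f ^^ n) z = y \<and> (\<forall>j\<le>n. rh ((f ^^ j) x) ((f ^^ j) z) < ep)"
  using lift[OF ep] by blast
 obtain g where g: "!!x y. x \<in> X ==> y \<in> X ==> \<exists>z\<in>X. rh x z < d \<and> (f ^^ g) z = y"
  using uniform_onto[OF d(1)] by blast
 show ?thesis
 proof (rule that)
  fix x y n assume xy: "x \<in> X" "y \<in> X"
  obtain w where w: "w \<in> X" "rh ((f ^^ n) x) w < d" "(f ^^ g) w = y" using g[OF funpow_X[OF xy(1)] xy(2)] by blast
  obtain z where z: "z \<in> X" "(f ^^ n) z = w" "\<forall>j\<le>n. rh ((f ^^ j) x) ((f ^^ j) z) < ep"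
   using d(2)[OF xy(1) w(1,2)] by blast
  have "(f ^^ (n + g)) z = y" using z w by (simp add: funpow_add add.commute[of n])
  then show "\<exists>z\<in>X. (f ^^ (n + g)) z = y \<and> (\<forall>j\<le>n. rh ((f ^^ j) x) ((f ^^ j) z) < ep)" using z by blast
 qed
qed

end

section \<open>Entropy of expanding maps\<close>

context expanding_map
begin

lemma invariant_prob_on: "nu \<in> invariant_measures f X ==> prob_on nu"
 by (simp add: invariant_measures_def prob_on_def)

lemma invariant_prob: "nu \<in> invariant_measures f X ==> invariant_prob nu f"
 by (simp add: invariant_measures_def invariant_prob_def invariant_prob_axioms_def)

lemma f_measurable: "prob_on nu ==> f ^^ n \<in> measurable nu nu"
proof -
 assume nu: "prob_on nu"
 have "f ^^ n \<in> measurable (restrict_space borel X) (restrict_space borel X)"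
 proof (rule measurable_restrict_space2)
  show "f ^^ n \<in> space (restrict_space borel X) \<rightarrow> X"
   using funpow_X by (auto simp: space_restrict_space)
  show "f ^^ n \<in> borel_measurable (restrict_space borel X)"
   using funpow_cont by (rule borel_measurable_continuous_on_restrict)
 qed
 then show ?thesis
  using measurable_cong_sets[OF prob_onD(3)[OF nu] prob_onD(3)[OF nu]] by blast
qed

lemma simple_function_prob_on:
 assumes "prob_on nu" "finite (bt ` X)" "!!v. bt -` {v} \<inter> X \<in> sets borel"
 shows "simple_function nu bt"
 using assms sets_prob_on[OF assms(1)] unfolding simple_function_def by (auto simp: prob_onD(2)[OF assms(1)])

section \<open>Bowen balls and partitions into pieces of them\<close>

definition bowen :: "'m => nat => real => 'm set" where
 "bowen x n r = {y \<in> X. \<forall>j\<le>n. rh ((f ^^ j) x) ((f ^^ j) y) <= r}"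

lemma bowen_closed: "x \<in> X ==> closed (bowen x n r)"
proof -
 assume x: "x \<in> X"
 have "closed {y \<in> X. rh ((f ^^ j) x) ((f ^^ j) y) <= r}" for j
 proof (rule continuous_on_closed_Collect_le[OF _ continuous_on_const closed_X])
  show "continuous_on X (%y. rh ((f ^^ j) x) ((f ^^ j) y))"
   by (rule continuous_on_compose2[OF continuous_rho[OF funpow_X[OF x]] funpow_cont])
    (use funpow_X in auto)
 qed
 then have "closed (\<Inter>j\<le>n. {y \<in> X. rh ((f ^^ j) x) ((f ^^ j) y) <= r})" by (intro closed_INT) simp
 moreover have "bowen x n r = (\<Inter>j\<le>n. {y \<in> X. rh ((f ^^ j) x) ((f ^^ j) y) <= r})"
  by (auto simp: bowen_def)
 ultimately show ?thesis by simp
qed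

lemma bowen_borel: "x \<in> X ==> bowen x n r \<in> sets borel"
 by (rule borel_closed[OF bowen_closed])

lemma bowen_sub: "bowen x n r \<subseteq> X"
 by (auto simp: bowen_def)

lemma bowen_mono: "r <= s ==> m <= n ==> bowen x n r \<subseteq> bowen x m s"
 unfolding bowen_def by (auto intro: order_trans)

lemma bowen_self: "x \<in> X ==> 0 <= r ==> x \<in> bowen x n r"
 using funpow_X by (simp add: bowen_def)

lemma bowen_sym: "x \<in> X ==> y \<in> bowen x n r ==> x \<in> bowen y n r"
proof -
 assume "x \<in> X" "y \<in> bowen x n r"
 then show "x \<in> bowen y n r"
  using rho_sym[OF funpow_X funpow_X, of x y] by (auto simp: bowen_def)
qed

lemma bowen_trans:
 assumes "x \<in> X" "y \<in> bowen x n r" "z \<in> bowen y n s"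
 shows "z \<in> bowen x n (r + s)"
proof -
 have yz: "y \<in> X" "z \<in> X" using assms by (auto simp: bowen_def)
 have "rh ((f ^^ j) x) ((f ^^ j) z) <= r + s" if "j <= n" for j
 proof -
  have "rh ((f ^^ j) x) ((f ^^ j) z) <= rh ((f ^^ j) x) ((f ^^ j) y) + rh ((f ^^ j) y) ((f ^^ j) z)"
   using assms(1) yz funpow_X by (intro rho_tri) auto
  moreover have "rh ((f ^^ j) x) ((f ^^ j) y) <= r" "rh ((f ^^ j) y) ((f ^^ j) z) <= s"
   using assms that by (auto simp: bowen_def)
  ultimately show ?thesis by linarith
 qed
 then show ?thesis using yz by (simp add: bowen_def)
qed

definition separated :: "nat => real => 'm set => bool" where
 "separated n r S \<longleftrightarrow> S \<subseteq> X \<and> (\<forall>x\<in>S. \<forall>y\<in>S. y \<in> bowen x n r --> x = y)"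

text \<open>A finite cover by balls so small that points of one ball stay \<open>r\<close>-close up
  to time \<open>n\<close>: each ball contains at most one point of \<open>S\<close>.\<close>

lemma separated_card:
 assumes "r > 0"
 obtains K where "!!S. separated n r S ==> finite S \<and> card S <= K"
proof -
 obtain dl where dl: "dl > 0" "\<forall>x\<in>X. \<forall>y\<in>X. rh x y < dl --> (\<forall>j\<le>n. rh ((f ^^ j) x) ((f ^^ j) y) < r)"
  using bowen_unif[OF assms] by blast
 obtain C where C: "finite C" "C \<subseteq> X" "!!x. x \<in> X ==> \<exists>c\<in>C. rh c x < dl / 2"
  using ball_cover[of "%_. dl / 2"] dl(1) by (metis half_gt_zero)
 have "finite S \<and> card S <= card C" if S: "separated n r S" for S
 proof -
  have SX: "S \<subseteq> X" using S by (simp add: separated_def)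
  have "\<exists>c. c \<in> C \<and> rh c x < dl / 2" if "x \<in> S" for x using C(3) SX that by blast
  then obtain c where c: "!!x. x \<in> S ==> c x \<in> C" "!!x. x \<in> S ==> rh (c x) x < dl / 2" by metis
  have "inj_on c S"
  proof (rule inj_onI)
   fix x y assume xy: "x \<in> S" "y \<in> S" "c x = c y"
   have X: "x \<in> X" "y \<in> X" "c x \<in> X" using xy SX c(1) C(2) by auto
   have "rh x y <= rh x (c x) + rh (c x) y" using X by (intro rho_tri)
   also have "\<dots> < dl" using c(2)[OF xy(1)] c(2)[OF xy(2)] xy(3) rho_sym[OF X(1,3)] by simp
   finally have "y \<in> bowen x n r" using dl(2) X by (auto simp: bowen_def intro: less_imp_le)
   then show "x = y" using S xy by (simp add: separated_def)
  qed
  moreover have "c ` S \<subseteq> C" using c(1) by blast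
  ultimately show ?thesis using C(1) by (metis card_inj_on_le inj_on_finite)
 qed
 then show ?thesis by (rule that)
qed

lemma maximal_separated:
 assumes r: "r > 0"
 obtains E where "finite E" "separated n r E" "!!y. y \<in> X ==> \<exists>x\<in>E. y \<in> bowen x n r"
proof -
 obtain K where K: "!!S. separated n r S ==> finite S \<and> card S <= K" using separated_card[OF r] by blast
 have "separated n r {}" by (simp add: separated_def)
 then obtain E where E: "separated n r E" "!!S. separated n r S ==> card S <= card E"
  using ex_has_greatest_nat[of "separated n r" "{}" card "Suc K"] K by (metis less_Suc_eq_le)
 have fin: "finite E" using K E by blast
 have "\<exists>x\<in>E. y \<in> bowen x n r" if y: "y \<in> X" for y
 proof (rule ccontr)
  assume n: "\<not> (\<exists>x\<in>E. y \<in> bowen x n r)"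
  have "y \<notin> E" using n bowen_self[OF y, of r n] r by force
  have "separated n r (insert y E)"
   unfolding separated_def
  proof (intro conjI ballI impI)
   show "insert y E \<subseteq> X" using y E by (simp add: separated_def)
   fix a b assume ab: "a \<in> insert y E" "b \<in> insert y E" "b \<in> bowen a n r"
   have "a \<in> X" using ab(1) y E(1) by (auto simp: separated_def)
   then have "a \<in> bowen b n r" using ab(3) by (rule bowen_sym)
   then show "a = b" using ab n E(1) by (auto simp: separated_def)
  qed
  from E(2)[OF this] show False using fin \<open>y \<notin> E\<close> by simp
 qed
 then show ?thesis using that fin E(1) by blast
qed

text \<open>Around the points of a maximal separated set the balls of radius \<open>r / 2\<close>
  are disjoint and go to their centres; a point in none of them goes to the first ball of radius
  \<open>r\<close> containing it. Each piece is thus trapped between two Bowen balls, which is what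
  two-sided Gibbs bounds require.\<close>

lemma bowen_partition:
 assumes r: "r > 0"
 obtains E bt where "finite E" "E \<subseteq> X" "!!y. y \<in> X ==> bt y \<in> E" "!!y. y \<in> X ==> y \<in> bowen (bt y) n r"
  "!!x y. x \<in> E ==> y \<in> bowen x n (r / 2) ==> bt y = x" "!!v. bt -` {v} \<inter> X \<in> sets borel"
proof -
 obtain E where E: "finite E" "separated n r E" "!!y. y \<in> X ==> \<exists>x\<in>E. y \<in> bowen x n r"
  using maximal_separated[OF r] by blast
 have EX: "E \<subseteq> X" using E(2) by (simp add: separated_def)
 obtain xs where xs: "set xs = E" "distinct xs" using finite_distinct_list[OF E(1)] by blast
 define N where "N = length xs"
 have nth: "xs ! i \<in> E" if "i < N" for i using that xs by (auto simp: N_def)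
 define H where "H i = bowen (xs ! i) n (r / 2)" for i
 define W where "W i = bowen (xs ! i) n r" for i
 define A where "A i = H i \<union> (W i - (\<Union>j<N. H j) - (\<Union>j<i. W j))" for i
 have HW: "H i \<subseteq> W i" for i unfolding H_def W_def using r by (intro bowen_mono) auto
 have Hdisj: "i = j" if "i < N" "j < N" "y \<in> H i" "y \<in> H j" for i j y
 proof -
  have xi: "xs ! i \<in> X" "xs ! j \<in> X" using nth that EX by auto
  have "xs ! j \<in> bowen (xs ! i) n (r / 2 + r / 2)"
   using bowen_trans[OF xi(1) that(3)[unfolded H_def] bowen_sym[OF xi(2) that(4)[unfolded H_def]]] .
  then have "xs ! i = xs ! j" using E(2) nth that by (simp add: separated_def)
  then show ?thesis using xs(2) that by (simp add: N_def nth_eq_iff_index_eq)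
 qed
 have Aex: "\<exists>i<N. y \<in> A i" if y: "y \<in> X" for y
 proof (cases "\<exists>i<N. y \<in> H i")
  case True then show ?thesis by (auto simp: A_def)
 next
  case False
  obtain x where "x \<in> E" "y \<in> bowen x n r" using E(3)[OF y] by blast
  then have ex: "\<exists>i. i < N \<and> y \<in> W i" using xs by (metis N_def W_def in_set_conv_nth)
  define i where "i = (LEAST i. i < N \<and> y \<in> W i)"
  have i: "i < N" "y \<in> W i" using LeastI_ex[OF ex] by (auto simp: i_def)
  have "y \<notin> W j" if "j < i" for j
   using not_less_Least[OF that[unfolded i_def]] that i(1) by auto
  then show ?thesis using i False by (auto simp: A_def)
 qed
 have Auniq: "i = j" if "i < N" "j < N" "y \<in> A i" "y \<in> A j" for i j y
 proof (cases "\<exists>k<N. y \<in> H k")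
  case True
  then have "y \<in> H i" "y \<in> H j" using that by (auto simp: A_def)
  then show ?thesis using Hdisj that by blast
 next
  case False
  then have "y \<in> W i" "y \<in> W j" "\<forall>k<i. y \<notin> W k" "\<forall>k<j. y \<notin> W k" using that by (auto simp: A_def)
  then show ?thesis by (metis linorder_neqE_nat)
 qed
 define bt where "bt y = xs ! (THE i. i < N \<and> y \<in> A i)" for y
 have bt_eq: "bt y = xs ! i" if "i < N" "y \<in> A i" for i y
 proof -
  have "(THE i. i < N \<and> y \<in> A i) = i" using that Auniq by (intro the_equality) blast+
  then show ?thesis by (simp add: bt_def)
 qed
 have AX: "A i \<subseteq> X" for i using bowen_sub by (auto simp: A_def H_def W_def)
 show ?thesis
 proof (rule that[OF E(1) EX])
  fix y assume y: "y \<in> X"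
  obtain i where i: "i < N" "y \<in> A i" using Aex[OF y] by blast
  show "bt y \<in> E" using bt_eq[OF i] nth[OF i(1)] by simp
  have "y \<in> W i" using i(2) HW by (auto simp: A_def)
  then show "y \<in> bowen (bt y) n r" using bt_eq[OF i] by (simp add: W_def)
 next
  fix x y assume x: "x \<in> E" "y \<in> bowen x n (r / 2)"
  then obtain i where i: "i < N" "xs ! i = x" using xs by (metis N_def in_set_conv_nth)
  then have "y \<in> A i" using x by (simp add: A_def H_def)
  then show "bt y = x" using bt_eq i by blast
 next
  fix v
  show "bt -` {v} \<inter> X \<in> sets borel"
  proof (cases "v \<in> E")
   case True
   then obtain i where i: "i < N" "xs ! i = v" using xs by (metis N_def in_set_conv_nth)
   have "bt -` {v} \<inter> X = A i"
   proof (intro equalityI subsetI)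
    fix y assume y: "y \<in> bt -` {v} \<inter> X"
    then obtain j where j: "j < N" "y \<in> A j" using Aex by blast
    then have "xs ! j = xs ! i" using bt_eq[OF j] y i by simp
    then have "j = i" using nth_eq_iff_index_eq[OF xs(2), of j i] i(1) j(1) by (simp add: N_def)
    then show "y \<in> A i" using j by simp
   next
    fix y assume "y \<in> A i"
    then show "y \<in> bt -` {v} \<inter> X" using bt_eq[OF i(1)] i(2) AX by auto
   qed
   also have "A i \<in> sets borel"
   proof -
    have HWb: "H j \<in> sets borel" "W j \<in> sets borel" if "j < N" for j
     unfolding H_def W_def using nth[OF that] EX by (auto intro!: bowen_borel)
    have "(\<Union>j<N. H j) \<in> sets borel" using HWb by (intro sets.finite_UN) auto
    moreover have "(\<Union>j<i. W j) \<in> sets borel" using HWb i(1) by (intro sets.finite_UN) auto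
    ultimately show ?thesis unfolding A_def using HWb[OF i(1)] by (intro sets.Un sets.Diff)
   qed
   finally show ?thesis .
  next
   case False
   have "bt y \<noteq> v" if "y \<in> X" for y using Aex[OF that] bt_eq nth False by metis
   then have "bt -` {v} \<inter> X = {}" by blast
   then show ?thesis by simp
  qed
 qed
qed

lemma disjoint_closed_gap:
 assumes V: "finite V" and C: "!!v. v \<in> V ==> closed (C v)" "!!v. v \<in> V ==> C v \<subseteq> X"
  and disj: "!!v w. v \<in> V ==> w \<in> V ==> v \<noteq> w ==> C v \<inter> C w = {}"
 obtains th where "th > 0" "!!v w x y. v \<in> V ==> w \<in> V ==> x \<in> C v ==> y \<in> C w ==> rh x y < th ==> v = w"
proof -
 define P where "P = {p \<in> V \<times> V. fst p \<noteq> snd p}"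
 have finP: "finite P" unfolding P_def using V by simp
 have "\<exists>t>0. \<forall>x\<in>C (fst p). \<forall>y\<in>C (snd p). t <= rh x y" if p: "p \<in> P" for p
 proof -
  have pV: "fst p \<in> V" "snd p \<in> V" "fst p \<noteq> snd p" using p by (auto simp: P_def)
  let ?Q = "C (fst p) \<times> C (snd p)"
  have cpt: "compact (C v)" if "v \<in> V" for v
   using compact_Int_closed[OF compact_X C(1)[OF that]] C(2)[OF that] by (simp add: inf.absorb2)
  show ?thesis
  proof (cases "?Q = {}")
   case True then show ?thesis by (intro exI[of _ 1]) auto
  next
   case False
   have "?Q \<subseteq> X \<times> X" using C(2) pV by blast
   then have "continuous_on ?Q (%(x, y). rh x y)" using rho_cont continuous_on_subset by blast
   then obtain q where q: "q \<in> ?Q" "!!q'. q' \<in> ?Q ==> (%(x, y). rh x y) q <= (%(x, y). rh x y) q'"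
    using continuous_attains_inf[OF compact_Times[OF cpt[OF pV(1)] cpt[OF pV(2)]] False] by blast
   obtain a b where ab: "q = (a, b)" by (cases q)
   have "a \<in> C (fst p)" "b \<in> C (snd p)" using q(1) ab by auto
   then have "a \<in> X" "b \<in> X" "a \<noteq> b" using disj[OF pV] C(2) pV by blast+
   then have "rh a b > 0" using rho_zero[of a b] rho_nonneg[of a b] by simp
   then show ?thesis using q(2) ab by (intro exI[of _ "rh a b"]) auto
  qed
 qed
 then obtain t where t: "!!p. p \<in> P ==> t p > 0" "!!p x y. p \<in> P ==> x \<in> C (fst p) ==> y \<in> C (snd p) ==> t p <= rh x y"
  by metis
 define th where "th = Min (insert 1 (t ` P))"
 have "th > 0" unfolding th_def using finP t(1) by (subst Min_gr_iff) auto
 moreover have "v = w" if A: "v \<in> V" "w \<in> V" "x \<in> C v" "y \<in> C w" "rh x y < th" for v w x y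
 proof (rule ccontr)
  assume "v \<noteq> w"
  then have p: "(v, w) \<in> P" using A by (simp add: P_def)
  have "th <= t (v, w)" unfolding th_def using finP p by (intro Min_le) auto
  also have "\<dots> <= rh x y" using t(2)[OF p, of x y] A by simp
  finally show False using A by simp
 qed
 ultimately show ?thesis by (rule that)
qed

text \<open>
 Points with the same \<open>bt\<close>-itinerary stay \<open>e0\<close>-close, hence by expansiveness they are \<open>th\<close>-close
 except at the last \<open>M\<close> times. A second partition, up to closed sets that are \<open>th\<close>-apart and
 carry almost all the mass, is therefore predicted by \<open>bt\<close> at all earlier times.
\<close>

theorem metric_entropy_le_bowen:
 fixes bt :: "'m => 'c"
 assumes nu: "nu \<in> invariant_measures f X" and bt: "simple_function nu bt" and n: "n >= 1"
  and sub: "!!x y j. x \<in> X ==> y \<in> X ==> bt x = bt y ==> j < n ==> rh ((f ^^ j) x) ((f ^^ j) y) <= e0"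
 shows "metric_entropy f nu <= ereal (shannon nu bt / n)"
proof -
 note pnu = invariant_prob_on[OF nu]
 note space = prob_onD(2)[OF pnu]
 interpret invariant_prob nu f by (rule invariant_prob[OF nu])
 interpret fn: invariant_prob nu "f ^^ n"
  by unfold_locales (rule funpow_meas, rule funpow_inv)
 have main: "ks_rate xx <= shannon nu bt / n + \<omega>" if xx: "simple_function nu xx" and \<omega>: "\<omega> > 0"
  for xx :: "'m => 'm set" and \<omega>
 proof -
  define V where "V = xx ` X"
  have finV: "finite V" using simple_functionD(1)[OF xx] by (simp add: V_def space)
  have Vne: "card V > 0" using finV X_nonempty by (simp add: V_def card_gt_0_iff)
  obtain dl where dl: "0 < dl" "dl < 1" "- ln (1 - dl) + dl * (ln (card V) - ln dl) < \<omega>"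
   using prediction_error_small[OF \<omega>] by blast
  let ?A = "%v. xx -` {v} \<inter> X"
  have Aev: "?A v \<in> events" for v using simple_functionD(2)[OF xx] by (simp add: space)
  have dV: "dl / card V > 0" using dl(1) Vne by simp
  have "\<exists>C. closed C \<and> C \<subseteq> ?A v \<and> prob (?A v - C) <= dl / card V" for v
  proof -
   obtain C D where CD: "closed C" "closed D" "C \<subseteq> ?A v" "D \<subseteq> X - ?A v" "prob (X - (C \<union> D)) < dl / card V"
    using regular_sandwich[OF pnu Aev dV] by blast
   have "X - (C \<union> D) \<in> events"
    using sets_prob_on[OF pnu] CD closed_X by auto
   then have "prob (?A v - C) <= prob (X - (C \<union> D))" using CD by (intro finite_measure_mono) auto
   then show ?thesis using CD by (intro exI[of _ C]) auto
  qed
  then obtain C where C: "!!v. closed (C v)" "!!v. C v \<subseteq> ?A v" "!!v. prob (?A v - C v) <= dl / card V" by metis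
  obtain th where th: "th > 0" "!!v w x y. v \<in> V ==> w \<in> V ==> x \<in> C v ==> y \<in> C w ==> rh x y < th ==> v = w"
  proof (rule disjoint_closed_gap[OF finV, of C])
   show "C v \<inter> C w = {}" if "v \<noteq> w" for v w using C(2)[of v] C(2)[of w] that by blast
  qed (use C in auto)
  obtain M where M: "!!x y. x \<in> X ==> y \<in> X ==> (!!j. j <= M ==> rh ((f ^^ j) x) ((f ^^ j) y) <= e0) ==> rh x y < th"
   using uniform_expansive[OF th(1)] by blast
  have Cev: "C v \<in> events" for v using C(1,2)[of v] sets_prob_on[OF pnu] by auto
  have bad: "prob (X - (\<Union>v\<in>V. C v)) <= dl"
  proof -
   have "X - (\<Union>v\<in>V. C v) \<subseteq> (\<Union>v\<in>V. ?A v - C v)" by (auto simp: V_def)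
   then have "prob (X - (\<Union>v\<in>V. C v)) <= prob (\<Union>v\<in>V. ?A v - C v)"
    using finV Aev Cev by (intro finite_measure_mono sets.finite_UN) auto
   also have "\<dots> <= (\<Sum>v\<in>V. prob (?A v - C v))"
    using finV Aev Cev by (intro finite_measure_subadditive_finite) auto
   also have "\<dots> <= (\<Sum>v\<in>V. dl / card V)" using C(3) by (intro sum_mono)
   also have "\<dots> = dl" using Vne by simp
   finally show ?thesis .
  qed
  have badev: "X - (\<Union>v\<in>V. C v) \<in> events"
   using finV Cev sets.top[of nu] by (intro sets.Diff sets.finite_UN) (auto simp: space)
  have step: "shannon nu (itinerary f xx (n * K)) <= K * shannon nu bt + n * K * \<omega> + M * shannon nu xx"
   if K: "n * K >= M" for K
  proof -
   \<comment> \<open>\<open>W\<close> reads \<open>bt\<close> only at multiples of \<open>n\<close>,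
     so its entropy is at most \<open>K\<close> times that of \<open>bt\<close>, yet it determines
     orbits up to \<open>e0\<close> at all times below \<open>n * K\<close>.\<close>
   define W where "W = itinerary (f ^^ n) bt K"
   have sW: "simple_function nu W" unfolding W_def by (rule fn.simple_itinerary[OF bt])
   have HW: "shannon nu W <= K * shannon nu bt" unfolding W_def by (rule fn.shannon_itinerary_mult[OF bt])
   have close: "rh ((f ^^ j) x) ((f ^^ j) y) <= e0"
    if "x \<in> X" "y \<in> X" "W x = W y" "j < n * K" for x y j
   proof -
    let ?k = "j div n" and ?i = "j mod n"
    have k: "?k < K" using that(4) n by (simp add: less_mult_imp_div_less mult.commute)
    have "W x ! ?k = W y ! ?k" using that by simp
    then have "bt (((f ^^ n) ^^ ?k) x) = bt (((f ^^ n) ^^ ?k) y)"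
     using k by (simp add: W_def itinerary_def)
    then have eq: "bt ((f ^^ (n * ?k)) x) = bt ((f ^^ (n * ?k)) y)" by (simp add: funpow_mult mult.commute)
    have dec: "(f ^^ j) z = (f ^^ ?i) ((f ^^ (n * ?k)) z)" for z
    proof -
     have "j = ?i + n * ?k" by simp
     then show ?thesis by (metis comp_apply funpow_add)
    qed
    show ?thesis
     unfolding dec using sub[OF funpow_X[OF that(1)] funpow_X[OF that(2)] eq, of ?i] n by simp
   qed
   have ind: "shannon nu (%x. (W x, itinerary f xx j x)) <= shannon nu W + j * \<omega>" if "j + M <= n * K" for j
    using that
   proof (induction j)
    case 0
    have "shannon nu (%x. (W x, itinerary f xx 0 x)) <= shannon nu W"
     by (rule shannon_mono[OF sW, where h = "%w. (w, [])"]) (simp add: itinerary_def)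
    then show ?case by simp
   next
    case (Suc j)
    let ?Wj = "%x. (W x, itinerary f xx j x)"
    have sWj: "simple_function nu ?Wj" by (intro simple_function_Pair sW simple_itinerary xx)
    \<comment> \<open>The prediction uses only the \<open>W\<close> component: a value whose core
      \<open>C v\<close> is visited at time \<open>j\<close> by some point with the same
      \<open>W\<close>. If the given point is itself in a core at that time, closeness below
      \<open>th\<close> leaves only one possible value.\<close>
    define pp where "pp p = (SOME v. v \<in> V \<and> (\<exists>x\<in>X. W x = fst p \<and> (f ^^ j) x \<in> C v))" for p :: "'c list \<times> 'm set list"
    have pred: "xx ((f ^^ j) x) = pp (?Wj x)" if x: "x \<in> X" "(f ^^ j) x \<in> (\<Union>v\<in>V. C v)" for x
    proof -
     obtain v where v: "v \<in> V" "(f ^^ j) x \<in> C v" using x(2) by blast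
     have "\<exists>v. v \<in> V \<and> (\<exists>x'\<in>X. W x' = fst (?Wj x) \<and> (f ^^ j) x' \<in> C v)" using v x by auto
     from someI_ex[OF this, folded pp_def] obtain x' where
      x': "pp (?Wj x) \<in> V" "x' \<in> X" "W x' = W x" "(f ^^ j) x' \<in> C (pp (?Wj x))" by auto
     have "rh ((f ^^ j) x') ((f ^^ j) x) < th"
     proof (rule M)
      show "rh ((f ^^ i) ((f ^^ j) x')) ((f ^^ i) ((f ^^ j) x)) <= e0" if "i <= M" for i
       using close[OF x'(2) x(1) x'(3), of "i + j"] Suc.prems that by (simp add: funpow_add)
     qed (use x x' funpow_X in auto)
     then have "pp (?Wj x) = v" using th(2)[OF x'(1) v(1) x'(4) v(2)] by simp
     moreover have "xx ((f ^^ j) x) = v" using v(2) C(2) by blast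
     ultimately show ?thesis by simp
    qed
    have err: "prob {x \<in> space nu. xx ((f ^^ j) x) \<noteq> pp (?Wj x)} <= dl"
    proof -
     have "{x \<in> space nu. xx ((f ^^ j) x) \<noteq> pp (?Wj x)} \<subseteq> (f ^^ j) -` (X - (\<Union>v\<in>V. C v)) \<inter> space nu"
      using pred funpow_X by (auto simp: space)
     then have "prob {x \<in> space nu. xx ((f ^^ j) x) \<noteq> pp (?Wj x)} <= prob ((f ^^ j) -` (X - (\<Union>v\<in>V. C v)) \<inter> space nu)"
      using measurable_sets[OF funpow_meas badev] by (intro finite_measure_mono)
     also have "\<dots> = prob (X - (\<Union>v\<in>V. C v))" by (rule prob_funpow_vimage[OF badev])
     finally show ?thesis using bad by simp
    qed
    have "shannon nu (%x. (W x, itinerary f xx (Suc j) x)) <= shannon nu (%x. (?Wj x, xx ((f ^^ j) x)))"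
    proof (rule shannon_mono[where h = "%((w, l), v). (w, l @ [v])"])
     show "simple_function nu (%x. (?Wj x, xx ((f ^^ j) x)))"
      by (intro simple_function_Pair sW simple_itinerary xx simple_funpow)
    qed (simp add: itinerary_def)
    also have "\<dots> <= shannon nu ?Wj + (- ln (1 - dl) + dl * (ln (card V) - ln dl))"
     using funpow_X by (intro shannon_pair_predict[OF sWj simple_funpow[OF xx] finV _ dl(1,2) err])
      (auto simp: V_def space)
    also have "\<dots> <= shannon nu W + Suc j * \<omega>" using Suc.IH Suc.prems dl(3) by (simp add: algebra_simps)
    finally show ?case .
   qed
   \<comment> \<open>The last \<open>M\<close> names cannot be predicted. They cost at most
     \<open>M * shannon nu xx\<close>, which disappears after division by
     \<open>n * K\<close>.\<close>
   define L where "L = n * K - M"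
   have L: "n * K = L + M" "L + M <= n * K" using K by (auto simp: L_def)
   have "shannon nu (itinerary f xx L) <= shannon nu (%x. (W x, itinerary f xx L x))"
    by (rule shannon_mono[where h = snd]) (auto intro!: simple_function_Pair sW simple_itinerary xx)
   also have "\<dots> <= shannon nu W + L * \<omega>" by (rule ind[OF L(2)])
   also have "L * \<omega> <= n * K * \<omega>"
    using \<omega> L(1) by (intro mult_right_mono) (auto simp flip: of_nat_mult)
   finally have "shannon nu (itinerary f xx L) <= K * shannon nu bt + n * K * \<omega>" using HW by linarith
   moreover have "shannon nu (itinerary f xx (n * K)) <= shannon nu (itinerary f xx L) + shannon nu (itinerary f xx M)"
    unfolding L(1) by (rule shannon_itinerary_add[OF xx])
   ultimately show ?thesis using shannon_itinerary_mult[OF xx, of M] by linarith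
  qed
  have lim: "(%K. shannon nu bt / n + \<omega> + (M * shannon nu xx / n) / real K) \<longlonglongrightarrow> shannon nu bt / n + \<omega> + 0"
   by (intro tendsto_add tendsto_const lim_const_over_n)
  have "ks_rate xx <= shannon nu bt / n + \<omega> + (M * shannon nu xx / n) / real K" if "K >= M + 1" for K
  proof -
   have nK: "n * K >= M" "n * K >= 1" using n that by (auto intro: order_trans[OF _ mult_le_mono1[of 1 n K]])
   have "ks_rate xx <= shannon nu (itinerary f xx (n * K)) / real (n * K)" by (rule ks_rate_le[OF xx nK(2)])
   also have "\<dots> <= (K * shannon nu bt + n * K * \<omega> + M * shannon nu xx) / real (n * K)"
    using step[OF nK(1)] by (intro divide_right_mono) auto
   also have "\<dots> = shannon nu bt / n + \<omega> + (M * shannon nu xx / n) / real K"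
    using n that by (simp add: field_simps)
   finally show ?thesis .
  qed
  then show ?thesis using LIMSEQ_le_const[OF lim, of "ks_rate xx"] by auto
 qed
 show ?thesis
 proof (rule metric_entropy_leI)
  fix xx :: "'m => 'm set" assume xx: "simple_function nu xx"
  have "ks_rate xx <= shannon nu bt / n" using main[OF xx] by (rule field_le_epsilon)
  then show "ereal (ks_rate xx) <= ereal (shannon nu bt / n)" by simp
 qed
qed

end

section \<open>Gibbs measures\<close>

lemma one_le_mult:
 fixes x y :: real
 shows "1 <= x ==> 1 <= y ==> 1 <= x * y"
 using mult_mono[of 1 x 1 y] by simp

text \<open>Both \<open>m * a n\<close> and \<open>n * a m\<close> are near
  \<open>a (m * n)\<close>, which makes the quotients a Cauchy sequence with explicit error; letting
  one index tend to infinity leaves the error bound \<open>C\<close> for every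
  \<open>n\<close>.\<close>

lemma almost_additive_real:
 fixes a :: "nat => real"
 assumes aa: "!!m n. m >= 1 ==> n >= 1 ==> \<bar>a (m + n) - a m - a n\<bar> <= C"
 obtains L where "(%n. a n / n) \<longlonglongrightarrow> L" "!!n. n >= 1 ==> \<bar>a n - n * L\<bar> <= C"
proof -
 have C0: "C >= 0" using aa[of 1 1] by linarith
 have mult: "\<bar>a (k * n) - k * a n\<bar> <= k * C" if "n >= 1" "k >= 1" for k n
  using that(2)
 proof (induction k rule: dec_induct)
  case base then show ?case using C0 by simp
 next
  case (step k)
  have "\<bar>a (k * n + n) - a (k * n) - a n\<bar> <= C" using that step by (intro aa) auto
  moreover have "a (Suc k * n) = a (k * n + n)" by (simp add: add.commute)
  ultimately show ?case using step.IH by (simp add: algebra_simps)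
 qed
 have near: "\<bar>a m / m - a n / n\<bar> <= C / m + C / n" if "m >= 1" "n >= 1" for m n
 proof -
  have *: "\<bar>a (m * n) / (real m * real n) - a n / n\<bar> <= C / n" if "m >= 1" "n >= 1" for m n
  proof -
   have "\<bar>a (m * n) / (real m * real n) - a n / n\<bar> = \<bar>a (m * n) - m * a n\<bar> / (m * n)"
   proof -
    have "a (m * n) / (real m * real n) - a n / n = (a (m * n) - m * a n) / (m * n)"
     using that by (simp add: field_simps)
    then show ?thesis by (simp add: abs_divide abs_mult)
   qed
   also have "\<dots> <= (m * C) / (m * n)" using mult[OF that(2,1)] by (intro divide_right_mono) auto
   also have "\<dots> = C / n" using that by simp
   finally show ?thesis .
  qed
  have "\<bar>a (n * m) / (real n * real m) - a m / m\<bar> <= C / m" using * that by blast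
  then have "\<bar>a (m * n) / (real m * real n) - a m / m\<bar> <= C / m" by (simp add: mult.commute)
  then show ?thesis using *[OF that] by linarith
 qed
 have "Cauchy (%n. a n / n)"
 proof (rule metric_CauchyI)
  fix e :: real assume e: "e > 0"
  obtain N :: nat where N: "real N > 2 * C / e" using reals_Archimedean2 by blast
  show "\<exists>M. \<forall>m\<ge>M. \<forall>n\<ge>M. dist (a m / m) (a n / n) < e"
  proof (intro exI[of _ "max N 1"] allI impI)
   fix m n assume mn: "max N 1 <= m" "max N 1 <= n"
   have half: "C / k < e / 2" if "max N 1 <= k" for k :: nat
   proof -
    have "real k > 2 * C / e" "real k > 0" using that N by linarith+
    then show ?thesis using e by (simp add: field_simps)
   qed
   have "C / m + C / n < e" using half[OF mn(1)] half[OF mn(2)] by linarith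
   then show "dist (a m / m) (a n / n) < e" using near[of m n] mn by (simp add: dist_real_def)
  qed
 qed
 then obtain L where L: "(%n. a n / n) \<longlonglongrightarrow> L" using Cauchy_convergent_iff convergent_def by blast
 have "\<bar>a n - n * L\<bar> <= C" if n: "n >= 1" for n
 proof -
  have "(%m. \<bar>a m / m - a n / n\<bar>) \<longlonglongrightarrow> \<bar>L - a n / n\<bar>" by (intro tendsto_intros L)
  moreover have "(%m. C / real m + C / n) \<longlonglongrightarrow> 0 + C / n" by (intro tendsto_intros lim_const_over_n)
  ultimately have "\<bar>L - a n / n\<bar> <= 0 + C / n"
   by (rule LIMSEQ_le) (use near n in \<open>blast\<close>)
  then have "n * \<bar>L - a n / n\<bar> <= n * (C / n)" by (intro mult_left_mono) auto
  moreover have "n * \<bar>L - a n / n\<bar> = \<bar>n * (L - a n / n)\<bar>" by (simp add: abs_mult)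
  moreover have "n * (L - a n / n) = n * L - a n" using n by (simp add: field_simps)
  ultimately show ?thesis using n by (simp add: abs_minus_commute)
 qed
 with L show ?thesis by (rule that)
qed

text \<open>The constants are parameters so that two potentials can share them.
  \<open>2 * ep <= e0\<close> ensures that two preimages of one point under the \<open>n\<close>-th
  iterate coincide as soon as they lie in a common Bowen ball of radius \<open>ep\<close> and length
  at least \<open>n\<close>.\<close>

locale potential = expanding_map X rh f e0
 for X :: "'m::{t2_space, second_countable_topology} set" and rh f e0 +
 fixes Ph :: "nat => 'm => real" and ep C K B :: real
 assumes eps_pos: "0 < ep" and eps_e0: "2 * ep <= e0"
  and potential_cont: "n >= 1 ==> continuous_on X (Ph n)"
  and additive: "m >= 1 ==> n >= 1 ==> x \<in> X ==> \<bar>Ph (m + n) x - Ph m x - Ph n ((f ^^ m) x)\<bar> <= C"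
  and distort: "n >= 1 ==> x \<in> X ==> y \<in> bowen x n ep ==> \<bar>Ph n x - Ph n y\<bar> <= K"
  and bounded: "n >= 1 ==> x \<in> X ==> \<bar>Ph n x\<bar> <= n * B"
  and C_nonneg: "0 <= C" and K_nonneg: "0 <= K" and B_nonneg: "0 <= B"
begin

text \<open>The term of index \<open>0\<close> is unspecified; setting it to \<open>0\<close> keeps all estimates valid.\<close>

definition ph :: "nat => 'm => real" where
 "ph n x = (if n = 0 then 0 else Ph n x)"

lemma ph_add: "x \<in> X ==> \<bar>ph (m + n) x - ph m x - ph n ((f ^^ m) x)\<bar> <= C"
 using additive[of m n x] C_nonneg by (cases "m = 0"; cases "n = 0") (auto simp: ph_def)

lemma ph_dist: "x \<in> X ==> y \<in> bowen x n ep ==> \<bar>ph n x - ph n y\<bar> <= K"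
 using distort[of n x y] K_nonneg by (auto simp: ph_def)

lemma ph_bound: "x \<in> X ==> \<bar>ph n x\<bar> <= n * B"
 using bounded[of n x] B_nonneg by (auto simp: ph_def)

section \<open>Weighted sums over preimages\<close>

definition Pre :: "nat => 'm => 'm set" where
 "Pre n w = {z \<in> X. (f ^^ n) z = w}"

lemma Pre_X: "z \<in> Pre n w ==> z \<in> X" by (simp add: Pre_def)

text \<open>Preimages of the same point have the same future from time \<open>n\<close> on; if they
  are also \<open>e0\<close>-close up to then, expansiveness identifies them.\<close>

lemma Pre_separated: "separated n e0 (Pre n w)"
 unfolding separated_def
proof (intro conjI ballI impI)
 show "Pre n w \<subseteq> X" using Pre_X by blast
 fix x y assume "x \<in> Pre n w" "y \<in> Pre n w" "y \<in> bowen x n e0"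
 then show "x = y" by (intro eq_if_funpow_eq[of x y n]) (auto simp: Pre_def bowen_def)
qed

lemma Pre_finite: "finite (Pre n w)"
 using separated_card[OF e0_pos, of n] Pre_separated by metis

lemma Pre_card: obtains N where "N >= 1" "!!w. card (Pre n w) <= N"
proof -
 obtain k where "!!S. separated n e0 S ==> finite S \<and> card S <= k" using separated_card[OF e0_pos] by blast
 then show ?thesis using Pre_separated by (intro that[of "max k 1"]) (auto simp: le_max_iff_disj)
qed

lemma Pre_nonempty: "w \<in> X ==> Pre n w \<noteq> {}"
proof (induction n arbitrary: w)
 case 0 then show ?case by (auto simp: Pre_def)
next
 case (Suc n)
 obtain v where v: "v \<in> X" "f v = w" using Suc.prems f_onto by (metis imageE)
 obtain z where "z \<in> Pre n v" using Suc.IH[OF v(1)] by blast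
 then show ?case using v by (auto simp: Pre_def)
qed

lemma sum_Pre_add:
 fixes F :: "'m => real"
 shows "(\<Sum>z\<in>Pre (m + n) w. F z) = (\<Sum>v\<in>Pre n w. \<Sum>z\<in>Pre m v. F z)"
proof -
 have "Pre (m + n) w = (\<Union>v\<in>Pre n w. Pre m v)"
  using funpow_X by (auto simp: Pre_def funpow_add add.commute[of m])
 moreover have "(\<Sum>z\<in>(\<Union>v\<in>Pre n w. Pre m v). F z) = (\<Sum>v\<in>Pre n w. \<Sum>z\<in>Pre m v. F z)"
  by (intro sum.UNION_disjoint Pre_finite ballI impI) (auto simp: Pre_def)
 ultimately show ?thesis by simp
qed

text \<open>The counterpart of the \<open>n\<close>-th power of a transfer operator applied to the
  constant 1; composition holds only up to the factor \<open>exp C\<close>, see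
  \<open>L_add\<close>.\<close>

definition L :: "nat => 'm => real" where
 "L n w = (\<Sum>z\<in>Pre n w. exp (ph n z))"

lemma L_pos: "w \<in> X ==> L n w > 0"
 unfolding L_def using Pre_nonempty Pre_finite by (intro sum_pos) auto

lemma L_0: "w \<in> X ==> L 0 w = 1"
proof -
 assume "w \<in> X"
 then have "Pre 0 w = {w}" by (auto simp: Pre_def)
 then show ?thesis by (simp add: L_def ph_def)
qed

lemma L_add:
 "L (m + n) w <= exp C * (\<Sum>v\<in>Pre n w. exp (ph n v) * L m v)"
 "(\<Sum>v\<in>Pre n w. exp (ph n v) * L m v) <= exp C * L (m + n) w"
proof -
 have *: "\<bar>ph (m + n) z - ph m z - ph n v\<bar> <= C" if "v \<in> Pre n w" "z \<in> Pre m v" for v z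
  using ph_add[of z m n] that by (auto simp: Pre_def)
 have "L (m + n) w = (\<Sum>v\<in>Pre n w. \<Sum>z\<in>Pre m v. exp (ph (m + n) z))"
  unfolding L_def by (rule sum_Pre_add)
 also have "\<dots> <= (\<Sum>v\<in>Pre n w. \<Sum>z\<in>Pre m v. exp (C + ph n v + ph m z))"
  using * by (intro sum_mono) (force simp: abs_le_iff)
 also have "\<dots> = exp C * (\<Sum>v\<in>Pre n w. exp (ph n v) * L m v)"
  by (simp add: L_def exp_add sum_distrib_left mult_ac)
 finally show "L (m + n) w <= exp C * (\<Sum>v\<in>Pre n w. exp (ph n v) * L m v)" .
 have "(\<Sum>v\<in>Pre n w. exp (ph n v) * L m v) = (\<Sum>v\<in>Pre n w. \<Sum>z\<in>Pre m v. exp (ph n v + ph m z))"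
  by (simp add: L_def exp_add sum_distrib_left)
 also have "\<dots> <= (\<Sum>v\<in>Pre n w. \<Sum>z\<in>Pre m v. exp (C + ph (m + n) z))"
  using * by (intro sum_mono) (force simp: abs_le_iff)
 also have "\<dots> = exp C * L (m + n) w"
  unfolding L_def sum_Pre_add by (simp add: exp_add sum_distrib_left)
 finally show "(\<Sum>v\<in>Pre n w. exp (ph n v) * L m v) <= exp C * L (m + n) w" .
qed

lemma L_upper:
 assumes "!!v. v \<in> X ==> L m v <= c" "0 <= c"
 shows "L (m + n) w <= exp C * c * L n w"
proof -
 have "L (m + n) w <= exp C * (\<Sum>v\<in>Pre n w. exp (ph n v) * L m v)" by (rule L_add)
 also have "\<dots> <= exp C * (\<Sum>v\<in>Pre n w. exp (ph n v) * c)"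
  using assms Pre_X by (intro mult_left_mono sum_mono) auto
 finally show ?thesis by (simp add: L_def sum_distrib_left sum_distrib_right mult_ac)
qed

lemma L_lower:
 assumes "!!v. v \<in> X ==> c <= L m v"
 shows "c * L n w <= exp C * L (m + n) w"
proof -
 have "c * L n w = (\<Sum>v\<in>Pre n w. exp (ph n v) * c)"
  by (simp add: L_def sum_distrib_left mult_ac)
 also have "\<dots> <= (\<Sum>v\<in>Pre n w. exp (ph n v) * L m v)"
  using assms Pre_X by (intro sum_mono mult_left_mono) auto
 also have "\<dots> <= exp C * L (m + n) w" by (rule L_add)
 finally show ?thesis .
qed

lemma L_crude: obtains N where "N > 0" "!!w. w \<in> X ==> L n w <= N" "!!w. w \<in> X ==> 1 <= N * L n w"
proof -
 obtain N0 where N0: "N0 >= 1" "!!w. card (Pre n w) <= N0" using Pre_card by blast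
 have up: "L n w <= N0 * exp (n * B)" if "w \<in> X" for w
 proof -
  have "L n w <= (\<Sum>z\<in>Pre n w. exp (n * B))"
   unfolding L_def using ph_bound Pre_X by (intro sum_mono) (force simp: abs_le_iff)
  also have "\<dots> = card (Pre n w) * exp (n * B)" by simp
  also have "\<dots> <= N0 * exp (n * B)" using N0(2) by (intro mult_right_mono) auto
  finally show ?thesis .
 qed
 have low: "exp (- (n * B)) <= L n w" if w: "w \<in> X" for w
 proof -
  obtain z where z: "z \<in> Pre n w" using Pre_nonempty[OF w] by blast
  have "- (n * B) <= ph n z" using ph_bound[OF Pre_X[OF z], of n] by (simp add: abs_le_iff)
  then have "exp (- (n * B)) <= exp (ph n z)" by simp
  also have "\<dots> <= L n w" unfolding L_def using z Pre_finite by (intro member_le_sum) auto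
  finally show ?thesis .
 qed
 show ?thesis
 proof (rule that[of "N0 * exp (n * B)"])
  show "1 <= N0 * exp (n * B) * L n w" if "w \<in> X" for w
  proof -
   have "1 = 1 * (exp (n * B) * exp (- (n * B)))" by (simp add: exp_minus)
   also have "\<dots> <= N0 * (exp (n * B) * L n w)"
    using N0(1) low[OF that] by (intro mult_mono mult_left_mono) auto
   finally show ?thesis by simp
  qed
 qed (use up N0 in auto)
qed

text \<open>Specification replaces each \<open>n\<close>-th preimage of \<open>w\<close> by a
  shadowing preimage of \<open>v\<close> at time \<open>n + g\<close>. Shadowing is injective
  because the preimages of \<open>w\<close> are \<open>e0\<close>-separated and
  \<open>2 * ep <= e0\<close>.\<close>

lemma L_shift: obtains g D where "D > 0" "!!n v w. v \<in> X ==> w \<in> X ==> L n w <= D * L (n + g) v"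
proof -
 obtain g where g: "!!x y n. x \<in> X ==> y \<in> X ==>
  \<exists>z\<in>X. (f ^^ (n + g)) z = y \<and> (\<forall>j\<le>n. rh ((f ^^ j) x) ((f ^^ j) z) < ep)"
  using orbit_specification[OF eps_pos] by blast
 have "L n w <= exp (K + C + g * B) * L (n + g) v" if vw: "v \<in> X" "w \<in> X" for n v w
 proof -
  have "\<exists>z'. z' \<in> Pre (n + g) v \<and> z' \<in> bowen z n ep" if "z \<in> Pre n w" for z
   using g[OF Pre_X[OF that] vw(1), of n] by (auto simp: Pre_def bowen_def intro: less_imp_le)
  then obtain s where s: "!!z. z \<in> Pre n w ==> s z \<in> Pre (n + g) v" "!!z. z \<in> Pre n w ==> s z \<in> bowen z n ep"
   by metis
  have inj: "inj_on s (Pre n w)"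
  proof (rule inj_onI)
   fix a b assume ab: "a \<in> Pre n w" "b \<in> Pre n w" "s a = s b"
   have "b \<in> bowen a n (ep + ep)"
    by (rule bowen_trans[OF Pre_X[OF ab(1)] s(2)[OF ab(1)]])
     (use bowen_sym[OF Pre_X[OF ab(2)] s(2)[OF ab(2)]] ab(3) in \<open>simp only:\<close>)
   then have "b \<in> bowen a n e0" using bowen_mono[of "ep + ep" e0 n n a] eps_e0 by auto
   then show "a = b" using Pre_separated[of n w] ab by (simp add: separated_def)
  qed
  have "L n w <= (\<Sum>z\<in>Pre n w. exp (K + C + g * B) * exp (ph (n + g) (s z)))"
   unfolding L_def
  proof (rule sum_mono)
   fix z assume z: "z \<in> Pre n w"
   have sX: "s z \<in> X" using s(1)[OF z] Pre_X by blast
   have "ph n z <= ph n (s z) + K" using ph_dist[OF Pre_X[OF z] s(2)[OF z]] by linarith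
   moreover have "ph n (s z) + ph g ((f ^^ n) (s z)) - C <= ph (n + g) (s z)"
    using ph_add[OF sX, of n g] by linarith
   moreover have "- (g * B) <= ph g ((f ^^ n) (s z))"
    using ph_bound[OF funpow_X[OF sX], of g n] by linarith
   ultimately have "ph n z <= (K + C + g * B) + ph (n + g) (s z)" by linarith
   then show "exp (ph n z) <= exp (K + C + g * B) * exp (ph (n + g) (s z))"
    by (simp flip: exp_add)
  qed
  also have "\<dots> = exp (K + C + g * B) * (\<Sum>z'\<in>s ` Pre n w. exp (ph (n + g) z'))"
   by (simp add: sum_distrib_left sum.reindex[OF inj])
  also have "\<dots> <= exp (K + C + g * B) * L (n + g) v"
   unfolding L_def using s(1) Pre_finite by (intro mult_left_mono sum_mono2) auto
  finally show ?thesis .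
 qed
 then show ?thesis by (intro that[of "exp (K + C + g * B)" g]) auto
qed

text \<open>The time shift \<open>g\<close> of \<open>L_shift\<close> is undone by writing
  \<open>n = m + g\<close>: all values of \<open>L m\<close> are bounded through
  \<open>L n v\<close>, and those of \<open>L g\<close> by a constant. The finitely many
  \<open>n < g\<close> are covered by \<open>D2\<close>.\<close>

lemma L_comparable: obtains D where "D >= 1" "!!n v w. v \<in> X ==> w \<in> X ==> L n w <= D * L n v"
proof -
 obtain g D where D: "D > 0" "!!n v w. v \<in> X ==> w \<in> X ==> L n w <= D * L (n + g) v" using L_shift by metis
 obtain N where N: "N > 0" "!!w. w \<in> X ==> L g w <= N" "!!w. w \<in> X ==> 1 <= N * L g w" using L_crude by metis
 have "\<exists>Nn. Nn > 0 \<and> (\<forall>w\<in>X. L n w <= Nn \<and> 1 <= Nn * L n w)" for n using L_crude[of n] by metis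
 then obtain Ns where Ns: "!!n. Ns n > 0" "!!n w. w \<in> X ==> L n w <= Ns n" "!!n w. w \<in> X ==> 1 <= Ns n * L n w" by metis
 define D1 where "D1 = exp C * N * D"
 define D2 where "D2 = (\<Sum>n<g. Ns n * Ns n)"
 have D1: "D1 > 0" using N D by (simp add: D1_def)
 have D2: "D2 >= 0" unfolding D2_def by (intro sum_nonneg) auto
 have "L n w <= (1 + D1 + D2) * L n v" if vw: "v \<in> X" "w \<in> X" for n v w
 proof (cases "n < g")
  case True
  have "L n w <= Ns n * 1" using Ns(2)[OF vw(2)] by simp
  also have "\<dots> <= Ns n * (Ns n * L n v)" using Ns(3)[OF vw(1), of n] Ns(1)[of n] by (intro mult_left_mono) auto
  also have "\<dots> = (Ns n * Ns n) * L n v" by simp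
  also have "\<dots> <= (1 + D1 + D2) * L n v"
  proof (intro mult_right_mono)
   have "Ns n * Ns n <= D2" unfolding D2_def using True by (intro member_le_sum) auto
   then show "Ns n * Ns n <= 1 + D1 + D2" using D1 by linarith
  qed (use L_pos[OF vw(1), of n] in auto)
  finally show ?thesis .
 next
  case False
  define m where "m = n - g"
  have n: "n = m + g" using False by (simp add: m_def)
  have bd: "L m u <= D * L n v" if "u \<in> X" for u using D(2)[OF vw(1) that, of m] n by simp
  have "L n w <= exp C * (D * L n v) * L g w"
   unfolding n using bd[unfolded n] L_pos[OF vw(1), of "m + g"] D(1) by (intro L_upper) auto
  also have "\<dots> <= exp C * (D * L n v) * N"
   using N(2)[OF vw(2)] L_pos[OF vw(1), of n] D(1) by (intro mult_left_mono) auto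
  also have "\<dots> = D1 * L n v" by (simp add: D1_def)
  also have "\<dots> <= (1 + D1 + D2) * L n v" using D2 L_pos[OF vw(1), of n] by (intro mult_right_mono) auto
  finally show ?thesis .
 qed
 then show ?thesis using D1 D2 by (intro that[of "1 + D1 + D2"]) auto
qed

text \<open>Comparability makes \<open>ln (L n x0)\<close> almost additive, hence linear up to a
  bounded error. The growth rate \<open>P\<close> is identified with the pressure in
  \<open>Ptop_eq\<close>.\<close>

lemma L_growth: obtains P D :: real where "D >= 1" "!!n w. w \<in> X ==> L n w <= D * exp (n * P)"
 "!!n w. w \<in> X ==> exp (n * P) <= D * L n w"
proof -
 obtain D where D: "D >= 1" "!!n v w. v \<in> X ==> w \<in> X ==> L n w <= D * L n v" using L_comparable by blast
 obtain x0 where x0: "x0 \<in> X" using X_nonempty by blast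
 note pos = L_pos[OF x0]
 define a where "a n = ln (L n x0)" for n
 have ea: "exp (a n) = L n x0" for n using pos by (simp add: a_def)
 have aa: "\<bar>a (m + n) - a m - a n\<bar> <= C + ln D" for m n
 proof -
  have "L (m + n) x0 <= exp C * (D * L m x0) * L n x0"
   using D pos[of m] x0 by (intro L_upper) auto
  then have "exp (a (m + n)) <= exp (C + ln D + a m + a n)" using D(1) by (simp add: exp_add ea mult_ac)
  moreover have "(L m x0 / D) * L n x0 <= exp C * L (m + n) x0"
   using D x0 by (intro L_lower) (auto simp: field_simps)
  then have "exp (a m + a n) <= exp (C + ln D + a (m + n))" using D(1) by (simp add: exp_add ea field_simps)
  ultimately show ?thesis by simp
 qed
 obtain P where "(%n. a n / n) \<longlonglongrightarrow> P" and P: "!!n. n >= 1 ==> \<bar>a n - n * P\<bar> <= C + ln D"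
  by (rule almost_additive_real[of a "C + ln D"]) (rule aa, rule that)
 define D' where "D' = exp C * D"
 have D': "D' >= 1" using D(1) C_nonneg by (simp add: D'_def one_le_mult one_le_exp_iff)
 have eD': "D' = exp (C + ln D)" using D(1) by (simp add: D'_def exp_add)
 have x0b: "L n x0 <= D' * exp (n * P)" "exp (n * P) <= D' * L n x0" for n
 proof -
  have "a n <= C + ln D + n * P \<and> n * P <= C + ln D + a n"
  proof (cases "n = 0")
   case True then show ?thesis using C_nonneg D(1) L_0[OF x0] by (simp add: a_def)
  next
   case False
   then show ?thesis using P[of n] by (auto simp: abs_le_iff)
  qed
  then have "exp (a n) <= exp (C + ln D + n * P)" "exp (n * P) <= exp (C + ln D + a n)" by auto
  then show "L n x0 <= D' * exp (n * P)" "exp (n * P) <= D' * L n x0"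
   using eD' by (auto simp: exp_add ea)
 qed
 show ?thesis
 proof (rule that[of "D * D'" P])
  show "D * D' >= 1" using D(1) D' by (simp add: one_le_mult)
  fix n w assume w: "w \<in> X"
  have "L n w <= D * L n x0" using D(2) w x0 by blast
  also have "\<dots> <= D * (D' * exp (n * P))" using x0b(1) D(1) by (intro mult_left_mono) auto
  finally show "L n w <= D * D' * exp (n * P)" by (simp add: mult.assoc)
  have "exp (n * P) <= D' * L n x0" by (rule x0b)
  also have "\<dots> <= D' * (D * L n w)" using D(2)[OF w x0] D' by (intro mult_left_mono) auto
  finally show "exp (n * P) <= D * D' * L n w" by (simp add: mult_ac)
 qed
qed

lemma bowen_Pre_unique:
 assumes "y \<in> X" "r <= ep" "u \<in> Pre m v" "u \<in> bowen y n r" "u' \<in> Pre m v" "u' \<in> bowen y n r" "m <= n"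
 shows "u = u'"
proof -
 have "u' \<in> bowen u n (r + r)" using assms(4,6) bowen_trans[OF Pre_X[OF assms(3)] bowen_sym[OF assms(1,4)]] by blast
 then have "u' \<in> bowen u m e0" using bowen_mono[of "r + r" e0 m n u] eps_e0 assms(2,7) by auto
 then show ?thesis using Pre_separated[of m v] assms(3,5) by (simp add: separated_def)
qed

text \<open>Gibbs bounds before the limit. Orbits are cut into blocks of lengths \<open>j\<close>,
  \<open>m\<close> and \<open>k\<close>; the outer blocks sum to values of \<open>L j\<close> and
  \<open>L k\<close>. In the middle block separation admits at most one preimage inside the ball,
  while specification guarantees one after the block is lengthened by the gap \<open>g\<close>,
  whence the shape \<open>(m + g) + k\<close> in the lower bound.\<close>

lemma sum_bowen:
 obtains P D :: real where "D >= 1"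
  "!!y m j k w. y \<in> X ==> w \<in> X ==>
   (\<Sum>z\<in>Pre (j + (m + k)) w. indicator (bowen y m ep) ((f ^^ j) z) * exp (ph (j + (m + k)) z))
    <= D * exp (ph m y - m * P) * L (j + (m + k)) w"
  "!!r. 0 < r ==> r <= ep ==> \<exists>g D'. D' > 0 \<and> (\<forall>y m j k w. y \<in> X --> w \<in> X -->
   exp (ph m y - m * P) * L (j + ((m + g) + k)) w
    <= D' * (\<Sum>z\<in>Pre (j + ((m + g) + k)) w. indicator (bowen y m r) ((f ^^ j) z) * exp (ph (j + ((m + g) + k)) z)))"
proof -
 obtain P D where D: "D >= 1" "!!n w. w \<in> X ==> L n w <= D * exp (n * P)"
  "!!n w. w \<in> X ==> exp (n * P) <= D * L n w" using L_growth by metis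
 have split: "\<bar>ph (j + (m + k)) z - (ph j z + ph m u + ph k v)\<bar> <= 2 * C"
  if "v \<in> Pre k w" "u \<in> Pre m v" "z \<in> Pre j u" for j m k w v u z
 proof -
  have "\<bar>ph (j + (m + k)) z - ph j z - ph (m + k) u\<bar> <= C" "\<bar>ph (m + k) u - ph m u - ph k v\<bar> <= C"
   using ph_add[of z j "m + k"] ph_add[of u m k] that by (auto simp: Pre_def)
  then show ?thesis by linarith
 qed
 have nested: "(\<Sum>z\<in>Pre (j + (m + k)) w. indicator A ((f ^^ j) z) * F z)
   = (\<Sum>v\<in>Pre k w. \<Sum>u\<in>Pre m v. indicator A u * (\<Sum>z\<in>Pre j u. F z))" for j m k w A and F :: "'m => real"
 proof -
  have "(\<Sum>z\<in>Pre (j + (m + k)) w. indicator A ((f ^^ j) z) * F z)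
    = (\<Sum>v\<in>Pre k w. \<Sum>u\<in>Pre m v. \<Sum>z\<in>Pre j u. indicator A ((f ^^ j) z) * F z)"
   by (simp only: sum_Pre_add)
  also have "\<dots> = (\<Sum>v\<in>Pre k w. \<Sum>u\<in>Pre m v. \<Sum>z\<in>Pre j u. indicator A u * F z)"
   by (intro sum.cong refl) (auto simp: Pre_def)
  finally show ?thesis by (simp add: sum_distrib_left)
 qed
 define U where "U = exp (2 * C + K) * D * D * D"
 have U: "U >= 1"
 proof -
  have "exp (2 * C + K) >= 1" using C_nonneg K_nonneg by simp
  then show ?thesis unfolding U_def using D(1) by (intro one_le_mult) auto
 qed
 have up: "(\<Sum>z\<in>Pre (j + (m + k)) w. indicator (bowen y m ep) ((f ^^ j) z) * exp (ph (j + (m + k)) z))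
   <= U * exp (ph m y - m * P) * L (j + (m + k)) w" (is "?S <= _")
  if y: "y \<in> X" and w: "w \<in> X" for y m j k w
 proof -
  let ?B = "bowen y m ep"
  have inner: "indicator ?B u * (\<Sum>z\<in>Pre j u. exp (ph (j + (m + k)) z))
    <= (if u \<in> ?B then exp (2 * C + K + ph m y + ph k v) * (D * exp (j * P)) else 0)"
   if v: "v \<in> Pre k w" and u: "u \<in> Pre m v" for u v
  proof (cases "u \<in> ?B")
   case True
   have "(\<Sum>z\<in>Pre j u. exp (ph (j + (m + k)) z)) <= (\<Sum>z\<in>Pre j u. exp (2 * C + K + ph m y + ph k v) * exp (ph j z))"
   proof (rule sum_mono)
    fix z assume z: "z \<in> Pre j u"
    have "ph (j + (m + k)) z <= (2 * C + K + ph m y + ph k v) + ph j z"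
     using split[OF v u z] ph_dist[OF y True] by linarith
    then show "exp (ph (j + (m + k)) z) <= exp (2 * C + K + ph m y + ph k v) * exp (ph j z)"
     by (simp flip: exp_add)
   qed
   also have "\<dots> = exp (2 * C + K + ph m y + ph k v) * L j u" by (simp add: L_def sum_distrib_left)
   also have "\<dots> <= exp (2 * C + K + ph m y + ph k v) * (D * exp (j * P))"
    using D(2)[OF Pre_X[OF u]] by (intro mult_left_mono) auto
   finally show ?thesis using True by simp
  qed simp
  have "?S = (\<Sum>v\<in>Pre k w. \<Sum>u\<in>Pre m v. indicator ?B u * (\<Sum>z\<in>Pre j u. exp (ph (j + (m + k)) z)))"
   by (rule nested)
  also have "\<dots> <= (\<Sum>v\<in>Pre k w. exp (2 * C + K + ph m y + ph k v) * (D * exp (j * P)))"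
  proof (rule sum_mono)
   fix v assume v: "v \<in> Pre k w"
   let ?c = "exp (2 * C + K + ph m y + ph k v) * (D * exp (j * P))"
   have c: "?c >= 0" using D(1) by simp
   have "(\<Sum>u\<in>Pre m v. indicator ?B u * (\<Sum>z\<in>Pre j u. exp (ph (j + (m + k)) z)))
     <= (\<Sum>u\<in>Pre m v. if u \<in> ?B then ?c else 0)"
    using inner[OF v] by (rule sum_mono)
   also have "\<dots> = card (Pre m v \<inter> ?B) * ?c" using Pre_finite by (simp add: sum.If_cases)
   also have "\<dots> <= 1 * ?c"
   proof (intro mult_right_mono c)
    have "card (Pre m v \<inter> ?B) <= Suc 0"
    proof (subst card_le_Suc0_iff_eq)
     show "\<forall>u\<in>Pre m v \<inter> ?B. \<forall>u'\<in>Pre m v \<inter> ?B. u = u'"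
      using bowen_Pre_unique[OF y, of ep _ m v m] by blast
    qed (simp add: Pre_finite)
    then show "real (card (Pre m v \<inter> ?B)) <= 1" by simp
   qed
   finally show "(\<Sum>u\<in>Pre m v. indicator ?B u * (\<Sum>z\<in>Pre j u. exp (ph (j + (m + k)) z))) <= ?c" by simp
  qed
  also have "\<dots> = exp (2 * C + K + ph m y) * D * exp (j * P) * L k w"
   by (simp add: L_def sum_distrib_left exp_add mult_ac)
  also have "\<dots> <= exp (2 * C + K + ph m y) * D * exp (j * P) * (D * exp (k * P))"
   using D(1) D(2)[OF w] by (intro mult_left_mono) auto
  also have "\<dots> = exp (2 * C + K) * D * D * exp (ph m y - m * P) * exp (real (j + (m + k)) * P)"
   by (simp add: exp_add[symmetric] exp_diff algebra_simps)
     (simp add: exp_add exp_diff field_simps)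
  also have "\<dots> <= exp (2 * C + K) * D * D * exp (ph m y - m * P) * (D * L (j + (m + k)) w)"
   using D(1) D(3)[OF w, of "j + (m + k)"] by (intro mult_left_mono) auto
  finally show ?thesis by (simp add: U_def mult_ac)
 qed
 have low: "\<exists>g D'. D' > 0 \<and> (\<forall>y m j k w. y \<in> X --> w \<in> X -->
   exp (ph m y - m * P) * L (j + ((m + g) + k)) w
    <= D' * (\<Sum>z\<in>Pre (j + ((m + g) + k)) w. indicator (bowen y m r) ((f ^^ j) z) * exp (ph (j + ((m + g) + k)) z)))"
  if r: "0 < r" "r <= ep" for r
 proof -
  obtain g where g: "!!x y n. x \<in> X ==> y \<in> X ==>
   \<exists>z\<in>X. (f ^^ (n + g)) z = y \<and> (\<forall>j\<le>n. rh ((f ^^ j) x) ((f ^^ j) z) < r)"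
   using orbit_specification[OF r(1)] by blast
  \<comment> \<open>\<open>2 * C\<close> for cutting into three blocks, \<open>C\<close> and
    \<open>g * B\<close> for splitting off the gap, \<open>K\<close> for the distortion in the
    ball.\<close>
  define c where "c = 3 * C + K + g * B"
  define D' where "D' = exp c * D * D * D * exp (g * P)"
  have D'pos: "D' > 0" using D(1) by (simp add: D'_def)
  have "exp (ph m y - m * P) * L (j + ((m + g) + k)) w
    <= D' * (\<Sum>z\<in>Pre (j + ((m + g) + k)) w. indicator (bowen y m r) ((f ^^ j) z) * exp (ph (j + ((m + g) + k)) z))"
   (is "_ <= D' * ?S")
   if y: "y \<in> X" and w: "w \<in> X" for y m j k w
  proof -
   let ?B = "bowen y m r"
   have inner: "exp (ph m y + ph k v) * exp (j * P) <= exp c * D * (\<Sum>u\<in>Pre (m + g) v. indicator ?B u * (\<Sum>z\<in>Pre j u. exp (ph (j + ((m + g) + k)) z)))"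
    if v: "v \<in> Pre k w" for v
   proof -
    obtain u where u: "u \<in> Pre (m + g) v" "u \<in> ?B"
     using g[OF y Pre_X[OF v], of m] by (auto simp: Pre_def bowen_def intro: less_imp_le)
    have uX: "u \<in> X" using Pre_X[OF u(1)] .
    have ub: "u \<in> bowen y m ep" using bowen_mono[of r ep m m y] r u(2) by auto
    have le: "ph m y + ph k v + ph j z <= c + ph (j + ((m + g) + k)) z" if z: "z \<in> Pre j u" for z
    proof -
     have "\<bar>ph (m + g) u - ph m u - ph g ((f ^^ m) u)\<bar> <= C" by (rule ph_add[OF uX])
     moreover have "\<bar>ph g ((f ^^ m) u)\<bar> <= g * B" by (rule ph_bound[OF funpow_X[OF uX]])
     ultimately show ?thesis
      using split[OF v u(1) z] ph_dist[OF y ub] unfolding c_def by linarith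
    qed
    have "exp (ph m y + ph k v) * exp (j * P) <= exp (ph m y + ph k v) * (D * L j u)"
     using D(3)[OF uX] by (intro mult_left_mono) auto
    also have "\<dots> = D * (\<Sum>z\<in>Pre j u. exp (ph m y + ph k v + ph j z))"
     by (simp add: L_def exp_add sum_distrib_left mult_ac)
    also have "\<dots> <= D * (\<Sum>z\<in>Pre j u. exp (c + ph (j + ((m + g) + k)) z))"
     using D(1) le by (intro mult_left_mono sum_mono) auto
    also have "\<dots> = exp c * D * (indicator ?B u * (\<Sum>z\<in>Pre j u. exp (ph (j + ((m + g) + k)) z)))"
     using u(2) by (simp add: exp_add sum_distrib_left mult_ac)
    also have "\<dots> <= exp c * D * (\<Sum>u\<in>Pre (m + g) v. indicator ?B u * (\<Sum>z\<in>Pre j u. exp (ph (j + ((m + g) + k)) z)))"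
     using D(1) u(1) Pre_finite
     by (intro mult_left_mono member_le_sum[of u "Pre (m + g) v" "%u. indicator ?B u * (\<Sum>z\<in>Pre j u. exp (ph (j + ((m + g) + k)) z))"])
      (auto intro!: mult_nonneg_nonneg sum_nonneg)
    finally show ?thesis .
   qed
   have "exp (ph m y - m * P) * L (j + ((m + g) + k)) w <= exp (ph m y - m * P) * (D * exp (real (j + ((m + g) + k)) * P))"
    using D(2)[OF w, of "j + ((m + g) + k)"] by (intro mult_left_mono) auto
   also have "\<dots> = D * exp (ph m y) * exp (j * P) * exp (g * P) * exp (k * P)"
    by (simp add: exp_add[symmetric] exp_diff algebra_simps)
     (simp add: exp_add exp_diff field_simps)
   also have "\<dots> <= D * exp (ph m y) * exp (j * P) * exp (g * P) * (D * L k w)"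
    using D(1) D(3)[OF w] by (intro mult_left_mono) auto
   also have "\<dots> = D * D * exp (g * P) * (\<Sum>v\<in>Pre k w. exp (ph m y + ph k v) * exp (j * P))"
    by (simp add: L_def sum_distrib_left exp_add mult_ac)
   also have "\<dots> <= D * D * exp (g * P) * (\<Sum>v\<in>Pre k w. exp c * D * (\<Sum>u\<in>Pre (m + g) v. indicator ?B u * (\<Sum>z\<in>Pre j u. exp (ph (j + ((m + g) + k)) z))))"
    using D(1) inner by (intro mult_left_mono sum_mono) auto
   also have "\<dots> = D' * ?S" unfolding nested by (simp add: D'_def sum_distrib_left mult_ac)
   finally show ?thesis .
  qed
  then show ?thesis using D'pos by blast
 qed
 show ?thesis by (rule that[OF U up low])
qed

end

section \<open>Construction of Gibbs measures\<close>

lemma sum_if_card: "(\<Sum>j<N. if Q j then e else 0) = real (card {j. j < N \<and> Q j}) * e" for N :: nat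
 by (simp add: sum.If_cases Int_def)

lemma (in compact_metric) finite_support_measure:
 fixes w :: "'s => real" and T :: "'s => 'm"
 assumes S: "finite S" and w: "!!s. s \<in> S ==> 0 <= w s" "(\<Sum>s\<in>S. w s) = 1" and T: "!!s. s \<in> S ==> T s \<in> X"
 obtains nu where "prob_on nu" "!!A. A \<in> sets borel ==> A \<subseteq> X ==> measure nu A = (\<Sum>s\<in>S. w s * indicator A (T s))"
  "!!h :: 'm => real. continuous_on X h ==> (\<integral>x. h x \<partial>nu) = (\<Sum>s\<in>S. w s * h (T s))"
proof -
 define pm where "pm = point_measure S (%s. ennreal (w s))"
 have sp: "space pm = S" "sets pm = Pow S" by (auto simp: pm_def space_point_measure sets_point_measure)
 have em: "emeasure pm A = ennreal (\<Sum>s\<in>A. w s)" if "A \<subseteq> S" for A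
 proof -
  have "emeasure pm A = (\<Sum>s\<in>A. ennreal (w s))"
   unfolding pm_def using S that by (rule emeasure_point_measure_finite)
  also have "\<dots> = ennreal (\<Sum>s\<in>A. w s)" using w(1) that by (intro sum_ennreal) auto
  finally show ?thesis .
 qed
 have Tm: "T \<in> measurable pm (restrict_space borel X)"
 proof (rule measurableI)
  show "T s \<in> space (restrict_space borel X)" if "s \<in> space pm" for s
   using that T by (simp add: sp space_restrict_space)
 qed (auto simp: sp)
 define nu where "nu = distr pm (restrict_space borel X) T"
 interpret pm: prob_space pm by (rule prob_spaceI) (simp add: sp em w(2))
 have nu: "prob_on nu"
  unfolding prob_on_def nu_def using pm.prob_space_distr[OF Tm] by (simp add: space_restrict_space)
 have "measure nu A = (\<Sum>s\<in>S. w s * indicator A (T s))" if A: "A \<in> sets borel" "A \<subseteq> X" for A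
 proof -
  have "A \<in> sets (restrict_space borel X)" using A closed_X by (auto simp: sets_restrict_space_iff)
  then have "measure nu A = measure pm (T -` A \<inter> S)"
   unfolding nu_def using measure_distr[OF Tm] by (simp add: sp)
  also have "\<dots> = (\<Sum>s\<in>T -` A \<inter> S. w s)"
  proof -
   have "0 <= (\<Sum>s\<in>T -` A \<inter> S. w s)" using w(1) by (intro sum_nonneg) auto
   then show ?thesis by (simp add: measure_def em)
  qed
  also have "\<dots> = (\<Sum>s\<in>S. w s * indicator A (T s))"
   using S by (intro sum.mono_neutral_cong_left) (auto simp: indicator_def)
  finally show ?thesis .
 qed
 moreover have "(\<integral>x. h x \<partial>nu) = (\<Sum>s\<in>S. w s * h (T s))" if h: "continuous_on X h" for h :: "'m => real"
 proof -
  have "(\<integral>x. h x \<partial>nu) = (\<integral>s. h (T s) \<partial>pm)"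
   unfolding nu_def using Tm borel_measurable_continuous_on_restrict[OF h] by (rule integral_distr)
  also have "\<dots> = (\<Sum>s\<in>S. w s * h (T s))"
   unfolding pm_def using S w(1) by (subst lebesgue_integral_point_measure_finite) auto
  finally show ?thesis .
 qed
 ultimately show ?thesis using that nu by blast
qed

lemma (in expanding_map) invariant_measureI:
 assumes mu: "prob_on mu"
  and inv: "!!h :: 'm => real. continuous_on X h ==> (\<integral>x. h (f x) \<partial>mu) = (\<integral>x. h x \<partial>mu)"
 shows "mu \<in> invariant_measures f X"
proof -
 interpret prob_space mu using prob_onD(1)[OF mu] .
 have fm: "f \<in> measurable mu mu" using f_measurable[OF mu, of 1] by simp
 have d: "prob_on (distr mu mu f)"
  using mu prob_space_distr[OF fm] by (simp add: prob_on_def)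
 have "distr mu mu f = mu"
 proof (rule prob_on_eqI[OF d mu])
  fix h :: "'m => real" assume h: "continuous_on X h"
  show "(\<integral>x. h x \<partial>distr mu mu f) = (\<integral>x. h x \<partial>mu)"
   using integral_distr[OF fm continuous_measurable[OF mu h]] inv[OF h] by simp
 qed
 then show ?thesis using mu fm by (simp add: invariant_measures_def prob_on_def)
qed

text \<open>The upper bound is fixed at one scale, the lower one holds at every scale
  \<open>r\<close> with a constant depending on \<open>r\<close>, since later arguments evaluate it
  at the radii \<open>ep / 4\<close> and \<open>ep / 8\<close>. \<open>P\<close> is a parameter here
  and turns out to be the pressure.\<close>

definition (in expanding_map) gibbs :: "real => (nat => 'm => real) => real => 'm measure => bool" where
 "gibbs ep Ph P mu \<longleftrightarrow> mu \<in> invariant_measures f X \<and>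
  (\<exists>D>0. \<forall>n\<ge>1. \<forall>x\<in>X. measure mu (bowen x n ep) <= D * exp (Ph n x - n * P)) \<and>
  (\<forall>r>0. \<exists>D>0. \<forall>n\<ge>1. \<forall>x\<in>X. exp (Ph n x - n * P) <= D * measure mu (bowen x n r))"

context potential
begin

text \<open>
 The measure is a limit of orbit averages of the measures on the preimages of a point with
 weights proportional to \<open>exp \<circ> Ph n\<close>.
\<close>

theorem gibbs_exists: obtains P mu where "gibbs (ep / 2) Ph P mu"
proof -
 obtain P D :: real where D: "D >= 1"
  and up: "!!y m j k w. y \<in> X ==> w \<in> X ==>
   (\<Sum>z\<in>Pre (j + (m + k)) w. indicator (bowen y m ep) ((f ^^ j) z) * exp (ph (j + (m + k)) z))
    <= D * exp (ph m y - m * P) * L (j + (m + k)) w"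
  and low: "!!r. 0 < r ==> r <= ep ==> \<exists>g D'. D' > 0 \<and> (\<forall>y m j k w. y \<in> X --> w \<in> X -->
   exp (ph m y - m * P) * L (j + ((m + g) + k)) w
    <= D' * (\<Sum>z\<in>Pre (j + ((m + g) + k)) w. indicator (bowen y m r) ((f ^^ j) z) * exp (ph (j + ((m + g) + k)) z)))"
  by (rule sum_bowen, rule that)
 obtain x0 where x0: "x0 \<in> X" using X_nonempty by blast
 note Lpos = L_pos[OF x0]
 define a where "a N A j = (\<Sum>z\<in>Pre N x0. indicator A ((f ^^ j) z) * exp (ph N z)) / L N x0" for N A j
 have a01: "0 <= a N A j" "a N A j <= 1" for N A j
 proof -
  show "0 <= a N A j" unfolding a_def using Lpos[of N] by (intro divide_nonneg_nonneg sum_nonneg) auto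
  have "(\<Sum>z\<in>Pre N x0. indicator A ((f ^^ j) z) * exp (ph N z)) <= L N x0"
   unfolding L_def by (intro sum_mono) (auto simp: indicator_def)
  then show "a N A j <= 1" unfolding a_def using Lpos[of N] by simp
 qed
 have ex: "\<exists>nu. prob_on nu \<and> (\<forall>A. A \<in> sets borel --> A \<subseteq> X --> measure nu A = (\<Sum>j<N. a N A j) / N) \<and>
   (\<forall>h :: 'm => real. continuous_on X h -->
    (\<integral>x. h x \<partial>nu) = (\<Sum>j<N. \<Sum>z\<in>Pre N x0. exp (ph N z) / (N * L N x0) * h ((f ^^ j) z)))"
  if N: "N >= 1" for N
 proof -
  let ?S = "{..<N} \<times> Pre N x0" and ?w = "%s. exp (ph N (snd s)) / (N * L N x0)" and ?T = "%s. (f ^^ fst s) (snd s)"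
  have sum: "(\<Sum>s\<in>?S. F (fst s) (snd s)) = (\<Sum>j<N. \<Sum>z\<in>Pre N x0. F j z)" for F :: "nat => 'm => real"
   by (simp add: sum.cartesian_product case_prod_beta)
  have "(\<Sum>s\<in>?S. ?w s) = (\<Sum>j<N. \<Sum>z\<in>Pre N x0. exp (ph N z) / (N * L N x0))" by (rule sum)
  also have "\<dots> = 1" using N Lpos[of N] by (simp add: sum_divide_distrib[symmetric] L_def)
  finally have w1: "(\<Sum>s\<in>?S. ?w s) = 1" .
  obtain nu where nu: "prob_on nu"
   "!!A. A \<in> sets borel ==> A \<subseteq> X ==> measure nu A = (\<Sum>s\<in>?S. ?w s * indicator A (?T s))"
   "!!h :: 'm => real. continuous_on X h ==> (\<integral>x. h x \<partial>nu) = (\<Sum>s\<in>?S. ?w s * h (?T s))"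
  proof (rule finite_support_measure[of ?S ?w ?T])
   show "0 <= ?w s" for s using Lpos[of N] by simp
  qed (use w1 Pre_finite Pre_X funpow_X in auto)
  show ?thesis
  proof (intro exI[of _ nu] conjI allI impI)
   fix A :: "'m set" assume A: "A \<in> sets borel" "A \<subseteq> X"
   have "measure nu A = (\<Sum>j<N. \<Sum>z\<in>Pre N x0. exp (ph N z) / (N * L N x0) * indicator A ((f ^^ j) z))"
    unfolding nu(2)[OF A] by (rule sum)
   also have "\<dots> = (\<Sum>j<N. a N A j / N)"
    unfolding a_def by (simp add: sum_divide_distrib mult_ac)
   finally show "measure nu A = (\<Sum>j<N. a N A j) / N" by (simp add: sum_divide_distrib)
  next
   fix h :: "'m => real" assume "continuous_on X h"
   from nu(3)[OF this] show "(\<integral>x. h x \<partial>nu) = (\<Sum>j<N. \<Sum>z\<in>Pre N x0. exp (ph N z) / (N * L N x0) * h ((f ^^ j) z))"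
    using sum[of "%j z. exp (ph N z) / (N * L N x0) * h ((f ^^ j) z)"] by (rule trans)
  qed (rule nu(1))
 qed
 define Q where "Q n nu \<longleftrightarrow> prob_on nu \<and> (\<forall>A. A \<in> sets borel --> A \<subseteq> X --> measure nu A = (\<Sum>j<Suc n. a (Suc n) A j) / Suc n) \<and>
   (\<forall>h :: 'm => real. continuous_on X h -->
    (\<integral>x. h x \<partial>nu) = (\<Sum>j<Suc n. \<Sum>z\<in>Pre (Suc n) x0. exp (ph (Suc n) z) / (Suc n * L (Suc n) x0) * h ((f ^^ j) z)))"
  for n nu
 have "\<forall>n. \<exists>nu. Q n nu" unfolding Q_def by (intro allI, rule ex) simp
 from choice[OF this] obtain nu where E: "\<forall>n. Q n (nu n)" by (rule exE)
 note E' = E[THEN spec, unfolded Q_def]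
 have nu: "prob_on (nu n)" for n using E'[of n] by (rule conjunct1)
 have nuA: "measure (nu n) A = (\<Sum>j<Suc n. a (Suc n) A j) / Suc n" if "A \<in> sets borel" "A \<subseteq> X" for n A
  using E'[of n, THEN conjunct2, THEN conjunct1] that by (elim allE impE)
 have nuh: "(\<integral>x. h x \<partial>nu n) = (\<Sum>j<Suc n. \<Sum>z\<in>Pre (Suc n) x0. exp (ph (Suc n) z) / (Suc n * L (Suc n) x0) * h ((f ^^ j) z))"
  if "continuous_on X h" for n and h :: "'m => real"
  using E'[of n, THEN conjunct2, THEN conjunct2] that by (elim allE impE)
 obtain r mu where r: "strict_mono (r :: nat => nat)" and mu: "prob_on mu" and wc: "wconv (nu \<circ> r) mu"
  using weak_compactness[of nu, OF nu] by blast
 \<comment> \<open>Applying \<open>f\<close> shifts the orbit sum by one step, so the two integrals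
   differ only in the end terms of each orbit segment.\<close>
 have inv_small: "\<bar>(\<integral>x. h (f x) \<partial>nu n) - (\<integral>x. h x \<partial>nu n)\<bar> <= 2 * b / Suc n"
  if h: "continuous_on X h" and b: "!!x. x \<in> X ==> \<bar>h x\<bar> <= b" for h :: "'m => real" and b n
 proof -
  let ?N = "Suc n"
  let ?c = "%z. exp (ph ?N z) / (?N * L ?N x0)"
  have hf: "continuous_on X (%x. h (f x))"
   by (rule continuous_on_compose2[OF h f_cont]) (use f_X in auto)
  have "(\<integral>x. h (f x) \<partial>nu n) - (\<integral>x. h x \<partial>nu n)
    = (\<Sum>j<?N. \<Sum>z\<in>Pre ?N x0. ?c z * (h ((f ^^ Suc j) z) - h ((f ^^ j) z)))"
   unfolding nuh[OF h] nuh[OF hf] by (simp add: sum_subtractf right_diff_distrib)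
  also have "\<dots> = (\<Sum>z\<in>Pre ?N x0. ?c z * (\<Sum>j<?N. h ((f ^^ Suc j) z) - h ((f ^^ j) z)))"
   by (subst sum.swap) (simp only: sum_distrib_left)
  also have "\<dots> = (\<Sum>z\<in>Pre ?N x0. ?c z * (h ((f ^^ ?N) z) - h z))"
   by (subst sum_lessThan_telescope) simp
  finally have eq: "(\<integral>x. h (f x) \<partial>nu n) - (\<integral>x. h x \<partial>nu n) = \<dots>" .
  have "\<bar>\<Sum>z\<in>Pre ?N x0. ?c z * (h ((f ^^ ?N) z) - h z)\<bar> <= (\<Sum>z\<in>Pre ?N x0. ?c z * (2 * b))"
  proof (rule order_trans[OF sum_abs sum_mono])
   fix z assume z: "z \<in> Pre ?N x0"
   have "\<bar>h ((f ^^ ?N) z) - h z\<bar> <= 2 * b"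
    using b[OF funpow_X[OF Pre_X[OF z], of ?N]] b[OF Pre_X[OF z]] by linarith
   then show "\<bar>?c z * (h ((f ^^ ?N) z) - h z)\<bar> <= ?c z * (2 * b)"
    using Lpos[of ?N] by (simp only: abs_mult) (intro mult_mono, auto)
  qed
  also have "\<dots> = 2 * b / ?N"
  proof -
   have "(\<Sum>z\<in>Pre ?N x0. ?c z * (2 * b)) = L ?N x0 / (?N * L ?N x0) * (2 * b)"
    by (simp only: sum_distrib_right[symmetric] sum_divide_distrib[symmetric] L_def)
   then show ?thesis using Lpos[of ?N] by simp
  qed
  finally show ?thesis using eq by simp
 qed
 have inv: "mu \<in> invariant_measures f X"
 proof (rule invariant_measureI[OF mu])
  fix h :: "'m => real" assume h: "continuous_on X h"
  have hf: "continuous_on X (%x. h (f x))"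
   by (rule continuous_on_compose2[OF h f_cont]) (use f_X in auto)
  obtain b where b: "b > 0" "!!x. x \<in> X ==> \<bar>h x\<bar> <= b" using continuous_bounded[OF h] by blast
  have l1: "(%n. (\<integral>x. h (f x) \<partial>nu (r n)) - (\<integral>x. h x \<partial>nu (r n))) \<longlonglongrightarrow> (\<integral>x. h (f x) \<partial>mu) - (\<integral>x. h x \<partial>mu)"
   using wc h hf unfolding wconv_def comp_def by (intro tendsto_diff) blast+
  have l2: "(%n. (\<integral>x. h (f x) \<partial>nu (r n)) - (\<integral>x. h x \<partial>nu (r n))) \<longlonglongrightarrow> 0"
  proof (rule Lim_null_comparison)
   show "\<forall>\<^sub>F n in sequentially. norm ((\<integral>x. h (f x) \<partial>nu (r n)) - (\<integral>x. h x \<partial>nu (r n))) <= 2 * b / Suc n"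
   proof (intro always_eventually allI)
    fix n
    have "2 * b / Suc (r n) <= 2 * b / Suc n"
     using b(1) seq_suble[OF r, of n] by (intro divide_left_mono) auto
    then show "norm ((\<integral>x. h (f x) \<partial>nu (r n)) - (\<integral>x. h x \<partial>nu (r n))) <= 2 * b / Suc n"
     using inv_small[OF h b(2), of "r n"] by simp
   qed
   show "(%n. 2 * b / real (Suc n)) \<longlonglongrightarrow> 0"
    using tendsto_mult_right_zero[OF lim_inverse_n', of "2 * b", THEN LIMSEQ_Suc] by simp
  qed
  show "(\<integral>x. h (f x) \<partial>mu) = (\<integral>x. h x \<partial>mu)" using LIMSEQ_unique[OF l1 l2] by simp
 qed
 have rlim: "(%n. c / real (Suc (r n))) \<longlonglongrightarrow> 0" for c
  using LIMSEQ_subseq_LIMSEQ[OF LIMSEQ_Suc[OF lim_const_over_n[of c]] r] by (simp add: comp_def)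
 have upper: "measure mu (bowen y m (ep / 2)) <= D * exp (Ph m y - m * P)" if y: "y \<in> X" and m: "m >= 1" for y m
 proof -
  let ?e = "D * exp (Ph m y - m * P)"
  have e0: "?e >= 0" using D by simp
  \<comment> \<open>An open set between the closed balls of radii \<open>ep / 2\<close> and
    \<open>ep\<close>. In a weak limit the mass of an open set cannot exceed the lower limit of the
    masses, so the upper bound passes to the limit at half the radius.\<close>
  define G where "G = {x \<in> X. \<forall>j\<le>m. rh ((f ^^ j) y) ((f ^^ j) x) < ep}"
  have OX: "G \<subseteq> X" and O1: "G \<subseteq> bowen y m ep" and O2: "bowen y m (ep / 2) \<subseteq> G"
   using eps_pos by (force simp: G_def bowen_def)+
  have cl: "closed (X - G)"
  proof -
   have "closed {x \<in> X. ep <= rh ((f ^^ j) y) ((f ^^ j) x)}" for j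
   proof (rule continuous_on_closed_Collect_le[OF continuous_on_const _ closed_X])
    show "continuous_on X (%x. rh ((f ^^ j) y) ((f ^^ j) x))"
     by (rule continuous_on_compose2[OF continuous_rho[OF funpow_X[OF y]] funpow_cont]) (use funpow_X in auto)
   qed
   then have "closed (\<Union>j\<in>{..m}. {x \<in> X. ep <= rh ((f ^^ j) y) ((f ^^ j) x)})" by (intro closed_UN) auto
   moreover have "X - G = (\<Union>j\<in>{..m}. {x \<in> X. ep <= rh ((f ^^ j) y) ((f ^^ j) x)})" by (auto simp: G_def not_less)
   ultimately show ?thesis by simp
  qed
  have Ob: "G \<in> sets borel"
  proof -
   have "G = X - (X - G)" using OX by blast
   then show ?thesis using cl closed_X by (metis borel_closed sets.Diff)
  qed
  have bound: "measure (nu n) G <= ?e + m / Suc n" for n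
  proof -
   let ?N = "Suc n"
   \<comment> \<open>For the at most \<open>m\<close> starting times with fewer than
     \<open>m\<close> steps left the trivial bound 1 is used; their share \<open>m / Suc n\<close>
     disappears in the limit.\<close>
   have aj: "a ?N G j <= ?e + (if j + m > ?N then 1 else 0)" if "j < ?N" for j
   proof (cases "j + m > ?N")
    case True then show ?thesis using a01(2)[of ?N G j] e0 by simp
   next
    case False
    define k where "k = ?N - (j + m)"
    have N: "?N = j + (m + k)" using False by (simp add: k_def)
    have "(\<Sum>z\<in>Pre ?N x0. indicator G ((f ^^ j) z) * exp (ph ?N z))
      <= (\<Sum>z\<in>Pre ?N x0. indicator (bowen y m ep) ((f ^^ j) z) * exp (ph ?N z))"
     using O1 by (intro sum_mono mult_right_mono) (auto simp: indicator_def)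
    also have "\<dots> <= ?e * L ?N x0"
     unfolding N using up[OF y x0, of m j k] m by (simp add: ph_def)
    finally show ?thesis using False Lpos[of ?N] by (simp add: a_def field_simps)
   qed
   have "(\<Sum>j<?N. a ?N G j) <= (\<Sum>j<?N. ?e + (if j + m > ?N then 1 else 0))"
    using aj by (intro sum_mono) auto
   also have "\<dots> = ?N * ?e + card {j. j < ?N \<and> j + m > ?N}"
    by (simp only: sum.distrib sum_if_card sum_constant card_lessThan mult_1_right)
   also have "card {j. j < ?N \<and> j + m > ?N} <= card {?N - m..<?N}"
    by (intro card_mono) auto
   also have "\<dots> <= m" by simp
   finally have "(\<Sum>j<?N. a ?N G j) <= ?N * ?e + m" by simp
   then have "(\<Sum>j<?N. a ?N G j) / ?N <= (?N * ?e + m) / ?N" by (rule divide_right_mono) simp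
   also have "\<dots> = ?e + m / ?N" by (simp add: field_simps)
   finally show ?thesis unfolding nuA[OF Ob OX] .
  qed
  have "measure mu G <= ?e + e" if e: "e > 0" for e
  proof -
   have "\<forall>\<^sub>F n in sequentially. measure ((nu \<circ> r) n) G > measure mu G - e"
    using nu mu wc cl OX e by (intro wconv_open) (auto simp: comp_def)
   then have "\<forall>\<^sub>F n in sequentially. measure mu G - e <= ?e + m / Suc (r n)"
    by eventually_elim (use bound in \<open>force intro: less_imp_le less_le_trans\<close>)
   moreover have "(%n. ?e + m / Suc (r n)) \<longlonglongrightarrow> ?e + 0" by (intro tendsto_intros rlim)
   ultimately have "measure mu G - e <= ?e + 0"
    by (intro tendsto_lowerbound[of "%n. ?e + m / Suc (r n)" _ sequentially]) auto
   then show ?thesis by simp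
  qed
  then have "measure mu G <= ?e" by (rule field_le_epsilon)
  moreover have "measure mu (bowen y m (ep / 2)) <= measure mu G"
  proof -
   interpret prob_space mu using prob_onD(1)[OF mu] .
   show ?thesis using O2 Ob OX sets_prob_on[OF mu] by (intro finite_measure_mono) auto
  qed
  ultimately show ?thesis by linarith
 qed
 have lower: "\<exists>D'>0. \<forall>m\<ge>1. \<forall>y\<in>X. exp (Ph m y - m * P) <= D' * measure mu (bowen y m s)" if s: "s > 0" for s
 proof -
  define s' where "s' = min s ep"
  have s': "0 < s'" "s' <= ep" "s' <= s" using s eps_pos by (auto simp: s'_def)
  obtain g D' where D': "D' > 0" and lw: "!!y m j k w. y \<in> X ==> w \<in> X ==>
   exp (ph m y - m * P) * L (j + ((m + g) + k)) w
    <= D' * (\<Sum>z\<in>Pre (j + ((m + g) + k)) w. indicator (bowen y m s') ((f ^^ j) z) * exp (ph (j + ((m + g) + k)) z))"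
   using low[OF s'(1,2)] by blast
  have "exp (Ph m y - m * P) <= D' * measure mu (bowen y m s)" if y: "y \<in> X" and m: "m >= 1" for y m
  proof -
   let ?e = "exp (Ph m y - m * P) / D'" and ?B = "bowen y m s'"
   have e0: "?e > 0" using D' by simp
   note B = bowen_closed[OF y, of m s'] bowen_sub[of y m s'] bowen_borel[OF y, of m s']
   have bound: "?e - (m + g) * ?e / Suc n <= measure (nu n) ?B" for n
   proof -
    let ?N = "Suc n"
    have aj: "?e - (if j + (m + g) > ?N then ?e else 0) <= a ?N ?B j" if "j < ?N" for j
    proof (cases "j + (m + g) > ?N")
     case True then show ?thesis using a01(1)[of ?N ?B j] by simp
    next
     case False
     define k where "k = ?N - (j + (m + g))"
     have N: "?N = j + ((m + g) + k)" using False by (simp add: k_def)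
     have "exp (Ph m y - m * P) * L ?N x0 <= D' * (\<Sum>z\<in>Pre ?N x0. indicator ?B ((f ^^ j) z) * exp (ph ?N z))"
      unfolding N using lw[OF y x0, of m j k] m by (simp add: ph_def)
     then show ?thesis using False Lpos[of ?N] D' by (simp add: a_def field_simps)
    qed
    have "?N * ?e - (m + g) * ?e <= ?N * ?e - card {j. j < ?N \<and> j + (m + g) > ?N} * ?e"
    proof -
     have "card {j. j < ?N \<and> j + (m + g) > ?N} <= card {?N - (m + g)..<?N}" by (intro card_mono) auto
     also have "\<dots> <= m + g" by simp
     finally have "real (card {j. j < ?N \<and> j + (m + g) > ?N}) * ?e <= real (m + g) * ?e"
      using e0 by (intro mult_right_mono) auto
     then show ?thesis by simp
    qed
    also have "\<dots> = (\<Sum>j<?N. ?e - (if j + (m + g) > ?N then ?e else 0))"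
     by (simp only: sum_subtractf sum_if_card sum_constant card_lessThan)
    also have "\<dots> <= (\<Sum>j<?N. a ?N ?B j)" using aj by (intro sum_mono) auto
    finally have "(?N * ?e - (m + g) * ?e) / ?N <= (\<Sum>j<?N. a ?N ?B j) / ?N" by (rule divide_right_mono) simp
    moreover have "(?N * ?e - (m + g) * ?e) / ?N = ?e - (m + g) * ?e / ?N"
     by (simp only: diff_divide_distrib) simp
    ultimately show ?thesis unfolding nuA[OF B(3,2)] by linarith
   qed
   have "?e <= measure mu ?B + e" if e: "e > 0" for e
   proof -
    have "\<forall>\<^sub>F n in sequentially. measure ((nu \<circ> r) n) ?B < measure mu ?B + e"
     using nu mu wc B e by (intro wconv_closed) (auto simp: comp_def)
    then have "\<forall>\<^sub>F n in sequentially. ?e - (m + g) * ?e / Suc (r n) <= measure mu ?B + e"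
    proof eventually_elim
     case (elim n)
     then show ?case using bound[of "r n"] by simp
    qed
    moreover have "(%n. ?e - (m + g) * ?e / Suc (r n)) \<longlonglongrightarrow> ?e - 0" by (intro tendsto_intros rlim)
    ultimately have "?e - 0 <= measure mu ?B + e"
     by (intro tendsto_upperbound[of "%n. ?e - (m + g) * ?e / Suc (r n)" _ sequentially]) auto
    then show ?thesis by simp
   qed
   then have "?e <= measure mu ?B" by (rule field_le_epsilon)
   also have "measure mu ?B <= measure mu (bowen y m s)"
   proof -
    interpret prob_space mu using prob_onD(1)[OF mu] .
    show ?thesis using bowen_mono[OF s'(3) order.refl] bowen_sub bowen_borel[OF y] sets_prob_on[OF mu]
     by (intro finite_measure_mono) auto
   qed
   finally show ?thesis using D' by (simp add: field_simps)
  qed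
  then show ?thesis using D' by blast
 qed
 have "D > 0" using D by simp
 then have "gibbs (ep / 2) Ph P mu"
  unfolding gibbs_def using inv upper lower by blast
 then show ?thesis by (rule that)
qed

end

section \<open>Variational principle and uniqueness of equilibrium states\<close>

lemma (in prob_space) prob_vimage_finite:
 assumes X: "simple_function M X" and A: "finite A"
 shows "prob (X -` A \<inter> space M) = (\<Sum>v\<in>A. prob (X -` {v} \<inter> space M))"
proof -
 have ev: "!!v. X -` {v} \<inter> space M \<in> events" using simple_functionD[OF X] by auto
 have "X -` A \<inter> space M = (\<Union>v\<in>A. X -` {v} \<inter> space M)" by auto
 moreover have "prob (\<Union>v\<in>A. X -` {v} \<inter> space M) = (\<Sum>v\<in>A. prob (X -` {v} \<inter> space M))"
  using A ev by (intro finite_measure_finite_Union) (auto simp: disjoint_family_on_def)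
 ultimately show ?thesis by simp
qed

context expanding_map
begin

definition ent :: "'m measure => real" where
 "ent nu = real_of_ereal (metric_entropy f nu)"

lemma entropy_finite:
 assumes nu: "nu \<in> invariant_measures f X"
 shows "metric_entropy f nu = ereal (ent nu)" and "0 <= ent nu"
proof -
 interpret invariant_prob nu f by (rule invariant_prob[OF nu])
 have r: "e0 / 2 > 0" using e0_pos by simp
 obtain E bt where bt: "finite E" "E \<subseteq> X" "!!y. y \<in> X ==> bt y \<in> E" "!!y. y \<in> X ==> y \<in> bowen (bt y) 1 (e0 / 2)"
  "!!v. bt -` {v} \<inter> X \<in> sets borel" using bowen_partition[OF r, of 1] by metis
 have s: "simple_function nu bt"
  using bt by (intro simple_function_prob_on invariant_prob_on[OF nu]) (auto intro: finite_subset[of _ E])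
 have "metric_entropy f nu <= ereal (shannon nu bt / real 1)"
 proof (rule metric_entropy_le_bowen[OF nu s order.refl])
  fix x y and j :: nat assume xy: "x \<in> X" "y \<in> X" "bt x = bt y" and "j < 1"
  have "y \<in> bowen x 1 (e0 / 2 + e0 / 2)"
   using bowen_trans[OF xy(1) bowen_sym[OF _ bt(4)[OF xy(1)]] bt(4)[OF xy(2), folded xy(3)]] bt(2,3) xy by blast
  then show "rh ((f ^^ j) x) ((f ^^ j) y) <= e0" using \<open>j < 1\<close> by (auto simp: bowen_def)
 qed
 moreover have "0 <= metric_entropy f nu" by (rule metric_entropy_nonneg)
 ultimately have "\<bar>metric_entropy f nu\<bar> \<noteq> \<infinity>" by auto
 then show "metric_entropy f nu = ereal (ent nu)" by (simp add: ent_def ereal_real)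
 then show "0 <= ent nu" using \<open>0 <= metric_entropy f nu\<close> by simp
qed

lemma ent_le_bowen:
 fixes bt :: "'m => 'c" and n :: nat
 assumes nu: "nu \<in> invariant_measures f X" and bt: "simple_function nu bt" and n: "n >= 1"
  and sub: "!!x y j. x \<in> X ==> y \<in> X ==> bt x = bt y ==> j < n ==> rh ((f ^^ j) x) ((f ^^ j) y) <= e0"
 shows "n * ent nu <= shannon nu bt"
proof -
 have "metric_entropy f nu <= ereal (shannon nu bt / n)" by (rule metric_entropy_le_bowen[OF nu bt n sub])
 then have "ent nu <= shannon nu bt / n" unfolding entropy_finite(1)[OF nu] by simp
 then show ?thesis using n by (simp add: field_simps)
qed

text \<open>
 The level set \<open>{h > 1}\<close> of the density is invariant modulo null sets: invariance of both measures
 equates the masses of \<open>A - f\<^sup>-\<^sup>1 A\<close> and \<open>f\<^sup>-\<^sup>1 A - A\<close>, while the density is \<open>> 1\<close> on the first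
 and \<open><= 1\<close> on the second.
\<close>

lemma absolutely_continuous_unique:
 assumes nu: "nu \<in> invariant_measures f X" and mu: "mu \<in> invariant_measures f X"
  and ac: "!!A. A \<in> sets mu ==> measure mu A = 0 ==> measure nu A = 0"
  and erg: "!!A. A \<in> sets mu ==> measure mu (f -` A \<inter> X - A) = 0 ==> measure mu A = 0 \<or> measure mu A = 1"
 shows "nu = mu"
proof -
 interpret nu: invariant_prob nu f by (rule invariant_prob[OF nu])
 interpret mu: invariant_prob mu f by (rule invariant_prob[OF mu])
 have sp: "space nu = X" "space mu = X" using prob_onD(2) invariant_prob_on nu mu by auto
 have ss: "sets nu = sets mu" using prob_onD(3) invariant_prob_on nu mu by auto
 have "absolutely_continuous mu nu"
  unfolding absolutely_continuous_def using ac ss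
  by (auto simp: null_sets_def nu.emeasure_eq_measure mu.emeasure_eq_measure)
 then obtain h where h: "h \<in> borel_measurable mu" "density mu h = nu"
  using mu.Radon_Nikodym[of nu] ss by metis
 have em: "emeasure nu B = (\<integral>\<^sup>+x. h x * indicator B x \<partial>mu)" if "B \<in> sets mu" for B
  using emeasure_density[OF h(1) that] h(2) by simp
 define A where "A = {x \<in> X. h x > 1}"
 have A: "A \<in> sets mu"
  using h(1) borel_measurable_less[OF borel_measurable_const h(1), of 1] unfolding A_def by (simp add: sp)
 have fA: "f -` B \<inter> X \<in> sets mu" if "B \<in> sets mu" for B
  using measurable_sets[OF mu.f_meas that] by (simp add: sp)
 have inv: "measure nn (A - f -` A \<inter> X) = measure nn (f -` A \<inter> X - A)" if "invariant_prob nn f" "sets nn = sets mu" "space nn = X" for nn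
 proof -
  interpret invariant_prob nn f by (rule that(1))
  have ev: "A \<in> events" "f -` A \<inter> X \<in> events" using A fA[OF A] that(2) by auto
  have eq: "measure nn (f -` A \<inter> X) = measure nn A"
   using prob_funpow_vimage[OF ev(1), of 1] that(3) by simp
  have "measure nn (A - f -` A \<inter> X) = measure nn A - measure nn (A \<inter> (f -` A \<inter> X))"
   using ev by (intro finite_measure_Diff') 
  moreover have "measure nn (f -` A \<inter> X - A) = measure nn (f -` A \<inter> X) - measure nn (f -` A \<inter> X \<inter> A)"
   using ev by (intro finite_measure_Diff')
  ultimately show ?thesis using eq by (simp add: Int_commute)
 qed
 have strict: "measure mu B = 0" if B: "B \<in> sets mu" "B \<subseteq> A" "measure nu B <= measure mu B" for B
 proof -
  have "emeasure nu B = (\<integral>\<^sup>+x. (indicator B x + (h x - 1) * indicator B x) \<partial>mu)"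
   unfolding em[OF B(1)]
  proof (rule nn_integral_cong)
   fix x
   show "h x * indicator B x = indicator B x + (h x - 1) * indicator B x"
   proof (cases "x \<in> B")
    case True
    then have "h x >= 1" using B(2) by (auto simp: A_def)
    then have "h x = 1 + (h x - 1)" by (simp add: add_diff_inverse_ennreal)
    then show ?thesis using True by simp
   qed simp
  qed
  also have "\<dots> = emeasure mu B + (\<integral>\<^sup>+x. (h x - 1) * indicator B x \<partial>mu)"
   using B(1) h(1) by (subst nn_integral_add) auto
  finally have eq: "emeasure nu B = emeasure mu B + (\<integral>\<^sup>+x. (h x - 1) * indicator B x \<partial>mu)" .
  have "emeasure nu B <= emeasure mu B + 0"
   using B(3) by (simp add: nu.emeasure_eq_measure mu.emeasure_eq_measure)
  then have "emeasure mu B + (\<integral>\<^sup>+x. (h x - 1) * indicator B x \<partial>mu) <= emeasure mu B + 0"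
   unfolding eq .
  then have "(\<integral>\<^sup>+x. (h x - 1) * indicator B x \<partial>mu) = 0"
   unfolding ennreal_add_left_cancel_le by (simp add: mu.emeasure_eq_measure)
  then have "AE x in mu. (h x - 1) * indicator B x = 0"
   using B(1) h(1) by (subst (asm) nn_integral_0_iff_AE) auto
  then have "AE x in mu. x \<notin> B"
  proof eventually_elim
   case (elim x)
   show "x \<notin> B"
   proof
    assume x: "x \<in> B"
    then have "h x > 1" using B(2) by (auto simp: A_def)
    moreover have "h x - 1 = 0" using elim x by simp
    ultimately show False by (simp add: diff_eq_0_iff_ennreal leD)
   qed
  qed
  then have "emeasure mu B = 0" using B(1) by (subst (asm) AE_iff_measurable[OF B(1)]) (use sets.sets_into_space[OF B(1)] in auto)
  then show ?thesis by (simp add: measure_def)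
 qed
 have le: "measure nu B <= measure mu B" if B: "B \<in> sets mu" "B \<inter> A = {}" for B
 proof -
  have "emeasure nu B <= (\<integral>\<^sup>+x. indicator B x \<partial>mu)"
   unfolding em[OF B(1)]
  proof (rule nn_integral_mono)
   fix x assume "x \<in> space mu"
   then show "h x * indicator B x <= indicator B x"
    using B(2) by (cases "x \<in> B") (auto simp: A_def sp not_less)
  qed
  then show ?thesis using B(1) by (simp add: nu.emeasure_eq_measure mu.emeasure_eq_measure)
 qed
 have ev: "A - f -` A \<inter> X \<in> sets mu" "f -` A \<inter> X - A \<in> sets mu" using A fA[OF A] by auto
 have "measure nu (f -` A \<inter> X - A) <= measure mu (f -` A \<inter> X - A)" by (intro le ev) auto
 then have "measure nu (A - f -` A \<inter> X) <= measure mu (A - f -` A \<inter> X)"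
  using inv[OF invariant_prob[OF nu] ss sp(1)] inv[OF invariant_prob[OF mu] refl sp(2)] by simp
 then have "measure mu (A - f -` A \<inter> X) = 0" by (intro strict ev) auto
 then have "measure mu (f -` A \<inter> X - A) = 0" using inv[OF invariant_prob[OF mu] refl sp(2)] by simp
 from erg[OF A this] have A0: "measure mu A = 0"
 proof
  assume 1: "measure mu A = 1"
  then have "measure nu A <= measure mu A" using nu.prob_le_1 by simp
  then show ?thesis using strict[OF A order.refl] by simp
 qed
 \<comment> \<open>\<open>A\<close> is null for both measures, so \<open>nu\<close> is dominated by
   \<open>mu\<close> on every set; applied to complements this gives equality.\<close>
 have le': "measure nu B <= measure mu B" if B: "B \<in> sets mu" for B
 proof -
  have "measure nu B <= measure nu (B - A) + measure nu A"
   using B A ss by (intro order_trans[OF nu.finite_measure_mono[of B "(B - A) \<union> A"] measure_Un_le]) auto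
  also have "measure nu A = 0" using ac[OF A A0] .
  also have "measure nu (B - A) <= measure mu (B - A)" using B A by (intro le) auto
  also have "\<dots> <= measure mu B" using B A by (intro mu.finite_measure_mono) auto
  finally show ?thesis by simp
 qed
 show ?thesis
 proof (rule measure_eqI[OF ss])
  fix B assume "B \<in> sets nu"
  then have B: "B \<in> sets mu" "X - B \<in> sets mu" using ss sets.compl_sets[of B mu] by (auto simp: sp)
  have "1 - measure nu B <= 1 - measure mu B"
   using le'[OF B(2)] nu.prob_compl[of B] mu.prob_compl[of B] B(1) ss by (simp add: sp)
  then show "emeasure nu B = emeasure mu B"
   using le'[OF B(1)] by (simp add: nu.emeasure_eq_measure mu.emeasure_eq_measure)
 qed
qed

end

context potential
begin

section \<open>Mean values, and atoms at the scale of the potential\<close>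

lemma potential_integrable: "prob_on nu ==> n >= 1 ==> integrable nu (Ph n)"
 by (intro continuous_integrable potential_cont)

text \<open>Invariance makes the integrals an almost additive sequence of numbers. The error
  \<open>C\<close> is the same for all invariant measures, which is what makes the mean value weakly
  continuous in \<open>mean_value_tendsto\<close>.\<close>

lemma mean_value_bound:
 assumes nu: "nu \<in> invariant_measures f X"
 shows "(%n. (\<integral>x. Ph n x \<partial>nu) / n) \<longlonglongrightarrow> mean_value Ph nu"
  and "n >= 1 ==> \<bar>(\<integral>x. Ph n x \<partial>nu) - n * mean_value Ph nu\<bar> <= C"
proof -
 note p = invariant_prob_on[OF nu]
 interpret invariant_prob nu f by (rule invariant_prob[OF nu])
 define a where "a n = (\<integral>x. Ph n x \<partial>nu)" for n
 have aa: "\<bar>a (m + n) - a m - a n\<bar> <= C" if mn: "m >= 1" "n >= 1" for m n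
 proof -
  have i: "integrable nu (Ph (m + n))" "integrable nu (Ph m)" "integrable nu (Ph n)"
   using mn by (auto intro: potential_integrable[OF p])
  have i': "integrable nu (%x. Ph n ((f ^^ m) x))" by (rule integrable_funpow[OF i(3)])
  have "a (m + n) - a m - a n = (\<integral>x. Ph (m + n) x - Ph m x - Ph n ((f ^^ m) x) \<partial>nu)"
   unfolding a_def using i i' integral_funpow[OF borel_measurable_integrable[OF i(3)], of m]
   by (simp add: Bochner_Integration.integral_diff)
  also have "\<bar>\<dots>\<bar> <= (\<integral>x. \<bar>Ph (m + n) x - Ph m x - Ph n ((f ^^ m) x)\<bar> \<partial>nu)" by (rule integral_abs_bound)
  also have "\<dots> <= (\<integral>x. C \<partial>nu)"
   using i i' additive[OF mn] prob_onD(2)[OF p] by (intro integral_mono) auto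
  finally show ?thesis by (simp add: prob_space)
 qed
 obtain l where l: "(%n. a n / n) \<longlonglongrightarrow> l" "!!n. n >= 1 ==> \<bar>a n - n * l\<bar> <= C"
  by (rule almost_additive_real[of a C]) (rule aa, assumption+, rule that)
 have "mean_value Ph nu = l" unfolding mean_value_def using l(1) by (simp add: limI a_def)
 then show "(%n. (\<integral>x. Ph n x \<partial>nu) / n) \<longlonglongrightarrow> mean_value Ph nu"
  and "n >= 1 ==> \<bar>(\<integral>x. Ph n x \<partial>nu) - n * mean_value Ph nu\<bar> <= C"
  using l by (auto simp: a_def)
qed

lemma mean_value_abs_le:
 assumes nu: "nu \<in> invariant_measures f X"
 shows "\<bar>mean_value Ph nu\<bar> <= B"
proof (rule LIMSEQ_le_const2[OF tendsto_rabs[OF mean_value_bound(1)[OF nu]]], intro exI allI impI)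
 note p = invariant_prob_on[OF nu]
 interpret prob_space nu using prob_onD(1)[OF p] .
 fix n :: nat assume n: "1 <= n"
 have "\<bar>\<integral>x. Ph n x \<partial>nu\<bar> <= (\<integral>x. \<bar>Ph n x\<bar> \<partial>nu)" by (rule integral_abs_bound)
 also have "\<dots> <= (\<integral>x. n * B \<partial>nu)"
  using potential_integrable[OF p n] bounded[OF n] prob_onD(2)[OF p] by (intro integral_mono) auto
 finally show "\<bar>(\<integral>x. Ph n x \<partial>nu) / n\<bar> <= B" using n by (simp add: prob_space field_simps)
qed

text \<open>\<open>bt\<close> names each piece by a point of it, and the piece lies between the
  Bowen balls of radii \<open>ep / 4\<close> and \<open>ep / 2\<close> around that point;
  \<open>ep / 2\<close> is the scale at which the Gibbs upper bound is available.\<close>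

definition atoms :: "nat => ('m => 'm) => bool" where
 "atoms n bt \<longleftrightarrow> finite (bt ` X) \<and> bt ` X \<subseteq> X \<and> (\<forall>y\<in>X. y \<in> bowen (bt y) n (ep / 2)) \<and>
  (\<forall>x\<in>bt ` X. \<forall>y\<in>bowen x n (ep / 4). bt y = x) \<and> (\<forall>v. bt -` {v} \<inter> X \<in> sets borel)"

lemma atoms_exist: obtains bt where "atoms n bt"
proof -
 have r: "ep / 2 > 0" using eps_pos by simp
 obtain E bt where bt: "finite E" "E \<subseteq> X" "!!y. y \<in> X ==> bt y \<in> E" "!!y. y \<in> X ==> y \<in> bowen (bt y) n (ep / 2)"
  "!!x y. x \<in> E ==> y \<in> bowen x n (ep / 2 / 2) ==> bt y = x" "!!v. bt -` {v} \<inter> X \<in> sets borel"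
  by (rule bowen_partition[OF r, of n], rule that)
 have sub: "bt ` X \<subseteq> E" using bt(3) by blast
 have "atoms n bt"
  unfolding atoms_def
 proof (intro conjI ballI allI)
  show "finite (bt ` X)" using sub bt(1) finite_subset by blast
  show "bt ` X \<subseteq> X" using sub bt(2) by blast
  show "bt y = x" if "x \<in> bt ` X" "y \<in> bowen x n (ep / 4)" for x y
   using bt(5)[of x y] that sub by auto
 qed (use bt in auto)
 then show ?thesis by (rule that)
qed

lemma atomsD:
 assumes "atoms n bt"
 shows "finite (bt ` X)" "bt ` X \<subseteq> X" "y \<in> X ==> y \<in> bowen (bt y) n (ep / 2)"
  "x \<in> bt ` X ==> bowen x n (ep / 4) \<subseteq> bt -` {x} \<inter> X" "bt -` {v} \<inter> X \<in> sets borel"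
  "x \<in> bt ` X ==> bt -` {x} \<inter> X \<subseteq> bowen x n (ep / 2)"
  "prob_on nu ==> simple_function nu bt"
 using assms bowen_sub[of x n "ep / 4"] simple_function_prob_on[of nu bt] unfolding atoms_def by blast+

lemma atoms_close:
 assumes "atoms n bt" "x \<in> X" "y \<in> X" "bt x = bt y"
 shows "y \<in> bowen x n ep" "y \<in> bowen x n e0"
proof -
 have "bt x \<in> X" using atomsD(2)[OF assms(1)] assms(2) by blast
 then have "x \<in> bowen (bt x) n (ep / 2)" "y \<in> bowen (bt x) n (ep / 2)" "bt x \<in> X"
  using atomsD(3)[OF assms(1), of x] atomsD(3)[OF assms(1), of y] assms by auto
 then have "y \<in> bowen x n (ep / 2 + ep / 2)" using assms(2) bowen_trans bowen_sym by blast
 then show "y \<in> bowen x n ep" by simp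
 then show "y \<in> bowen x n e0" using bowen_mono[of ep e0 n n x] eps_e0 eps_pos by auto
qed

text \<open>\<open>A\<close> and its complement contain closed sets that fill almost all mass and
  are a positive distance apart. For large \<open>n\<close> points of one atom are closer than this
  distance, so no atom meets both closed sets. One union of atoms serves both measures, as the
  comparison of null sets requires.\<close>

lemma approx_by_atoms:
 assumes nu: "prob_on nu" and mu: "prob_on mu" and A: "A \<in> sets nu" and e: "(e::real) > 0"
 shows "\<exists>M. \<forall>n\<ge>M. \<forall>bt. atoms n bt --> (\<exists>S. S \<subseteq> bt ` X \<and>
  measure nu (A - (bt -` S \<inter> X)) < e \<and> measure nu ((bt -` S \<inter> X) - A) < e \<and>
  measure mu (A - (bt -` S \<inter> X)) < e \<and> measure mu ((bt -` S \<inter> X) - A) < e)"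
proof -
 have Amu: "A \<in> sets mu" using A prob_onD(3) nu mu by simp
 obtain C1 D1 where 1: "closed C1" "closed D1" "C1 \<subseteq> A" "D1 \<subseteq> X - A" "measure nu (X - (C1 \<union> D1)) < e"
  using regular_sandwich[OF nu A e] by blast
 obtain C2 D2 where 2: "closed C2" "closed D2" "C2 \<subseteq> A" "D2 \<subseteq> X - A" "measure mu (X - (C2 \<union> D2)) < e"
  using regular_sandwich[OF mu Amu e] by blast
 define C where "C = C1 \<union> C2"
 define D where "D = D1 \<union> D2"
 have AX: "A \<subseteq> X" "A \<in> sets borel" using A sets_prob_on[OF nu] by auto
 have CD: "closed C" "closed D" "C \<subseteq> A" "D \<subseteq> X - A" using 1 2 by (auto simp: C_def D_def)
 obtain th where th: "th > 0" "!!v w x y. v \<in> UNIV ==> w \<in> UNIV ==> x \<in> (if v then C else D) ==> y \<in> (if w then C else D) ==> rh x y < th ==> v = w"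
 proof (rule disjoint_closed_gap[of "UNIV :: bool set" "%v. if v then C else D"])
  show "(if v then C else D) \<subseteq> X" for v using CD AX by auto
  show "(if v then C else D) \<inter> (if w then C else D) = {}" if "v \<noteq> w" for v w
   using CD that by (cases v; cases w) auto
 qed (use CD in auto)
 obtain M where M: "!!x y. x \<in> X ==> y \<in> X ==> (!!j. j <= M ==> rh ((f ^^ j) x) ((f ^^ j) y) <= e0) ==> rh x y < th"
  using uniform_expansive[OF th(1)] by blast
 show ?thesis
 proof (intro exI[of _ M] allI impI)
  fix n bt assume n: "M <= n" and at: "atoms n bt"
  note bt = atoms_close(2)[OF at] and fin = atomsD(1)[OF at] and meas = atomsD(5)[OF at]
  have CX: "C \<subseteq> X" using CD AX by blast
  let ?S = "bt ` C"
  let ?U = "bt -` ?S \<inter> X"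
  have finS: "finite ?S" using fin CX by (meson finite_subset image_mono)
  have "C \<subseteq> ?U" using CX by blast
  moreover have "?U \<inter> D = {}"
  proof -
   have False if "x \<in> X" "x \<in> D" "c \<in> C" "bt x = bt c" for x c
   proof -
    have c: "c \<in> X" using that(3) CX by blast
    have "c \<in> bowen x n e0" using bt that c by blast
    then have "rh x c < th" using M[OF that(1) c] n by (auto simp: bowen_def)
    then show False using th(2)[of False True x c] that by simp
   qed
   then show ?thesis by blast
  qed
  ultimately have sub: "A - ?U \<subseteq> X - (C \<union> D)" "?U - A \<subseteq> X - (C \<union> D)" using AX CD by blast+
  have Ub: "?U \<in> sets borel"
  proof -
   have "?U = (\<Union>v\<in>?S. bt -` {v} \<inter> X)" by blast
   also have "\<dots> \<in> sets borel" using finS meas by (intro sets.finite_UN) auto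
   finally show ?thesis .
  qed
  have small: "measure nn (A - ?U) < e \<and> measure nn (?U - A) < e"
   if nn: "prob_on nn" and sm: "measure nn (X - (C \<union> D)) < e" for nn
  proof -
   interpret prob_space nn using prob_onD(1)[OF nn] .
   have ev: "X - (C \<union> D) \<in> events"
    using sets_prob_on[OF nn] CD closed_X by auto
   have "measure nn (A - ?U) <= measure nn (X - (C \<union> D))" by (rule finite_measure_mono[OF sub(1) ev])
   moreover have "measure nn (?U - A) <= measure nn (X - (C \<union> D))" by (rule finite_measure_mono[OF sub(2) ev])
   ultimately show ?thesis using sm by linarith
  qed
  have "measure nu (X - (C \<union> D)) < e"
  proof -
   interpret prob_space nu using prob_onD(1)[OF nu] .
   have "X - (C1 \<union> D1) \<in> events" using sets_prob_on[OF nu] 1 closed_X by auto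
   then have "measure nu (X - (C \<union> D)) <= measure nu (X - (C1 \<union> D1))"
    by (intro finite_measure_mono) (auto simp: C_def D_def)
   then show ?thesis using 1 by linarith
  qed
  moreover have "measure mu (X - (C \<union> D)) < e"
  proof -
   interpret prob_space mu using prob_onD(1)[OF mu] .
   have "X - (C2 \<union> D2) \<in> events" using sets_prob_on[OF mu] 2 closed_X by auto
   then have "measure mu (X - (C \<union> D)) <= measure mu (X - (C2 \<union> D2))"
    by (intro finite_measure_mono) (auto simp: C_def D_def)
   then show ?thesis using 2 by linarith
  qed
  ultimately show "\<exists>S. S \<subseteq> bt ` X \<and>
   measure nu (A - (bt -` S \<inter> X)) < e \<and> measure nu ((bt -` S \<inter> X) - A) < e \<and>
   measure mu (A - (bt -` S \<inter> X)) < e \<and> measure mu ((bt -` S \<inter> X) - A) < e"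
   using small[OF nu] small[OF mu] image_mono[OF CX, of bt] by (intro exI[of _ ?S]) blast
 qed
qed

lemma atom_dist:
 assumes "atoms n bt" "n >= 1" "y \<in> X"
 shows "\<bar>Ph n (bt y) - Ph n y\<bar> <= K"
proof (rule distort[OF assms(2)])
 show "bt y \<in> X" using atomsD(2)[OF assms(1)] assms(3) by blast
 show "y \<in> bowen (bt y) n ep"
  using atomsD(3)[OF assms(1,3)] bowen_mono[of "ep / 2" ep n n "bt y"] eps_pos by auto
qed

end

section \<open>Variational principle, ergodicity and uniqueness for a Gibbs measure\<close>

locale gibbs_measure = potential X rh f e0 Ph ep C K B
 for X :: "'m::{t2_space, second_countable_topology} set" and rh f e0 Ph ep C K B +
 fixes P :: real and mu :: "'m measure"
 assumes gibbs: "gibbs (ep / 2) Ph P mu"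
begin

lemma mu_inv: "mu \<in> invariant_measures f X"
 using gibbs by (simp add: gibbs_def)

lemmas mu_prob_on = invariant_prob_on[OF mu_inv]

sublocale mu: invariant_prob mu f
 by (rule invariant_prob[OF mu_inv])

lemma gibbs_upper: obtains D where "D > 0" "!!n x. n >= 1 ==> x \<in> X ==> measure mu (bowen x n (ep / 2)) <= D * exp (Ph n x - n * P)"
 using gibbs unfolding gibbs_def by blast

lemma gibbs_lower:
 assumes "r > 0"
 obtains D where "D > 0" "!!n x. n >= 1 ==> x \<in> X ==> exp (Ph n x - n * P) <= D * measure mu (bowen x n r)"
proof -
 have "\<forall>r>0. \<exists>D>0. \<forall>n\<ge>1. \<forall>x\<in>X. exp (Ph n x - n * P) <= D * measure mu (bowen x n r)"
  using gibbs unfolding gibbs_def by (elim conjE)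
 then obtain D where "D > 0" "\<forall>n\<ge>1. \<forall>x\<in>X. exp (Ph n x - n * P) <= D * measure mu (bowen x n r)"
  using assms by blast
 then show ?thesis by (intro that[of D]) auto
qed

lemma atom_lower: obtains D where "D > 0"
 "!!(n::nat) bt v. n >= 1 ==> atoms n bt ==> v \<in> bt ` X ==> exp (Ph n v - n * P) <= D * measure mu (bt -` {v} \<inter> X)"
proof -
 have "ep / 4 > 0" using eps_pos by simp
 then obtain D where D: "D > 0" "!!n x. n >= 1 ==> x \<in> X ==> exp (Ph n x - n * P) <= D * measure mu (bowen x n (ep / 4))"
  using gibbs_lower by blast
 have "exp (Ph n v - n * P) <= D * measure mu (bt -` {v} \<inter> X)"
  if "n >= 1" "atoms n bt" "v \<in> bt ` X" for n bt v
 proof -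
  have "measure mu (bowen v n (ep / 4)) <= measure mu (bt -` {v} \<inter> X)"
   using atomsD(4)[OF that(2,3)] atomsD(5)[OF that(2)] sets_prob_on[OF mu_prob_on]
   by (intro mu.finite_measure_mono) auto
  then have "D * measure mu (bowen v n (ep / 4)) <= D * measure mu (bt -` {v} \<inter> X)"
   using D(1) by (intro mult_left_mono) auto
  moreover have "v \<in> X" using atomsD(2)[OF that(2)] that(3) by blast
  ultimately show ?thesis using D(2)[OF that(1), of v] by linarith
 qed
 then show ?thesis using D(1) that by blast
qed

lemma atom_upper: obtains D where "D > 0"
 "!!(n::nat) bt v. n >= 1 ==> atoms n bt ==> v \<in> bt ` X ==> measure mu (bt -` {v} \<inter> X) <= D * exp (Ph n v - n * P)"
proof -
 obtain D where D: "D > 0" "!!n x. n >= 1 ==> x \<in> X ==> measure mu (bowen x n (ep / 2)) <= D * exp (Ph n x - n * P)"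
  using gibbs_upper by blast
 have "measure mu (bt -` {v} \<inter> X) <= D * exp (Ph n v - n * P)"
  if "n >= 1" "atoms n bt" "v \<in> bt ` X" for n bt v
 proof -
  have v: "v \<in> X" using atomsD(2)[OF that(2)] that(3) by blast
  have "measure mu (bt -` {v} \<inter> X) <= measure mu (bowen v n (ep / 2))"
   using atomsD(6)[OF that(2,3)] bowen_borel[OF v] bowen_sub sets_prob_on[OF mu_prob_on]
   by (intro mu.finite_measure_mono) auto
  then show ?thesis using D(2)[OF that(1) v] by linarith
 qed
 then show ?thesis using D(1) that by blast
qed

text \<open>
 The left-hand side is at most a constant minus the relative entropy of \<open>nu\<close> with respect to \<open>mu\<close> on
 the atoms, whose divergence on sets that are small for \<open>mu\<close> but not for \<open>nu\<close> is recorded.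
\<close>

lemma entropy_deficit:
 obtains c where "c >= 0" "!!(n::nat) bt nu S dl. n >= 1 ==> atoms n bt ==> nu \<in> invariant_measures f X ==> 0 < dl ==>
  measure mu (bt -` S \<inter> X) <= dl ==>
  n * (ent nu + mean_value Ph nu - P) <= c + measure nu (bt -` S \<inter> X) * ln dl"
proof -
 obtain D where D: "D > 0" "!!(n::nat) bt v. n >= 1 ==> atoms n bt ==> v \<in> bt ` X ==> exp (Ph n v - n * P) <= D * measure mu (bt -` {v} \<inter> X)"
  using atom_lower by metis
 \<comment> \<open>\<open>ln D\<close> comes from the Gibbs lower bound on atoms, \<open>K\<close>
   from replacing a point by the name of its atom, \<open>C\<close> from replacing the integral of
   \<open>Ph n\<close> by \<open>n\<close> times the mean value, and \<open>1\<close> from the total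
   weight 2 in the relative entropy estimate.\<close>
 define c where "c = max 0 (ln D) + K + C + 1"
 have c: "c >= 0" using K_nonneg C_nonneg by (simp add: c_def)
 have "n * (ent nu + mean_value Ph nu - P) <= c + measure nu (bt -` S \<inter> X) * ln dl"
  if n: "n >= 1" and bt: "atoms n bt" and nu: "nu \<in> invariant_measures f X" and dl: "0 < dl"
   and S: "measure mu (bt -` S \<inter> X) <= dl" for n bt nu S dl
 proof -
  note p = invariant_prob_on[OF nu]
  interpret nu: invariant_prob nu f by (rule invariant_prob[OF nu])
  have sp: "space nu = X" "space mu = X" using prob_onD(2) p mu_prob_on by auto
  have snu: "simple_function nu bt" and smu: "simple_function mu bt" using atomsD(7)[OF bt] p mu_prob_on by auto
  let ?R = "bt ` X"
  let ?e = "%v. measure nu (bt -` {v} \<inter> X)" and ?m = "%v. measure mu (bt -` {v} \<inter> X)"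
  have finR: "finite ?R" by (rule atomsD(1)[OF bt])
  have mpos: "?m v > 0" if "v \<in> ?R" for v
  proof -
   have "0 < exp (Ph n v - n * P)" by simp
   also have "\<dots> <= D * ?m v" by (rule D(2)[OF n bt that])
   finally show ?thesis using D(1) by (simp add: zero_less_mult_iff)
  qed
  have vim: "measure nn (bt -` S \<inter> X) = (\<Sum>v\<in>?R \<inter> S. measure nn (bt -` {v} \<inter> X))"
   if "prob_space nn" "simple_function nn bt" "space nn = X" for nn
  proof -
   have "bt -` S \<inter> X = bt -` (?R \<inter> S) \<inter> X" by blast
   then show ?thesis
    using prob_space.prob_vimage_finite[OF that(1,2), of "?R \<inter> S"] finR that(3) by simp
  qed
  \<comment> \<open>The weights on \<open>S\<close> are enlarged by \<open>inverse dl\<close>; as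
    \<open>S\<close> has \<open>mu\<close>-mass at most \<open>dl\<close>, they still sum to at most
    1 there. The enlargement produces the term with \<open>ln dl\<close>.\<close>
  define q where "q v = ?m v * (if v \<in> S then inverse dl else 1)" for v
  have q: "q v > 0" if "v \<in> ?R" for v using mpos[OF that] dl by (simp add: q_def)
  have "shannon nu bt + (\<Sum>v\<in>?R. ?e v * ln (q v)) <= (\<Sum>v\<in>?R. q v) - 1"
   using nu.shannon_gibbs_weighted[OF snu, of q] q by (simp add: sp)
  also have "(\<Sum>v\<in>?R. q v) <= 2"
  proof -
   have "(\<Sum>v\<in>?R. q v) <= (\<Sum>v\<in>?R. ?m v + (if v \<in> S then ?m v * inverse dl else 0))"
    by (intro sum_mono) (auto simp: q_def)
   also have "\<dots> = (\<Sum>v\<in>?R. ?m v) + (\<Sum>v\<in>?R \<inter> S. ?m v) * inverse dl"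
    using finR by (simp add: sum.distrib sum.If_cases Int_def sum_distrib_right)
   also have "(\<Sum>v\<in>?R. ?m v) = 1" using mu.sum_prob_simple[OF smu] by (simp add: sp)
   also have "(\<Sum>v\<in>?R \<inter> S. ?m v) = measure mu (bt -` S \<inter> X)"
    using vim[OF prob_onD(1)[OF mu_prob_on] smu sp(2)] by simp
   also have "\<dots> * inverse dl <= 1" using S dl by (simp add: field_simps)
   finally show ?thesis by simp
  qed
  finally have 1: "shannon nu bt + (\<Sum>v\<in>?R. ?e v * ln (q v)) <= 1" by simp
  have "(\<Sum>v\<in>?R. ?e v * ln (q v)) = (\<Sum>v\<in>?R. ?e v * ln (?m v) - (if v \<in> S then ?e v * ln dl else 0))"
  proof (intro sum.cong refl)
   fix v assume "v \<in> ?R"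
   then show "?e v * ln (q v) = ?e v * ln (?m v) - (if v \<in> S then ?e v * ln dl else 0)"
    using mpos[of v] dl by (simp add: q_def ln_mult ln_inverse algebra_simps)
  qed
  also have "\<dots> = (\<Sum>v\<in>?R. ?e v * ln (?m v)) - (\<Sum>v\<in>?R \<inter> S. ?e v) * ln dl"
   using finR by (simp add: sum_subtractf sum.If_cases Int_def sum_distrib_right)
  also have "(\<Sum>v\<in>?R \<inter> S. ?e v) = measure nu (bt -` S \<inter> X)"
   using vim[OF prob_onD(1)[OF p] snu sp(1)] by simp
  finally have 2: "(\<Sum>v\<in>?R. ?e v * ln (q v)) = (\<Sum>v\<in>?R. ?e v * ln (?m v)) - measure nu (bt -` S \<inter> X) * ln dl" .
  have e1: "(\<Sum>v\<in>?R. ?e v) = 1" using nu.sum_prob_simple[OF snu] by (simp add: sp)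
  have "(\<integral>x. Ph n x \<partial>nu) <= (\<integral>x. Ph n (bt x) + K \<partial>nu)"
  proof (rule integral_mono[OF potential_integrable[OF p n]])
   show "integrable nu (%x. Ph n (bt x) + K)" using nu.expectation_simple(2)[OF snu, of "%v. Ph n v + K"] .
   show "Ph n x <= Ph n (bt x) + K" if "x \<in> space nu" for x using atom_dist[OF bt n, of x] that sp by auto
  qed
  also have "\<dots> = (\<Sum>v\<in>?R. ?e v * (Ph n v + K))"
   using nu.expectation_simple(1)[OF snu, of "%v. Ph n v + K"] by (simp add: sp)
  also have "\<dots> <= (\<Sum>v\<in>?R. ?e v * (ln (?m v) + n * P + max 0 (ln D) + K))"
  proof (intro sum_mono mult_left_mono)
   fix v assume v: "v \<in> ?R"
   have "Ph n v - n * P = ln (exp (Ph n v - n * P))" by simp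
   also have "\<dots> <= ln (D * ?m v)" using D(2)[OF n bt v] by (intro ln_mono) auto
   also have "\<dots> = ln D + ln (?m v)" using D(1) mpos[OF v] by (simp add: ln_mult)
   finally show "Ph n v + K <= ln (?m v) + n * P + max 0 (ln D) + K" by simp
  qed simp
  also have "\<dots> = (\<Sum>v\<in>?R. ?e v * ln (?m v)) + (\<Sum>v\<in>?R. ?e v) * (n * P + max 0 (ln D) + K)"
   by (simp add: distrib_left sum.distrib sum_distrib_right)
  finally have 3: "(\<integral>x. Ph n x \<partial>nu) <= (\<Sum>v\<in>?R. ?e v * ln (?m v)) + n * P + max 0 (ln D) + K"
   using e1 by simp
  have 4: "n * ent nu <= shannon nu bt"
  proof (rule ent_le_bowen[OF nu snu n])
   show "rh ((f ^^ j) x) ((f ^^ j) y) <= e0" if "x \<in> X" "y \<in> X" "bt x = bt y" "j < n" for x y j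
    using atoms_close(2)[OF bt that(1-3)] that(4) by (auto simp: bowen_def)
  qed
  have 5: "n * mean_value Ph nu <= (\<integral>x. Ph n x \<partial>nu) + C" using mean_value_bound(2)[OF nu n] by linarith
  have "n * (ent nu + mean_value Ph nu - P) = n * ent nu + n * mean_value Ph nu - n * P" by (simp add: algebra_simps)
  then show ?thesis using 1 2 3 4 5 unfolding c_def by linarith
 qed
 with c show ?thesis by (rule that)
qed

text \<open>For empty \<open>S\<close> the bound of \<open>entropy_deficit\<close> is a constant;
  dividing by \<open>n\<close> gives the inequality of the variational principle.\<close>

lemma free_energy_le:
 assumes nu: "nu \<in> invariant_measures f X"
 shows "ent nu + mean_value Ph nu <= P"
proof -
 obtain c where c: "c >= 0" "!!(n::nat) bt nu S dl. n >= 1 ==> atoms n bt ==> nu \<in> invariant_measures f X ==> 0 < dl ==>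
  measure mu (bt -` S \<inter> X) <= dl ==>
  n * (ent nu + mean_value Ph nu - P) <= c + measure nu (bt -` S \<inter> X) * ln dl"
  by (rule entropy_deficit, rule that)
 have "ent nu + mean_value Ph nu - P <= c / n" if n: "n >= 1" for n :: nat
 proof -
  obtain bt where bt: "atoms n bt" by (rule atoms_exist)
  have "n * (ent nu + mean_value Ph nu - P) <= c" using c(2)[OF n bt nu, of 1 "{}"] by simp
  then show ?thesis using n by (simp add: field_simps)
 qed
 then have "ent nu + mean_value Ph nu - P <= 0" by (intro LIMSEQ_le_const[OF lim_const_over_n[of c]]) auto
 then show ?thesis by simp
qed

text \<open>A lower bound for the entropy needs joins of one fixed partition. Its pieces are small
  enough for the itineraries of length \<open>n + 1\<close> to lie in Bowen balls of radius
  \<open>ep / 2\<close>, where the Gibbs upper bound makes them light; their entropy is then at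
  least \<open>n * P\<close> minus the integral of \<open>Ph n\<close>, up to a constant.\<close>

lemma free_energy_mu: "ent mu + mean_value Ph mu = P"
proof (rule antisym[OF free_energy_le[OF mu_inv]])
 obtain D where D: "D > 0" "!!n x. n >= 1 ==> x \<in> X ==> measure mu (bowen x n (ep / 2)) <= D * exp (Ph n x - n * P)"
  using gibbs_upper by blast
 have r: "ep / 4 > 0" using eps_pos by simp
 obtain E xx where xx: "finite E" "E \<subseteq> X" "!!y. y \<in> X ==> xx y \<in> E" "!!y. y \<in> X ==> y \<in> bowen (xx y) 0 (ep / 4)"
  "!!v. xx -` {v} \<inter> X \<in> sets borel" using bowen_partition[OF r, of 0] by metis
 have s: "simple_function mu xx"
  using xx by (intro simple_function_prob_on mu_prob_on) (auto intro: finite_subset[of _ E])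
 have sp: "space mu = X" by (rule prob_onD(2)[OF mu_prob_on])
 have close: "rh x y <= ep / 2" if "x \<in> X" "y \<in> X" "xx x = xx y" for x y
 proof -
  have "xx x \<in> X" using xx(2,3) that by blast
  then have "y \<in> bowen x 0 (ep / 4 + ep / 4)"
   using bowen_trans[OF that(1) bowen_sym[OF _ xx(4)[OF that(1)]] xx(4)[OF that(2), folded that(3)]] by blast
  then show ?thesis by (auto simp: bowen_def)
 qed
 have main: "shannon mu (itinerary f xx (Suc n)) >= n * (P - mean_value Ph mu) - (ln D + K + C)" if n: "n >= 1" for n
 proof -
  let ?I = "itinerary f xx (Suc n)"
  have sI: "simple_function mu ?I" by (rule mu.simple_itinerary[OF s])
  have sub: "?I -` {?I x} \<inter> X \<subseteq> bowen x n (ep / 2)" if x: "x \<in> X" for x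
  proof
   fix y assume y: "y \<in> ?I -` {?I x} \<inter> X"
   have "xx ((f ^^ j) x) = xx ((f ^^ j) y)" if "j <= n" for j
   proof -
    have "?I y ! j = ?I x ! j" using y by simp
    then show ?thesis using that by (simp add: itinerary_def del: upt_Suc)
   qed
   then show "y \<in> bowen x n (ep / 2)" using close[OF funpow_X[OF x] funpow_X] y by (auto simp: bowen_def)
  qed
  define rep where "rep l = (SOME x. x \<in> X \<and> ?I x = l)" for l
  have rep: "rep (?I x) \<in> X" "?I (rep (?I x)) = ?I x" if "x \<in> X" for x
   using someI[of "%y. y \<in> X \<and> ?I y = ?I x" x] that unfolding rep_def by auto
  have repd: "\<bar>Ph n (rep (?I x)) - Ph n x\<bar> <= K" if x: "x \<in> X" for x
  proof (rule distort[OF n rep(1)[OF x]])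
   have "x \<in> bowen (rep (?I x)) n (ep / 2)" using sub[OF rep(1)[OF x]] rep(2)[OF x] x by auto
   then show "x \<in> bowen (rep (?I x)) n ep" using bowen_mono[of "ep / 2" ep n n] eps_pos by auto
  qed
  let ?p = "%l. measure mu (?I -` {l} \<inter> X)"
  have "(\<Sum>l\<in>?I ` X. ?p l * (n * P - ln D - Ph n (rep l))) <= (\<Sum>l\<in>?I ` X. - ?p l * ln (?p l))"
  proof (rule sum_mono)
   fix l assume "l \<in> ?I ` X"
   then obtain x where x: "x \<in> X" "l = ?I x" by blast
   show "?p l * (n * P - ln D - Ph n (rep l)) <= - ?p l * ln (?p l)"
   proof (cases "?p l = 0")
    case False
    then have p: "?p l > 0" by (simp add: zero_less_measure_iff)
    have "?p l <= measure mu (bowen (rep l) n (ep / 2))"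
     using sub[OF rep(1)[OF x(1)]] rep(2)[OF x(1)] x(2) bowen_borel[OF rep(1)[OF x(1)]] bowen_sub sets_prob_on[OF mu_prob_on]
     by (intro mu.finite_measure_mono) auto
    also have "\<dots> <= D * exp (Ph n (rep l) - n * P)" using D(2)[OF n rep(1)[OF x(1)]] x(2) by simp
    finally have "ln (?p l) <= ln (D * exp (Ph n (rep l) - n * P))" using p by (intro ln_mono) auto
    also have "\<dots> = ln D + (Ph n (rep l) - n * P)" using D(1) by (simp add: ln_mult)
    finally have "n * P - ln D - Ph n (rep l) <= - ln (?p l)" by simp
    then have "?p l * (n * P - ln D - Ph n (rep l)) <= ?p l * - ln (?p l)"
     using p by (intro mult_left_mono) auto
    then show ?thesis by simp
   qed simp
  qed
  also have "\<dots> = shannon mu ?I" by (simp add: shannon_def sp)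
  finally have "shannon mu ?I >= (\<integral>x. n * P - ln D - Ph n (rep (?I x)) \<partial>mu)"
   using mu.expectation_simple(1)[OF sI, of "%l. n * P - ln D - Ph n (rep l)"] by (simp add: sp)
  moreover have "(\<integral>x. n * P - ln D - K - Ph n x \<partial>mu) <= (\<integral>x. n * P - ln D - Ph n (rep (?I x)) \<partial>mu)"
  proof (rule integral_mono)
   show "integrable mu (%x. n * P - ln D - K - Ph n x)" using potential_integrable[OF mu_prob_on n] by simp
   show "integrable mu (%x. n * P - ln D - Ph n (rep (?I x)))"
    using mu.expectation_simple(2)[OF sI, of "%l. n * P - ln D - Ph n (rep l)"] .
   show "n * P - ln D - K - Ph n x <= n * P - ln D - Ph n (rep (?I x))" if "x \<in> space mu" for x
    using repd[of x] that sp by auto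
  qed
  moreover have "(\<integral>x. n * P - ln D - K - Ph n x \<partial>mu) = n * P - ln D - K - (\<integral>x. Ph n x \<partial>mu)"
   using potential_integrable[OF mu_prob_on n] by (simp add: mu.prob_space)
  moreover have "(\<integral>x. Ph n x \<partial>mu) <= n * mean_value Ph mu + C" using mean_value_bound(2)[OF mu_inv n] by linarith
  ultimately show ?thesis by (simp add: algebra_simps)
 qed
 let ?a = "P - mean_value Ph mu" and ?b = "ln D + K + C"
 have l1: "(%n. shannon mu (itinerary f xx (Suc n)) / real (Suc n)) \<longlonglongrightarrow> mu.ks_rate xx"
  by (rule LIMSEQ_Suc[OF mu.ks_rate_tendsto[OF s]])
 have l2: "(%n. ?a - (?a + ?b) / real (Suc n)) \<longlonglongrightarrow> ?a - 0"
  by (intro tendsto_diff tendsto_const LIMSEQ_Suc[OF lim_const_over_n])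
 have "?a - 0 <= mu.ks_rate xx"
 proof (rule LIMSEQ_le[OF l2 l1], intro exI allI impI)
  fix n :: nat assume n: "1 <= n"
  have "?a - (?a + ?b) / real (Suc n) = (n * ?a - ?b) / real (Suc n)" by (simp add: field_simps)
  also have "\<dots> <= shannon mu (itinerary f xx (Suc n)) / real (Suc n)"
   using main[OF n] by (intro divide_right_mono) auto
  finally show "?a - (?a + ?b) / real (Suc n) <= shannon mu (itinerary f xx (Suc n)) / real (Suc n)" .
 qed
 moreover have "mu.ks_rate xx <= ent mu"
  using mu.ks_rate_le_metric_entropy[OF s] unfolding entropy_finite(1)[OF mu_inv] by simp
 ultimately show "P <= ent mu + mean_value Ph mu" by linarith
qed

theorem Ptop_eq: "Ptop f X Ph = ereal P"
 unfolding Ptop_def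
proof (rule antisym)
 show "(SUP nu\<in>invariant_measures f X. metric_entropy f nu + ereal (mean_value Ph nu)) <= ereal P"
  using free_energy_le by (intro SUP_least) (simp add: entropy_finite(1))
 show "ereal P <= (SUP nu\<in>invariant_measures f X. metric_entropy f nu + ereal (mean_value Ph nu))"
  using free_energy_mu by (intro SUP_upper2[OF mu_inv]) (simp add: entropy_finite(1)[OF mu_inv])
qed

text \<open>Specification supplies an orbit that follows \<open>v\<close> for \<open>n\<close> steps
  and reaches \<open>w\<close> after the gap. The Bowen ball of radius \<open>ep / 8\<close> around
  its start lies in the intersection for the atoms of \<open>v\<close> and \<open>w\<close>, and by
  the Gibbs bounds its mass is at least a constant times the product of their masses, uniformly in
  \<open>n\<close> and \<open>N\<close>. Summation extends this to unions.\<close>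

lemma quasi_mixing:
 obtains c g where "c > 0" "!!n N bt ga S T. n >= 1 ==> N >= 1 ==> atoms n bt ==> atoms N ga ==> S \<subseteq> bt ` X ==> T \<subseteq> ga ` X ==>
  c * measure mu (bt -` S \<inter> X) * measure mu (ga -` T \<inter> X) <= measure mu ((bt -` S \<inter> X) \<inter> ((f ^^ (n + g)) -` (ga -` T \<inter> X) \<inter> X))"
proof -
 have e8: "ep / 8 > 0" using eps_pos by simp
 obtain D where D: "D > 0" "!!n x. n >= 1 ==> x \<in> X ==> exp (Ph n x - n * P) <= D * measure mu (bowen x n (ep / 8))"
  using gibbs_lower[OF e8] by blast
 obtain D1 where D1: "D1 > 0" "!!(n::nat) bt v. n >= 1 ==> atoms n bt ==> v \<in> bt ` X ==> measure mu (bt -` {v} \<inter> X) <= D1 * exp (Ph n v - n * P)"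
  by (rule atom_upper, rule that)
 obtain g where g: "!!x y n. x \<in> X ==> y \<in> X ==>
  \<exists>z\<in>X. (f ^^ (n + g)) z = y \<and> (\<forall>j\<le>n. rh ((f ^^ j) x) ((f ^^ j) z) < ep / 8)"
  using orbit_specification[OF e8] by blast
 define a where "a = exp (- K - g * B - 2 * C - g * P)"
 define c where "c = a / (D * D1 * D1)"
 have a: "a > 0" by (simp add: a_def)
 have c: "c > 0" using a D D1 by (simp add: c_def)
 have sp: "space mu = X" by (rule prob_onD(2)[OF mu_prob_on])
 have "c * measure mu (bt -` S \<inter> X) * measure mu (ga -` T \<inter> X)
   <= measure mu ((bt -` S \<inter> X) \<inter> ((f ^^ (n + g)) -` (ga -` T \<inter> X) \<inter> X))"
  if n: "n >= 1" and N: "N >= 1" and bt: "atoms n bt" and ga: "atoms N ga" and S: "S \<subseteq> bt ` X" and T: "T \<subseteq> ga ` X"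
  for n N bt ga S T
 proof -
  let ?m = "n + g"
  have s: "simple_function mu bt" "simple_function mu ga" using atomsD(7) bt ga mu_prob_on by auto
  let ?Y = "%x. (bt x, ga ((f ^^ ?m) x))"
  have sY: "simple_function mu ?Y" by (intro simple_function_Pair s(1) mu.simple_funpow s(2))
  have fin: "finite S" "finite T" using atomsD(1) bt ga S T finite_subset by metis+
  have pair: "c * measure mu (bt -` {v} \<inter> X) * measure mu (ga -` {w} \<inter> X) <= measure mu (?Y -` {(v, w)} \<inter> X)"
   if v: "v \<in> S" and w: "w \<in> T" for v w
  proof -
   have vw: "v \<in> bt ` X" "w \<in> ga ` X" "v \<in> X" "w \<in> X" using v w S T atomsD(2) bt ga by blast+
   obtain z where z: "z \<in> X" "(f ^^ ?m) z = w" "\<forall>j\<le>n. rh ((f ^^ j) v) ((f ^^ j) z) < ep / 8" using g[OF vw(3,4)] by blast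
   have zb: "z \<in> bowen v n (ep / 8)" using z by (auto simp: bowen_def intro: less_imp_le)
   have sub: "bowen z (?m + N) (ep / 8) \<subseteq> ?Y -` {(v, w)} \<inter> X"
   proof
    fix y assume y: "y \<in> bowen z (?m + N) (ep / 8)"
    have yX: "y \<in> X" using y bowen_sub by blast
    have "y \<in> bowen z n (ep / 8)" using y bowen_mono[of "ep / 8" "ep / 8" n "?m + N" z] by auto
    then have "y \<in> bowen v n (ep / 8 + ep / 8)" using bowen_trans[OF vw(3) zb] by blast
    then have 1: "bt y = v" using atomsD(4)[OF bt vw(1)] by auto
    have "(f ^^ ?m) y \<in> bowen w N (ep / 8)"
    proof -
     have "rh ((f ^^ j) w) ((f ^^ j) ((f ^^ ?m) y)) <= ep / 8" if "j <= N" for j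
     proof -
      have e: "(f ^^ j) ((f ^^ ?m) u) = (f ^^ (?m + j)) u" for u
       by (metis add.commute comp_apply funpow_add)
      have "rh ((f ^^ (?m + j)) z) ((f ^^ (?m + j)) y) <= ep / 8" using y that by (auto simp: bowen_def)
      then show ?thesis using e[of y] e[of z] z(2) by simp
     qed
     then show ?thesis using funpow_X[OF yX] by (auto simp: bowen_def)
    qed
    then have "(f ^^ ?m) y \<in> bowen w N (ep / 4)" using bowen_mono[of "ep / 8" "ep / 4" N N w] eps_pos by auto
    then have "ga ((f ^^ ?m) y) = w" using atomsD(4)[OF ga vw(2)] by auto
    then show "y \<in> ?Y -` {(v, w)} \<inter> X" using 1 yX by simp
   qed
   have ev: "?Y -` {(v, w)} \<inter> X \<in> mu.events" using simple_functionD(2)[OF sY] by (simp add: sp)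
   have low: "(Ph n v - n * P) + (Ph N w - N * P) + (- K - g * B - 2 * C - g * P) <= Ph (?m + N) z - (?m + N) * P"
   proof -
    have "\<bar>Ph n v - Ph n z\<bar> <= K"
    proof (rule distort[OF n vw(3)])
     show "z \<in> bowen v n ep" using zb bowen_mono[of "ep / 8" ep n n v] eps_pos by auto
    qed
    moreover have "\<bar>Ph (?m + N) z - Ph ?m z - Ph N w\<bar> <= C" using additive[of ?m N z] n N z by simp
    moreover have "\<bar>Ph ?m z - Ph n z - ph g ((f ^^ n) z)\<bar> <= C" using ph_add[OF z(1), of n g] n by (simp add: ph_def)
    moreover have "\<bar>ph g ((f ^^ n) z)\<bar> <= g * B" by (rule ph_bound[OF funpow_X[OF z(1)]])
    ultimately show ?thesis by (simp add: algebra_simps) 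
   qed
   have "c * measure mu (bt -` {v} \<inter> X) * measure mu (ga -` {w} \<inter> X)
     <= c * (D1 * exp (Ph n v - n * P)) * (D1 * exp (Ph N w - N * P))"
    using c D1(1) D1(2)[OF n bt vw(1)] D1(2)[OF N ga vw(2)] by (intro mult_mono) auto
   also have "\<dots> = exp ((Ph n v - n * P) + (Ph N w - N * P) + (- K - g * B - 2 * C - g * P)) / D"
    using D(1) D1(1) by (simp add: c_def a_def exp_add)
   also have "\<dots> <= exp (Ph (?m + N) z - (?m + N) * P) / D" using low D(1) by (intro divide_right_mono) auto
   also have "\<dots> <= measure mu (bowen z (?m + N) (ep / 8))"
    using D(2)[of "?m + N" z] z(1) n D(1) by (simp add: field_simps)
   also have "\<dots> <= measure mu (?Y -` {(v, w)} \<inter> X)" using sub ev by (rule mu.finite_measure_mono)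
   finally show ?thesis .
  qed
  have "c * measure mu (bt -` S \<inter> X) * measure mu (ga -` T \<inter> X)
    = c * (\<Sum>v\<in>S. measure mu (bt -` {v} \<inter> X)) * (\<Sum>w\<in>T. measure mu (ga -` {w} \<inter> X))"
   using mu.prob_vimage_finite[OF s(1) fin(1)] mu.prob_vimage_finite[OF s(2) fin(2)] by (simp add: sp)
  also have "\<dots> = (\<Sum>v\<in>S. \<Sum>w\<in>T. c * measure mu (bt -` {v} \<inter> X) * measure mu (ga -` {w} \<inter> X))"
   by (subst sum_distrib_left) (rule sum_product)
  also have "\<dots> <= (\<Sum>v\<in>S. \<Sum>w\<in>T. measure mu (?Y -` {(v, w)} \<inter> X))" using pair by (intro sum_mono) auto
  also have "\<dots> = (\<Sum>p\<in>S \<times> T. measure mu (?Y -` {p} \<inter> X))" by (simp add: sum.cartesian_product case_prod_beta)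
  also have "\<dots> = measure mu (?Y -` (S \<times> T) \<inter> X)"
   using mu.prob_vimage_finite[OF sY, of "S \<times> T"] fin by (simp add: sp)
  also have "?Y -` (S \<times> T) \<inter> X = (bt -` S \<inter> X) \<inter> ((f ^^ ?m) -` (ga -` T \<inter> X) \<inter> X)"
   using funpow_X by auto
  finally show ?thesis .
 qed
 then show ?thesis by (intro that[OF c])
qed

text \<open>Preimages of \<open>A\<close> stay in \<open>A\<close> up to null sets, so a set
  approximating the complement can meet a preimage of a set approximating \<open>A\<close> only in
  small mass. Quasi-mixing bounds this mass below by a multiple of the product of the masses of
  \<open>A\<close> and its complement, so one of these is 0.\<close>

lemma ergodic:
 assumes A: "A \<in> sets mu" and inv: "measure mu (f -` A \<inter> X - A) = 0"
 shows "measure mu A = 0 \<or> measure mu A = 1"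
proof -
 obtain c g where c: "c > 0" "!!n N bt ga S T. n >= 1 ==> N >= 1 ==> atoms n bt ==> atoms N ga ==> S \<subseteq> bt ` X ==> T \<subseteq> ga ` X ==>
  c * measure mu (bt -` S \<inter> X) * measure mu (ga -` T \<inter> X) <= measure mu ((bt -` S \<inter> X) \<inter> ((f ^^ (n + g)) -` (ga -` T \<inter> X) \<inter> X))"
  by (rule quasi_mixing, rule that)
 have sp: "space mu = X" by (rule prob_onD(2)[OF mu_prob_on])
 have AX: "A \<subseteq> X" using sets.sets_into_space[OF A] sp by simp
 have pre: "(f ^^ m) -` Y \<inter> X \<in> sets mu" if "Y \<in> sets mu" for Y m
  using measurable_sets[OF mu.funpow_meas that] by (simp add: sp)
 have pre1: "f -` A \<inter> X \<in> sets mu" using pre[OF A, of 1] by simp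
 have null: "measure mu ((f ^^ m) -` A \<inter> X - A) = 0" for m
 proof (induction m)
  case 0 then show ?case by (simp add: Int_Diff)
 next
  case (Suc m)
  have "(f ^^ Suc m) -` A \<inter> X - A \<subseteq> ((f ^^ m) -` (f -` A \<inter> X - A) \<inter> X) \<union> ((f ^^ m) -` A \<inter> X - A)"
   using funpow_X by auto
  then have "measure mu ((f ^^ Suc m) -` A \<inter> X - A)
    <= measure mu (((f ^^ m) -` (f -` A \<inter> X - A) \<inter> X) \<union> ((f ^^ m) -` A \<inter> X - A))"
   using A pre1 pre by (intro mu.finite_measure_mono) auto
  also have "\<dots> <= measure mu ((f ^^ m) -` (f -` A \<inter> X - A) \<inter> X) + measure mu ((f ^^ m) -` A \<inter> X - A)"
   using A pre1 pre by (intro measure_Un_le) auto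
  also have "measure mu ((f ^^ m) -` (f -` A \<inter> X - A) \<inter> X) = 0"
   using mu.prob_funpow_vimage[of "f -` A \<inter> X - A" m] A pre1 inv by (simp add: sp)
  finally show ?case using Suc by (simp add: measure_le_0_iff)
 qed
 let ?a = "measure mu A" and ?b = "measure mu (X - A)"
 have XA: "X - A \<in> sets mu" using sets.compl_sets[OF A] by (simp add: sp)
 have key: "c * (?b * ?a) <= (2 + 2 * c) * e" if e: "e > 0" for e
 proof -
  obtain M1 where M1: "!!n bt. n >= M1 ==> atoms n bt ==> \<exists>S. S \<subseteq> bt ` X \<and>
   measure mu (A - (bt -` S \<inter> X)) < e \<and> measure mu ((bt -` S \<inter> X) - A) < e \<and>
   measure mu (A - (bt -` S \<inter> X)) < e \<and> measure mu ((bt -` S \<inter> X) - A) < e"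
   using approx_by_atoms[OF mu_prob_on mu_prob_on A e] by blast
  obtain M2 where M2: "!!n bt. n >= M2 ==> atoms n bt ==> \<exists>S. S \<subseteq> bt ` X \<and>
   measure mu ((X - A) - (bt -` S \<inter> X)) < e \<and> measure mu ((bt -` S \<inter> X) - (X - A)) < e \<and>
   measure mu ((X - A) - (bt -` S \<inter> X)) < e \<and> measure mu ((bt -` S \<inter> X) - (X - A)) < e"
   using approx_by_atoms[OF mu_prob_on mu_prob_on XA e] by blast
  define n where "n = max 1 (max M1 M2)"
  have n: "n >= 1" "M1 <= n" "M2 <= n" by (auto simp: n_def)
  obtain bt where bt: "atoms n bt" by (rule atoms_exist)
  obtain T where T: "T \<subseteq> bt ` X" "measure mu (A - (bt -` T \<inter> X)) < e" "measure mu ((bt -` T \<inter> X) - A) < e"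
   using M1[OF n(2) bt] by blast
  obtain S where S: "S \<subseteq> bt ` X" "measure mu ((X - A) - (bt -` S \<inter> X)) < e" "measure mu ((bt -` S \<inter> X) - (X - A)) < e"
   using M2[OF n(3) bt] by blast
  define U where "U = bt -` S \<inter> X"
  define W where "W = bt -` T \<inter> X"
  have UW: "U \<in> sets mu" "W \<in> sets mu"
   using simple_functionD(2)[OF atomsD(7)[OF bt mu_prob_on]] by (auto simp: U_def W_def sp)
  let ?m = "n + g"
  have dif: "measure mu Y <= measure mu Z + measure mu (Y - Z)" if "Y \<in> sets mu" "Z \<in> sets mu" for Y Z
   using that by (intro order_trans[OF mu.finite_measure_mono[of Y "Z \<union> (Y - Z)"] measure_Un_le]) auto
  have "c * measure mu U * measure mu W <= measure mu (U \<inter> ((f ^^ ?m) -` W \<inter> X))"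
   unfolding U_def W_def by (rule c(2)[OF n(1) n(1) bt bt S(1) T(1)])
  also have "\<dots> <= measure mu (((f ^^ ?m) -` A \<inter> X - A) \<union> ((U - (X - A)) \<union> ((f ^^ ?m) -` (W - A) \<inter> X)))"
   using A UW pre XA by (intro mu.finite_measure_mono) auto
  also have "\<dots> <= measure mu ((f ^^ ?m) -` A \<inter> X - A) + (measure mu (U - (X - A)) + measure mu ((f ^^ ?m) -` (W - A) \<inter> X))"
   using A UW pre XA
   by (intro order_trans[OF measure_Un_le] add_left_mono measure_Un_le) auto
  also have "measure mu ((f ^^ ?m) -` (W - A) \<inter> X) = measure mu (W - A)"
   using mu.prob_funpow_vimage[of "W - A" ?m] UW A by (simp add: sp)
  finally have 1: "c * measure mu U * measure mu W <= 2 * e" using null[of ?m] S(3) T(3) by (simp add: U_def W_def)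
  have "?b <= measure mu U + e" using dif[OF XA UW(1)] S(2) by (simp add: U_def)
  moreover have "?a <= measure mu W + e" using dif[OF A UW(2)] T(2) by (simp add: W_def)
  ultimately have "?b * ?a <= measure mu U * measure mu W + 2 * e"
  proof -
   assume ba: "?b <= measure mu U + e" "?a <= measure mu W + e"
   have "?b * ?a <= (measure mu U + e) * ?a" using ba(1) by (intro mult_right_mono) auto
   also have "\<dots> = measure mu U * ?a + e * ?a" by (simp add: algebra_simps)
   also have "\<dots> <= measure mu U * (measure mu W + e) + e * 1"
    using ba(2) e by (intro add_mono mult_left_mono) auto
   also have "\<dots> <= measure mu U * measure mu W + 1 * e + e * 1"
    unfolding distrib_left using e by (intro add_mono mult_right_mono) auto
   finally show ?thesis by simp
  qed
  then have "c * (?b * ?a) <= c * (measure mu U * measure mu W + 2 * e)" using c(1) by (intro mult_left_mono) auto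
  then show ?thesis using 1 by (simp add: algebra_simps)
 qed
 have "c * (?b * ?a) <= 0"
 proof (rule field_le_epsilon)
  fix e :: real assume e: "e > 0"
  have "c * (?b * ?a) <= (2 + 2 * c) * (e / (2 + 2 * c))" using c(1) e by (intro key) auto
  also have "(2 + 2 * c) * (e / (2 + 2 * c)) = e" using c(1) by simp
  finally show "c * (?b * ?a) <= 0 + e" by simp
 qed
 moreover have "?b * ?a >= 0" by simp
 ultimately have "?b * ?a = 0" using c(1) by (auto simp: mult_le_0_iff measure_le_0_iff)
 moreover have "?b = 1 - ?a" using mu.prob_compl[OF A] by (simp add: sp)
 ultimately show ?thesis by auto
qed

text \<open>On a set that is null for \<open>mu\<close> but charged by \<open>nu\<close>, the
  logarithmic term of \<open>entropy_deficit\<close> would make the free energy of \<open>nu\<close>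
  strictly smaller than \<open>P\<close>. Hence \<open>nu\<close> is absolutely continuous, and
  ergodicity of \<open>mu\<close> leaves no other invariant measure.\<close>

theorem equilibrium_unique:
 assumes nu: "nu \<in> invariant_measures f X" and eq: "ent nu + mean_value Ph nu = P"
 shows "nu = mu"
proof (rule absolutely_continuous_unique[OF nu mu_inv _ ergodic])
 note p = invariant_prob_on[OF nu]
 interpret nu: prob_space nu using prob_onD(1)[OF p] .
 obtain c where c: "c >= 0" "!!(n::nat) bt nu S dl. n >= 1 ==> atoms n bt ==> nu \<in> invariant_measures f X ==> 0 < dl ==>
  measure mu (bt -` S \<inter> X) <= dl ==>
  n * (ent nu + mean_value Ph nu - P) <= c + measure nu (bt -` S \<inter> X) * ln dl"
  by (rule entropy_deficit, rule that)
 fix A assume A: "A \<in> sets mu" and A0: "measure mu A = 0"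
 have Anu: "A \<in> sets nu" using A prob_onD(3) p mu_prob_on by simp
 show "measure nu A = 0"
 proof (rule ccontr)
  assume "measure nu A \<noteq> 0"
  then have b: "measure nu A > 0" by (simp add: zero_less_measure_iff)
  define b where "b = measure nu A"
  \<comment> \<open>The chosen atoms keep at least half of the mass \<open>b\<close>, and
    \<open>b / 2 * ln dl <= - (c + 1)\<close>, which beats the constant \<open>c\<close>.\<close>
  define dl where "dl = min (b / 2) (exp (- (2 * (c + 1) / b)))"
  have dl: "dl > 0" "dl <= b / 2" "dl <= exp (- (2 * (c + 1) / b))" using b by (auto simp: dl_def b_def)
  obtain M where M: "!!n bt. n >= M ==> atoms n bt ==> \<exists>S. S \<subseteq> bt ` X \<and>
   measure nu (A - (bt -` S \<inter> X)) < dl \<and> measure nu ((bt -` S \<inter> X) - A) < dl \<and>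
   measure mu (A - (bt -` S \<inter> X)) < dl \<and> measure mu ((bt -` S \<inter> X) - A) < dl"
   using approx_by_atoms[OF p mu_prob_on Anu dl(1)] by blast
  define n where "n = max 1 M"
  have n: "n >= 1" "M <= n" by (auto simp: n_def)
  obtain bt where bt: "atoms n bt" by (rule atoms_exist)
  obtain S where S: "measure nu (A - (bt -` S \<inter> X)) < dl" "measure mu ((bt -` S \<inter> X) - A) < dl"
   using M[OF n(2) bt] by blast
  let ?U = "bt -` S \<inter> X"
  have U: "?U \<in> sets mu" "?U \<in> sets nu"
   using simple_functionD(2)[OF atomsD(7)[OF bt mu_prob_on], of S] simple_functionD(2)[OF atomsD(7)[OF bt p], of S]
    prob_onD(2) p mu_prob_on by simp_all
  have "measure mu ?U <= measure mu A + measure mu (?U - A)"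
   using A U by (intro order_trans[OF mu.finite_measure_mono[of ?U "A \<union> (?U - A)"] measure_Un_le]) auto
  then have "measure mu ?U <= dl" using A0 S(2) by linarith
  from c(2)[OF n(1) bt nu dl(1) this] have "0 <= c + measure nu ?U * ln dl" using eq by simp
  moreover have "measure nu ?U * ln dl <= (b / 2) * (- (2 * (c + 1) / b))"
  proof -
   have "b <= measure nu ?U + measure nu (A - ?U)"
    unfolding b_def using Anu U
    by (intro order_trans[OF nu.finite_measure_mono[of A "?U \<union> (A - ?U)"] measure_Un_le]) auto
   then have Ub: "b / 2 <= measure nu ?U" using S(1) dl(2) by linarith
   have ln: "ln dl <= - (2 * (c + 1) / b)" using dl(1,3) by (metis ln_exp ln_mono)
   have neg: "- (2 * (c + 1) / b) <= 0" using c(1) b by (simp add: b_def)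
   have "measure nu ?U * ln dl <= measure nu ?U * - (2 * (c + 1) / b)" using ln by (intro mult_left_mono) auto
   also have "\<dots> <= (b / 2) * - (2 * (c + 1) / b)" using Ub neg by (rule mult_right_mono_neg)
   finally show ?thesis .
  qed
  moreover have "(b / 2) * (- (2 * (c + 1) / b)) = - (c + 1)" using b by (simp add: b_def field_simps)
  ultimately show False by linarith
 qed
qed

end

section \<open>Upper semicontinuity of the entropy\<close>

lemma continuous_on_xlnx: "continuous_on {0..} (%x::real. x * ln x)"
 unfolding continuous_on_def
proof
 fix a :: real assume a: "a \<in> {0..}"
 show "((%x. x * ln x) \<longlongrightarrow> a * ln a) (at a within {0..})"
 proof (cases "a = 0")
  case True
  have "((%x::real. x * ln x) \<longlongrightarrow> 0) (at_right 0)" by real_asymp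
  then show ?thesis using True by (simp add: at_within_Ici_at_right)
 next
  case False
  then show ?thesis using a by (intro tendsto_intros) auto
 qed
qed

context expanding_map
begin

text \<open>The law of the distance from \<open>x\<close> has only countably many atoms.\<close>

lemma null_sphere:
 assumes nu: "prob_on nu" and x: "x \<in> X" and ab: "a < (b::real)"
 obtains r where "a < r" "r < b" "measure nu {y \<in> X. rh x y = r} = 0"
proof -
 interpret prob_space nu using prob_onD(1)[OF nu] .
 have m: "rh x \<in> borel_measurable nu" using continuous_measurable[OF nu continuous_rho[OF x]] .
 interpret D: prob_space "distr nu borel (rh x)" by (rule prob_space_distr[OF m])
 have "countable {r. measure (distr nu borel (rh x)) {r} \<noteq> 0}" by (rule D.countable_support)
 moreover have "uncountable {a<..<b}" using ab by (simp add: uncountable_open_interval)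
 ultimately obtain r where r: "r \<in> {a<..<b}" "measure (distr nu borel (rh x)) {r} = 0"
  by (metis (mono_tags, lifting) countable_subset mem_Collect_eq subsetI)
 have "measure (distr nu borel (rh x)) {r} = measure nu (rh x -` {r} \<inter> X)"
  using measure_distr[OF m, of "{r}"] prob_onD(2)[OF nu] by simp
 moreover have "rh x -` {r} \<inter> X = {y \<in> X. rh x y = r}" by auto
 ultimately show ?thesis using r that by auto
qed

lemma wconv_invariant:
 assumes nus: "!!k. nus k \<in> invariant_measures f X" and nu: "prob_on nu" and w: "wconv nus nu"
 shows "nu \<in> invariant_measures f X"
proof (rule invariant_measureI[OF nu])
 fix h :: "'m => real" assume h: "continuous_on X h"
 have hf: "continuous_on X (%x. h (f x))"
  by (rule continuous_on_compose2[OF h f_cont]) (use f_X in auto)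
 have "(\<integral>x. h (f x) \<partial>nus k) = (\<integral>x. h x \<partial>nus k)" for k
 proof -
  interpret invariant_prob "nus k" f by (rule invariant_prob[OF nus])
  show ?thesis
   using integral_funpow[OF continuous_measurable[OF invariant_prob_on[OF nus] h], of 1] by simp
 qed
 moreover have "(%k. \<integral>x. h (f x) \<partial>nus k) \<longlonglongrightarrow> (\<integral>x. h (f x) \<partial>nu)"
  using w hf unfolding wconv_def by blast
 moreover have "(%k. \<integral>x. h x \<partial>nus k) \<longlonglongrightarrow> (\<integral>x. h x \<partial>nu)"
  using w h unfolding wconv_def by blast
 ultimately show "(\<integral>x. h (f x) \<partial>nu) = (\<integral>x. h x \<partial>nu)" using LIMSEQ_unique by simp
qed

text \<open>A partition by finitely many balls with null spheres has pieces that stay null on the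
  boundary along itineraries, so for fixed \<open>n\<close> the entropy of the itineraries converges
  along the sequence. Since the balls are small, this finite-time entropy bounds the entropy of
  every \<open>nus k\<close> from above, while for suitable \<open>n\<close> it is below
  \<open>n * c\<close> at the limit measure.\<close>

theorem ent_usc:
 assumes nus: "!!k. nus k \<in> invariant_measures f X" and nu: "nu \<in> invariant_measures f X" and w: "wconv nus nu"
  and c: "ent nu < c"
 shows "\<forall>\<^sub>F k in sequentially. ent (nus k) < c"
proof -
 note p = invariant_prob_on[OF nu] and ps = invariant_prob_on[OF nus]
 interpret invariant_prob nu f by (rule invariant_prob[OF nu])
 have sp: "space nu = X" "!!k. space (nus k) = X" using prob_onD(2) p ps by auto
 have "\<exists>r. 0 < r \<and> r < e0 / 2 \<and> measure nu {y \<in> X. rh x y = r} = 0" if "x \<in> X" for x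
  using null_sphere[OF p that, of 0 "e0 / 2"] e0_pos by auto
 then obtain r where r: "!!x. x \<in> X ==> 0 < r x" "!!x. x \<in> X ==> r x < e0 / 2"
  "!!x. x \<in> X ==> measure nu {y \<in> X. rh x y = r x} = 0" by metis
 obtain D where D: "finite D" "D \<subseteq> X" "!!x. x \<in> X ==> \<exists>d\<in>D. rh d x < r d"
  using ball_cover[of r, OF r(1)] by blast
 \<comment> \<open>The name of a point is the set of balls containing it. There is at least one, so
   points with equal names share a ball and are \<open>e0\<close>-close.\<close>
 define xx where "xx x = {d \<in> D. rh d x < r d}" for x
 have close: "rh x y <= e0" if "x \<in> X" "y \<in> X" "xx x = xx y" for x y
 proof -
  obtain d where d: "d \<in> D" "rh d x < r d" using D(3) \<open>x \<in> X\<close> by blast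
  then have "d \<in> xx y" using that(3) by (auto simp: xx_def)
  then have "rh d y < r d" by (simp add: xx_def)
  moreover have dX: "d \<in> X" using d D by blast
  ultimately show ?thesis
   using rho_tri[OF that(1) dX that(2)] rho_sym[OF that(1) dX] d r(2)[OF dX] by linarith
 qed
 \<comment> \<open>\<open>up\<close> and \<open>lo\<close> make all inequalities describing the
   itinerary \<open>l\<close> weak or strict. One is closed, the other relatively open, and they
   differ only on preimages of the null spheres.\<close>
 define up where "up n l = {x \<in> X. \<forall>j<n. \<forall>d\<in>D. if d \<in> l ! j then rh d ((f ^^ j) x) <= r d else r d <= rh d ((f ^^ j) x)}"
  for n and l :: "'m set list"
 define lo where "lo n l = {x \<in> X. \<forall>j<n. \<forall>d\<in>D. if d \<in> l ! j then rh d ((f ^^ j) x) < r d else r d < rh d ((f ^^ j) x)}"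
  for n and l :: "'m set list"
 have cont: "continuous_on X (%x. rh d ((f ^^ j) x))" if "d \<in> D" for d j
  by (rule continuous_on_compose2[OF continuous_rho funpow_cont]) (use that D funpow_X in auto)
 have cls: "closed {x \<in> X. rh d ((f ^^ j) x) <= r d}" "closed {x \<in> X. r d <= rh d ((f ^^ j) x)}" if "d \<in> D" for d j
  using cont[OF that] by (auto intro!: continuous_on_closed_Collect_le continuous_on_const closed_X)
 have clup: "closed (up n l)" for n l
 proof -
  have "up n l = X \<inter> (\<Inter>j\<in>{..<n}. \<Inter>d\<in>D. if d \<in> l ! j then {x \<in> X. rh d ((f ^^ j) x) <= r d} else {x \<in> X. r d <= rh d ((f ^^ j) x)})"
   by (auto simp: up_def split: if_splits)
  also have "closed \<dots>" using cls closed_X by (intro closed_Int closed_INT ballI) auto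
  finally show ?thesis .
 qed
 have cllo: "closed (X - lo n l)" for n l
 proof -
  have neg: "\<not> (if c then u < v else v < u) \<longleftrightarrow> (if c then v <= u else u <= v)" for c and u v :: real by auto
  have "X - lo n l = (\<Union>j\<in>{..<n}. \<Union>d\<in>D. if d \<in> l ! j then {x \<in> X. r d <= rh d ((f ^^ j) x)} else {x \<in> X. rh d ((f ^^ j) x) <= r d})"
   (is "_ = ?R")
  proof (rule set_eqI)
   fix x
   have "x \<in> X - lo n l \<longleftrightarrow> x \<in> X \<and> (\<exists>j<n. \<exists>d\<in>D. \<not> (if d \<in> l ! j then rh d ((f ^^ j) x) < r d else r d < rh d ((f ^^ j) x)))"
    unfolding lo_def by blast
   also have "\<dots> \<longleftrightarrow> (\<exists>j<n. \<exists>d\<in>D. x \<in> X \<and> (if d \<in> l ! j then r d <= rh d ((f ^^ j) x) else rh d ((f ^^ j) x) <= r d))"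
    unfolding neg by blast
   also have "\<dots> \<longleftrightarrow> x \<in> ?R"
    unfolding UN_iff Bex_def lessThan_iff by (intro ex_cong1 conj_cong refl) simp
   finally show "x \<in> X - lo n l \<longleftrightarrow> x \<in> ?R" .
  qed
  also have "closed \<dots>" using cls D(1) by (intro closed_UN ballI) auto
  finally show ?thesis .
 qed
 have upX: "up n l \<subseteq> X" "lo n l \<subseteq> X" for n l by (auto simp: up_def lo_def)
 have small: "measure nu (up n l) <= measure nu (lo n l)" for n l
 proof -
  let ?N = "%d. {y \<in> X. rh d y = r d}"
  have Nev: "?N d \<in> events" if "d \<in> D" for d
  proof -
   have "?N d = {x \<in> X. rh d ((f ^^ 0) x) <= r d} \<inter> {x \<in> X. r d <= rh d ((f ^^ 0) x)}" by auto
   then have "closed (?N d)" using closed_Int[OF cls(1)[OF that, of 0] cls(2)[OF that, of 0]] by (simp only:)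
   then show ?thesis using sets_prob_on[OF p] by auto
  qed
  have pN: "measure nu ((f ^^ j) -` ?N d \<inter> X) = 0" if "d \<in> D" for j d
   using prob_funpow_vimage[OF Nev[OF that], of j] r(3)[of d] that D(2) by (auto simp: sp)
  have ev: "(f ^^ j) -` ?N d \<inter> X \<in> events" if "d \<in> D" for j d
   using measurable_sets[OF funpow_meas Nev[OF that], of j] by (simp add: sp)
  have sub: "up n l \<subseteq> lo n l \<union> (\<Union>j\<in>{..<n}. \<Union>d\<in>D. (f ^^ j) -` ?N d \<inter> X)"
   using funpow_X by (force simp: up_def lo_def split: if_splits)
  have evj: "(\<Union>d\<in>D. (f ^^ j) -` ?N d \<inter> X) \<in> events" for j
   using ev by (intro sets.finite_UN D(1))
  have loev: "lo n l \<in> events"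
  proof -
   have "lo n l = X - (X - lo n l)" using upX by blast
   then show ?thesis using cllo[of n l] closed_X sets_prob_on[OF p] upX by (metis borel_closed sets.Diff)
  qed
  have "measure nu (\<Union>j\<in>{..<n}. \<Union>d\<in>D. (f ^^ j) -` ?N d \<inter> X) <= (\<Sum>j<n. measure nu (\<Union>d\<in>D. (f ^^ j) -` ?N d \<inter> X))"
   by (intro finite_measure_subadditive_finite finite_lessThan image_subsetI evj)
  also have "\<dots> <= (\<Sum>j<n. \<Sum>d\<in>D. measure nu ((f ^^ j) -` ?N d \<inter> X))"
   using ev D(1) by (intro sum_mono finite_measure_subadditive_finite image_subsetI) simp_all
  also have "\<dots> = 0" using pN by simp
  finally have null: "measure nu (\<Union>j\<in>{..<n}. \<Union>d\<in>D. (f ^^ j) -` ?N d \<inter> X) <= 0" .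
  have evU: "(\<Union>j\<in>{..<n}. \<Union>d\<in>D. (f ^^ j) -` ?N d \<inter> X) \<in> events"
   by (intro sets.finite_UN finite_lessThan evj)
  have "measure nu (up n l) <= measure nu (lo n l \<union> (\<Union>j\<in>{..<n}. \<Union>d\<in>D. (f ^^ j) -` ?N d \<inter> X))"
   by (intro finite_measure_mono sub sets.Un loev evU)
  also have "\<dots> <= measure nu (lo n l) + measure nu (\<Union>j\<in>{..<n}. \<Union>d\<in>D. (f ^^ j) -` ?N d \<inter> X)"
   using loev evU by (rule measure_Un_le)
  finally show ?thesis using null by linarith
 qed
 have xxb: "xx -` {v} \<inter> X \<in> sets borel" for v
 proof (cases "v \<subseteq> D")
  case True
  have "xx -` {v} \<inter> X = X \<inter> (\<Inter>d\<in>D. if d \<in> v then X - {x \<in> X. r d <= rh d x} else {x \<in> X. r d <= rh d x})"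
   (is "_ = X \<inter> ?R")
  proof (rule set_eqI)
   fix x
   have "x \<in> xx -` {v} \<inter> X \<longleftrightarrow> x \<in> X \<and> (\<forall>d\<in>D. d \<in> v \<longleftrightarrow> rh d x < r d)"
    using True unfolding xx_def by blast
   also have "\<dots> \<longleftrightarrow> x \<in> X \<and> (\<forall>d\<in>D. x \<in> (if d \<in> v then X - {x \<in> X. r d <= rh d x} else {x \<in> X. r d <= rh d x}))"
    by (intro conj_cong refl ball_cong) (simp add: not_le not_less)
   finally show "x \<in> xx -` {v} \<inter> X \<longleftrightarrow> x \<in> X \<inter> ?R" by (simp only: Int_iff INT_iff)
  qed
  also have "\<dots> \<in> sets borel"
  proof (cases "D = {}")
   case False
   have "{x \<in> X. r d <= rh d x} \<in> sets borel" if "d \<in> D" for d using cls(2)[OF that, of 0] by simp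
   then show ?thesis using D(1) False closed_X by (intro sets.Int sets.finite_INT) auto
  qed (use closed_X in simp)
  finally show ?thesis .
 next
  case False
  then have "xx -` {v} \<inter> X = {}" by (auto simp: xx_def)
  then show ?thesis by simp
 qed
 have sxx: "simple_function nn xx" if "prob_on nn" for nn
  using that D(1) xxb by (intro simple_function_prob_on) (auto simp: xx_def intro!: finite_subset[of _ "Pow D"])
 have conv: "(%k. shannon (nus k) (itinerary f xx n)) \<longlonglongrightarrow> shannon nu (itinerary f xx n)" for n
 proof -
  let ?I = "itinerary f xx n"
  have "(%k. measure (nus k) (?I -` {l} \<inter> X)) \<longlonglongrightarrow> measure nu (?I -` {l} \<inter> X)" if l: "l \<in> ?I ` X" for l
  proof (rule wconv_null_boundary[OF ps p w])
   have len: "length l = n" "!!j. j < n ==> l ! j \<subseteq> D" using l by (auto simp: itinerary_def xx_def)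
   have mem: "x \<in> ?I -` {l} \<longleftrightarrow> (\<forall>j<n. xx ((f ^^ j) x) = l ! j)" for x
    using len(1) by (auto simp: itinerary_def list_eq_iff_nth_eq)
   have xxeq: "xx y = v \<longleftrightarrow> (\<forall>d\<in>D. if d \<in> v then rh d y < r d else r d <= rh d y)" if "v \<subseteq> D" for v y
    using that by (auto simp: xx_def not_less split: if_splits)
   have mem': "x \<in> ?I -` {l} \<inter> X \<longleftrightarrow> x \<in> X \<and> (\<forall>j<n. \<forall>d\<in>D. if d \<in> l ! j then rh d ((f ^^ j) x) < r d else r d <= rh d ((f ^^ j) x))" for x
    using mem[of x] xxeq[OF len(2)] by auto
   show "lo n l \<subseteq> ?I -` {l} \<inter> X"
   proof
    fix x assume "x \<in> lo n l"
    then have "x \<in> X" "!!j d. j < n ==> d \<in> D ==> if d \<in> l ! j then rh d ((f ^^ j) x) < r d else r d < rh d ((f ^^ j) x)"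
     unfolding lo_def by auto
    then show "x \<in> ?I -` {l} \<inter> X" unfolding mem' by (meson less_imp_le)
   qed
   show "?I -` {l} \<inter> X \<subseteq> up n l"
   proof
    fix x assume "x \<in> ?I -` {l} \<inter> X"
    then have "x \<in> X \<and> (\<forall>j<n. \<forall>d\<in>D. if d \<in> l ! j then rh d ((f ^^ j) x) < r d else r d <= rh d ((f ^^ j) x))"
     unfolding mem' .
    then show "x \<in> up n l" unfolding up_def by (auto intro: less_imp_le)
   qed
   show "?I -` {l} \<inter> X \<in> sets borel"
    using simple_functionD(2)[OF simple_itinerary[OF sxx[OF p]], of n "{l}"] sets_prob_on[OF p] by (simp add: sp)
  qed (use clup cllo upX small in auto)
  then have "(%k. \<Sum>l\<in>?I ` X. - (measure (nus k) (?I -` {l} \<inter> X) * ln (measure (nus k) (?I -` {l} \<inter> X))))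
   \<longlonglongrightarrow> (\<Sum>l\<in>?I ` X. - (measure nu (?I -` {l} \<inter> X) * ln (measure nu (?I -` {l} \<inter> X))))"
   by (intro tendsto_sum tendsto_minus continuous_on_tendsto_compose[OF continuous_on_xlnx]) auto
  then show ?thesis by (simp add: shannon_def sp)
 qed
 have "ks_rate xx <= ent nu" using ks_rate_le_metric_entropy[OF sxx[OF p]] entropy_finite(1)[OF nu] by simp
 then have "ks_rate xx < c" using c by simp
 then have "\<forall>\<^sub>F n in sequentially. shannon nu (itinerary f xx n) / n < c"
  using ks_rate_tendsto[OF sxx[OF p]] by (rule order_tendstoD(2)[rotated])
 then obtain n where n: "n >= 1" "shannon nu (itinerary f xx n) / n < c"
  unfolding eventually_sequentially by (metis le_add1 le_add2)
 have le: "ent (nus k) <= shannon (nus k) (itinerary f xx n) / n" for k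
 proof -
  interpret k: invariant_prob "nus k" f by (rule invariant_prob[OF nus])
  have "n * ent (nus k) <= shannon (nus k) (itinerary f xx n)"
  proof (rule ent_le_bowen[OF nus k.simple_itinerary[OF sxx[OF ps]] n(1)])
   fix x y j assume xy: "x \<in> X" "y \<in> X" "itinerary f xx n x = itinerary f xx n y" "j < n"
   have "itinerary f xx n x ! j = itinerary f xx n y ! j" using xy(3) by simp
   then have "xx ((f ^^ j) x) = xx ((f ^^ j) y)" using xy(4) by (simp add: itinerary_def)
   then show "rh ((f ^^ j) x) ((f ^^ j) y) <= e0" using close funpow_X xy by blast
  qed
  then show ?thesis using n(1) by (simp add: field_simps)
 qed
 have "(%k. shannon (nus k) (itinerary f xx n) / n) \<longlonglongrightarrow> shannon nu (itinerary f xx n) / n"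
  by (intro tendsto_divide conv tendsto_const) (use n in auto)
 then have "\<forall>\<^sub>F k in sequentially. shannon (nus k) (itinerary f xx n) / n < c" using n(2) by (rule order_tendstoD)
 then show ?thesis by eventually_elim (use le in \<open>auto intro: le_less_trans\<close>)
qed

end

text \<open>Up to an error \<open>C / n\<close> uniform in the measure, the mean value is the
  integral of the continuous function \<open>Ph n / n\<close>.\<close>

lemma (in potential) mean_value_tendsto:
 assumes nus: "!!k. nus k \<in> invariant_measures f X" and nu: "nu \<in> invariant_measures f X" and w: "wconv nus nu"
 shows "(%k. mean_value Ph (nus k)) \<longlonglongrightarrow> mean_value Ph nu"
proof (rule LIMSEQ_I)
 fix e :: real assume e: "e > 0"
 obtain n :: nat where n: "real n > 3 * (C + 1) / e" using reals_Archimedean2 by blast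
 have "3 * (C + 1) / e > 0" using e C_nonneg by (intro divide_pos_pos) auto
 then have n1: "n >= 1" "real n > 0" using n by linarith+
 have Cn: "C / n < e / 3" using n n1 e by (simp add: field_simps)
 have near: "\<bar>(\<integral>x. Ph n x \<partial>nn) / n - mean_value Ph nn\<bar> < e / 3" if "nn \<in> invariant_measures f X" for nn
 proof -
  have "(\<integral>x. Ph n x \<partial>nn) / n - mean_value Ph nn = ((\<integral>x. Ph n x \<partial>nn) - n * mean_value Ph nn) / n"
   using n1 by (simp add: field_simps)
  also have "\<bar>\<dots>\<bar> <= C / n" using mean_value_bound(2)[OF that n1(1)] n1 by (simp add: abs_divide divide_right_mono)
  finally show ?thesis using Cn by linarith
 qed
 have "(%k. (\<integral>x. Ph n x \<partial>nus k) / n) \<longlonglongrightarrow> (\<integral>x. Ph n x \<partial>nu) / n"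
  using w potential_cont[OF n1(1)] n1 unfolding wconv_def by (intro tendsto_divide tendsto_const) auto
 then obtain N where N: "!!k. k >= N ==> norm ((\<integral>x. Ph n x \<partial>nus k) / n - (\<integral>x. Ph n x \<partial>nu) / n) < e / 3"
  using LIMSEQ_D[of _ _ "e / 3"] e by (metis divide_pos_pos zero_less_numeral)
 show "\<exists>N. \<forall>k\<ge>N. norm (mean_value Ph (nus k) - mean_value Ph nu) < e"
 proof (intro exI allI impI)
  fix k assume "N <= k"
  then show "norm (mean_value Ph (nus k) - mean_value Ph nu) < e"
   using N[of k] near[OF nus[of k]] near[OF nu] unfolding real_norm_def by linarith
 qed
qed

section \<open>Large deviations for expanding maps\<close>

locale two_potentials = Ph: potential X rh f e0 Ph ep C K B + Ps: potential X rh f e0 Ps ep C K B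
 for X :: "'m::{t2_space, second_countable_topology} set" and rh f e0 Ph Ps ep C K B
begin

text \<open>Only the constants grow with \<open>t\<close>; the scale \<open>ep\<close> is kept, so
  that the Gibbs measures of different parameters can be compared on the same atoms.\<close>

lemma comb_potential:
 "potential X rh f e0 (seq_comb Ph t Ps) ep ((1 + \<bar>t\<bar>) * C) ((1 + \<bar>t\<bar>) * K) ((1 + \<bar>t\<bar>) * B)"
proof
 have comb: "\<bar>a + t * b\<bar> <= (1 + \<bar>t\<bar>) * c" if "\<bar>a\<bar> <= c" "\<bar>b\<bar> <= c" for a b c
 proof -
  have "\<bar>a + t * b\<bar> <= \<bar>a\<bar> + \<bar>t\<bar> * \<bar>b\<bar>" by (metis abs_mult abs_triangle_ineq)
  also have "\<dots> <= c + \<bar>t\<bar> * c" using that by (intro add_mono mult_left_mono) auto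
  finally show ?thesis by (simp add: algebra_simps)
 qed
 show "continuous_on X (seq_comb Ph t Ps n)" if "n >= 1" for n
  unfolding seq_comb_def by (intro continuous_intros Ph.potential_cont Ps.potential_cont that)
 show "\<bar>seq_comb Ph t Ps (m + n) x - seq_comb Ph t Ps m x - seq_comb Ph t Ps n ((f ^^ m) x)\<bar> <= (1 + \<bar>t\<bar>) * C"
  if "m >= 1" "n >= 1" "x \<in> X" for m n x
  using comb[OF Ph.additive[OF that] Ps.additive[OF that]] by (simp add: seq_comb_def algebra_simps)
 show "\<bar>seq_comb Ph t Ps n x - seq_comb Ph t Ps n y\<bar> <= (1 + \<bar>t\<bar>) * K" if "n >= 1" "x \<in> X" "y \<in> Ph.bowen x n ep" for n x y
  using comb[OF Ph.distort[OF that] Ps.distort[OF that]] by (simp add: seq_comb_def algebra_simps)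
 show "\<bar>seq_comb Ph t Ps n x\<bar> <= n * ((1 + \<bar>t\<bar>) * B)" if "n >= 1" "x \<in> X" for n x
  using comb[OF Ph.bounded[OF that] Ps.bounded[OF that]] by (simp add: seq_comb_def mult_ac)
qed (use Ph.eps_pos Ph.eps_e0 Ph.C_nonneg Ph.K_nonneg Ph.B_nonneg in auto)

lemma gibbs_family_exists: "\<exists>P mu. \<forall>t. Ph.gibbs (ep / 2) (seq_comb Ph t Ps) (P t) (mu t)"
proof -
 have "\<exists>P mu. Ph.gibbs (ep / 2) (seq_comb Ph t Ps) P mu" for t
  using potential.gibbs_exists[OF comb_potential[of t]] by metis
 then show ?thesis by metis
qed

end

section \<open>The pressure as a function of the parameter, and its slopes\<close>

locale gibbs_family = two_potentials X rh f e0 Ph Ps ep C K B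
 for X :: "'m::{t2_space, second_countable_topology} set" and rh f e0 Ph Ps ep C K B +
 fixes P :: "real => real" and mu :: "real => 'm measure"
 assumes gibbs_t: "Ph.gibbs (ep / 2) (seq_comb Ph t Ps) (P t) (mu t)"
begin

lemma gibbs_measure_t:
 "gibbs_measure X rh f e0 (seq_comb Ph t Ps) ep ((1 + \<bar>t\<bar>) * C) ((1 + \<bar>t\<bar>) * K) ((1 + \<bar>t\<bar>) * B) (P t) (mu t)"
 unfolding gibbs_measure_def gibbs_measure_axioms_def using comb_potential gibbs_t by blast

abbreviation "mphi \<equiv> mean_value Ph"
abbreviation "mpsi \<equiv> mean_value Ps"
abbreviation "slope t \<equiv> mpsi (mu t)"
abbreviation "inv_meas \<equiv> invariant_measures f X"

lemma mu_t_inv: "mu t \<in> inv_meas"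
 using gibbs_measure.mu_inv[OF gibbs_measure_t] .

lemma mean_comb:
 assumes "nu \<in> inv_meas"
 shows "mean_value (seq_comb Ph t Ps) nu = mphi nu + t * mpsi nu"
proof -
 note p = Ph.invariant_prob_on[OF assms]
 have eq: "(\<integral>x. seq_comb Ph t Ps n x \<partial>nu) / n = (\<integral>x. Ph n x \<partial>nu) / n + t * ((\<integral>x. Ps n x \<partial>nu) / n)" if "n >= 1" for n
  using Ph.potential_integrable[OF p that] Ps.potential_integrable[OF p that] by (simp add: seq_comb_def add_divide_distrib)
 have "(%n. (\<integral>x. Ph n x \<partial>nu) / n + t * ((\<integral>x. Ps n x \<partial>nu) / n)) \<longlonglongrightarrow> mphi nu + t * mpsi nu"
  by (intro tendsto_intros Ph.mean_value_bound Ps.mean_value_bound assms)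
 then have "(%n. (\<integral>x. seq_comb Ph t Ps n x \<partial>nu) / n) \<longlonglongrightarrow> mphi nu + t * mpsi nu"
  by (rule Lim_transform_eventually) (use eq in \<open>auto simp: eventually_sequentially intro!: exI[of _ 1]\<close>)
 then show ?thesis unfolding mean_value_def by (rule limI)
qed

lemma free_energy_le_t: "nu \<in> inv_meas ==> Ph.ent nu + mphi nu + t * mpsi nu <= P t"
 using gibbs_measure.free_energy_le[OF gibbs_measure_t, of nu t] mean_comb[of nu t] by simp

lemma free_energy_eq_t: "Ph.ent (mu t) + mphi (mu t) + t * slope t = P t"
 using gibbs_measure.free_energy_mu[OF gibbs_measure_t, of t] mean_comb[OF mu_t_inv, of t t] by simp

lemma equilibrium_unique_t:
 "nu \<in> inv_meas ==> P t <= Ph.ent nu + mphi nu + t * mpsi nu ==> nu = mu t"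
 using gibbs_measure.equilibrium_unique[OF gibbs_measure_t, of nu t] mean_comb[of nu t] free_energy_le_t[of nu t] by simp

lemma Ptop_t: "Ptop f X (seq_comb Ph t Ps) = ereal (P t)"
 by (rule gibbs_measure.Ptop_eq[OF gibbs_measure_t])

lemma the_equilibrium_t: "the_equilibrium_state f X (seq_comb Ph t Ps) = mu t"
 unfolding the_equilibrium_state_def
proof (rule the_equality)
 show "equilibrium_state f X (seq_comb Ph t Ps) (mu t)"
  unfolding equilibrium_state_def Ptop_t Ph.entropy_finite(1)[OF mu_t_inv] mean_comb[OF mu_t_inv]
  using free_energy_eq_t[of t] mu_t_inv by (simp add: add.assoc)
 fix nu assume "equilibrium_state f X (seq_comb Ph t Ps) nu"
 then have nu: "nu \<in> inv_meas" and eq: "metric_entropy f nu + ereal (mean_value (seq_comb Ph t Ps) nu) = ereal (P t)"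
  by (auto simp: equilibrium_state_def Ptop_t)
 have "Ph.ent nu + mphi nu + t * mpsi nu = P t"
  using eq unfolding Ph.entropy_finite(1)[OF nu] mean_comb[OF nu] by (simp add: add.assoc)
 then show "nu = mu t" using equilibrium_unique_t[OF nu] by simp
qed

lemma comb_0: "seq_comb Ph 0 Ps = Ph"
 by (simp add: seq_comb_def)

text \<open>\<open>mu t\<close> competes in the variational principle at \<open>u\<close>, and its
  free energy is affine in the parameter. This is the form in which convexity of the pressure is
  used.\<close>

lemma subgradient: "P t + (u - t) * slope t <= P u"
 using free_energy_le_t[OF mu_t_inv, of t u] free_energy_eq_t[of t] by (simp add: algebra_simps)

lemma slope_mono: "t <= u ==> slope t <= slope u"
proof -
 assume "t <= u"
 have "(u - t) * (slope u - slope t) >= 0" using subgradient[of t u] subgradient[of u t] by (simp add: algebra_simps)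
 then show ?thesis using \<open>t <= u\<close> by (cases "t = u") (auto simp: zero_le_mult_iff)
qed

lemma limit_measure:
 fixes ts :: "nat => real"
 obtains r nu where "strict_mono (r :: nat => nat)" "nu \<in> inv_meas"
  "(%k. mphi (mu (ts (r k)))) \<longlonglongrightarrow> mphi nu" "(%k. slope (ts (r k))) \<longlonglongrightarrow> mpsi nu"
  "!!c. Ph.ent nu < c ==> \<forall>\<^sub>F k in sequentially. Ph.ent (mu (ts (r k))) < c"
proof -
 have "Ph.prob_on (mu (ts k))" for k by (rule Ph.invariant_prob_on[OF mu_t_inv])
 then obtain r nu where r: "strict_mono (r :: nat => nat)" "Ph.prob_on nu" "Ph.wconv ((%k. mu (ts k)) \<circ> r) nu"
  using Ph.weak_compactness[of "%k. mu (ts k)"] by blast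
 have w: "Ph.wconv (%k. mu (ts (r k))) nu" using r(3) by (simp add: comp_def)
 have nu: "nu \<in> inv_meas" by (rule Ph.wconv_invariant[OF mu_t_inv r(2) w])
 show ?thesis
  by (rule that[OF r(1) nu Ph.mean_value_tendsto[OF mu_t_inv nu w] Ps.mean_value_tendsto[OF mu_t_inv nu w]])
   (rule Ph.ent_usc[OF mu_t_inv nu w])
qed

text \<open>Upper semicontinuity of the entropy, prepared for limits of equilibrium states. The
  lower bounds \<open>a\<close> may vary with \<open>k\<close>: they depend on the parameters in
  \<open>slope_near\<close> and are constant in \<open>endpoint_measure\<close>.\<close>

lemma limit_free_energy:
 assumes nu: "nu \<in> inv_meas" and m: "(%k. mphi (mu (ts k))) \<longlonglongrightarrow> mphi nu"
  and e: "!!c. Ph.ent nu < c ==> \<forall>\<^sub>F k in sequentially. Ph.ent (mu (ts k)) < c"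
  and a: "a \<longlonglongrightarrow> l" "\<forall>\<^sub>F k in sequentially. a k <= Ph.ent (mu (ts k)) + mphi (mu (ts k))"
 shows "l <= Ph.ent nu + mphi nu"
proof (rule field_le_epsilon)
 fix d :: real assume d: "d > 0"
 have "\<forall>\<^sub>F k in sequentially. Ph.ent (mu (ts k)) < Ph.ent nu + d" using d by (intro e) simp
 with a(2) have "\<forall>\<^sub>F k in sequentially. a k <= Ph.ent nu + d + mphi (mu (ts k))" by eventually_elim simp
 moreover have "(%k. Ph.ent nu + d + mphi (mu (ts k))) \<longlonglongrightarrow> Ph.ent nu + d + mphi nu"
  by (intro tendsto_intros m)
 ultimately have "l <= Ph.ent nu + d + mphi nu" using a(1) by (intro tendsto_le[of sequentially]) auto
 then show "l <= Ph.ent nu + mphi nu + d" by simp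
qed

lemma P_lipschitz: "\<bar>P u - P t\<bar> <= \<bar>u - t\<bar> * B"
proof -
 have *: "P u - P t <= \<bar>u - t\<bar> * B" for u t
 proof -
  have "P u - P t <= (u - t) * slope u" using subgradient[of u t] by (simp add: algebra_simps)
  also have "\<dots> <= \<bar>u - t\<bar> * \<bar>slope u\<bar>" by (metis abs_ge_self abs_mult)
  also have "\<dots> <= \<bar>u - t\<bar> * B" using Ps.mean_value_abs_le[OF mu_t_inv] by (intro mult_left_mono) auto
  finally show ?thesis .
 qed
 show ?thesis using *[of u t] *[of t u] by (simp add: abs_le_iff abs_minus_commute)
qed

text \<open>\<open>w\<close> is the direction of approach, from the right or from the left. A limit
  of the measures at parameters \<open>t + w / k\<close> has full free energy at \<open>t\<close>
  and is therefore \<open>mu t\<close>, so the slopes converge along a subsequence.\<close>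

lemma slope_near:
 assumes dl: "dl > 0" and w: "w \<noteq> 0"
 obtains u where "u > 0" "\<bar>slope (t + u * w) - slope t\<bar> < dl"
proof -
 define ts where "ts k = t + 1 / Suc k * w" for k
 have "(%k. t + 1 / Suc k * w) \<longlonglongrightarrow> t + 0 * w"
  by (intro tendsto_intros LIMSEQ_Suc[OF lim_const_over_n])
 then have ts: "ts \<longlonglongrightarrow> t" unfolding ts_def by (simp only: mult_zero_left add_0_right)
 obtain r nu where r: "strict_mono (r :: nat => nat)" "nu \<in> inv_meas"
  "(%k. mphi (mu (ts (r k)))) \<longlonglongrightarrow> mphi nu" "(%k. slope (ts (r k))) \<longlonglongrightarrow> mpsi nu"
  "!!c. Ph.ent nu < c ==> \<forall>\<^sub>F k in sequentially. Ph.ent (mu (ts (r k))) < c"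
  using limit_measure[of ts] by metis
 have tr: "(%k. ts (r k)) \<longlonglongrightarrow> t" using LIMSEQ_subseq_LIMSEQ[OF ts r(1)] by (simp add: comp_def)
 have "(%k. P (ts (r k)) - P t) \<longlonglongrightarrow> 0"
 proof (rule Lim_null_comparison)
  show "\<forall>\<^sub>F k in sequentially. norm (P (ts (r k)) - P t) <= \<bar>ts (r k) - t\<bar> * B" using P_lipschitz by simp
  show "(%k. \<bar>ts (r k) - t\<bar> * B) \<longlonglongrightarrow> 0"
   using tendsto_mult[OF tendsto_rabs[OF tendsto_diff[OF tr tendsto_const[of t]]] tendsto_const[of B]] by simp
 qed
 then have "(%k. P (ts (r k))) \<longlonglongrightarrow> P t" by (simp add: LIM_zero_iff)
 then have "(%k. P (ts (r k)) - ts (r k) * slope (ts (r k))) \<longlonglongrightarrow> P t - t * mpsi nu"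
  by (intro tendsto_intros tr r)
 moreover have "P (ts (r k)) - ts (r k) * slope (ts (r k)) <= Ph.ent (mu (ts (r k))) + mphi (mu (ts (r k)))" for k
  using free_energy_eq_t[of "ts (r k)"] by simp
 ultimately have "P t - t * mpsi nu <= Ph.ent nu + mphi nu"
  using r by (intro limit_free_energy[of nu "%k. ts (r k)"]) auto
 then have "nu = mu t" by (intro equilibrium_unique_t r(2)) simp
 then have "\<forall>\<^sub>F k in sequentially. dist (slope (ts (r k))) (slope t) < dl" using r(4) dl by (auto dest: tendstoD)
 then obtain k where "dist (slope (ts (r k))) (slope t) < dl" by (auto simp: eventually_sequentially)
 then show ?thesis by (intro that[of "1 / Suc (r k)"]) (auto simp: ts_def dist_real_def)
qed

text \<open>The supremum of the parameters with slope at most \<open>s\<close> works: slopes are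
  monotone, and by \<open>slope_near\<close> they cannot jump over \<open>s\<close> from either
  side.\<close>

lemma slope_surj:
 assumes "slope a < s" "s < slope b"
 obtains t where "slope t = s"
proof -
 define T where "T = {t. slope t <= s}"
 have aT: "a \<in> T" using assms by (simp add: T_def)
 have bd: "t <= b" if "t \<in> T" for t
  using slope_mono[of b t] that assms(2) by (force simp: T_def)
 then have bdd: "bdd_above T" by (rule bdd_aboveI)
 let ?t = "Sup T"
 have "\<not> slope ?t < s"
 proof
  assume "slope ?t < s"
  then obtain u where u: "u > 0" "\<bar>slope (?t + u * 1) - slope ?t\<bar> < s - slope ?t"
   using slope_near[of "s - slope ?t" 1 ?t] by auto
  then have "?t + u \<in> T" by (simp add: T_def)
  then have "?t + u <= ?t" using bdd by (rule cSup_upper)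
  then show False using u(1) by simp
 qed
 moreover have "\<not> s < slope ?t"
 proof
  assume "s < slope ?t"
  then obtain u where u: "u > 0" "\<bar>slope (?t + u * - 1) - slope ?t\<bar> < slope ?t - s"
   using slope_near[of "slope ?t - s" "- 1" ?t] by auto
  then have gt: "slope (?t - u) > s" by simp
  obtain v where v: "v \<in> T" "?t - u < v" using less_cSup_iff[of T "?t - u"] aT bdd u(1) by auto
  have "slope (?t - u) <= slope v" using v(2) by (intro slope_mono) simp
  then show False using gt v(1) by (simp add: T_def)
 qed
 ultimately show ?thesis using that[of ?t] by simp
qed

text \<open>On one atom the Gibbs measures at \<open>a\<close> and \<open>a + w\<close> are related
  by the exponential factor shown, up to a constant; summed over the atoms meeting the tail set this
  is the exponential Chebyshev inequality. The sign of \<open>w\<close> selects the upper or the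
  lower tail. The comparison on atoms is exported for the change of measure in the lower
  bound.\<close>

lemma tail:
 obtains D where "D > 0" "!!n b. n >= 1 ==>
  measure (mu a) {x \<in> X. n * (w * b) <= w * Ps n x} <= D * exp (n * (P (a + w) - P a - w * b))"
  and "!!n bt v. n >= 1 ==> Ph.atoms n bt ==> v \<in> bt ` X ==>
   measure (mu a) (bt -` {v} \<inter> X) <= D * exp (n * (P (a + w) - P a) - w * Ps n v) * measure (mu (a + w)) (bt -` {v} \<inter> X)"
proof -
 obtain D1 where D1: "D1 > 0" "!!(n::nat) bt v. n >= 1 ==> Ph.atoms n bt ==> v \<in> bt ` X ==>
  measure (mu a) (bt -` {v} \<inter> X) <= D1 * exp (seq_comb Ph a Ps n v - n * P a)"
  by (rule gibbs_measure.atom_upper[OF gibbs_measure_t[of a]], rule that)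
 obtain D2 where D2: "D2 > 0" "!!(n::nat) bt v. n >= 1 ==> Ph.atoms n bt ==> v \<in> bt ` X ==>
  exp (seq_comb Ph (a + w) Ps n v - n * P (a + w)) <= D2 * measure (mu (a + w)) (bt -` {v} \<inter> X)"
  by (rule gibbs_measure.atom_lower[OF gibbs_measure_t[of "a + w"]], rule that)
 have cmp: "measure (mu a) (bt -` {v} \<inter> X)
   <= D1 * D2 * exp (n * (P (a + w) - P a) - w * Ps n v) * measure (mu (a + w)) (bt -` {v} \<inter> X)"
  if n: "n >= 1" and bt: "Ph.atoms n bt" "v \<in> bt ` X" for n bt v
 proof -
  have "measure (mu a) (bt -` {v} \<inter> X) <= D1 * exp (seq_comb Ph a Ps n v - n * P a)" by (rule D1(2)[OF n bt])
  also have "seq_comb Ph a Ps n v - n * P a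
    = (n * (P (a + w) - P a) - w * Ps n v) + (seq_comb Ph (a + w) Ps n v - n * P (a + w))"
   by (simp add: seq_comb_def algebra_simps)
  also have "D1 * exp \<dots> = D1 * exp (n * (P (a + w) - P a) - w * Ps n v) * exp (seq_comb Ph (a + w) Ps n v - n * P (a + w))"
   by (simp add: exp_add)
  also have "\<dots> <= D1 * exp (n * (P (a + w) - P a) - w * Ps n v) * (D2 * measure (mu (a + w)) (bt -` {v} \<inter> X))"
   using D1(1) D2(2)[OF n bt] by (intro mult_left_mono) auto
  finally show ?thesis by (simp add: mult_ac)
 qed
 \<comment> \<open>The extra factor pays for replacing \<open>Ps n x\<close> by its value at the
   point naming the atom of \<open>x\<close>.\<close>
 define D where "D = D1 * D2 * exp (\<bar>w\<bar> * K)"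
 have Dpos: "D > 0" using D1 D2 by (simp add: D_def)
 have "D1 * D2 * 1 <= D" unfolding D_def using D1(1) D2(1) Ph.K_nonneg by (intro mult_left_mono) auto
 then have cmp': "measure (mu a) (bt -` {v} \<inter> X)
   <= D * exp (n * (P (a + w) - P a) - w * Ps n v) * measure (mu (a + w)) (bt -` {v} \<inter> X)"
  if n: "n >= 1" and bt: "Ph.atoms n bt" "v \<in> bt ` X" for n bt v
  by (intro order_trans[OF cmp[OF that]] mult_right_mono) auto
 have "measure (mu a) {x \<in> X. n * (w * b) <= w * Ps n x} <= D * exp (n * (P (a + w) - P a - w * b))"
  if n: "n >= 1" for n b
 proof -
  note pa = Ph.invariant_prob_on[OF mu_t_inv[of a]] and pb = Ph.invariant_prob_on[OF mu_t_inv[of "a + w"]]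
  interpret a: prob_space "mu a" using Ph.prob_onD(1)[OF pa] .
  interpret b: prob_space "mu (a + w)" using Ph.prob_onD(1)[OF pb] .
  have sp: "space (mu a) = X" "space (mu (a + w)) = X" using Ph.prob_onD(2) pa pb by auto
  define G where "G = {x \<in> X. n * (w * b) <= w * Ps n x}"
  obtain bt where bt: "Ph.atoms n bt" by (rule Ph.atoms_exist)
  note s = Ph.atomsD(7)[OF bt pa] Ph.atomsD(7)[OF bt pb]
  have GX: "G \<subseteq> X" by (auto simp: G_def)
  have finS: "finite (bt ` G)" using Ph.atomsD(1)[OF bt] GX by (meson finite_subset image_mono)
  have "measure (mu a) G <= measure (mu a) (bt -` (bt ` G) \<inter> X)"
   using GX simple_functionD(2)[OF s(1), of "bt ` G"] by (intro a.finite_measure_mono) (auto simp: sp)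
  also have "\<dots> = (\<Sum>v\<in>bt ` G. measure (mu a) (bt -` {v} \<inter> X))"
   using a.prob_vimage_finite[OF s(1) finS] by (simp add: sp)
  also have "\<dots> <= (\<Sum>v\<in>bt ` G. D * exp (n * (P (a + w) - P a - w * b)) * measure (mu (a + w)) (bt -` {v} \<inter> X))"
  proof (rule sum_mono)
   fix v assume "v \<in> bt ` G"
   then obtain x where x: "x \<in> G" "v = bt x" by blast
   have vX: "v \<in> bt ` X" using x GX by blast
   have "\<bar>Ps n v - Ps n x\<bar> <= K" using Ps.atom_dist[OF bt n, of x] x GX by auto
   then have "\<bar>w\<bar> * \<bar>Ps n v - Ps n x\<bar> <= \<bar>w\<bar> * K" by (intro mult_left_mono) auto
   then have "\<bar>w * Ps n v - w * Ps n x\<bar> <= \<bar>w\<bar> * K" by (simp add: abs_mult[symmetric] right_diff_distrib)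
   moreover have "n * (w * b) <= w * Ps n x" using x(1) by (simp add: G_def)
   ultimately have "n * (w * b) - \<bar>w\<bar> * K <= w * Ps n v" by linarith
   then have ex: "n * (P (a + w) - P a) - w * Ps n v <= \<bar>w\<bar> * K + n * (P (a + w) - P a - w * b)"
    by (simp add: algebra_simps)
   have "measure (mu a) (bt -` {v} \<inter> X)
     <= D1 * D2 * exp (n * (P (a + w) - P a) - w * Ps n v) * measure (mu (a + w)) (bt -` {v} \<inter> X)"
    by (rule cmp[OF n bt vX])
   also have "\<dots> <= D1 * D2 * exp (\<bar>w\<bar> * K + n * (P (a + w) - P a - w * b)) * measure (mu (a + w)) (bt -` {v} \<inter> X)"
    using ex D1(1) D2(1) by (intro mult_right_mono mult_left_mono) auto
   finally show "measure (mu a) (bt -` {v} \<inter> X)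
     <= D * exp (n * (P (a + w) - P a - w * b)) * measure (mu (a + w)) (bt -` {v} \<inter> X)"
    by (simp add: D_def exp_add mult_ac)
  qed
  also have "\<dots> = D * exp (n * (P (a + w) - P a - w * b)) * measure (mu (a + w)) (bt -` (bt ` G) \<inter> X)"
   using b.prob_vimage_finite[OF s(2) finS] by (simp add: sp sum_distrib_left)
  also have "\<dots> <= D * exp (n * (P (a + w) - P a - w * b)) * 1"
   using Dpos by (intro mult_left_mono) auto
  finally show ?thesis by (simp add: G_def)
 qed
 then show ?thesis by (rule that[OF Dpos _ cmp'])
qed

end

section \<open>Exponential bounds for the deviations\<close>

context gibbs_family
begin

lemma exp_eventually_small:
 fixes D ka e :: real
 assumes "ka > 0" "e > 0"
 shows "\<forall>\<^sub>F n in sequentially. D * exp (real n * - ka) < e"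
proof -
 have "(%n. D * exp (real n * - ka)) \<longlonglongrightarrow> 0" using assms(1) by real_asymp
 then show ?thesis using assms(2) by (rule order_tendstoD)
qed

text \<open>A law of large numbers drawn from \<open>tail\<close> instead of an ergodic theorem: for
  a suitable tilt in either direction the slope has moved by less than \<open>dl\<close>, so the
  exponent is strictly negative. Each of the two tails eventually has mass below a quarter.\<close>

lemma concentration:
 fixes dl :: real
 assumes dl: "dl > 0"
 shows "\<forall>\<^sub>F n in sequentially. 1 / 2 <= measure (mu t) {x \<in> X. \<bar>Ps n x - n * slope t\<bar> < n * dl}"
proof -
 note pt = Ph.invariant_prob_on[OF mu_t_inv[of t]]
 interpret t: prob_space "mu t" using Ph.prob_onD(1)[OF pt] .
 have sp: "space (mu t) = X" using Ph.prob_onD(2) pt by auto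
 have side: "\<forall>\<^sub>F n in sequentially. measure (mu t) {x \<in> X. n * dl <= sg * (Ps n x - n * slope t)} < 1 / 4"
  if sg: "sg = 1 \<or> sg = - 1" for sg :: real
 proof -
  have sg2: "sg * sg = 1" using sg by auto
  have sg0: "sg \<noteq> 0" using sg by auto
  obtain u where u: "u > 0" "\<bar>slope (t + u * sg) - slope t\<bar> < dl"
   by (rule slope_near[OF dl sg0], rule that)
  let ?w = "u * sg" and ?b = "slope t + sg * dl"
  obtain D where D: "D > 0" "!!n b. n >= 1 ==>
   measure (mu t) {x \<in> X. n * (?w * b) <= ?w * Ps n x} <= D * exp (n * (P (t + ?w) - P t - ?w * b))"
   by (rule tail[of t ?w], rule that)
  \<comment> \<open>By the subgradient inequality at \<open>t + ?w\<close> the exponent in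
    \<open>tail\<close> is at most \<open>- ka\<close>; the choice of \<open>u\<close> makes
    \<open>ka\<close> positive.\<close>
  define ka where "ka = u * (dl - sg * (slope (t + ?w) - slope t))"
  have "sg * (slope (t + ?w) - slope t) < dl" using sg u(2) by auto
  then have ka: "ka > 0" unfolding ka_def using u(1) by (intro mult_pos_pos) auto
  have "P (t + ?w) - P t <= ?w * slope (t + ?w)" using subgradient[of "t + ?w" t] by simp
  then have "P (t + ?w) - P t - ?w * ?b <= ?w * slope (t + ?w) - ?w * ?b" by simp
  also have "\<dots> = - ka" using sg2 by (simp add: ka_def algebra_simps)
  finally have ex: "P (t + ?w) - P t - ?w * ?b <= - ka" .
  have bound: "measure (mu t) {x \<in> X. n * dl <= sg * (Ps n x - n * slope t)} <= D * exp (real n * - ka)" if n: "n >= 1" for n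
  proof -
   have "n * (?w * ?b) <= ?w * Ps n x" if "n * dl <= sg * (Ps n x - n * slope t)" for x
   proof -
    have "u * (n * dl) <= u * (sg * (Ps n x - n * slope t))" using that u(1) by (intro mult_left_mono) auto
    moreover have "n * (?w * ?b) = u * (n * (sg * slope t)) + u * (n * dl) * (sg * sg)"
     by (simp only: distrib_left mult_ac)
    then have "n * (?w * ?b) = u * (n * (sg * slope t)) + u * (n * dl)" unfolding sg2 by simp
    ultimately show ?thesis by (simp only: right_diff_distrib mult_ac)
   qed
   then have sub: "{x \<in> X. n * dl <= sg * (Ps n x - n * slope t)} \<subseteq> {x \<in> X. n * (?w * ?b) <= ?w * Ps n x}" by blast
   have "closed {x \<in> X. n * (?w * ?b) <= ?w * Ps n x}"
    by (intro continuous_on_closed_Collect_le continuous_intros Ps.potential_cont[OF n] Ph.closed_X)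
   then have "{x \<in> X. n * (?w * ?b) <= ?w * Ps n x} \<in> t.events"
    by (intro Ph.sets_prob_on[OF pt, THEN iffD2] conjI borel_closed Collect_restrict)
   then have "measure (mu t) {x \<in> X. n * dl <= sg * (Ps n x - n * slope t)} <= measure (mu t) {x \<in> X. n * (?w * ?b) <= ?w * Ps n x}"
    by (rule t.finite_measure_mono[OF sub])
   also have "\<dots> <= D * exp (n * (P (t + ?w) - P t - ?w * ?b))" by (rule D(2)[OF n])
   also have "\<dots> <= D * exp (real n * - ka)" using D(1) mult_left_mono[OF ex, of "real n"] by (intro mult_left_mono) auto
   finally show ?thesis .
  qed
  have "\<forall>\<^sub>F n in sequentially. D * exp (real n * - ka) < 1 / 4" using ka by (intro exp_eventually_small) auto
  then show ?thesis using eventually_ge_at_top[of 1] by eventually_elim (use bound in \<open>force intro: le_less_trans\<close>)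
 qed
 have "\<forall>\<^sub>F n in sequentially. measure (mu t) {x \<in> X. n * dl <= 1 * (Ps n x - n * slope t)} < 1 / 4" by (rule side) simp
 moreover have "\<forall>\<^sub>F n in sequentially. measure (mu t) {x \<in> X. n * dl <= - 1 * (Ps n x - n * slope t)} < 1 / 4" by (rule side) simp
 ultimately show ?thesis using eventually_ge_at_top[of 1]
 proof eventually_elim
  case (elim n)
  let ?G = "{x \<in> X. \<bar>Ps n x - n * slope t\<bar> < n * dl}"
  let ?A = "{x \<in> X. n * dl <= 1 * (Ps n x - n * slope t)}" and ?B = "{x \<in> X. n * dl <= - 1 * (Ps n x - n * slope t)}"
  have "closed ?A" "closed ?B"
   by (intro continuous_on_closed_Collect_le continuous_intros Ps.potential_cont[OF elim(3)] Ph.closed_X)+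
  then have ev: "?A \<in> t.events" "?B \<in> t.events" using Ph.sets_prob_on[OF pt] by auto
  have "?G = X - (?A \<union> ?B)" by auto
  then have "measure (mu t) ?G = 1 - measure (mu t) (?A \<union> ?B)"
   using t.prob_compl[of "?A \<union> ?B"] ev by (simp only: sp sets.Un)
  moreover have "measure (mu t) (?A \<union> ?B) <= measure (mu t) ?A + measure (mu t) ?B" using ev by (rule measure_Un_le)
  ultimately show ?case using elim(1,2) by linarith
 qed
qed

text \<open>Change of measure: at least half of the mass of \<open>mu t\<close> eventually sits
  where \<open>Ps n / n\<close> is near \<open>slope t\<close>, and passing to \<open>mu 0\<close>
  on the atoms there costs the Legendre transform at this slope, up to an arbitrarily small
  exponential rate.\<close>

theorem ldp_lower:
 fixes c :: real
 assumes E: "open E" "slope t \<in> E" and c: "t * slope t - (P t - P 0) < c"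
 shows "\<forall>\<^sub>F n in sequentially. exp (- (n * c)) <= measure (mu 0) {x \<in> X. Ps n x / n \<in> E}"
proof -
 let ?s = "slope t" and ?I = "t * slope t - (P t - P 0)"
 note pt = Ph.invariant_prob_on[OF mu_t_inv[of t]] and p0 = Ph.invariant_prob_on[OF mu_t_inv[of 0]]
 interpret t: prob_space "mu t" using Ph.prob_onD(1)[OF pt] .
 interpret z: prob_space "mu 0" using Ph.prob_onD(1)[OF p0] .
 have sp: "space (mu t) = X" "space (mu 0) = X" using Ph.prob_onD(2) pt p0 by auto
 obtain d where d: "d > 0" "!!y. \<bar>y - ?s\<bar> < d ==> y \<in> E" using E unfolding open_dist dist_real_def by blast
 \<comment> \<open>\<open>d / 2\<close> leaves room in \<open>E\<close> for the variation within an
   atom; the second bound keeps the error \<open>\<bar>t\<bar> * dl\<close> of the tilt at most half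
   of the margin \<open>c - ?I\<close>.\<close>
 define dl where "dl = min (d / 2) ((c - ?I) / (2 * (\<bar>t\<bar> + 1)))"
 have dl: "dl > 0" using d(1) c by (simp add: dl_def)
 have td: "\<bar>t\<bar> * dl <= (c - ?I) / 2"
 proof -
  have "(\<bar>t\<bar> + 1) * dl <= (\<bar>t\<bar> + 1) * ((c - ?I) / (2 * (\<bar>t\<bar> + 1)))" by (intro mult_left_mono) (auto simp: dl_def)
  also have "\<dots> = (c - ?I) / 2" by (simp add: field_simps)
  finally show ?thesis using dl by (simp add: algebra_simps)
 qed
 obtain D where D: "D > 0" "!!(n::nat) bt v. n >= 1 ==> Ph.atoms n bt ==> v \<in> bt ` X ==>
   measure (mu t) (bt -` {v} \<inter> X) <= D * exp (n * (P (t + - t) - P t) - - t * Ps n v) * measure (mu (t + - t)) (bt -` {v} \<inter> X)"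
  by (rule tail[of t "- t"], rule that)
 define D' where "D' = D * exp (\<bar>t\<bar> * K)"
 have D': "D' > 0" using D(1) by (simp add: D'_def)
 have key: "1 / 2 <= D' * exp (n * (?I + \<bar>t\<bar> * dl)) * measure (mu 0) {x \<in> X. Ps n x / n \<in> E}"
  if n: "n >= 1" and half: "1 / 2 <= measure (mu t) {x \<in> X. \<bar>Ps n x - n * ?s\<bar> < n * dl}" and big: "2 * K <= n * dl" for n
 proof -
  define G where "G = {x \<in> X. \<bar>Ps n x - n * ?s\<bar> < n * dl}"
  obtain bt where bt: "Ph.atoms n bt" by (rule Ph.atoms_exist)
  note s = Ph.atomsD(7)[OF bt pt] Ph.atomsD(7)[OF bt p0]
  have GX: "G \<subseteq> X" by (auto simp: G_def)
  have finS: "finite (bt ` G)" using Ph.atomsD(1)[OF bt] GX by (meson finite_subset image_mono)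
  let ?U = "bt -` (bt ` G) \<inter> X"
  have U: "?U \<in> t.events" "?U \<in> z.events"
   using simple_functionD(2)[OF s(1), of "bt ` G"] simple_functionD(2)[OF s(2), of "bt ` G"] by (auto simp: sp)
  have UE: "?U \<subseteq> {x \<in> X. Ps n x / n \<in> E}"
  proof
   fix x assume "x \<in> ?U"
   then obtain y where y: "x \<in> X" "y \<in> G" "bt x = bt y" by auto
   have "\<bar>Ps n (bt x) - Ps n x\<bar> <= K" "\<bar>Ps n (bt y) - Ps n y\<bar> <= K"
    using Ps.atom_dist[OF bt n y(1)] Ps.atom_dist[OF bt n, of y] y(2) GX by auto
   moreover have "\<bar>Ps n y - n * ?s\<bar> < n * dl" using y(2) by (simp add: G_def)
   ultimately have "\<bar>Ps n x - n * ?s\<bar> < n * (2 * dl)" using y(3) big by simp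
   moreover have "n * (2 * dl) <= n * d" by (intro mult_left_mono) (auto simp: dl_def)
   ultimately have "\<bar>Ps n x - n * ?s\<bar> < n * d" by linarith
   moreover have "Ps n x / n - ?s = (Ps n x - n * ?s) / n" using n by (simp add: field_simps)
   ultimately have "\<bar>Ps n x / n - ?s\<bar> < d" using n by (simp add: abs_divide field_simps)
   then show "x \<in> {x \<in> X. Ps n x / n \<in> E}" using d(2) y(1) by simp
  qed
  have Eev: "{x \<in> X. Ps n x / n \<in> E} \<in> z.events"
  proof -
   have "(%x. Ps n x / n) \<in> borel_measurable (mu 0)"
    using n by (intro Ph.continuous_measurable[OF p0] continuous_intros Ps.potential_cont) auto
   from measurable_sets[OF this, of E] E(1) show ?thesis by (simp add: sp vimage_def Int_def conj_commute)
  qed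
  have "1 / 2 <= measure (mu t) ?U"
  proof -
   have "G \<subseteq> ?U" using GX by blast
   then show ?thesis using half t.finite_measure_mono[OF _ U(1), of G] unfolding G_def[symmetric] by linarith
  qed
  also have "\<dots> = (\<Sum>v\<in>bt ` G. measure (mu t) (bt -` {v} \<inter> X))"
   using t.prob_vimage_finite[OF s(1) finS] by (simp add: sp)
  also have "\<dots> <= (\<Sum>v\<in>bt ` G. D' * exp (n * (?I + \<bar>t\<bar> * dl)) * measure (mu 0) (bt -` {v} \<inter> X))"
  proof (rule sum_mono)
   fix v assume "v \<in> bt ` G"
   then obtain x where x: "x \<in> G" "v = bt x" by blast
   have vX: "v \<in> bt ` X" using x GX by blast
   have "\<bar>Ps n v - Ps n x\<bar> <= K" using Ps.atom_dist[OF bt n, of x] x GX by auto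
   moreover have "\<bar>Ps n x - n * ?s\<bar> < n * dl" using x(1) by (simp add: G_def)
   ultimately have "\<bar>Ps n v - n * ?s\<bar> <= n * dl + K" by linarith
   then have "\<bar>t\<bar> * \<bar>Ps n v - n * ?s\<bar> <= \<bar>t\<bar> * (n * dl + K)" by (intro mult_left_mono) auto
   then have "\<bar>t * (Ps n v - n * ?s)\<bar> <= \<bar>t\<bar> * (n * dl + K)" by (simp add: abs_mult)
   then have "t * (Ps n v - n * ?s) <= \<bar>t\<bar> * (n * dl + K)" by linarith
   then have ex: "n * (P 0 - P t) + t * Ps n v <= \<bar>t\<bar> * K + n * (?I + \<bar>t\<bar> * dl)" by (simp add: algebra_simps)
   have "measure (mu t) (bt -` {v} \<inter> X) <= D * exp (n * (P 0 - P t) + t * Ps n v) * measure (mu 0) (bt -` {v} \<inter> X)"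
    using D(2)[OF n bt vX] by simp
   also have "\<dots> <= D * exp (\<bar>t\<bar> * K + n * (?I + \<bar>t\<bar> * dl)) * measure (mu 0) (bt -` {v} \<inter> X)"
    using ex D(1) by (intro mult_right_mono mult_left_mono) auto
   finally show "measure (mu t) (bt -` {v} \<inter> X) <= D' * exp (n * (?I + \<bar>t\<bar> * dl)) * measure (mu 0) (bt -` {v} \<inter> X)"
    by (simp add: D'_def exp_add mult_ac)
  qed
  also have "\<dots> = D' * exp (n * (?I + \<bar>t\<bar> * dl)) * measure (mu 0) ?U"
   using z.prob_vimage_finite[OF s(2) finS] by (simp add: sp sum_distrib_left)
  also have "\<dots> <= D' * exp (n * (?I + \<bar>t\<bar> * dl)) * measure (mu 0) {x \<in> X. Ps n x / n \<in> E}"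
   using D' z.finite_measure_mono[OF UE Eev] by (intro mult_left_mono) auto
  finally show ?thesis .
 qed
 have gap: "(c - ?I) / 2 > 0" using c by simp
 have ev1: "\<forall>\<^sub>F n in sequentially. D' * exp (real n * - ((c - ?I) / 2)) < 1 / 2"
  using gap by (intro exp_eventually_small) auto
 have ev2: "\<forall>\<^sub>F n in sequentially. 2 * K <= real n * dl" using dl by real_asymp
 show ?thesis using concentration[OF dl, of t] ev1 ev2 eventually_ge_at_top[of 1]
 proof eventually_elim
  case (elim n)
  let ?m = "measure (mu 0) {x \<in> X. Ps n x / n \<in> E}"
  have "D' * exp (real n * - ((c - ?I) / 2)) <= D' * exp (n * (?I + \<bar>t\<bar> * dl)) * ?m"
   using key[OF elim(4,1,3)] elim(2) by linarith
  then have "exp (real n * - ((c - ?I) / 2)) <= exp (n * (?I + \<bar>t\<bar> * dl)) * ?m" using D' by (simp add: mult.assoc)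
  also have "\<dots> <= exp (n * (?I + (c - ?I) / 2)) * ?m"
   using td by (intro mult_right_mono) (auto intro!: mult_left_mono)
  finally have le: "exp (real n * - ((c - ?I) / 2)) <= exp (n * (?I + (c - ?I) / 2)) * ?m" .
  have "exp (- (n * c)) = exp (- (n * (?I + (c - ?I) / 2))) * exp (real n * - ((c - ?I) / 2))"
   unfolding exp_add[symmetric] by (rule arg_cong[where f = exp]) (simp add: field_simps)
  also have "\<dots> <= exp (- (n * (?I + (c - ?I) / 2))) * (exp (n * (?I + (c - ?I) / 2)) * ?m)"
   using le by (intro mult_left_mono) auto
  also have "\<dots> = ?m" by (simp add: exp_minus)
  finally show ?case .
 qed
qed

text \<open>On each side of the mean \<open>slope 0\<close> only the nearest point \<open>b\<close>
  of \<open>F\<close> matters. A tilt that beats \<open>c >= 0\<close> at \<open>b\<close> points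
  away from the mean, so the half-line it controls contains the whole part of \<open>F\<close> on
  that side. For \<open>c < 0\<close> the bound 1 on probabilities suffices.\<close>

theorem ldp_upper:
 fixes c :: real
 assumes F: "closed F" and c: "!!b. b \<in> F ==> \<exists>w. w * b - (P w - P 0) > c"
 shows "\<exists>D>0. \<forall>n\<ge>1. measure (mu 0) {x \<in> X. Ps n x / n \<in> F} <= D * exp (- (n * c))"
proof (cases "c < 0")
 case True
 interpret z: prob_space "mu 0" using Ph.prob_onD(1)[OF Ph.invariant_prob_on[OF mu_t_inv]] .
 have "measure (mu 0) {x \<in> X. Ps n x / n \<in> F} <= 1 * exp (- (n * c))" for n
 proof -
  have "(1::real) <= exp (- (n * c))" using True by (simp add: mult_nonneg_nonpos)
  then show ?thesis using z.prob_le_1[of "{x \<in> X. Ps n x / n \<in> F}"] unfolding mult_1 by linarith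
 qed
 then show ?thesis by (intro exI[of _ 1]) auto
next
 case False
 note p0 = Ph.invariant_prob_on[OF mu_t_inv[of 0]]
 interpret z: prob_space "mu 0" using Ph.prob_onD(1)[OF p0] .
 have sp: "space (mu 0) = X" using Ph.prob_onD(2) p0 by auto
 let ?m = "slope 0"
 have meas: "{x \<in> X. Ps n x / n \<in> H} \<in> z.events" if "n >= 1" "closed H" for n H
 proof -
  have "(%x. Ps n x / n) \<in> borel_measurable (mu 0)"
   using that by (intro Ph.continuous_measurable[OF p0] continuous_intros Ps.potential_cont) auto
  from measurable_sets[OF this, of H] that(2) show ?thesis by (simp add: sp vimage_def Int_def conj_commute)
 qed
 have side: "\<exists>D>0. \<forall>n\<ge>1. measure (mu 0) {x \<in> X. Ps n x / n \<in> {y \<in> F. sg * ?m <= sg * y}} <= D * exp (- (n * c))"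
  if sg: "sg = 1 \<or> sg = - 1" for sg :: real
 proof (cases "{y \<in> F. sg * ?m <= sg * y} = {}")
  case True
  then show ?thesis by (intro exI[of _ 1]) (simp only: empty_iff, simp)
 next
  case ne: False
  have sg2: "sg * sg = 1" using sg by auto
  define H where "H = {z. sg * z \<in> F} \<inter> {sg * ?m..}"
  have Hcl: "closed H"
   unfolding H_def
  proof (intro closed_Int closed_atLeast)
   have "closed ((%z. sg * z) -` F)" by (rule closed_vimage[OF F]) (intro continuous_intros)
   then show "closed {z. sg * z \<in> F}" by (simp add: vimage_def)
  qed
  obtain y where y: "y \<in> F" "sg * ?m <= sg * y" using ne by blast
  have invsg: "sg * (sg * z) = z" for z using sg2 by (simp add: mult.assoc[symmetric])
  have "sg * y \<in> H" using y by (simp add: H_def invsg)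
  then have Hne: "H \<noteq> {}" by blast
  have Hbd: "bdd_below H" unfolding H_def by (intro bdd_belowI[of _ "sg * ?m"]) auto
  define b where "b = sg * Inf H"
  have InfH: "Inf H \<in> H" by (rule closed_contains_Inf[OF Hne Hbd Hcl])
  have bF: "b \<in> F" and bm: "sg * ?m <= sg * b" using InfH by (auto simp: b_def H_def invsg)
  obtain w where w: "w * b - (P w - P 0) > c" using c[OF bF] by blast
  \<comment> \<open>At the mean no tilt gains anything, while at \<open>b\<close> this one gains
    more than \<open>c >= 0\<close>; hence \<open>w\<close> points from the mean towards
    \<open>b\<close>.\<close>
  have "w * ?m <= P w - P 0" using subgradient[of 0 w] by simp
  then have "w * b - w * ?m > 0" using w False by linarith
  then have "(sg * w) * (sg * b - sg * ?m) > 0"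
  proof -
   have "(sg * w) * (sg * b - sg * ?m) = (sg * sg) * (w * b - w * ?m)" by (simp add: algebra_simps)
   then show ?thesis using sg2 \<open>w * b - w * ?m > 0\<close> by simp
  qed
  then have sgw: "sg * w > 0" using bm by (simp add: zero_less_mult_iff)
  obtain D where D: "D > 0" "!!n b. n >= 1 ==>
   measure (mu 0) {x \<in> X. n * (w * b) <= w * Ps n x} <= D * exp (n * (P (0 + w) - P 0 - w * b))"
   by (rule tail[of 0 w], rule that)
  have "measure (mu 0) {x \<in> X. Ps n x / n \<in> {y \<in> F. sg * ?m <= sg * y}} <= D * exp (- (n * c))" if n: "n >= 1" for n
  proof -
   have sub: "{x \<in> X. Ps n x / n \<in> {y \<in> F. sg * ?m <= sg * y}} \<subseteq> {x \<in> X. n * (w * b) <= w * Ps n x}"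
   proof
    fix x assume x: "x \<in> {x \<in> X. Ps n x / n \<in> {y \<in> F. sg * ?m <= sg * y}}"
    define y where "y = Ps n x / n"
    have y: "y \<in> F" "sg * ?m <= sg * y" using x by (auto simp: y_def)
    then have "sg * y \<in> H" by (simp add: H_def invsg)
    then have "Inf H <= sg * y" using Hbd by (rule cInf_lower)
    then have "(sg * w) * Inf H <= (sg * w) * (sg * y)" using sgw by (intro mult_left_mono) auto
    then have "w * b <= w * (sg * (sg * y))" by (simp add: b_def mult_ac)
    then have "w * b <= w * y" by (simp add: invsg)
    then have "n * (w * b) <= n * (w * y)" by (rule mult_left_mono) simp
    also have "\<dots> = w * Ps n x" using n by (simp add: y_def)
    finally show "x \<in> {x \<in> X. n * (w * b) <= w * Ps n x}" using x by simp
   qed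
   have "closed {x \<in> X. n * (w * b) <= w * Ps n x}"
    by (intro continuous_on_closed_Collect_le continuous_intros Ps.potential_cont[OF n] Ph.closed_X)
   then have "{x \<in> X. n * (w * b) <= w * Ps n x} \<in> z.events" using Ph.sets_prob_on[OF p0] by auto
   then have "measure (mu 0) {x \<in> X. Ps n x / n \<in> {y \<in> F. sg * ?m <= sg * y}} <= measure (mu 0) {x \<in> X. n * (w * b) <= w * Ps n x}"
    by (rule z.finite_measure_mono[OF sub])
   also have "\<dots> <= D * exp (n * (P (0 + w) - P 0 - w * b))" by (rule D(2)[OF n])
   also have "\<dots> <= D * exp (- (n * c))"
   proof -
    have "n * (P (0 + w) - P 0 - w * b) <= n * (- c)" using w by (intro mult_left_mono) auto
    then show ?thesis using D(1) by (intro mult_left_mono) auto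
   qed
   finally show ?thesis .
  qed
  then show ?thesis using D(1) by blast
 qed
 obtain D1 where D1: "D1 > 0" "!!n. n >= 1 ==> measure (mu 0) {x \<in> X. Ps n x / n \<in> {y \<in> F. 1 * ?m <= 1 * y}} <= D1 * exp (- (n * c))"
  using side[of 1] by auto
 obtain D2 where D2: "D2 > 0" "!!n. n >= 1 ==> measure (mu 0) {x \<in> X. Ps n x / n \<in> {y \<in> F. - 1 * ?m <= - 1 * y}} <= D2 * exp (- (n * c))"
  using side[of "- 1"] by auto
 have "measure (mu 0) {x \<in> X. Ps n x / n \<in> F} <= (D1 + D2) * exp (- (n * c))" if n: "n >= 1" for n
 proof -
  let ?A = "{x \<in> X. Ps n x / n \<in> {y \<in> F. 1 * ?m <= 1 * y}}" and ?B = "{x \<in> X. Ps n x / n \<in> {y \<in> F. - 1 * ?m <= - 1 * y}}"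
  have cl: "closed {y \<in> F. sg * ?m <= sg * y}" for sg
   using F by (intro continuous_on_closed_Collect_le continuous_intros)
  have "{x \<in> X. Ps n x / n \<in> F} = ?A \<union> ?B" by auto
  then have "measure (mu 0) {x \<in> X. Ps n x / n \<in> F} <= measure (mu 0) ?A + measure (mu 0) ?B"
   using measure_Un_le[OF meas[OF n cl[of 1]] meas[OF n cl[of "- 1"]]] by (simp only:)
  then show ?thesis using D1(2)[OF n] D2(2)[OF n] by (simp add: algebra_simps)
 qed
 then show ?thesis using D1(1) D2(1) by (intro exI[of _ "D1 + D2"]) auto
qed

section \<open>The Legendre transform at the ends of the range of slopes\<close>

lemma legendre_attained: "w * slope t - (P w - P 0) <= t * slope t - (P t - P 0)"
 using subgradient[of t w] by (simp add: algebra_simps)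

text \<open>At \<open>t = sg * k\<close> the subgradient inequality and the bound \<open>R\<close>
  on the Legendre transform at \<open>s\<close> leave
  \<open>k * \<bar>s - slope t\<bar> <= R\<close>. So a point beyond all slopes whose Legendre
  transform is finite is an endpoint of their range.\<close>

lemma slope_limit:
 assumes sg: "sg = 1 \<or> sg = - 1" and s: "!!t. sg * slope t <= sg * s" and R: "!!w. w * s - (P w - P 0) <= R"
 shows "(%k. slope (sg * real k)) \<longlonglongrightarrow> s"
proof -
 have sg2: "sg * sg = 1" using sg by auto
 have "(%k. slope (sg * real k) - s) \<longlonglongrightarrow> 0"
 proof (rule Lim_null_comparison)
  show "(%k. R / real k) \<longlonglongrightarrow> 0" by (rule lim_const_over_n)
  show "\<forall>\<^sub>F k in sequentially. norm (slope (sg * real k) - s) <= R / real k"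
   using eventually_ge_at_top[of 1]
  proof eventually_elim
   case (elim k)
   let ?t = "sg * real k"
   have "P ?t - P 0 <= ?t * slope ?t" using subgradient[of ?t 0] by simp
   then have "?t * s - R <= ?t * slope ?t" using R[of ?t] by linarith
   then have "k * (sg * s - sg * slope ?t) <= R" by (simp add: algebra_simps)
   then have "sg * s - sg * slope ?t <= R / k" using elim by (simp add: field_simps)
   moreover have "\<bar>slope ?t - s\<bar> = sg * s - sg * slope ?t" using s[of ?t] sg by auto
   ultimately show ?case by simp
  qed
 qed
 then show ?thesis by (simp add: LIM_zero_iff)
qed

text \<open>
 At an endpoint of the range of slopes the infimum in the rate function is attained by a limit of
 the measures \<open>mu t\<close> as \<open>t \<rightarrow> \<plusminus>\<infinity>\<close>.
\<close>

lemma endpoint_measure: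
 assumes sg: "sg = 1 \<or> sg = - 1" and s: "!!t. sg * slope t <= sg * s" and R: "!!w. w * s - (P w - P 0) <= R"
 obtains nu where "nu \<in> inv_meas" "mpsi nu = s" "P 0 - Ph.ent nu - mphi nu <= R"
proof -
 let ?ts = "%k. sg * real k"
 obtain r nu where r: "strict_mono (r :: nat => nat)" "nu \<in> inv_meas"
  "(%k. mphi (mu (?ts (r k)))) \<longlonglongrightarrow> mphi nu" "(%k. slope (?ts (r k))) \<longlonglongrightarrow> mpsi nu"
  "!!c. Ph.ent nu < c ==> \<forall>\<^sub>F k in sequentially. Ph.ent (mu (?ts (r k))) < c"
  using limit_measure[of ?ts] by metis
 have "(%k. slope (?ts (r k))) \<longlonglongrightarrow> s"
  using LIMSEQ_subseq_LIMSEQ[OF slope_limit[OF sg s R] r(1)] by (simp add: comp_def)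
 with r(4) have m: "mpsi nu = s" by (rule LIMSEQ_unique)
 have low: "P 0 - R <= Ph.ent (mu (?ts k)) + mphi (mu (?ts k))" for k
 proof -
  have "k * (sg * slope (?ts k)) <= k * (sg * s)" by (rule mult_left_mono[OF s]) simp
  then have "?ts k * slope (?ts k) <= ?ts k * s" by (simp add: mult_ac)
  then show ?thesis using free_energy_eq_t[of "?ts k"] R[of "?ts k"] by linarith
 qed
 have "P 0 - R <= Ph.ent nu + mphi nu"
  using r low by (intro limit_free_energy[of nu "%k. ?ts (r k)" "%_. P 0 - R"]) auto
 then show ?thesis using r(2) m by (intro that[of nu]) auto
qed

text \<open>The free energy of \<open>nu\<close> bounds the Legendre transform at \<open>s\<close>,
  so \<open>slope_limit\<close> applies and the slopes enter \<open>E\<close>. As they stay on one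
  side of \<open>s\<close>, the transform at these slopes does not exceed the cost of
  \<open>nu\<close>.\<close>

lemma outside_slope:
 assumes sg: "sg = 1 \<or> sg = - 1" and s: "!!t. sg * slope t <= sg * s" and nu: "nu \<in> inv_meas" "mpsi nu = s"
  and E: "open E" "s \<in> E"
 obtains t where "slope t \<in> E" "t * slope t - (P t - P 0) <= P 0 - Ph.ent nu - mphi nu"
proof -
 let ?R = "P 0 - Ph.ent nu - mphi nu"
 have R: "w * s - (P w - P 0) <= ?R" for w using free_energy_le_t[OF nu(1), of w] nu(2) by simp
 have "\<forall>\<^sub>F k in sequentially. slope (sg * real k) \<in> E"
  using slope_limit[OF sg s R] E by (rule topological_tendstoD)
 then obtain k where k: "slope (sg * real k) \<in> E" by (auto simp: eventually_sequentially)
 have "k * (sg * slope (sg * k)) <= k * (sg * s)" by (rule mult_left_mono[OF s]) simp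
 then have "sg * k * slope (sg * k) <= sg * k * s" by (simp add: mult_ac)
 then show ?thesis using k R[of "sg * k"] by (intro that[of "sg * k"]) auto
qed

lemma rate_interval_slopes:
 "s \<in> rate_interval f X Ph Ps \<longleftrightarrow> (\<exists>a b. slope a < s \<and> s < slope b)"
 unfolding rate_interval_def the_equilibrium_t by (auto simp: INF_less_iff less_SUP_iff)

lemma variational_rate:
 "(INF nu\<in>{nu \<in> inv_meas. mpsi nu = s}. Ptop f X Ph - metric_entropy f nu - ereal (mphi nu))
  = (INF nu\<in>{nu \<in> inv_meas. mpsi nu = s}. ereal (P 0 - Ph.ent nu - mphi nu))"
 using Ptop_t[of 0] by (intro INF_cong) (auto simp: comb_0 Ph.entropy_finite(1))

text \<open>
 Admissible functions change the pressure at \<open>u\<close> by at most \<open>ep (1 + \<bar>u\<bar>)\<close>; for \<open>s\<close> between two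
 slopes the Legendre transform is coercive, so that this is harmless for small \<open>ep\<close>.
\<close>

lemma function_rate_tendsto:
 assumes F: "!!e nu. 0 < e ==> e < 1 ==> nu \<in> inv_meas ==> integrable nu (F e) \<and> \<bar>(\<integral>x. F e x \<partial>nu) - mphi nu\<bar> <= e"
  and G: "!!e nu. 0 < e ==> e < 1 ==> nu \<in> inv_meas ==> integrable nu (G e) \<and> \<bar>(\<integral>x. G e x \<partial>nu) - mpsi nu\<bar> <= e"
  and ab: "slope a < s" "s < slope b" and t: "slope t = s"
 shows "((%e. function_rate f X (F e) (G e) s) \<longlongrightarrow> ereal (t * s - (P t - P 0))) (at_right 0)"
proof -
 let ?L = "t * s - (P t - P 0)"
 \<comment> \<open>\<open>ka\<close> bounds from below the rate at which
   \<open>s * u - (P u - P 0)\<close> decreases outside the interval from \<open>a\<close> to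
   \<open>b\<close>, so an error \<open>e * \<bar>u\<bar>\<close> with \<open>e < ka\<close> is
   absorbed there. The entry \<open>1 / 2\<close> keeps \<open>e\<close> below 1, where the
   assumptions on \<open>F\<close> and \<open>G\<close> apply.\<close>
 define ka where "ka = min (min (s - slope a) (slope b - s)) (1 / 2)"
 have ka: "ka > 0" "ka <= s - slope a" "ka <= slope b - s" "ka < 1" using ab by (auto simp: ka_def)
 define c where "c = \<bar>a\<bar> + \<bar>b\<bar>"
 have press: "\<exists>p. pressure f X (%x. F e x + u * G e x) = ereal p \<and> \<bar>p - P u\<bar> <= e * (1 + \<bar>u\<bar>)"
  if e: "0 < e" "e < 1" for e u
 proof -
  have near: "\<bar>(Ph.ent nu + (\<integral>x. F e x + u * G e x \<partial>nu)) - (Ph.ent nu + mphi nu + u * mpsi nu)\<bar> <= e * (1 + \<bar>u\<bar>)"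
   if nu: "nu \<in> inv_meas" for nu
  proof -
   have "(\<integral>x. F e x + u * G e x \<partial>nu) = (\<integral>x. F e x \<partial>nu) + u * (\<integral>x. G e x \<partial>nu)"
    using F[OF e nu] G[OF e nu] by simp
   moreover have "\<bar>((\<integral>x. F e x \<partial>nu) - mphi nu) + u * ((\<integral>x. G e x \<partial>nu) - mpsi nu)\<bar> <= e + \<bar>u\<bar> * e"
   proof (rule order_trans[OF abs_triangle_ineq])
    show "\<bar>(\<integral>x. F e x \<partial>nu) - mphi nu\<bar> + \<bar>u * ((\<integral>x. G e x \<partial>nu) - mpsi nu)\<bar> <= e + \<bar>u\<bar> * e"
     unfolding abs_mult using F[OF e nu] G[OF e nu] by (intro add_mono mult_left_mono) auto
   qed
   ultimately show ?thesis by (simp add: algebra_simps)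
  qed
  have up: "pressure f X (%x. F e x + u * G e x) <= ereal (P u + e * (1 + \<bar>u\<bar>))"
   unfolding pressure_def
  proof (rule SUP_least)
   fix nu assume nu: "nu \<in> inv_meas"
   have "Ph.ent nu + (\<integral>x. F e x + u * G e x \<partial>nu) <= P u + e * (1 + \<bar>u\<bar>)"
    using near[OF nu] free_energy_le_t[OF nu, of u] by linarith
   then show "metric_entropy f nu + ereal (\<integral>x. F e x + u * G e x \<partial>nu) <= ereal (P u + e * (1 + \<bar>u\<bar>))"
    by (simp add: Ph.entropy_finite(1)[OF nu])
  qed
  have lo: "ereal (P u - e * (1 + \<bar>u\<bar>)) <= pressure f X (%x. F e x + u * G e x)"
   unfolding pressure_def
  proof (rule SUP_upper2[OF mu_t_inv[of u]])
   have "P u - e * (1 + \<bar>u\<bar>) <= Ph.ent (mu u) + (\<integral>x. F e x + u * G e x \<partial>mu u)"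
    using near[OF mu_t_inv[of u]] free_energy_eq_t[of u] by linarith
   then show "ereal (P u - e * (1 + \<bar>u\<bar>)) <= metric_entropy f (mu u) + ereal (\<integral>x. F e x + u * G e x \<partial>mu u)"
    by (simp add: Ph.entropy_finite(1)[OF mu_t_inv])
  qed
  obtain p where p: "pressure f X (%x. F e x + u * G e x) = ereal p"
   using up lo by (cases "pressure f X (%x. F e x + u * G e x)") auto
  then show ?thesis using up lo by (auto simp: abs_le_iff)
 qed
 have bounds: "ereal (?L - e * (2 + \<bar>t\<bar>)) <= function_rate f X (F e) (G e) s \<and>
   function_rate f X (F e) (G e) s <= ereal (?L + e * (2 + c))" if e: "0 < e" "e < ka" for e
 proof -
  have e1: "e < 1" using e ka by linarith
  obtain p where p: "!!u. pressure f X (%x. F e x + u * G e x) = ereal (p u)" "!!u. \<bar>p u - P u\<bar> <= e * (1 + \<bar>u\<bar>)"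
   using press[OF e(1) e1] by metis
  have p0: "pressure f X (F e) = ereal (p 0)" using p(1)[of 0] by simp
  have fr: "function_rate f X (F e) (G e) s = (SUP u. ereal (s * u - (p u - p 0)))"
   unfolding function_rate_def free_energy_def p p0 by simp
  have d: "\<bar>(p u - p 0) - (P u - P 0)\<bar> <= e * (2 + \<bar>u\<bar>)" for u
  proof -
   have "e * (2 + \<bar>u\<bar>) = e * (1 + \<bar>u\<bar>) + e * (1 + \<bar>0\<bar>)" by (simp add: algebra_simps)
   then show ?thesis using p(2)[of u] p(2)[of 0] by linarith
  qed
  have "ereal (?L - e * (2 + \<bar>t\<bar>)) <= (SUP u. ereal (s * u - (p u - p 0)))"
   using d[of t] by (intro SUP_upper2[of t]) (auto simp: mult.commute)
  moreover have "(SUP u. ereal (s * u - (p u - p 0))) <= ereal (?L + e * (2 + c))"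
  proof (rule SUP_least)
   fix u :: real
   have L: "s * v - (P v - P 0) <= ?L" for v using legendre_attained[of v t] t by (simp add: mult.commute)
   have "s * u - (P u - P 0) + e * \<bar>u\<bar> <= ?L + e * c"
   proof -
    consider "u < a" | "a <= u" "u <= b" | "b < u" by linarith
    then show ?thesis
    proof cases
     case 1
     have "(a - u) * ka <= (a - u) * (s - slope a)" using 1 ka by (intro mult_left_mono) auto
     moreover have "P a + (u - a) * slope a <= P u" by (rule subgradient)
     ultimately have "s * u - (P u - P 0) <= s * a - (P a - P 0) - (a - u) * ka" by (simp add: algebra_simps)
     moreover have "e * \<bar>u\<bar> <= e * (c + (a - u))" using 1 e by (intro mult_left_mono) (auto simp: c_def)
     moreover have "e * (a - u) <= ka * (a - u)" using 1 e by (intro mult_right_mono) auto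
     ultimately show ?thesis using L[of a] by (simp add: algebra_simps)
    next
     case 2
     have "e * \<bar>u\<bar> <= e * c" using 2 e by (intro mult_left_mono) (auto simp: c_def)
     then show ?thesis using L[of u] by linarith
    next
     case 3
     have "(u - b) * ka <= (u - b) * (slope b - s)" using 3 ka by (intro mult_left_mono) auto
     moreover have "P b + (u - b) * slope b <= P u" by (rule subgradient)
     ultimately have "s * u - (P u - P 0) <= s * b - (P b - P 0) - (u - b) * ka" by (simp add: algebra_simps)
     moreover have "e * \<bar>u\<bar> <= e * (c + (u - b))" using 3 e by (intro mult_left_mono) (auto simp: c_def)
     moreover have "e * (u - b) <= ka * (u - b)" using 3 e by (intro mult_right_mono) auto
     ultimately show ?thesis using L[of b] by (simp add: algebra_simps)
    qed
   qed
   moreover have "s * u - (p u - p 0) <= s * u - (P u - P 0) + e * (2 + \<bar>u\<bar>)" using d[of u] by linarith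
   ultimately have "s * u - (p u - p 0) <= ?L + e * (2 + c)" by (simp add: algebra_simps)
   then show "ereal (s * u - (p u - p 0)) <= ereal (?L + e * (2 + c))" by simp
  qed
  ultimately show ?thesis unfolding fr by blast
 qed
 have ev: "\<forall>\<^sub>F e in at_right 0. 0 < e \<and> e < ka"
  using ka(1) by (auto simp: eventually_at_right_field intro!: exI[of _ ka])
 have "((%e. ?L - e * (2 + \<bar>t\<bar>)) \<longlongrightarrow> ?L - 0 * (2 + \<bar>t\<bar>)) (at_right 0)"
  "((%e. ?L + e * (2 + c)) \<longlongrightarrow> ?L + 0 * (2 + c)) (at_right 0)"
  by (intro tendsto_intros)+
 then have lims: "((%e. ereal (?L - e * (2 + \<bar>t\<bar>))) \<longlongrightarrow> ereal ?L) (at_right 0)"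
  "((%e. ereal (?L + e * (2 + c))) \<longlongrightarrow> ereal ?L) (at_right 0)" by simp_all
 show ?thesis
 proof (rule tendsto_sandwich[OF _ _ lims])
  show "\<forall>\<^sub>F e in at_right 0. ereal (?L - e * (2 + \<bar>t\<bar>)) <= function_rate f X (F e) (G e) s"
   using ev by eventually_elim (use bounds in blast)
  show "\<forall>\<^sub>F e in at_right 0. function_rate f X (F e) (G e) s <= ereal (?L + e * (2 + c))"
   using ev by eventually_elim (use bounds in blast)
 qed
qed

end

section \<open>Strict differentiability\<close>

text \<open>Both points vary, so expansion by \<open>D\<close> passes to the differences of any two
  points near \<open>p\<close>. Being a condition at the single point \<open>p\<close>, it composes
  along an orbit without bookkeeping of domains.\<close>

definition strict_deriv :: "('a::real_normed_vector => 'b::real_normed_vector) => ('a => 'b) => 'a => bool" where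
 "strict_deriv h D p \<longleftrightarrow> bounded_linear D \<and>
   (\<forall>e>0. \<exists>d>0. \<forall>a\<in>ball p d. \<forall>b\<in>ball p d. norm (h b - h a - D (b - a)) <= e * norm (b - a))"

lemma strict_deriv_has_derivative:
 assumes "strict_deriv h D p"
 shows "(h has_derivative D) (at p)"
 unfolding has_derivative_at_alt
proof (intro conjI allI impI)
 show "bounded_linear D" using assms by (simp add: strict_deriv_def)
 fix e :: real assume "e > 0"
 then obtain d where d: "d > 0"
  "!!a b. a \<in> ball p d ==> b \<in> ball p d ==> norm (h b - h a - D (b - a)) <= e * norm (b - a)"
  using assms unfolding strict_deriv_def by blast
 have "norm (h y - h p - D (y - p)) <= e * norm (y - p)" if "norm (y - p) < d" for y
  using d(1) that by (intro d(2)) (auto simp: dist_norm norm_minus_commute)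
 then show "\<exists>d>0. \<forall>y. norm (y - p) < d --> norm (h y - h p - D (y - p)) <= e * norm (y - p)"
  using d(1) by blast
qed

lemma strict_deriv_compose:
 assumes h: "strict_deriv h D p" and k: "strict_deriv k E (h p)"
 shows "strict_deriv (k \<circ> h) (E \<circ> D) p"
 unfolding strict_deriv_def
proof (intro conjI allI impI)
 have D: "bounded_linear D" and E: "bounded_linear E" using h k by (auto simp: strict_deriv_def)
 show "bounded_linear (E \<circ> D)" using bounded_linear_compose[OF E D] by (simp add: comp_def)
 obtain BD where BD: "BD > 0" "!!v. norm (D v) <= norm v * BD" using bounded_linear.pos_bounded[OF D] by blast
 obtain BE where BE: "BE > 0" "!!v. norm (E v) <= norm v * BE" using bounded_linear.pos_bounded[OF E] by blast
 fix e :: real assume e: "e > 0"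
 define e1 where "e1 = e / (2 * (BD + 1))"
 define e2 where "e2 = min 1 (e / (2 * BE))"
 have e12: "e1 > 0" "e2 > 0" "e2 <= 1" "e2 * BE <= e / 2" "e1 * (BD + 1) = e / 2"
  using e BD(1) BE(1) by (auto simp: e1_def e2_def field_simps min_def)
 obtain d1 where d1: "d1 > 0"
  "!!a b. a \<in> ball (h p) d1 ==> b \<in> ball (h p) d1 ==> norm (k b - k a - E (b - a)) <= e1 * norm (b - a)"
  using k e12(1) unfolding strict_deriv_def by blast
 obtain d2 where d2: "d2 > 0"
  "!!a b. a \<in> ball p d2 ==> b \<in> ball p d2 ==> norm (h b - h a - D (b - a)) <= e2 * norm (b - a)"
  using h e12(2) unfolding strict_deriv_def by blast
 have lip: "norm (h b - h a) <= (BD + 1) * norm (b - a)" if "a \<in> ball p d2" "b \<in> ball p d2" for a b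
 proof -
  have "norm (h b - h a) <= norm (h b - h a - D (b - a)) + norm (D (b - a))"
   using norm_triangle_ineq[of "h b - h a - D (b - a)" "D (b - a)"] by simp
  also have "\<dots> <= 1 * norm (b - a) + norm (b - a) * BD"
   using d2(2)[OF that] mult_right_mono[OF e12(3) norm_ge_zero[of "b - a"]] BD(2)[of "b - a"] by linarith
  finally show ?thesis by (simp add: algebra_simps)
 qed
 define d where "d = min d2 (d1 / (BD + 1))"
 have d: "d > 0" "d <= d2" using d1(1) d2(1) BD(1) by (auto simp: d_def)
 have "d <= d1 / (BD + 1)" by (simp add: d_def)
 then have d1': "(BD + 1) * d <= d1" using BD(1) by (simp add: pos_le_divide_eq mult.commute)
 have near: "h a \<in> ball (h p) d1" if "a \<in> ball p d" for a
 proof -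
  have "a \<in> ball p d2" "p \<in> ball p d2" using that d by auto
  then have "norm (h a - h p) <= (BD + 1) * norm (a - p)" by (intro lip)
  also have "\<dots> < (BD + 1) * d" using that BD(1) by (auto simp: dist_norm norm_minus_commute intro!: mult_strict_left_mono)
  finally show ?thesis using d1' by (simp add: dist_norm norm_minus_commute)
 qed
 have "norm ((k \<circ> h) b - (k \<circ> h) a - (E \<circ> D) (b - a)) <= e * norm (b - a)" if ab: "a \<in> ball p d" "b \<in> ball p d" for a b
 proof -
  have ab2: "a \<in> ball p d2" "b \<in> ball p d2" using ab d(2) by auto
  have "norm (k (h b) - k (h a) - E (D (b - a))) <=
    norm (k (h b) - k (h a) - E (h b - h a)) + norm (E (h b - h a - D (b - a)))"
   using norm_triangle_ineq[of "k (h b) - k (h a) - E (h b - h a)" "E (h b - h a - D (b - a))"]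
   by (simp add: linear_diff[OF bounded_linear.linear[OF E]])
  also have "\<dots> <= e1 * norm (h b - h a) + norm (h b - h a - D (b - a)) * BE"
   by (rule add_mono[OF d1(2)[OF near[OF ab(1)] near[OF ab(2)]] BE(2)])
  also have "\<dots> <= e1 * ((BD + 1) * norm (b - a)) + (e2 * norm (b - a)) * BE"
   using e12(1) BE(1) by (intro add_mono mult_left_mono mult_right_mono lip ab2 d2(2)) auto
  also have "\<dots> = (e1 * (BD + 1)) * norm (b - a) + (e2 * BE) * norm (b - a)" by (simp add: algebra_simps)
  also have "\<dots> <= e / 2 * norm (b - a) + e / 2 * norm (b - a)"
   using e12(4) unfolding e12(5) by (intro add_mono mult_right_mono) auto
  finally show ?thesis by simp
 qed
 then show "\<exists>d>0. \<forall>a\<in>ball p d. \<forall>b\<in>ball p d. norm ((k \<circ> h) b - (k \<circ> h) a - (E \<circ> D) (b - a)) <= e * norm (b - a)"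
  using d(1) by blast
qed

lemma strict_deriv_transform:
 assumes h: "strict_deriv h D p" and N: "open N" "p \<in> N" and eq: "!!x. x \<in> N ==> h x = k x"
 shows "strict_deriv k D p"
 unfolding strict_deriv_def
proof (intro conjI allI impI)
 show "bounded_linear D" using h by (simp add: strict_deriv_def)
 fix e :: real assume "e > 0"
 then obtain d where d: "d > 0"
  "!!a b. a \<in> ball p d ==> b \<in> ball p d ==> norm (h b - h a - D (b - a)) <= e * norm (b - a)"
  using h unfolding strict_deriv_def by blast
 obtain r where r: "r > 0" "ball p r \<subseteq> N" using N openE by blast
 have "norm (k b - k a - D (b - a)) <= e * norm (b - a)" if "a \<in> ball p (min d r)" "b \<in> ball p (min d r)" for a b
 proof -
  have "a \<in> N" "b \<in> N" using that r(2) by auto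
  then show ?thesis using d(2)[of a b] that eq by simp
 qed
 then show "\<exists>d>0. \<forall>a\<in>ball p d. \<forall>b\<in>ball p d. norm (k b - k a - D (b - a)) <= e * norm (b - a)"
  using d(1) r(1) by (intro exI[of _ "min d r"]) auto
qed

lemma Ck_1D:
 assumes "Ck_on 1 S h"
 shows "p \<in> S ==> (h has_derivative frechet_derivative h (at p)) (at p)"
  and "continuous_on S (%p. frechet_derivative h (at p) v)"
 using assms by (auto simp: frechet_derivative_works[symmetric])

text \<open>\<open>Ck_on\<close> provides continuity of each directional derivative separately. In
  finite dimension the basis directions control the operator norm, whence the factor
  \<open>DIM('a)\<close> in \<open>e'\<close>, and the mean value inequality on a ball does the
  rest.\<close>

lemma strict_deriv_Ck:
 fixes h :: "'a::euclidean_space => 'b::real_normed_vector"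
 assumes S: "open S" "p \<in> S" and h: "Ck_on 1 S h"
 shows "strict_deriv h (frechet_derivative h (at p)) p"
 unfolding strict_deriv_def
proof (intro conjI allI impI)
 define D where "D q = frechet_derivative h (at q)" for q
 have D: "(h has_derivative D q) (at q)" if "q \<in> S" for q unfolding D_def by (rule Ck_1D(1)[OF h that])
 have linD: "linear (D q)" if "q \<in> S" for q by (rule has_derivative_linear[OF D[OF that]])
 show "bounded_linear (frechet_derivative h (at p))"
  using has_derivative_bounded_linear[OF D[OF S(2)]] by (simp add: D_def)
 fix e :: real assume e: "e > 0"
 define e' where "e' = e / DIM('a)"
 have e': "e' > 0" using e by (simp add: e'_def)
 have "\<forall>\<^sub>F q in nhds p. norm (D q i - D p i) < e'" for i
 proof -
  have "continuous (at p) (%q. D q i)"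
   using Ck_1D(2)[OF h, of i] S unfolding D_def by (simp add: continuous_on_eq_continuous_at)
  then have "((%q. D q i) \<longlongrightarrow> D p i) (nhds p)" unfolding continuous_at by (rule tendsto_at_iff_tendsto_nhds[THEN iffD1])
  from tendstoD[OF this e'] show ?thesis by (simp add: dist_norm)
 qed
 then have "\<forall>\<^sub>F q in nhds p. \<forall>i\<in>Basis. norm (D q i - D p i) < e'" by (intro eventually_ball_finite) auto
 moreover have "\<forall>\<^sub>F q in nhds p. q \<in> S" by (rule eventually_nhds_in_open[OF S])
 ultimately have "\<forall>\<^sub>F q in nhds p. q \<in> S \<and> (\<forall>i\<in>Basis. norm (D q i - D p i) < e')" by eventually_elim blast
 then obtain d where d: "d > 0" "!!q. dist q p < d ==> q \<in> S" "!!q i. dist q p < d ==> i \<in> Basis ==> norm (D q i - D p i) < e'"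
  unfolding eventually_nhds_metric by blast
 have dS: "q \<in> S" "i \<in> Basis ==> norm (D q i - D p i) < e'" if "q \<in> ball p d" for q i
  using d(2,3) that by (auto simp: dist_commute)
 have on: "onorm (D q - D p) <= e" if q: "q \<in> ball p d" for q
 proof (rule onorm_le)
  fix v :: 'a
  have "linear (%v. D q v - D p v)" by (intro linear_compose_sub linD dS q S)
  then have "D q v - D p v = (\<Sum>i\<in>Basis. (v \<bullet> i) *\<^sub>R (D q i - D p i))"
   using linear_sum[of "%v. D q v - D p v" "%i. (v \<bullet> i) *\<^sub>R i" Basis] linear_scale[of "%v. D q v - D p v"]
   by (simp add: euclidean_representation)
  then have "norm (D q v - D p v) <= (\<Sum>i\<in>(Basis :: 'a set). norm v * e')"
   using dS(2)[OF q] by (auto intro!: order_trans[OF norm_sum] sum_mono mult_mono simp: Basis_le_norm less_imp_le simp del: sum_constant)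
  also have "\<dots> = e * norm v" by (simp add: e'_def)
  finally show "norm ((D q - D p) v) <= e * norm v" by simp
 qed
 have "norm (h b - h a - D p (b - a)) <= e * norm (b - a)" if ab: "a \<in> ball p d" "b \<in> ball p d" for a b
 proof -
  have "norm (h b - h a - D p (b - a)) <= norm (b - a) * e"
  proof (rule differentiable_bound_linearization[where S = "ball p d"])
   fix t :: real assume t: "t \<in> {0..1}"
   have "(1 - t) *\<^sub>R a + t *\<^sub>R b \<in> ball p d" using ab t by (intro convexD_alt[OF convex_ball]) auto
   moreover have "(1 - t) *\<^sub>R a + t *\<^sub>R b = a + t *\<^sub>R (b - a)" by (simp add: algebra_simps)
   ultimately show "a + t *\<^sub>R (b - a) \<in> ball p d" by simp
  qed (use D dS on d(1) in \<open>auto intro: has_derivative_at_withinI\<close>)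
  then show ?thesis by (simp add: mult.commute)
 qed
 then show "\<exists>d>0. \<forall>a\<in>ball p d. \<forall>b\<in>ball p d. norm (h b - h a - frechet_derivative h (at p) (b - a)) <= e * norm (b - a)"
  using d(1) unfolding D_def by blast
qed

lemma bilinear_expand:
 fixes h :: "'a::euclidean_space => 'a => real"
 assumes "bilinear h"
 shows "h v w = (\<Sum>i\<in>Basis. \<Sum>j\<in>Basis. (v \<bullet> i) * (w \<bullet> j) * h i j)"
proof -
 have l: "linear (h x)" "linear (%x. h x y)" for x y using assms by (auto simp: bilinear_def)
 have "h v w = (\<Sum>i\<in>Basis. (v \<bullet> i) * h i w)" using Linear_Algebra.linear_componentwise[OF l(2), of v w 1] by simp
 also have "\<dots> = (\<Sum>i\<in>Basis. (v \<bullet> i) * (\<Sum>j\<in>Basis. (w \<bullet> j) * h i j))"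
  using Linear_Algebra.linear_componentwise[OF l(1), of _ w 1] by simp
 finally show ?thesis by (simp add: sum_distrib_left mult.assoc)
qed

section \<open>Curves and lengths in charts\<close>

context riemannian_manifold
begin

lemma chart_inv_chart [simp]: "c \<in> A ==> x \<in> fst c ==> chart_inv c (snd c x) = x"
 using chart_homeomorphism by (auto simp: homeomorphism_def)

lemma chart_cont: "c \<in> A ==> continuous_on (fst c) (snd c)"
 and chart_inv_cont: "c \<in> A ==> continuous_on (snd c ` fst c) (chart_inv c)"
 using chart_homeomorphism by (auto simp: homeomorphism_def)

lemma chart_preimage_open: "c \<in> A ==> open U ==> open (fst c \<inter> snd c -` U)"
 by (intro continuous_open_preimage chart_cont chart_open)

lemma chart_image_open:
 assumes c: "c \<in> A" and W: "open W"
 shows "open (snd c ` (fst c \<inter> W))"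
proof -
 have "snd c ` (fst c \<inter> W) = snd c ` fst c \<inter> chart_inv c -` W"
  using c by (auto simp: image_iff)
 then show ?thesis
  using continuous_open_preimage[OF chart_inv_cont[OF c] chart_open(2)[OF c] W] by simp
qed

lemma chart_at: obtains c where "c \<in> A" "x \<in> fst c"
 using cover by blast

text \<open>\<open>m\<close> is the minimum of the quadratic form at \<open>x\<close> on the unit
  sphere. Where the metric coefficients have changed by less than \<open>m / 3\<close> in total, the
  forms at \<open>x\<close> and \<open>y\<close> agree up to the factor \<open>3 / 2\<close> and are
  comparable to the Euclidean norm.\<close>

lemma metric_local:
 assumes c: "c \<in> A" and x: "x \<in> fst c"
 obtains V m M where "open V" "x \<in> V" "V \<subseteq> fst c" "0 < m" "0 < M"
  "!!y v. y \<in> V ==> m * (norm v)\<^sup>2 <= g c y v v" "!!y v. y \<in> V ==> g c y v v <= M * (norm v)\<^sup>2"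
  "!!y v. y \<in> V ==> 2 * g c y v v <= 3 * g c x v v" "!!y v. y \<in> V ==> 2 * g c x v v <= 3 * g c y v v"
proof -
 note bil = metric_bilinear[OF c]
 obtain B where B: "B > 0" "!!v w. norm (g c x v w) <= B * norm v * norm w"
  using bilinear_bounded_pos[OF bil[OF x]] by blast
 have cont: "continuous_on (sphere 0 1) (%v. g c x v v)"
  by (rule bilinear_continuous_on_compose[OF continuous_on_id continuous_on_id bil[OF x], unfolded id_def])
 have ne: "sphere (0::'e) 1 \<noteq> {}" by simp
 obtain v0 where v0: "v0 \<in> sphere 0 1" "!!v. v \<in> sphere 0 1 ==> g c x v0 v0 <= g c x v v"
  using continuous_attains_inf[OF compact_sphere ne cont] by blast
 define m where "m = g c x v0 v0"
 have m: "m > 0" unfolding m_def using v0(1) by (intro metric_pos c x) auto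
 have low: "m * (norm v)\<^sup>2 <= g c x v v" for v
 proof (cases "v = 0")
  case True then show ?thesis using bilinear_lzero[OF bil[OF x]] by simp
 next
  case False
  define w where "w = v /\<^sub>R norm v"
  have v: "v = norm v *\<^sub>R w" using False by (simp add: w_def)
  have w: "w \<in> sphere 0 1" using False by (simp add: w_def)
  have "g c x v v = (norm v)\<^sup>2 * g c x w w"
   using bilinear_lmul[OF bil[OF x], of "norm v" w v] bilinear_rmul[OF bil[OF x], of w "norm v" w] v
   by (simp add: power2_eq_square)
  moreover have "m * (norm v)\<^sup>2 <= g c x w w * (norm v)\<^sup>2"
   unfolding m_def by (rule mult_right_mono[OF v0(2)[OF w]]) simp
  ultimately show ?thesis by (simp add: mult.commute)
 qed
 define fi where "fi y = (\<Sum>i\<in>Basis. \<Sum>j\<in>Basis. \<bar>g c y i j - g c x i j\<bar>)" for y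
 have entry: "continuous_on (fst c) (%y. g c y i j)" for i j
 proof -
  have "continuous_on (snd c ` fst c) (%p. g c (chart_inv c p) i j)"
   using metric_smooth[OF c, of i j] unfolding smooth_on_def by (metis Ck_on.simps(1))
  from continuous_on_compose[OF chart_cont[OF c] this]
  show ?thesis by (rule continuous_on_eq) (use c in simp)
 qed
 have "continuous_on (fst c) fi" unfolding fi_def by (intro continuous_intros entry)
 then have oV: "open (fst c \<inter> fi -` {..<m / 3})" by (intro continuous_open_preimage chart_open c open_lessThan)
 have diff: "\<bar>g c y v v - g c x v v\<bar> <= m / 3 * (norm v)\<^sup>2" if y: "y \<in> fst c \<inter> fi -` {..<m / 3}" for y v
 proof -
  have "\<bar>g c y v v - g c x v v\<bar> = \<bar>\<Sum>i\<in>Basis. \<Sum>j\<in>Basis. (v \<bullet> i) * (v \<bullet> j) * (g c y i j - g c x i j)\<bar>"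
   using bilinear_expand[OF bil[OF x], of v v] bilinear_expand[OF bil, of y v v] y
   by (simp add: sum_subtractf[symmetric] right_diff_distrib)
  also have "\<dots> <= (\<Sum>i\<in>Basis. \<Sum>j\<in>Basis. (norm v)\<^sup>2 * \<bar>g c y i j - g c x i j\<bar>)"
   unfolding power2_eq_square
   by (intro order_trans[OF sum_abs] sum_mono) (auto simp: abs_mult Basis_le_norm intro!: mult_mono)
  also have "\<dots> = fi y * (norm v)\<^sup>2" by (simp add: fi_def sum_distrib_left mult.commute)
  also have "\<dots> <= m / 3 * (norm v)\<^sup>2" using y by (intro mult_right_mono) auto
  finally show ?thesis .
 qed
 show ?thesis
 proof (rule that[OF oV, of "2 / 3 * m" "B + m / 3"])
  show "x \<in> fst c \<inter> fi -` {..<m / 3}" using x m by (simp add: fi_def)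
  fix y v assume y: "y \<in> fst c \<inter> fi -` {..<m / 3}"
  note d = diff[OF y, of v] low[of v]
  have up: "g c x v v <= B * (norm v)\<^sup>2" using B(2)[of v v] by (simp add: power2_eq_square mult.assoc)
  have k: "m / 3 * (norm v)\<^sup>2 = (m * (norm v)\<^sup>2) / 3" by simp
  show "2 / 3 * m * (norm v)\<^sup>2 <= g c y v v" "2 * g c y v v <= 3 * g c x v v" "2 * g c x v v <= 3 * g c y v v"
   using d unfolding k by linarith+
  show "g c y v v <= (B + m / 3) * (norm v)\<^sup>2" using d up unfolding distrib_right k by linarith
 qed (use m B in auto)
qed

lemma transition_Ck: "c \<in> A ==> c' \<in> A ==> Ck_on 1 (snd c ` (fst c \<inter> fst c')) (snd c' \<circ> chart_inv c)"
 using transition_smooth unfolding smooth_on_def by blast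

lemma transition_deriv:
 assumes "c \<in> A" "c' \<in> A" "x \<in> fst c" "x \<in> fst c'"
 shows "((snd c' \<circ> chart_inv c) has_derivative local_deriv c c' id x) (at (snd c x))"
 using Ck_1D(1)[OF transition_Ck[OF assms(1,2)], of "snd c x"] assms(3,4) by (simp add: local_deriv_def)

lemma curve_chart_change:
 assumes c: "c \<in> A" "c' \<in> A" and N: "open N" "t \<in> N" "!!s. s \<in> N ==> ga s \<in> fst c \<inter> fst c'"
  and v: "((snd c \<circ> ga) has_vector_derivative v) (at t)"
 shows "((snd c' \<circ> ga) has_vector_derivative local_deriv c c' id (ga t) v) (at t)"
proof -
 have "((snd c' \<circ> chart_inv c) has_derivative local_deriv c c' id (ga t)) (at ((snd c \<circ> ga) t))"
  using transition_deriv[OF c] N by simp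
 then have "((snd c' \<circ> chart_inv c) \<circ> (snd c \<circ> ga) has_vector_derivative local_deriv c c' id (ga t) v) (at t)"
  using vector_derivative_diff_chain_within[of "snd c \<circ> ga" v t UNIV "snd c' \<circ> chart_inv c"] v
  by (simp add: has_derivative_at_withinI)
 then show ?thesis
  by (rule has_vector_derivative_transform_within_open[OF _ N(1,2)]) (use c N(3) in simp)
qed

text \<open>\<open>speed\<close> reads the velocity in an arbitrarily selected chart; the
  transformation law of the metric makes the result independent of it.\<close>

lemma speed_eq:
 assumes c: "c \<in> A" and N: "open N" "t \<in> N" "continuous_on N ga" and x: "ga t \<in> fst c"
  and v: "((snd c \<circ> ga) has_vector_derivative v) (at t)"
 shows "speed A g ga t = tangent_norm g c (ga t) v"
proof -
 define c0 where "c0 = (SOME c. c \<in> A \<and> ga t \<in> fst c)"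
 have c0: "c0 \<in> A" "ga t \<in> fst c0" unfolding c0_def using someI_ex[of "%c. c \<in> A \<and> ga t \<in> fst c"] c x by blast+
 have "open (N \<inter> ga -` (fst c \<inter> fst c0))"
  by (intro continuous_open_preimage N open_Int chart_open c c0)
 then have "((snd c0 \<circ> ga) has_vector_derivative local_deriv c c0 id (ga t) v) (at t)"
  by (rule curve_chart_change[OF c c0(1)]) (use N x c0 v in auto)
 then have "vector_derivative (snd c0 \<circ> ga) (at t) = local_deriv c c0 id (ga t) v" by (rule vector_derivative_at)
 then show ?thesis
  using metric_transform[OF c c0(1) x c0(2), of v v] by (simp add: speed_def c0_def[symmetric] tangent_norm_def)
qed

text \<open>The coordinate segment between two points of a small coordinate ball is a short curve.
  Continuity of Hoelder functions and the transfer of the distortion hypothesis to \<open>rh\<close>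
  rest on this.\<close>

lemma dist_small:
 assumes dl: "dl > 0"
 obtains V where "open V" "x \<in> V" "!!y z. y \<in> V ==> z \<in> V ==> riemannian_dist A g y z <= ennreal dl"
proof -
 obtain c where c: "c \<in> A" and xc: "x \<in> fst c" by (rule chart_at)
 obtain V m M where V: "open V" "x \<in> V" "V \<subseteq> fst c" "0 < m" "0 < M"
  "!!y v. y \<in> V ==> m * (norm v)\<^sup>2 <= g c y v v" "!!y v. y \<in> V ==> g c y v v <= M * (norm v)\<^sup>2"
  by (rule metric_local[OF c xc], rule that)
 have "open (snd c ` (fst c \<inter> V))" by (rule chart_image_open[OF c V(1)])
 then obtain r0 where r0: "r0 > 0" "ball (snd c x) r0 \<subseteq> snd c ` (fst c \<inter> V)"
  using openE[of _ "snd c x"] V(2) xc by blast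
 define r where "r = min r0 (dl / (2 * sqrt M))"
 have "ball (snd c x) r \<subseteq> ball (snd c x) r0" by (intro subset_ball) (simp add: r_def)
 with r0 dl V(5) have r: "r > 0" "ball (snd c x) r \<subseteq> snd c ` (fst c \<inter> V)" by (auto simp: r_def)
 have "r <= dl / (2 * sqrt M)" by (simp add: r_def)
 then have rdl: "sqrt M * (2 * r) <= dl" using V(5) by (simp add: field_simps)
 have inV: "chart_inv c p \<in> V" "chart_inv c p \<in> fst c" "snd c (chart_inv c p) = p" if "p \<in> ball (snd c x) r" for p
  using that r(2) c by auto
 show ?thesis
 proof (rule that[of "fst c \<inter> snd c -` ball (snd c x) r"])
  show "open (fst c \<inter> snd c -` ball (snd c x) r)" by (rule chart_preimage_open[OF c open_ball])
  show "x \<in> fst c \<inter> snd c -` ball (snd c x) r" using xc r(1) by simp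
  fix y z assume y: "y \<in> fst c \<inter> snd c -` ball (snd c x) r" and z: "z \<in> fst c \<inter> snd c -` ball (snd c x) r"
  define a b where "a = snd c y" and "b = snd c z"
  define ga where "ga t = chart_inv c (linepath a b t)" for t
  have lp: "linepath a b t \<in> ball (snd c x) r" if "t \<in> {0..1}" for t
   unfolding linepath_def using y z that by (intro convexD_alt[OF convex_ball]) (auto simp: a_def b_def)
  note inga = inV[OF lp, folded ga_def]
  have ball: "ball (snd c x) r \<subseteq> snd c ` fst c" using r(2) by blast
  have cont: "continuous_on {0..1} ga"
   unfolding ga_def using lp ball
   by (intro continuous_on_compose2[OF chart_inv_cont[OF c]] continuous_on_linepath) blast
  have ends: "ga 0 = y" "ga 1 = z" using y z c by (auto simp: ga_def a_def b_def linepath_def)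
  have cont': "continuous_on {0<..<1} ga" using cont by (rule continuous_on_subset) auto
  have vd: "((snd c \<circ> ga) has_vector_derivative b - a) (at t)" if t: "t \<in> {0<..<1}" for t
   by (rule has_vector_derivative_transform_within_open[OF has_vector_derivative_linepath_within open_greaterThanLessThan t])
    (use inga(3) in simp)
  have "piecewise_C1_curve A ga"
   unfolding piecewise_C1_curve_def path_def
  \<comment> \<open>The end points are excepted because the derivatives are two-sided and the
    segment may leave the ball outside the unit interval.\<close>
  proof (intro conjI cont exI[of _ "{0, 1}"] ballI)
   fix c' assume c': "c' \<in> A"
   show "(snd c' \<circ> ga) C1_differentiable_on ({t \<in> {0..1}. ga t \<in> fst c'} - {0, 1})" (is "_ C1_differentiable_on ?S")
    unfolding C1_differentiable_on_def
   proof (intro exI[of _ "%t. local_deriv c c' id (ga t) (b - a)"] conjI ballI)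
    fix t assume t: "t \<in> ?S"
    then have t01: "t \<in> {0<..<1}" by auto
    have "open ({0<..<1} \<inter> ga -` fst c')" by (intro continuous_open_preimage cont' chart_open c') simp
    then show "((snd c' \<circ> ga) has_vector_derivative local_deriv c c' id (ga t) (b - a)) (at t)"
     by (rule curve_chart_change[OF c c' _ _ _ vd[OF t01]]) (use t t01 inga(2) in auto)
   next
    have 1: "continuous_on ?S (%t. linepath a b t)" by (rule continuous_on_linepath)
    have "(%t. linepath a b t) ` ?S \<subseteq> snd c ` (fst c \<inter> fst c')"
    proof
     fix p assume "p \<in> (%t. linepath a b t) ` ?S"
     then obtain t where t: "t \<in> ?S" "p = linepath a b t" by blast
     then have "t \<in> {0..1}" by auto
     from inga(2,3)[OF this] t show "p \<in> snd c ` (fst c \<inter> fst c')" by (intro image_eqI[of _ _ "ga t"]) auto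
    qed
    from continuous_on_compose2[OF Ck_1D(2)[OF transition_Ck[OF c c'], of "b - a"] 1 this]
    show "continuous_on ?S (%t. local_deriv c c' id (ga t) (b - a))"
     by (rule continuous_on_eq) (use inga(3) in \<open>auto simp: local_deriv_def\<close>)
   qed
  qed simp
  then have "riemannian_dist A g y z <= curve_length A g ga"
   unfolding riemannian_dist_def using ends by (intro Inf_lower CollectI exI[of _ ga]) (auto simp: pathstart_def pathfinish_def)
  also have "\<dots> <= (\<integral>\<^sup>+t. ennreal dl * indicator {0..1::real} t \<partial>lborel)"
   unfolding curve_length_def
  proof (rule nn_integral_mono_AE)
   have sp: "speed A g ga t <= dl" if t: "t \<in> {0<..<1}" for t
   proof -
    have t': "t \<in> {0..1}" using t by auto
    have "dist a b <= 2 * r"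
     using y z dist_triangle2[of a b "snd c x"] by (simp add: a_def b_def dist_commute)
    then have ab: "norm (b - a) <= 2 * r" by (simp add: dist_norm norm_minus_commute)
    have "speed A g ga t = sqrt (g c (ga t) (b - a) (b - a))"
     unfolding tangent_norm_def[symmetric]
     by (rule speed_eq[OF c open_greaterThanLessThan t cont' inga(2)[OF t'] vd[OF t]])
    also have "\<dots> <= sqrt (M * (norm (b - a))\<^sup>2)" using V(7)[OF inga(1)[OF t']] by simp
    also have "\<dots> = sqrt M * norm (b - a)" by (simp add: real_sqrt_mult)
    also have "\<dots> <= sqrt M * (2 * r)" using ab V(5) by (intro mult_left_mono) auto
    finally show ?thesis using rdl by linarith
   qed
   show "AE t in lborel. ennreal (speed A g ga t) * indicator {0..1} t <= ennreal dl * indicator {0..1} t"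
    using AE_lborel_singleton[of "0::real"] AE_lborel_singleton[of "1::real"]
    by eventually_elim (use sp in \<open>auto simp: indicator_def ennreal_leI\<close>)
  qed
  also have "\<dots> = ennreal dl" by (simp add: nn_integral_cmult_indicator)
  finally show "riemannian_dist A g y z <= ennreal dl" .
 qed
qed

section \<open>Lipschitz functions and separation of points\<close>

definition lipschitz_function :: "('m => real) => bool" where
 "lipschitz_function u \<longleftrightarrow> continuous_on UNIV u \<and>
   (\<exists>L>0. \<forall>x y. ennreal (\<bar>u x - u y\<bar> / L) <= riemannian_dist A g x y)"

text \<open>The fundamental theorem of calculus is used for the gauge integral, which presupposes no
  integrability of the derivative \<open>D\<close>. If the length is finite, \<open>D\<close> is
  dominated by an integrable function, so its integral is a Lebesgue integral and can be compared
  with the length.\<close>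

lemma curve_increment:
 fixes u :: "'m => real"
 assumes u: "continuous_on UNIV u" and L: "L > 0" and path: "path ga" and S: "finite S"
  and D: "!!t. t \<in> {0<..<1} - S ==> ((u \<circ> ga) has_vector_derivative D t) (at t) \<and> \<bar>D t\<bar> <= L * speed A g ga t"
 shows "ennreal (\<bar>u (ga 0) - u (ga 1)\<bar> / L) <= curve_length A g ga"
proof -
 define h where "h t = (1 / L * D t) * indicator {0..1} t" for t
 define i where "i = 1 / L * (u (ga 1) - u (ga 0))"
 have "(D has_integral (u \<circ> ga) 1 - (u \<circ> ga) 0) {0..1}"
 proof (rule fundamental_theorem_of_calculus_interior_strong[OF S])
  show "continuous_on {0..1} (u \<circ> ga)"
   using path u unfolding path_def by (intro continuous_on_compose) (auto intro: continuous_on_subset)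
  show "((u \<circ> ga) has_vector_derivative D t) (at t)" if "t \<in> {0<..<1} - S" for t using D[OF that] by blast
 qed simp
 from has_integral_mult_right[OF this, of "1 / L"] have hD: "((%t. 1 / L * D t) has_integral i) {0..1}"
  by (simp only: i_def comp_apply)
 have "h = (%t. if t \<in> {0..1} then 1 / L * D t else 0)" by (auto simp: h_def indicator_def)
 then have hI: "(h has_integral i) UNIV" using hD by (simp only: has_integral_restrict_UNIV)
 have meas: "h \<in> borel_measurable lebesgue"
  using has_integral_implies_lebesgue_measurable_real[OF hD] unfolding h_def[abs_def] .
 have fin: "finite (insert 0 (insert 1 S))" using S by simp
 have "AE t in lborel. t \<notin> insert 0 (insert 1 S)"
  by (rule AE_not_in[OF finite_imp_null_set_lborel[OF fin]])
 then have "(\<integral>\<^sup>+t. ennreal \<bar>h t\<bar> \<partial>lborel) <= curve_length A g ga"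
  unfolding curve_length_def
 proof (intro nn_integral_mono_AE, eventually_elim)
  case (elim t)
  show ?case
  proof (cases "t \<in> {0..1}")
   case True
   then have "\<bar>D t\<bar> <= L * speed A g ga t" using elim D[of t] by auto
   then have "\<bar>1 / L * D t\<bar> <= speed A g ga t" using L by (simp add: abs_mult field_simps)
   then show ?thesis using True by (simp add: h_def ennreal_leI)
  qed (simp add: h_def)
 qed
 then have le: "(\<integral>\<^sup>+t. ennreal (norm (h t)) \<partial>lebesgue) <= curve_length A g ga"
  by (simp add: nn_integral_completion)
 show ?thesis
 proof (cases "curve_length A g ga = \<infinity>")
  case False
  then have "(\<integral>\<^sup>+t. ennreal (norm (h t)) \<partial>lebesgue) < \<infinity>"
   using le by (auto simp: top.not_eq_extremum intro: le_less_trans)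
  then have int: "integrable lebesgue h" using meas by (intro integrableI_bounded)
  have "integral\<^sup>L lebesgue h = i"
   using has_integral_unique[OF has_integral_integral_lebesgue[OF int] hI] .
  then have "ennreal (norm i) <= curve_length A g ga"
   using integral_norm_bound_ennreal[OF int] le by (simp only: order_trans)
  moreover have "norm i = \<bar>u (ga 0) - u (ga 1)\<bar> / L" using L by (simp add: i_def abs_mult abs_minus_commute)
  ultimately show ?thesis by simp
 qed simp
qed

text \<open>Compact support inside the chart lets the function extend by 0 and bounds its derivative
  by a constant times the Riemannian norm; \<open>curve_increment\<close> then bounds its increments
  by lengths of curves, also of those that leave the chart.\<close>

lemma chart_function_lipschitz:
 fixes h :: "'e => real"
 assumes c: "c \<in> A" and K: "compact K" "K \<subseteq> snd c ` fst c"
  and h: "!!p. (h has_derivative h' p) (at p)" "!!p. p \<notin> K ==> h p = 0"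
  and B: "!!p v. p \<in> K ==> \<bar>h' p v\<bar> <= B * norm v"
  and m: "m > 0" "!!p v. p \<in> K ==> m * (norm v)\<^sup>2 <= g c (chart_inv c p) v v"
 shows "lipschitz_function (%x. if x \<in> fst c then h (snd c x) else 0)" (is "lipschitz_function ?u")
proof -
 have cl: "closed (chart_inv c ` K)"
  by (intro compact_imp_closed compact_continuous_image continuous_on_subset[OF chart_inv_cont[OF c]] K)
 have zero: "?u x = 0" if "x \<notin> chart_inv c ` K" for x
 proof (cases "x \<in> fst c")
  case True
  then have "snd c x \<notin> K" using that c by (metis chart_inv_chart image_eqI)
  then show ?thesis using True h(2) by simp
 qed simp
 have cov: "(UNIV :: 'm set) = fst c \<union> - chart_inv c ` K" using K(2) c by auto
 have conth: "continuous_on UNIV h"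
  using h(1) by (meson continuous_at_imp_continuous_on has_derivative_continuous)
 have u1: "continuous_on (fst c) ?u"
  using continuous_on_compose[OF chart_cont[OF c] continuous_on_subset[OF conth subset_UNIV]]
  by (rule continuous_on_eq) simp
 have u2: "continuous_on (- chart_inv c ` K) ?u"
  using continuous_on_const by (rule continuous_on_eq) (use zero in simp)
 have cont: "continuous_on UNIV ?u"
  unfolding cov using chart_open(1)[OF c] cl u1 u2 by (intro continuous_on_open_Un) auto
 define L where "L = \<bar>B\<bar> / sqrt m + 1"
 have L: "L > 0" using m(1) by (simp add: L_def add_nonneg_pos)
 have hb: "\<bar>h' p v\<bar> <= L * tangent_norm g c (chart_inv c p) v" if p: "p \<in> snd c ` fst c" for p v
 proof (cases "p \<in> K")
  case True
  have "sqrt (m * (norm v)\<^sup>2) <= tangent_norm g c (chart_inv c p) v" unfolding tangent_norm_def using m(2)[OF True] by simp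
  then have n: "sqrt m * norm v <= tangent_norm g c (chart_inv c p) v" by (simp add: real_sqrt_mult)
  have "\<bar>h' p v\<bar> <= \<bar>B\<bar> * norm v"
   using B[OF True, of v] mult_right_mono[OF abs_ge_self[of B] norm_ge_zero[of v]] by linarith
  also have "\<dots> <= L * (sqrt m * norm v)" using m(1) by (simp add: L_def field_simps)
  also have "\<dots> <= L * tangent_norm g c (chart_inv c p) v" using n L by (intro mult_left_mono) auto
  finally show ?thesis .
 next
  case False
  have "(h has_derivative (%_. 0)) (at p)"
   by (rule has_derivative_transform_within_open[of "%_. 0" _ _ _ "- K"])
    (use False K(1) h(2) compact_imp_closed in auto)
  then have "h' p = (%_. 0)" by (rule has_derivative_unique[OF h(1)])
  then show ?thesis
   using L metric_pos[OF c, of "chart_inv c p" v] bilinear_lzero[OF metric_bilinear[OF c], of "chart_inv c p" 0] p c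
   by (cases "v = 0") (auto simp: tangent_norm_def less_imp_le)
 qed
 have "ennreal (\<bar>?u x - ?u y\<bar> / L) <= riemannian_dist A g x y" for x y
  unfolding riemannian_dist_def
 proof (rule Inf_greatest)
  fix l assume "l \<in> {curve_length A g ga |ga. piecewise_C1_curve A ga \<and> pathstart ga = x \<and> pathfinish ga = y}"
  then obtain ga where ga: "piecewise_C1_curve A ga" "ga 0 = x" "ga 1 = y" "l = curve_length A g ga"
   by (auto simp: pathstart_def pathfinish_def)
  obtain S where S: "finite S" "(snd c \<circ> ga) C1_differentiable_on ({t\<in>{0..1}. ga t \<in> fst c} - S)" and path: "path ga"
   using ga(1) c unfolding piecewise_C1_curve_def by blast
  obtain E where E: "!!t. t \<in> {t\<in>{0..1}. ga t \<in> fst c} - S ==> ((snd c \<circ> ga) has_vector_derivative E t) (at t)"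
   using S(2) unfolding C1_differentiable_on_def by blast
  have contga: "continuous_on {0<..<1} ga" using path unfolding path_def by (rule continuous_on_subset) auto
  define D where "D t = (if ga t \<in> fst c then h' (snd c (ga t)) (E t) else 0)" for t
  have "((?u \<circ> ga) has_vector_derivative D t) (at t) \<and> \<bar>D t\<bar> <= L * speed A g ga t" if t: "t \<in> {0<..<1} - S" for t
  proof (cases "ga t \<in> fst c")
   case True
   have t': "t \<in> {0<..<1}" and Et: "((snd c \<circ> ga) has_vector_derivative E t) (at t)" using t True E[of t] by auto
   have "open ({0<..<1} \<inter> ga -` fst c)" by (intro continuous_open_preimage contga chart_open c) simp
   moreover have "((h \<circ> (snd c \<circ> ga)) has_vector_derivative h' (snd c (ga t)) (E t)) (at t)"
    using vector_derivative_diff_chain_within[of "snd c \<circ> ga" "E t" t UNIV h] Et h(1)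
    by (simp add: has_derivative_at_withinI)
   ultimately have "((?u \<circ> ga) has_vector_derivative h' (snd c (ga t)) (E t)) (at t)"
    using True t' by (elim has_vector_derivative_transform_within_open[rotated]) auto
   moreover have "\<bar>h' (snd c (ga t)) (E t)\<bar> <= L * speed A g ga t"
    using hb[of "snd c (ga t)" "E t"] speed_eq[OF c open_greaterThanLessThan t' contga True Et] True c by simp
   ultimately show ?thesis using True by (simp add: D_def)
  next
   case False
   have "open ({0<..<1} \<inter> ga -` (- chart_inv c ` K))"
    using cl by (intro continuous_open_preimage contga) auto
   moreover have "t \<in> {0<..<1} \<inter> ga -` (- chart_inv c ` K)" using False t cov by auto
   ultimately have "((?u \<circ> ga) has_vector_derivative 0) (at t)"
    by (rule has_vector_derivative_transform_within_open[OF has_vector_derivative_const[of 0]]) (use zero in auto)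
   moreover have "0 <= speed A g ga t"
   proof -
    define c0 where "c0 = (SOME c. c \<in> A \<and> ga t \<in> fst c)"
    have c0: "c0 \<in> A" "ga t \<in> fst c0" unfolding c0_def using someI_ex[of "%c. c \<in> A \<and> ga t \<in> fst c"] chart_at[of "ga t"] by blast+
    have "0 <= g c0 (ga t) v v" for v
     using metric_pos[OF c0, of v] bilinear_lzero[OF metric_bilinear[OF c0], of 0] by (cases "v = 0") auto
    then show ?thesis by (simp add: speed_def c0_def[symmetric] tangent_norm_def)
   qed
   ultimately show ?thesis using False L by (simp add: D_def)
  qed
  from curve_increment[OF cont L path S(1) this] show "ennreal (\<bar>?u x - ?u y\<bar> / L) <= l" by (simp only: ga)
 qed
 then show ?thesis unfolding lipschitz_function_def using cont L by blast
qed

text \<open>The square of the positive part is differentiable also at 0, which yields a compactly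
  supported function with an elementary derivative.\<close>

lemma bump_derivative:
 fixes p0 :: 'e and r :: real
 defines "b \<equiv> %p. (max 0 (r\<^sup>2 - (p - p0) \<bullet> (p - p0)))\<^sup>2"
 shows "(b has_derivative (%v. - (4 * max 0 (r\<^sup>2 - (p - p0) \<bullet> (p - p0)) * ((p - p0) \<bullet> v)))) (at p)"
proof -
 have sq: "((%q::real. (max 0 q)\<^sup>2) has_derivative (%v. 2 * max 0 q * v)) (at q)" for q
 proof -
  consider "q > 0" | "q < 0" | "q = 0" by linarith
  then show ?thesis
  proof cases
   case 1
   have "((%q::real. q\<^sup>2) has_derivative (%v. 2 * max 0 q * v)) (at q)"
    using 1 by (auto intro!: derivative_eq_intros)
   then show ?thesis by (rule has_derivative_transform_within_open[of _ _ _ _ "{0<..}"]) (use 1 in auto)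
  next
   case 2
   have "((%q::real. 0::real) has_derivative (%v. 2 * max 0 q * v)) (at q)" using 2 by (simp add: max_def)
   then show ?thesis by (rule has_derivative_transform_within_open[of _ _ _ _ "{..<0}"]) (use 2 in auto)
  next
   case 3
   have "norm ((max 0 y)\<^sup>2) <= e * norm y" if "norm y < e" for e y :: real
   proof -
    have "(max 0 y)\<^sup>2 <= \<bar>y\<bar> * \<bar>y\<bar>" by (auto simp: max_def power2_eq_square)
    also have "\<dots> <= e * \<bar>y\<bar>" using that by (intro mult_right_mono) auto
    finally show ?thesis by simp
   qed
   then have "((%q::real. (max 0 q)\<^sup>2) has_derivative (%_. 0)) (at 0)" unfolding has_derivative_at_alt by auto
   moreover have "(%v. 2 * max 0 q * v) = (%_. 0)" using 3 by (intro ext) simp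
   ultimately show ?thesis unfolding 3 by simp
  qed
 qed
 have q: "((%p. r\<^sup>2 - (p - p0) \<bullet> (p - p0)) has_derivative (%v. - (2 * ((p - p0) \<bullet> v)))) (at p)"
  by (auto intro!: derivative_eq_intros simp: inner_commute)
 show ?thesis unfolding b_def by (rule has_derivative_eq_rhs[OF has_derivative_compose[OF q sq]]) auto
qed

text \<open>The bump \<open>b\<close> and its products with the coordinates. Equality of the bumps
  forces \<open>z\<close> into the same ball of the chart, since \<open>b\<close> vanishes exactly
  outside, and dividing by \<open>b\<close> then recovers the coordinates; so \<open>y\<close> is
  separated from every other point of the manifold.\<close>

lemma bump_family:
 obtains W F where "open W" "x \<in> W" "finite F" "!!u. u \<in> F ==> lipschitz_function u"
  "!!y z. y \<in> W ==> (!!u. u \<in> F ==> u y = u z) ==> y = z"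
proof -
 obtain c where c: "c \<in> A" and xc: "x \<in> fst c" by (rule chart_at)
 obtain V m M where V: "open V" "x \<in> V" "V \<subseteq> fst c" "0 < m" "0 < M"
  "!!y v. y \<in> V ==> m * (norm v)\<^sup>2 <= g c y v v" "!!y v. y \<in> V ==> g c y v v <= M * (norm v)\<^sup>2"
  by (rule metric_local[OF c xc], rule that)
 define p0 where "p0 = snd c x"
 have "open (snd c ` (fst c \<inter> V))" by (rule chart_image_open[OF c V(1)])
 then obtain r where r: "r > 0" "cball p0 r \<subseteq> snd c ` (fst c \<inter> V)"
  using V(2) xc unfolding open_contains_cball p0_def by blast
 have inV: "chart_inv c p \<in> V" if "p \<in> cball p0 r" for p using that r(2) c by auto
 define k where "k p = max 0 (r\<^sup>2 - (p - p0) \<bullet> (p - p0))" for p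
 define b where "b p = (k p)\<^sup>2" for p
 define b' where "b' p v = - (4 * k p * ((p - p0) \<bullet> v))" for p v
 have bd: "(b has_derivative b' p) (at p)" for p
  using bump_derivative[of r p0 p] unfolding b_def[abs_def] b'_def[abs_def] k_def .
 have b0: "b p = 0 \<longleftrightarrow> p \<notin> ball p0 r" for p
 proof -
  have "r\<^sup>2 - (p - p0) \<bullet> (p - p0) <= 0 \<longleftrightarrow> r <= norm (p - p0)"
   using r(1) abs_le_square_iff[of r "norm (p - p0)"] by (simp add: power2_norm_eq_inner)
  then show ?thesis by (auto simp: b_def k_def max_def dist_norm norm_minus_commute)
 qed
 have k: "0 <= k p" "k p <= r\<^sup>2" for p by (auto simp: k_def)
 have b'b: "\<bar>b' p v\<bar> <= 4 * r\<^sup>2 * r * norm v" if "p \<in> cball p0 r" for p v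
 proof -
  have "norm (p - p0) <= r" using that by (simp add: dist_norm norm_minus_commute)
  then have "\<bar>(p - p0) \<bullet> v\<bar> <= r * norm v"
   using Cauchy_Schwarz_ineq2[of "p - p0" v] mult_right_mono[of "norm (p - p0)" r "norm v"] by simp
  then have "k p * \<bar>(p - p0) \<bullet> v\<bar> <= r\<^sup>2 * (r * norm v)" using k by (intro mult_mono) auto
  then show ?thesis using k(1)[of p] by (simp add: b'_def abs_mult)
 qed
 let ?ext = "%h x. if x \<in> fst c then h (snd c x) else (0::real)"
 have K: "compact (cball p0 r)" "cball p0 r \<subseteq> snd c ` fst c" using r(2) by auto
 have low: "m * (norm v)\<^sup>2 <= g c (chart_inv c p) v v" if "p \<in> cball p0 r" for p v by (rule V(6)[OF inV[OF that]])
 have L1: "lipschitz_function (?ext b)"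
  by (rule chart_function_lipschitz[OF c K bd _ b'b V(4) low]) (use b0 in auto)
 have L2: "lipschitz_function (?ext (%p. b p * (p \<bullet> e)))" if e: "e \<in> Basis" for e
 proof (rule chart_function_lipschitz[OF c K _ _ _ V(4) low])
  show "((%p. b p * (p \<bullet> e)) has_derivative (%v. b p * (v \<bullet> e) + b' p v * (p \<bullet> e))) (at p)" for p
   by (intro derivative_intros bd has_derivative_inner_left)
  show "b p * (p \<bullet> e) = 0" if "p \<notin> cball p0 r" for p using that b0 by auto
  fix p v assume p: "p \<in> cball p0 r"
  have "norm p <= norm p0 + r" using p norm_triangle_ineq2[of p p0] by (simp add: dist_norm norm_minus_commute)
  then have pe: "\<bar>p \<bullet> e\<bar> <= norm p0 + r" using Basis_le_norm[OF e, of p] by linarith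
  have bp: "\<bar>b p\<bar> <= (r\<^sup>2)\<^sup>2" unfolding b_def using power_mono[OF k(2,1), of p 2] by simp
  have "\<bar>b p * (v \<bullet> e) + b' p v * (p \<bullet> e)\<bar> <= \<bar>b p\<bar> * \<bar>v \<bullet> e\<bar> + \<bar>b' p v\<bar> * \<bar>p \<bullet> e\<bar>"
   by (metis abs_mult abs_triangle_ineq)
  also have "\<dots> <= (r\<^sup>2)\<^sup>2 * norm v + (4 * r\<^sup>2 * r * norm v) * (norm p0 + r)"
   using r(1) by (intro add_mono mult_mono bp b'b[OF p] pe Basis_le_norm e) auto
  finally show "\<bar>b p * (v \<bullet> e) + b' p v * (p \<bullet> e)\<bar> <= ((r\<^sup>2)\<^sup>2 + 4 * r\<^sup>2 * r * (norm p0 + r)) * norm v"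
   by (simp add: algebra_simps)
 qed
 show ?thesis
 proof (rule that[of "fst c \<inter> snd c -` ball p0 r" "insert (?ext b) ((%e. ?ext (%p. b p * (p \<bullet> e))) ` Basis)"])
  show "open (fst c \<inter> snd c -` ball p0 r)" by (rule chart_preimage_open[OF c open_ball])
  show "x \<in> fst c \<inter> snd c -` ball p0 r" using xc r(1) by (simp add: p0_def)
  show "finite (insert (?ext b) ((%e. ?ext (%p. b p * (p \<bullet> e))) ` Basis))" by simp
  show "lipschitz_function u" if "u \<in> insert (?ext b) ((%e. ?ext (%p. b p * (p \<bullet> e))) ` Basis)" for u
   using that L1 L2 by blast
  fix y z assume y: "y \<in> fst c \<inter> snd c -` ball p0 r"
   and eq: "!!u. u \<in> insert (?ext b) ((%e. ?ext (%p. b p * (p \<bullet> e))) ` Basis) ==> u y = u z"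
  have e1: "?ext b y = ?ext b z" by (rule eq) simp
  have ny: "b (snd c y) \<noteq> 0" "y \<in> fst c" using y b0 by auto
  have z: "z \<in> fst c" "b (snd c z) = b (snd c y)" using e1 ny by (simp_all split: if_splits)
  have "snd c y \<bullet> e = snd c z \<bullet> e" if "e \<in> Basis" for e
  proof -
   have "?ext (%p. b p * (p \<bullet> e)) y = ?ext (%p. b p * (p \<bullet> e)) z" using that by (intro eq) blast
   then show ?thesis using ny z by simp
  qed
  then have "snd c y = snd c z" by (rule euclidean_eqI)
  then show "y = z" using c ny(2) z(1) by (metis chart_inv_chart)
 qed
qed

lemma separating_family:
 assumes X: "compact X"
 obtains F where "finite F" "!!u. u \<in> F ==> lipschitz_function u"
  "!!y z. y \<in> X ==> (!!u. u \<in> F ==> u y = u z) ==> y = z"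
proof -
 have "\<exists>W F. open W \<and> x \<in> W \<and> finite F \<and> (\<forall>u\<in>F. lipschitz_function u) \<and>
   (\<forall>y z. y \<in> W --> (\<forall>u\<in>F. u y = u z) --> y = z)" for x
  by (rule bump_family[of x]) metis
 then obtain W F where W: "!!x. open (W x)" "!!x. x \<in> W x" "!!x. finite (F x)"
  "!!x u. u \<in> F x ==> lipschitz_function u" "!!x y z. y \<in> W x ==> (\<forall>u\<in>F x. u y = u z) ==> y = z"
  by metis
 have "X \<subseteq> (\<Union>x\<in>X. W x)" using W(2) by blast
 then obtain T where T: "T \<subseteq> X" "finite T" "X \<subseteq> (\<Union>x\<in>T. W x)" using W(1) by (metis compactE_image[OF X])
 show ?thesis
 proof (rule that[of "\<Union>x\<in>T. F x"])
  fix y z assume y: "y \<in> X" and eq: "!!u. u \<in> (\<Union>x\<in>T. F x) ==> u y = u z"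
  obtain x where "x \<in> T" "y \<in> W x" using T(3) y by blast
  then show "y = z" using W(5)[of y x z] eq by blast
 qed (use T W in auto)
qed

end

text \<open>The pairs in no common \<open>V x\<close> form a compact set off the diagonal, on which
  \<open>rh\<close> is bounded below by a positive number.\<close>

lemma (in compact_metric) lebesgue_number:
 assumes V: "!!x. x \<in> X ==> open (V x)" "!!x. x \<in> X ==> x \<in> V x"
 obtains e where "e > 0" "!!y z. y \<in> X ==> z \<in> X ==> rh y z <= e ==> \<exists>x\<in>X. y \<in> V x \<and> z \<in> V x"
proof -
 define Q where "Q = X \<times> X - (\<Union>x\<in>X. V x \<times> V x)"
 have "open (\<Union>x\<in>X. V x \<times> V x)" using V(1) by (intro open_UN ballI open_Times)
 then have cQ: "compact Q" unfolding Q_def by (rule compact_diff[OF compact_Times[OF compact_X compact_X]])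
 have out: "(y, z) \<in> Q" if "y \<in> X" "z \<in> X" "\<not> (\<exists>x\<in>X. y \<in> V x \<and> z \<in> V x)" for y z
  using that by (auto simp: Q_def)
 show ?thesis
 proof (cases "Q = {}")
  case True
  then show ?thesis using out by (intro that[of 1]) auto
 next
  case False
  have "continuous_on Q (%(x, y). rh x y)" using rho_cont by (rule continuous_on_subset) (auto simp: Q_def)
  then obtain p where p: "p \<in> Q" "!!q. q \<in> Q ==> (%(x, y). rh x y) p <= (%(x, y). rh x y) q"
   using continuous_attains_inf[OF cQ False] by blast
  obtain a b where ab: "p = (a, b)" by (cases p)
  have "a \<in> X" "b \<in> X" "a \<noteq> b" using p(1) V(2) ab by (auto simp: Q_def)
  then have pos: "rh a b > 0" using rho_zero[of a b] rho_nonneg[of a b] by simp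
  show ?thesis
  proof (rule that[of "rh a b / 2"])
   fix y z assume yz: "y \<in> X" "z \<in> X" "rh y z <= rh a b / 2"
   show "\<exists>x\<in>X. y \<in> V x \<and> z \<in> V x"
   proof (rule ccontr)
    assume "\<not> ?thesis"
    from p(2)[OF out[OF yz(1,2) this]] show False using ab yz(3) pos by simp
   qed
  qed (use pos in simp)
 qed
qed

text \<open>The l1 distance pulled back along the map with components in \<open>F\<close>, which is
  injective on \<open>X\<close> by separation.\<close>

lemma separating_compact_metric:
 fixes X :: "'m::{t2_space, second_countable_topology} set"
 assumes X: "compact X" "X \<noteq> {}" and F: "finite F" "!!u. u \<in> F ==> continuous_on UNIV u"
  and sep: "!!y z. y \<in> X ==> (!!u. u \<in> F ==> u y = u z) ==> y = z"
 shows "compact_metric X (%x y. \<Sum>u\<in>F. \<bar>u x - u y\<bar> :: real)"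
proof
 have "continuous_on (X \<times> X) (%p. u (fst p))" "continuous_on (X \<times> X) (%p. u (snd p))" if "u \<in> F" for u
  by (rule continuous_on_compose2[OF F(2)[OF that] continuous_on_fst[OF continuous_on_id] subset_UNIV]
    continuous_on_compose2[OF F(2)[OF that] continuous_on_snd[OF continuous_on_id] subset_UNIV])+
 then show "continuous_on (X \<times> X) (%(x, y). \<Sum>u\<in>F. \<bar>u x - u y\<bar>)"
  unfolding split_beta by (intro continuous_intros)
 show "(\<Sum>u\<in>F. \<bar>u x - u y\<bar>) = 0 \<longleftrightarrow> x = y" if "x \<in> X" for x y
  using F(1) sep[OF that, of y] by (auto simp: sum_nonneg_eq_0_iff)
 show "(\<Sum>u\<in>F. \<bar>u x - u z\<bar>) <= (\<Sum>u\<in>F. \<bar>u x - u y\<bar>) + (\<Sum>u\<in>F. \<bar>u y - u z\<bar>)" for x y z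
  unfolding sum.distrib[symmetric] by (intro sum_mono) linarith
qed (use X in \<open>auto intro: sum_nonneg simp: abs_minus_commute\<close>)

section \<open>Repellers\<close>

context riemannian_manifold
begin

lemma metric_nonneg: "c \<in> A ==> x \<in> fst c ==> 0 <= g c x v v"
 using metric_pos[of c x v] bilinear_lzero[OF metric_bilinear, of c x 0] by (cases "v = 0") auto

lemma funpow_cont:
 fixes f :: "'m => 'm"
 assumes f: "continuous_on UNIV f"
 shows "continuous_on UNIV (f ^^ n)"
proof (induction n)
 case (Suc n)
 show ?case unfolding funpow.simps by (rule continuous_on_compose[OF Suc.IH continuous_on_subset[OF f subset_UNIV]])
qed (simp add: continuous_on_id[unfolded id_def[symmetric]])

lemma C1_mapD:
 assumes "C1_map A f"
 shows "continuous_on UNIV f" and "c \<in> A ==> c' \<in> A ==> Ck_on 1 (snd c ` (fst c \<inter> f -` fst c')) (snd c' \<circ> f \<circ> chart_inv c)"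
 using assms unfolding C1_map_def by blast+

lemma chart_domain_open:
 assumes "continuous_on UNIV h" "c \<in> A" "c' \<in> A"
 shows "open (snd c ` (fst c \<inter> h -` fst c'))"
 using assms by (intro chart_image_open open_vimage chart_open)

text \<open>Intermediate points of the orbit need charts of their own, so the chain rule is applied
  step by step and yields some strict derivative; uniqueness of derivatives identifies it with
  \<open>local_deriv\<close>.\<close>

lemma strict_funpow:
 assumes f: "C1_map A f" and c: "c \<in> A" "c' \<in> A" and x: "x \<in> fst c" "(f ^^ n) x \<in> fst c'"
 shows "strict_deriv (snd c' \<circ> f ^^ n \<circ> chart_inv c) (local_deriv c c' (f ^^ n) x) (snd c x)"
proof -
 have "\<exists>D. strict_deriv (snd c' \<circ> f ^^ n \<circ> chart_inv c) D (snd c x)" using c(2) x(2)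
 proof (induction n arbitrary: c')
  case 0
  have "strict_deriv (snd c' \<circ> chart_inv c) (frechet_derivative (snd c' \<circ> chart_inv c) (at (snd c x))) (snd c x)"
   by (rule strict_deriv_Ck[OF chart_image_open[OF c(1) chart_open(1)[OF 0(1)]] _ transition_Ck[OF c(1) 0(1)]])
    (use 0 x in auto)
  then show ?case by (simp only: funpow.simps comp_id) blast
 next
  case (Suc n)
  obtain c'' where c'': "c'' \<in> A" "(f ^^ n) x \<in> fst c''" by (rule chart_at)
  obtain D where D: "strict_deriv (snd c'' \<circ> f ^^ n \<circ> chart_inv c) D (snd c x)" using Suc.IH[OF c''] by blast
  define E where "E = frechet_derivative (snd c' \<circ> f \<circ> chart_inv c'') (at (snd c'' ((f ^^ n) x)))"
  have "strict_deriv (snd c' \<circ> f \<circ> chart_inv c'') E (snd c'' ((f ^^ n) x))"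
   unfolding E_def
   by (rule strict_deriv_Ck[OF chart_domain_open[OF C1_mapD(1)[OF f] c''(1) Suc.prems(1)] _ C1_mapD(2)[OF f c''(1) Suc.prems(1)]])
    (use Suc.prems c'' in auto)
  then have "strict_deriv (snd c' \<circ> f \<circ> chart_inv c'') E ((snd c'' \<circ> f ^^ n \<circ> chart_inv c) (snd c x))"
   using c(1) x(1) by simp
  from strict_deriv_compose[OF D this] have "strict_deriv (snd c' \<circ> f ^^ Suc n \<circ> chart_inv c) (E \<circ> D) (snd c x)"
   by (rule strict_deriv_transform[OF _ chart_domain_open[OF funpow_cont[OF C1_mapD(1)[OF f]] c(1) c''(1), of n]])
    (use c c'' x in auto)
  then show ?case by blast
 qed
 then obtain D where D: "strict_deriv (snd c' \<circ> f ^^ n \<circ> chart_inv c) D (snd c x)" by blast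
 then show ?thesis using frechet_derivative_at[OF strict_deriv_has_derivative[OF D]] by (simp add: local_deriv_def)
qed

text \<open>Of the factor 16 at \<open>x\<close>, the two mixed terms with the remainder of the
  strict derivative consume at most 1, because \<open>e\<close> makes each at most half of
  \<open>m * (norm v)\<^sup>2\<close>. Passing from \<open>x\<close> to \<open>y\<close> and from
  \<open>F x\<close> to \<open>F y\<close> costs a factor \<open>3 / 2\<close> each, and more than 2
  remains.\<close>

lemma local_growth:
 assumes F: "continuous_on UNIV F" and c: "c \<in> A" "c' \<in> A" and x: "x \<in> fst c" "F x \<in> fst c'"
  and D: "strict_deriv (snd c' \<circ> F \<circ> chart_inv c) D (snd c x)"
  and ex: "!!v. 16 * g c x v v <= g c' (F x) (D v) (D v)"
 obtains V where "open V" "x \<in> V" "!!y. y \<in> V ==> F y \<in> fst c'"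
  "!!y z. y \<in> V ==> z \<in> V ==> 2 * g c y (snd c z - snd c y) (snd c z - snd c y)
    <= g c' (F y) (snd c' (F z) - snd c' (F y)) (snd c' (F z) - snd c' (F y))"
proof -
 obtain V1 m M where V1: "open V1" "x \<in> V1" "V1 \<subseteq> fst c" "0 < m" "0 < M"
  "!!y v. y \<in> V1 ==> m * (norm v)\<^sup>2 <= g c y v v" "!!y v. y \<in> V1 ==> g c y v v <= M * (norm v)\<^sup>2"
  "!!y v. y \<in> V1 ==> 2 * g c y v v <= 3 * g c x v v" "!!y v. y \<in> V1 ==> 2 * g c x v v <= 3 * g c y v v"
  by (rule metric_local[OF c(1) x(1)], rule that)
 obtain V2 m' M' where V2: "open V2" "F x \<in> V2" "V2 \<subseteq> fst c'" "0 < m'" "0 < M'"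
  "!!y v. y \<in> V2 ==> m' * (norm v)\<^sup>2 <= g c' y v v" "!!y v. y \<in> V2 ==> g c' y v v <= M' * (norm v)\<^sup>2"
  "!!y v. y \<in> V2 ==> 2 * g c' y v v <= 3 * g c' (F x) v v" "!!y v. y \<in> V2 ==> 2 * g c' (F x) v v <= 3 * g c' y v v"
  by (rule metric_local[OF c(2) x(2)], rule that)
 note bil = metric_bilinear[OF c(2) x(2)]
 obtain B where B: "B > 0" "!!v w. norm (g c' (F x) v w) <= B * norm v * norm w"
  using bilinear_bounded_pos[OF bil] by blast
 have "bounded_linear D" using D by (simp add: strict_deriv_def)
 then obtain BD where BD: "BD > 0" "!!v. norm (D v) <= norm v * BD" using bounded_linear.pos_bounded by blast
 define e where "e = m / (2 * B * BD)"
 have e: "e > 0" using V1(4) B(1) BD(1) by (simp add: e_def)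
 obtain d where d: "d > 0" "!!a b. a \<in> ball (snd c x) d ==> b \<in> ball (snd c x) d ==>
   norm ((snd c' \<circ> F \<circ> chart_inv c) b - (snd c' \<circ> F \<circ> chart_inv c) a - D (b - a)) <= e * norm (b - a)"
  using D e unfolding strict_deriv_def by blast
 show ?thesis
 proof (rule that[of "V1 \<inter> (fst c \<inter> snd c -` ball (snd c x) d) \<inter> F -` V2"])
  show "open (V1 \<inter> (fst c \<inter> snd c -` ball (snd c x) d) \<inter> F -` V2)"
   by (intro open_Int V1 chart_preimage_open c open_ball open_vimage[OF V2(1)] F)
  show "x \<in> V1 \<inter> (fst c \<inter> snd c -` ball (snd c x) d) \<inter> F -` V2" using V1 V2 x d by simp
  show "F y \<in> fst c'" if "y \<in> V1 \<inter> (fst c \<inter> snd c -` ball (snd c x) d) \<inter> F -` V2" for y using that V2 by blast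
  fix y z assume y: "y \<in> V1 \<inter> (fst c \<inter> snd c -` ball (snd c x) d) \<inter> F -` V2"
   and z: "z \<in> V1 \<inter> (fst c \<inter> snd c -` ball (snd c x) d) \<inter> F -` V2"
  define v where "v = snd c z - snd c y"
  define u where "u = snd c' (F z) - snd c' (F y)"
  define r where "r = u - D v"
  have r: "norm r <= e * norm v"
   using d(2)[of "snd c y" "snd c z"] y z c by (simp add: r_def u_def v_def)
  have cross: "B * (norm v * BD) * (e * norm v) = m / 2 * (norm v)\<^sup>2"
   using B(1) BD(1) by (simp add: e_def power2_eq_square)
  have "norm (g c' (F x) (D v) r) <= B * (norm v * BD) * (e * norm v)"
   using B(1) BD r by (intro order_trans[OF B(2)] mult_mono mult_nonneg_nonneg) auto
  moreover have "norm (g c' (F x) r (D v)) <= B * (e * norm v) * (norm v * BD)"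
   using B(1) BD r e by (intro order_trans[OF B(2)] mult_mono mult_nonneg_nonneg) auto
  moreover have "B * (e * norm v) * (norm v * BD) = B * (norm v * BD) * (e * norm v)" by simp
  ultimately have cr: "\<bar>g c' (F x) (D v) r\<bar> <= m / 2 * (norm v)\<^sup>2" "\<bar>g c' (F x) r (D v)\<bar> <= m / 2 * (norm v)\<^sup>2"
   using cross by simp_all
  have "u = D v + r" by (simp add: r_def)
  then have "g c' (F x) u u = g c' (F x) (D v) (D v) + g c' (F x) (D v) r + g c' (F x) r (D v) + g c' (F x) r r"
   by (simp add: bilinear_ladd[OF bil] bilinear_radd[OF bil])
  moreover have "m * (norm v)\<^sup>2 <= g c x v v" using V1 by blast
  moreover have "0 <= g c' (F x) r r" by (rule metric_nonneg[OF c(2) x(2)])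
  ultimately have "15 * g c x v v <= g c' (F x) u u" using cr ex[of v] by simp
  moreover have "2 * g c' (F x) u u <= 3 * g c' (F y) u u" using V2(9) y by blast
  moreover have "2 * g c y v v <= 3 * g c x v v" using V1(8) y by blast
  moreover have "0 <= g c y v v" using y by (intro metric_nonneg c) auto
  ultimately show "2 * g c y (snd c z - snd c y) (snd c z - snd c y)
    <= g c' (F y) (snd c' (F z) - snd c' (F y)) (snd c' (F z) - snd c' (F y))"
   unfolding v_def[symmetric] u_def[symmetric] by linarith
 qed
qed

lemma repellerD:
 assumes "isolated_repeller A g f X"
 shows "X \<noteq> {}" "compact X" "f ` X = X"
 using assms by (auto simp: isolated_repeller_def)

lemma repeller_expansion:
 assumes "isolated_repeller A g f X"
 obtains C l where "C > 0" "l > 1" "!!x n c c' v. x \<in> X ==> n >= 1 ==> c \<in> A ==> c' \<in> A ==> x \<in> fst c ==>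
   (f ^^ n) x \<in> fst c' ==> tangent_norm g c' ((f ^^ n) x) (local_deriv c c' (f ^^ n) x v) >= C * l ^ n * tangent_norm g c x v"
proof -
 obtain C l where C: "C > 0" "l > 1" and ex: "\<forall>x\<in>X. \<forall>n\<ge>1. \<forall>c\<in>A. \<forall>c'\<in>A. x \<in> fst c --> (f ^^ n) x \<in> fst c' -->
    (\<forall>v. tangent_norm g c' ((f ^^ n) x) (local_deriv c c' (f ^^ n) x v) >= C * l ^ n * tangent_norm g c x v)"
  using assms unfolding isolated_repeller_def by (elim conjE exE)
 show ?thesis by (rule that[OF C]) (rule ex[rule_format])
qed

lemma compact_charts:
 obtains c K W where "c \<in> A" "compact K" "K \<subseteq> fst c" "open W" "x \<in> W" "W \<subseteq> K"
proof -
 obtain c where c: "c \<in> A" "x \<in> fst c" by (rule chart_at)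
 obtain r where r: "r > 0" "cball (snd c x) r \<subseteq> snd c ` fst c"
  using chart_open(2)[OF c(1)] c(2) unfolding open_contains_cball by blast
 show ?thesis
 proof (rule that[OF c(1), of "chart_inv c ` cball (snd c x) r" "fst c \<inter> snd c -` ball (snd c x) r"])
  show "compact (chart_inv c ` cball (snd c x) r)"
   by (intro compact_continuous_image continuous_on_subset[OF chart_inv_cont[OF c(1)]] r compact_cball)
  show "fst c \<inter> snd c -` ball (snd c x) r \<subseteq> chart_inv c ` cball (snd c x) r"
  proof
   fix y assume "y \<in> fst c \<inter> snd c -` ball (snd c x) r"
   then show "y \<in> chart_inv c ` cball (snd c x) r" using c(1) by (intro image_eqI[of _ _ "snd c y"]) auto
  qed
 qed (use c r chart_preimage_open in auto)
qed

lemma local_size: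
 assumes c: "c \<in> A" and x: "x \<in> fst c"
 obtains V where "open V" "x \<in> V" "V \<subseteq> fst c"
  "!!y z. y \<in> V ==> z \<in> V ==> g c y (snd c z - snd c y) (snd c z - snd c y) <= 1"
proof -
 obtain V m M where V: "open V" "x \<in> V" "V \<subseteq> fst c" "0 < m" "0 < M"
  "!!y v. y \<in> V ==> m * (norm v)\<^sup>2 <= g c y v v" "!!y v. y \<in> V ==> g c y v v <= M * (norm v)\<^sup>2"
  by (rule metric_local[OF c x], rule that)
 define r where "r = 1 / (2 * sqrt M)"
 have r: "r > 0" "M * (2 * r)\<^sup>2 = 1" using V(5) by (simp_all add: r_def power2_eq_square)
 show ?thesis
 proof (rule that[of "V \<inter> (fst c \<inter> snd c -` ball (snd c x) r)"])
  show "open (V \<inter> (fst c \<inter> snd c -` ball (snd c x) r))" by (intro open_Int V chart_preimage_open c open_ball)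
  fix y z assume y: "y \<in> V \<inter> (fst c \<inter> snd c -` ball (snd c x) r)" and z: "z \<in> V \<inter> (fst c \<inter> snd c -` ball (snd c x) r)"
  have "dist (snd c y) (snd c z) <= 2 * r"
   using y z dist_triangle2[of "snd c y" "snd c z" "snd c x"] by (simp add: dist_commute)
  then have "M * (norm (snd c z - snd c y))\<^sup>2 <= M * (2 * r)\<^sup>2"
   using V(5) by (intro mult_left_mono power_mono) (auto simp: dist_norm norm_minus_commute)
  then show "g c y (snd c z - snd c y) (snd c z - snd c y) <= 1" using V(7)[of y "snd c z - snd c y"] y r(2) by simp
 qed (use V x r in auto)
qed

text \<open>
 Charts are chosen from a finite set with compact domains. In these, an iterate of \<open>f\<close> doubles the
 squared length of the coordinate difference of nearby points, which stays bounded on close orbits.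
\<close>

lemma repeller_expansive:
 assumes f: "C1_map A f" and X: "isolated_repeller A g f X" and rh: "compact_metric X rh"
 obtains e0 where "e0 > 0" "!!x y. x \<in> X ==> y \<in> X ==> (!!n. rh ((f ^^ n) x) ((f ^^ n) y) <= e0) ==> x = y"
proof -
 interpret compact_metric X rh by (rule rh)
 obtain C l where C: "C > 0" "l > 1" and ex: "!!x n c c' v. x \<in> X ==> n >= 1 ==> c \<in> A ==> c' \<in> A ==> x \<in> fst c ==>
   (f ^^ n) x \<in> fst c' ==> tangent_norm g c' ((f ^^ n) x) (local_deriv c c' (f ^^ n) x v) >= C * l ^ n * tangent_norm g c x v"
  by (rule repeller_expansion[OF X], rule that)
 \<comment> \<open>Norms must grow by 4, hence squared norms by the factor 16 of
   \<open>local_growth\<close>. The iterate \<open>Suc k\<close> is taken because expansion is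
   assumed only at positive times.\<close>
 obtain k where "4 / C < l ^ k" using real_arch_pow[OF C(2)] by blast
 also have "l ^ k <= l ^ Suc k" using C(2) by (intro power_increasing) auto
 finally have N4: "4 <= C * l ^ Suc k" using C(1) by (simp add: field_simps)
 define F where "F = f ^^ Suc k"
 have contF: "continuous_on UNIV F" unfolding F_def by (rule funpow_cont[OF C1_mapD(1)[OF f]])
 have exF: "16 * g c x v v <= g c' (F x) (local_deriv c c' F x v) (local_deriv c c' F x v)"
  if x: "x \<in> X" and c: "c \<in> A" "c' \<in> A" "x \<in> fst c" "F x \<in> fst c'" for x c c' v
 proof -
  have "4 * sqrt (g c x v v) <= C * l ^ Suc k * sqrt (g c x v v)"
   using N4 metric_nonneg[OF c(1,3)] by (intro mult_right_mono) auto
  also have "\<dots> <= sqrt (g c' (F x) (local_deriv c c' F x v) (local_deriv c c' F x v))"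
   using ex[OF x _ c(1-3), of "Suc k" v] c(4) unfolding F_def tangent_norm_def by simp
  finally have "sqrt (16 * g c x v v) <= sqrt (g c' (F x) (local_deriv c c' F x v) (local_deriv c c' F x v))"
   by (simp add: real_sqrt_mult)
  then show ?thesis by simp
 qed
 have "\<exists>c K W. c \<in> A \<and> compact K \<and> K \<subseteq> fst c \<and> open W \<and> x \<in> W \<and> W \<subseteq> K" for x
  by (rule compact_charts[of x]) blast
 then obtain c K W where cK: "!!x. c x \<in> A" "!!x. compact (K x)" "!!x. K x \<subseteq> fst (c x)" "!!x. open (W x)"
  "!!x. x \<in> W x" "!!x. W x \<subseteq> K x" by metis
 have "X \<subseteq> (\<Union>x\<in>X. W x)" using cK(5) by blast
 then obtain T where T: "T \<subseteq> X" "finite T" "X \<subseteq> (\<Union>x\<in>T. W x)" using cK(4) by (metis compactE_image[OF compact_X])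
 define q where "q s y z = g (c s) y (snd (c s) z - snd (c s) y) (snd (c s) z - snd (c s) y)" for s y z
 \<comment> \<open>Nothing is demanded of points outside the compact cores \<open>K s\<close> and
   \<open>K t\<close>. As the cores are closed, every point has a good neighbourhood for each pair
   of charts, and finitely many pairs can be intersected.\<close>
 let ?good = "%V s t. \<forall>y\<in>V. \<forall>z\<in>V. y \<in> K s --> z \<in> fst (c s) \<and> q s y z <= 1 \<and> (F y \<in> K t --> 2 * q s y z <= q t (F y) (F z))"
 have "\<exists>V. open V \<and> x \<in> V \<and> ?good V s t" if x: "x \<in> X" for x s t
 proof (cases "x \<in> K s")
  case False
  then show ?thesis using compact_imp_closed[OF cK(2)] by (intro exI[of _ "- K s"]) auto
 next
  case True
  then have xs: "x \<in> fst (c s)" using cK(3) by blast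
  obtain V1 where V1: "open V1" "x \<in> V1" "V1 \<subseteq> fst (c s)" "!!y z. y \<in> V1 ==> z \<in> V1 ==> q s y z <= 1"
   by (rule local_size[OF cK(1) xs, folded q_def], rule that)
  show ?thesis
  proof (cases "F x \<in> K t")
   case False
   have "open (V1 \<inter> F -` (- K t))" using compact_imp_closed[OF cK(2)] V1(1) by (intro open_Int open_vimage contF) auto
   then show ?thesis using V1 False by (intro exI[of _ "V1 \<inter> F -` (- K t)"]) auto
  next
   case True
   then have xt: "F x \<in> fst (c t)" using cK(3) by blast
   have str: "strict_deriv (snd (c t) \<circ> F \<circ> chart_inv (c s)) (local_deriv (c s) (c t) F x) (snd (c s) x)"
    using strict_funpow[OF f cK(1) cK(1) xs, of "Suc k" t] xt unfolding F_def by blast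
   obtain V2 where V2: "open V2" "x \<in> V2" "!!y z. y \<in> V2 ==> z \<in> V2 ==> 2 * q s y z <= q t (F y) (F z)"
    by (rule local_growth[OF contF cK(1) cK(1) xs xt str exF[OF x cK(1) cK(1) xs xt], folded q_def], rule that)
   show ?thesis using V1 V2 by (intro exI[of _ "V1 \<inter> V2"]) auto
  qed
 qed
 then obtain V where V: "!!x s t. x \<in> X ==> open (V x s t)" "!!x s t. x \<in> X ==> x \<in> V x s t"
  "!!x s t. x \<in> X ==> ?good (V x s t) s t" by metis
 define Vs where "Vs x = (\<Inter>s\<in>T. \<Inter>t\<in>T. V x s t)" for x
 have oVs: "open (Vs x)" if "x \<in> X" for x unfolding Vs_def using T(2) V(1)[OF that] by (intro open_INT ballI)
 have xVs: "x \<in> Vs x" if "x \<in> X" for x using V(2)[OF that] by (simp add: Vs_def)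
 obtain e0 where e0: "e0 > 0" "!!y z. y \<in> X ==> z \<in> X ==> rh y z <= e0 ==> \<exists>x\<in>X. y \<in> Vs x \<and> z \<in> Vs x"
  by (rule lebesgue_number[OF oVs xVs], assumption, assumption, rule that)
 have close: "z \<in> fst (c s) \<and> q s y z <= 1 \<and> (F y \<in> K t --> 2 * q s y z <= q t (F y) (F z))"
  if "y \<in> X" "z \<in> X" "rh y z <= e0" "s \<in> T" "t \<in> T" "y \<in> K s" for y z s t
 proof -
  have "\<exists>x\<in>X. y \<in> Vs x \<and> z \<in> Vs x" by (rule e0(2)[OF that(1-3)])
  then obtain x where x: "x \<in> X" "y \<in> Vs x" "z \<in> Vs x" by blast
  then have "y \<in> V x s t" "z \<in> V x s t" using that(4,5) by (auto simp: Vs_def)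
  then show ?thesis using V(3)[OF x(1), of s t] that(6) by blast
 qed
 show ?thesis
 proof (rule that[OF e0(1)])
  fix x y assume x: "x \<in> X" and y: "y \<in> X" and orb: "!!n. rh ((f ^^ n) x) ((f ^^ n) y) <= e0"
  have fX: "(f ^^ n) z \<in> X" if "z \<in> X" for n z by (induction n) (use that repellerD(3)[OF X] in auto)
  define a where "a j = (F ^^ j) x" for j
  define b where "b j = (F ^^ j) y" for j
  have Fj: "F ^^ j = f ^^ (Suc k * j)" for j unfolding F_def by (simp only: funpow_mult)
  have ab: "a j \<in> X" "b j \<in> X" "rh (a j) (b j) <= e0" for j
   using fX x y orb by (simp_all only: a_def b_def Fj)
  have "\<exists>s\<in>T. a j \<in> K s" for j using ab(1)[of j] T(3) cK(6) by blast
  then obtain s where s: "!!j. s j \<in> T" "!!j. a j \<in> K (s j)" by metis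
  have step: "2 * q (s j) (a j) (b j) <= q (s (Suc j)) (a (Suc j)) (b (Suc j))" for j
   using close[OF ab[of j] s(1)[of j] s(1)[of "Suc j"] s(2)[of j]] s(2)[of "Suc j"] by (simp add: a_def b_def)
  have grow: "2 ^ j * q (s 0) (a 0) (b 0) <= q (s j) (a j) (b j)" for j
  proof (induction j)
   case (Suc j) then show ?case using step[of j] by simp
  qed simp
  have le1: "2 ^ j * q (s 0) (a 0) (b 0) <= 1" for j
   using grow[of j] close[OF ab[of j] s(1)[of j] s(1)[of j] s(2)[of j]] by linarith
  have bc: "b 0 \<in> fst (c (s 0))" using close[OF ab[of 0] s(1)[of 0] s(1)[of 0] s(2)[of 0]] by blast
  have ac: "a 0 \<in> fst (c (s 0))" using s(2)[of 0] cK(3) by blast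
  have "\<not> q (s 0) (a 0) (b 0) > 0"
  proof
   assume pos: "q (s 0) (a 0) (b 0) > 0"
   obtain j where "1 / q (s 0) (a 0) (b 0) < 2 ^ j" using real_arch_pow[of 2] by auto
   then show False using le1[of j] pos by (simp add: field_simps)
  qed
  then have "snd (c (s 0)) (b 0) - snd (c (s 0)) (a 0) = 0"
   using metric_pos[OF cK(1) ac] unfolding q_def by blast
  then have "b 0 = a 0" using chart_inv_chart[OF cK(1) ac] chart_inv_chart[OF cK(1) bc] by simp
  then show "x = y" by (simp add: a_def b_def)
 qed
qed

text \<open>Expansion makes the derivative injective, hence invertible since the dimensions agree,
  so \<open>f\<close> is open on the manifold near \<open>x\<close>. Isolation brings the preimages
  back: a point of \<open>U0\<close> whose image lies in \<open>X\<close> has its whole forward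
  orbit in \<open>U0\<close> and thus belongs to \<open>X\<close>.\<close>

lemma repeller_open:
 assumes f: "C1_map A f" and X: "isolated_repeller A g f X" and U: "openin (top_of_set X) U"
 shows "openin (top_of_set X) (f ` U)"
proof -
 obtain C l where C: "C > 0" "l > 1" and ex: "!!x n c c' v. x \<in> X ==> n >= 1 ==> c \<in> A ==> c' \<in> A ==> x \<in> fst c ==>
   (f ^^ n) x \<in> fst c' ==> tangent_norm g c' ((f ^^ n) x) (local_deriv c c' (f ^^ n) x v) >= C * l ^ n * tangent_norm g c x v"
  by (rule repeller_expansion[OF X], rule that)
 obtain U0 where U0: "open U0" "X \<subseteq> U0" "X = (\<Inter>n. (f ^^ n) -` U0)"
  using X unfolding isolated_repeller_def by (elim conjE exE)
 obtain W where W: "open W" "U = X \<inter> W" using U by (auto simp: openin_open)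
 have "\<exists>V. open V \<and> f x \<in> V \<and> X \<inter> V \<subseteq> f ` U" if x: "x \<in> U" for x
 proof -
  have xX: "x \<in> X" "x \<in> W" using x W by auto
  obtain c where c: "c \<in> A" "x \<in> fst c" by (rule chart_at)
  obtain c' where c': "c' \<in> A" "f x \<in> fst c'" by (rule chart_at)
  define h where "h = snd c' \<circ> f \<circ> chart_inv c"
  define D where "D = local_deriv c c' f x"
  define S where "S = snd c ` (fst c \<inter> f -` fst c')"
  define T where "T = snd c ` (fst c \<inter> (W \<inter> U0 \<inter> f -` fst c'))"
  note cont = C1_mapD(1)[OF f]
  have oS: "open S" unfolding S_def by (rule chart_domain_open[OF cont c(1) c'(1)])
  have xS: "snd c x \<in> S" using c c' by (auto simp: S_def)
  have oT: "open T" unfolding T_def by (intro chart_image_open c open_Int W U0 open_vimage chart_open c' cont)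
  have xT: "snd c x \<in> T" using c c' xX U0(2) by (auto simp: T_def)
  have TS: "T \<subseteq> S" by (auto simp: T_def S_def)
  have Ck: "Ck_on 1 S h" unfolding S_def h_def by (rule C1_mapD(2)[OF f c(1) c'(1)])
  have hS: "continuous_on S h"
   using Ck_1D(1)[OF Ck] by (meson continuous_at_imp_continuous_on has_derivative_continuous)
  have D: "(h has_derivative D) (at (snd c x))"
   using Ck_1D(1)[OF Ck xS] by (simp add: D_def local_deriv_def h_def)
  have linD: "linear D" by (rule has_derivative_linear[OF D])
  have "v = 0" if "D v = 0" for v
  proof (rule ccontr)
   assume "v \<noteq> 0"
   then have "tangent_norm g c x v > 0" using metric_pos[OF c] by (simp add: tangent_norm_def)
   then have "C * l * tangent_norm g c x v > 0" using C by simp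
   moreover have "tangent_norm g c' (f x) (D v) = 0"
    using that bilinear_lzero[OF metric_bilinear[OF c']] by (simp add: tangent_norm_def)
   ultimately show False using ex[OF xX(1) _ c(1) c'(1) c(2), of 1 v] c'(2) by (simp add: D_def)
  qed
  then have "inj D" using linear_injective_0[OF linD] by blast
  then obtain D' where D': "linear D'" "!!v. D (D' v) = v"
   using linear_injective_isomorphism[OF linD] by blast
  have "h (snd c x) \<in> interior (h ` T)"
  proof (rule sussmann_open_mapping[OF oS hS xS D _ _ TS])
   show "bounded_linear D'" using D'(1) by (rule linear_conv_bounded_linear[THEN iffD1])
   show "D \<circ> D' = id" using D'(2) by (simp add: fun_eq_iff)
   show "snd c x \<in> interior T" using xT oT by (simp add: interior_open)
  qed
  then have fx: "f x \<in> fst c' \<inter> snd c' -` interior (h ` T)" using c c' by (simp add: h_def)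
  have "y \<in> f ` U" if y: "y \<in> X" "y \<in> fst c' \<inter> snd c' -` interior (h ` T)" for y
  proof -
   have "snd c' y \<in> h ` T" using y(2) interior_subset by blast
   then obtain z where z: "z \<in> fst c" "z \<in> W" "z \<in> U0" "f z \<in> fst c'" "snd c' y = snd c' (f z)"
    using c by (auto simp: T_def h_def)
   then have fz: "f z = y" using y(2) c'(1) by (metis IntE chart_inv_chart)
   have "(f ^^ n) z \<in> U0" for n
   proof (cases n)
    case (Suc m)
    have "(f ^^ m) y \<in> U0" using y(1) U0(3) by blast
    then show ?thesis using Suc fz by (simp only: funpow_Suc_right comp_apply)
   qed (use z in simp)
   then have "z \<in> X" using U0(3) by blast
   then show ?thesis using z(2) fz W(2) by blast
  qed
  then show ?thesis
   using fx chart_preimage_open[OF c'(1) open_interior, of "h ` T"]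
   by (intro exI[of _ "fst c' \<inter> snd c' -` interior (h ` T)"]) auto
 qed
 moreover have "f ` U \<subseteq> X" using W(2) repellerD(3)[OF X] by blast
 ultimately show ?thesis
  unfolding openin_subopen[of _ "f ` U"] openin_open by (metis IntI Int_commute image_iff subsetD)
qed

lemma repeller_expanding_map:
 assumes "C1_map A f" "isolated_repeller A g f X" "topologically_mixing_on X f" "compact_metric X rh"
 obtains e0 where "expanding_map X rh f e0"
proof -
 interpret compact_metric X rh by (rule assms)
 obtain e0 where e0: "e0 > 0" "!!x y. x \<in> X ==> y \<in> X ==> (!!n. rh ((f ^^ n) x) ((f ^^ n) y) <= e0) ==> x = y"
  by (rule repeller_expansive[OF assms(1,2,4)]) (use that in blast)
 have "expanding_map X rh f e0"
  using e0 repellerD(3)[OF assms(2)] repeller_open[OF assms(1,2)] continuous_on_subset[OF C1_mapD(1)[OF assms(1)] subset_UNIV]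
   assms(3) by unfold_locales blast+
 then show ?thesis by (rule that)
qed

section \<open>Hoelder functions and distortion\<close>

lemma holder_continuous:
 assumes u: "holder_on (riemannian_dist A g) al X u" and al: "al > 0"
 shows "continuous_on X u"
 unfolding continuous_on_def
proof (intro ballI tendstoI)
 fix x and e :: real assume x: "x \<in> X" and e: "e > 0"
 obtain K where K: "!!x y. x \<in> X ==> y \<in> X ==> riemannian_dist A g x y < \<infinity> ==>
   \<bar>u x - u y\<bar> <= K * enn2real (riemannian_dist A g x y) powr al" using u unfolding holder_on_def by blast
 define dl where "dl = (e / (2 * (\<bar>K\<bar> + 1))) powr (1 / al)"
 have dl: "dl > 0" "dl powr al = e / (2 * (\<bar>K\<bar> + 1))" using e al by (auto simp: dl_def powr_powr)
 obtain V where V: "open V" "x \<in> V" "!!y z. y \<in> V ==> z \<in> V ==> riemannian_dist A g y z <= ennreal dl"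
  by (rule dist_small[OF dl(1), of x], rule that)
 have "dist (u y) (u x) < e" if y: "y \<in> V" "y \<in> X" for y
 proof -
  let ?d = "riemannian_dist A g y x"
  have d: "?d <= ennreal dl" using V y by blast
  then have fin: "?d < \<infinity>" using le_less_trans ennreal_less_top by (metis infinity_ennreal_def)
  have "enn2real ?d <= dl" using enn2real_mono[OF d ennreal_less_top] dl(1) by simp
  then have "enn2real ?d powr al <= dl powr al" using al by (intro powr_mono2) auto
  then have "\<bar>K\<bar> * enn2real ?d powr al <= \<bar>K\<bar> * (dl powr al)" by (intro mult_left_mono) auto
  moreover have "K * enn2real ?d powr al <= \<bar>K\<bar> * enn2real ?d powr al" by (intro mult_right_mono) auto
  moreover have "\<bar>K\<bar> * (dl powr al) < e" unfolding dl(2) using e by (simp add: field_simps add_nonneg_pos)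
  ultimately show ?thesis using K[OF y(2) x fin] by (simp add: dist_real_def)
 qed
 then show "\<forall>\<^sub>F y in at x within X. dist (u y) (u x) < e"
  unfolding eventually_at_topological using V(1,2) by blast
qed

text \<open>For distances up to 1 the power with exponent \<open>al\<close> only increases them; for
  larger finite distances the boundedness of \<open>u\<close> on the compact set suffices.\<close>

lemma lipschitz_holder:
 assumes u: "lipschitz_function u" and X: "compact X" and al: "0 < al" "al < 1"
 shows "holder_on (riemannian_dist A g) al X u"
proof -
 obtain L where L: "L > 0" "!!x y. ennreal (\<bar>u x - u y\<bar> / L) <= riemannian_dist A g x y"
  and cont: "continuous_on UNIV u" using u unfolding lipschitz_function_def by blast
 have "bounded (u ` X)"
  by (intro compact_imp_bounded compact_continuous_image continuous_on_subset[OF cont] X) simp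
 then obtain M where M: "!!x. x \<in> X ==> \<bar>u x\<bar> <= M" unfolding bounded_iff by auto
 show ?thesis
  unfolding holder_on_def
 proof (intro exI[of _ "L + 2 * \<bar>M\<bar>"] ballI impI)
  fix x y assume xy: "x \<in> X" "y \<in> X" and fin: "riemannian_dist A g x y < \<infinity>"
  define r where "r = enn2real (riemannian_dist A g x y)"
  have "\<bar>u x - u y\<bar> / L <= r" using enn2real_mono[OF L(2)[of x y]] fin L(1) by (simp add: r_def)
  then have rL: "\<bar>u x - u y\<bar> <= L * r" using L(1) by (simp add: field_simps)
  show "\<bar>u x - u y\<bar> <= (L + 2 * \<bar>M\<bar>) * enn2real (riemannian_dist A g x y) powr al"
   unfolding r_def[symmetric]
  proof (cases "r <= 1")
   case True
   have "r powr 1 <= r powr al" using True al by (intro powr_mono') (auto simp: r_def)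
   then have "r <= r powr al" by (simp add: r_def)
   then have "L * r <= (L + 2 * \<bar>M\<bar>) * r powr al" using L(1) by (intro mult_mono) (auto simp: r_def)
   then show "\<bar>u x - u y\<bar> <= (L + 2 * \<bar>M\<bar>) * r powr al" using rL by linarith
  next
   case False
   have "1 <= r powr al" using False al by (intro ge_one_powr_ge_zero) auto
   then have "(L + 2 * \<bar>M\<bar>) * 1 <= (L + 2 * \<bar>M\<bar>) * r powr al" using L(1) by (intro mult_left_mono) auto
   moreover have "\<bar>u x - u y\<bar> <= (L + 2 * \<bar>M\<bar>) * 1" using M[OF xy(1)] M[OF xy(2)] L(1) abs_ge_self[of M] abs_triangle_ineq4[of "u x" "u y"] by simp
   ultimately show "\<bar>u x - u y\<bar> <= (L + 2 * \<bar>M\<bar>) * r powr al" by (rule order_trans[rotated])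
  qed
 qed
qed

text \<open>Hoelder functions form an algebra, as they are bounded on the compact set, and contain
  the separating Lipschitz functions; Stone-Weierstrass applies.\<close>

lemma holder_dense:
 assumes X: "compact X" and al: "0 < al" "al < 1" and fi: "continuous_on X fi" and e: "e > 0"
 shows "\<exists>u. holder_on (riemannian_dist A g) al X u \<and> (\<forall>x\<in>X. \<bar>fi x - u x\<bar> < e)"
proof -
 let ?h = "holder_on (riemannian_dist A g) al X"
 obtain F where F: "!!u. u \<in> F ==> lipschitz_function u"
  "!!y z. y \<in> X ==> (!!u. u \<in> F ==> u y = u z) ==> y = z"
  by (rule separating_family[OF X]) (use that in blast)
 interpret function_ring_on "{u. ?h u}" X
 proof
  show "compact X" by (rule X)
  show "continuous_on X u" if "u \<in> {u. ?h u}" for u using that holder_continuous al(1) by blast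
  show "(%_. c) \<in> {u. ?h u}" for c by (auto simp: holder_on_def intro!: exI[of _ 0])
  show "\<exists>u\<in>{u. ?h u}. u x \<noteq> u y" if "x \<in> X" "x \<noteq> y" for x y
   using F(2)[OF that(1), of y] that(2) lipschitz_holder[OF F(1) X al] by blast
  fix u v assume "u \<in> {u. ?h u}" "v \<in> {u. ?h u}"
  then have uv: "?h u" "?h v" by auto
  obtain K where K: "!!x y. x \<in> X ==> y \<in> X ==> riemannian_dist A g x y < \<infinity> ==>
   \<bar>u x - u y\<bar> <= K * enn2real (riemannian_dist A g x y) powr al" using uv(1) unfolding holder_on_def by blast
  obtain L where L: "!!x y. x \<in> X ==> y \<in> X ==> riemannian_dist A g x y < \<infinity> ==>
   \<bar>v x - v y\<bar> <= L * enn2real (riemannian_dist A g x y) powr al" using uv(2) unfolding holder_on_def by blast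
  show "(%x. u x + v x) \<in> {u. ?h u}"
   unfolding mem_Collect_eq holder_on_def
  proof (intro exI[of _ "K + L"] ballI impI)
   fix x y assume "x \<in> X" "y \<in> X" "riemannian_dist A g x y < \<infinity>"
   from K[OF this] L[OF this] show "\<bar>u x + v x - (u y + v y)\<bar> <= (K + L) * enn2real (riemannian_dist A g x y) powr al"
    unfolding distrib_right by linarith
  qed
  have bdd: "\<exists>M. \<forall>x\<in>X. \<bar>w x\<bar> <= M" if "?h w" for w
   using compact_imp_bounded[OF compact_continuous_image[OF holder_continuous[OF that al(1)] X]]
   unfolding bounded_iff by auto
  obtain M where M: "!!x. x \<in> X ==> \<bar>u x\<bar> <= M" using bdd[OF uv(1)] by blast
  obtain N where N: "!!x. x \<in> X ==> \<bar>v x\<bar> <= N" using bdd[OF uv(2)] by blast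
  show "(%x. u x * v x) \<in> {u. ?h u}"
   unfolding mem_Collect_eq holder_on_def
  proof (intro exI[of _ "M * L + N * K"] ballI impI)
   fix x y assume xy: "x \<in> X" "y \<in> X" "riemannian_dist A g x y < \<infinity>"
   let ?r = "enn2real (riemannian_dist A g x y) powr al"
   have "u x * v x - u y * v y = u x * (v x - v y) + v y * (u x - u y)" by (simp add: algebra_simps)
   then have "\<bar>u x * v x - u y * v y\<bar> <= \<bar>u x\<bar> * \<bar>v x - v y\<bar> + \<bar>v y\<bar> * \<bar>u x - u y\<bar>"
    by (metis abs_mult abs_triangle_ineq)
   also have "\<dots> <= M * (L * ?r) + N * (K * ?r)"
    using M[OF xy(1)] N[OF xy(2)] K[OF xy] L[OF xy] by (intro add_mono mult_mono) auto
   finally show "\<bar>u x * v x - u y * v y\<bar> <= (M * L + N * K) * ?r" by (simp add: algebra_simps)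
  qed
 qed
 show ?thesis using Stone_Weierstrass_basic[OF fi e] by blast
qed

text \<open>Points that are close for \<open>rh\<close> are within \<open>dl\<close> in the
  Riemannian distance, by \<open>dist_small\<close> and a Lebesgue number. Bowen balls for
  \<open>rh\<close> of a small radius therefore lie in the Riemannian ones of radius
  \<open>dl\<close>.\<close>

lemma distortion_rho:
 assumes rh: "compact_metric X rh" and fX: "f ` X = X" and Ph: "bounded_distortion (riemannian_dist A g) f X Ph"
 obtains K e where "K > 0" "e > 0" "!!n x y. n >= 1 ==> x \<in> X ==> y \<in> X ==>
   (\<forall>j\<le>n. rh ((f ^^ j) x) ((f ^^ j) y) <= e) ==> \<bar>Ph n x - Ph n y\<bar> <= K"
proof -
 interpret compact_metric X rh by (rule rh)
 obtain K dl where K: "K > 0" "dl > 0" "(SUP n\<in>{1..}. distortion (riemannian_dist A g) f X Ph n dl) <= ereal K"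
  using Ph unfolding bounded_distortion_def by blast
 have "\<exists>V. open V \<and> x \<in> V \<and> (\<forall>y\<in>V. \<forall>z\<in>V. riemannian_dist A g y z <= ennreal dl)" for x
  by (rule dist_small[OF K(2), of x]) blast
 then obtain V where V: "!!x. open (V x)" "!!x. x \<in> V x"
  "!!x y z. y \<in> V x ==> z \<in> V x ==> riemannian_dist A g y z <= ennreal dl" by metis
 obtain e where e: "e > 0" "!!y z. y \<in> X ==> z \<in> X ==> rh y z <= e ==> \<exists>x\<in>X. y \<in> V x \<and> z \<in> V x"
  by (rule lebesgue_number[of V], rule V(1), rule V(2), rule that)
 have near: "riemannian_dist A g z y <= ennreal dl" if "y \<in> X" "z \<in> X" "rh y z <= e" for y z
  using e(2)[OF that] V(3) by blast
 show ?thesis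
 proof (rule that[OF K(1) e(1)])
  fix n x y assume n: "n >= 1" and x: "x \<in> X" and y: "y \<in> X" and orb: "\<forall>j\<le>n. rh ((f ^^ j) x) ((f ^^ j) y) <= e"
  have inX: "(f ^^ j) z \<in> X" if "z \<in> X" for j z by (induction j) (use that fX in auto)
  have "x \<in> bowen_ball (riemannian_dist A g) f X x n dl" "y \<in> bowen_ball (riemannian_dist A g) f X x n dl"
   using x y orb e(1) near[OF inX inX] by (auto simp: bowen_ball_def inX)
  then have "ereal \<bar>Ph n x - Ph n y\<bar> <= distortion (riemannian_dist A g) f X Ph n dl"
   unfolding distortion_def using x by (intro Sup_upper) blast
  also have "\<dots> <= ereal K" using n by (intro order_trans[OF SUP_upper K(3)]) simp
  finally show "\<bar>Ph n x - Ph n y\<bar> <= K" by simp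
 qed
qed

end

section \<open>Approximation by Hoelder functions\<close>

lemma sum_shift_diff:
 fixes a :: "nat => real"
 shows "(\<Sum>j<n. a (j + N) - a j) = (\<Sum>i<N. a (n + i) - a i)"
proof (induction n)
 case (Suc n)
 have "(\<Sum>i<N. a (Suc n + i) - a (n + i)) = a (n + N) - a n"
  using sum_lessThan_telescope[of "%i. a (n + i)" N] by simp
 moreover have "(\<Sum>i<N. a (Suc n + i) - a i) = (\<Sum>i<N. a (Suc n + i) - a (n + i)) + (\<Sum>i<N. a (n + i) - a i)"
  unfolding sum.distrib[symmetric] by simp
 ultimately show ?case unfolding sum.lessThan_Suc Suc.IH by linarith
qed simp

context potential
begin

text \<open>Over an invariant measure the Birkhoff sum of \<open>G e\<close> integrates to
  \<open>n\<close> times the integral of \<open>G e\<close>, so uniform closeness of the sums for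
  large \<open>n\<close> becomes closeness of the means.\<close>

lemma approximating_mean:
 assumes ap: "approximating_family al d f X Ph G" and cont: "continuous_on X (G e)" and e: "0 < e" "e < 1"
  and nu: "nu \<in> invariant_measures f X"
 shows "integrable nu (G e) \<and> \<bar>(\<integral>x. G e x \<partial>nu) - mean_value Ph nu\<bar> <= e"
proof -
 note p = invariant_prob_on[OF nu]
 interpret invariant_prob nu f by (rule invariant_prob[OF nu])
 have sp: "space nu = X" using prob_onD(2)[OF p] .
 have int: "integrable nu (G e)" by (rule continuous_integrable[OF p cont])
 let ?s = "%n. SUP x\<in>X. ereal \<bar>Ph n x - birkhoff_sum f n (G e) x\<bar>"
 have "limsup (%n. ereal (1 / real n) * ?s n) < ereal e"
  using ap e unfolding approximating_family_def by auto
 then have "\<forall>\<^sub>F n in sequentially. ereal (1 / real n) * ?s n < ereal e" by (rule Limsup_lessD)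
 then have close: "\<forall>\<^sub>F n in sequentially. \<bar>(\<integral>x. Ph n x \<partial>nu) / n - (\<integral>x. G e x \<partial>nu)\<bar> <= e"
  using eventually_ge_at_top[of 1]
 proof eventually_elim
  case (elim n)
  have pt: "\<bar>Ph n x - birkhoff_sum f n (G e) x\<bar> <= n * e" if "x \<in> X" for x
  proof -
   have "ereal (1 / real n) * ereal \<bar>Ph n x - birkhoff_sum f n (G e) x\<bar> <= ereal (1 / real n) * ?s n"
    using that by (intro ereal_mult_left_mono SUP_upper) auto
   also note elim(1)
   finally show ?thesis using elim(2) by (simp add: field_simps)
  qed
  have i1: "integrable nu (Ph n)" by (rule potential_integrable[OF p elim(2)])
  have i2: "integrable nu (birkhoff_sum f n (G e))"
   unfolding birkhoff_sum_def by (intro Bochner_Integration.integrable_sum integrable_funpow int)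
  have S: "(\<integral>x. birkhoff_sum f n (G e) x \<partial>nu) = n * (\<integral>x. G e x \<partial>nu)"
   unfolding birkhoff_sum_def
   by (subst Bochner_Integration.integral_sum)
    (auto intro: integrable_funpow int simp: integral_funpow[OF borel_measurable_integrable[OF int]])
  have "\<bar>\<integral>x. Ph n x - birkhoff_sum f n (G e) x \<partial>nu\<bar> <= (\<integral>x. \<bar>Ph n x - birkhoff_sum f n (G e) x\<bar> \<partial>nu)"
   by (rule integral_abs_bound)
  also have "\<dots> <= (\<integral>x. n * e \<partial>nu)" using i1 i2 pt sp by (intro integral_mono) auto
  also have "(\<integral>x. Ph n x - birkhoff_sum f n (G e) x \<partial>nu) = (\<integral>x. Ph n x \<partial>nu) - n * (\<integral>x. G e x \<partial>nu)"
   using i1 i2 S by simp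
  finally have le: "\<bar>(\<integral>x. Ph n x \<partial>nu) - n * (\<integral>x. G e x \<partial>nu)\<bar> <= n * e" by (simp add: prob_space)
  have "(\<integral>x. Ph n x \<partial>nu) / n - (\<integral>x. G e x \<partial>nu) = ((\<integral>x. Ph n x \<partial>nu) - n * (\<integral>x. G e x \<partial>nu)) / n"
   using elim(2) by (simp add: field_simps)
  then show ?case using le elim(2) by (simp add: abs_divide field_simps)
 qed
 have "(%n. \<bar>(\<integral>x. Ph n x \<partial>nu) / n - (\<integral>x. G e x \<partial>nu)\<bar>) \<longlonglongrightarrow> \<bar>mean_value Ph nu - (\<integral>x. G e x \<partial>nu)\<bar>"
  by (intro tendsto_intros mean_value_bound(1) nu)
 from tendsto_upperbound[OF this close] show ?thesis using int by (simp add: abs_minus_commute)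
qed

text \<open>Up to \<open>C\<close>, the value of \<open>Ph N\<close> at time \<open>j\<close> is the
  increment of \<open>Ph j x\<close> over \<open>N\<close> steps. These increments telescope to
  \<open>N\<close> differences between the end and the beginning of the orbit, each of them
  \<open>Ph n x\<close> up to a bounded error.\<close>

lemma telescope_bound:
 assumes n: "n >= 1" and N: "N >= 1" and x: "x \<in> X"
 shows "\<bar>(\<Sum>j<n. Ph N ((f ^^ j) x)) - N * Ph n x\<bar> <= n * C + N * (C + 2 * (N * B))"
proof -
 define a where "a j = (if j = 0 then 0 else Ph j x)" for j
 have 1: "\<bar>Ph N ((f ^^ j) x) - (a (j + N) - a j)\<bar> <= C" for j
 proof (cases "j = 0")
  case True then show ?thesis using N C_nonneg by (simp add: a_def)
 next
  case False then show ?thesis using additive[of j N x] N x by (simp add: a_def abs_minus_commute algebra_simps)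
 qed
 have ai: "\<bar>a i\<bar> <= N * B" if "i < N" for i
 proof (cases "i = 0")
  case False
  have "\<bar>a i\<bar> <= i * B" using bounded[of i x] False x by (simp add: a_def)
  also have "\<dots> <= N * B" using that B_nonneg by (intro mult_right_mono) auto
  finally show ?thesis .
 qed (use B_nonneg in \<open>simp add: a_def\<close>)
 have 2: "\<bar>a (n + i) - a i - Ph n x\<bar> <= C + 2 * (N * B)" if i: "i < N" for i
 proof (cases "i = 0")
  case True then show ?thesis using n C_nonneg B_nonneg by (simp add: a_def)
 next
  case False
  have "\<bar>a (n + i) - Ph n x - Ph i ((f ^^ n) x)\<bar> <= C" using additive[of n i x] n False x by (simp add: a_def)
  moreover have "\<bar>Ph i ((f ^^ n) x)\<bar> <= N * B"
  proof -
   have "\<bar>Ph i ((f ^^ n) x)\<bar> <= i * B" using bounded[of i "(f ^^ n) x"] False funpow_X[OF x] by simp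
   also have "\<dots> <= N * B" using i B_nonneg by (intro mult_right_mono) auto
   finally show ?thesis .
  qed
  ultimately show ?thesis using ai[OF i] by linarith
 qed
 have "\<bar>(\<Sum>j<n. Ph N ((f ^^ j) x)) - (\<Sum>j<n. a (j + N) - a j)\<bar> <= (\<Sum>j<n. C)"
  unfolding sum_subtractf[symmetric] by (intro order_trans[OF sum_abs] sum_mono 1)
 moreover have "\<bar>(\<Sum>i<N. a (n + i) - a i) - (\<Sum>i<N. Ph n x)\<bar> <= (\<Sum>i<N. C + 2 * (N * B))"
  unfolding sum_subtractf[symmetric] by (intro order_trans[OF sum_abs] sum_mono 2) simp
 ultimately show ?thesis unfolding sum_shift_diff by simp
qed

text \<open>The function to approximate is \<open>Ph N' / N'\<close>, whose Birkhoff sums follow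
  \<open>Ph n\<close> by \<open>telescope_bound\<close>. A quarter of \<open>e\<close> each goes to
  the choice of \<open>N'\<close>, to the uniform approximation and to the bounded error
  \<open>R\<close>, so the limit superior is strictly below \<open>e\<close>. The dense class
  \<open>Q\<close> is abstract so that it can also exclude coboundaries.\<close>

lemma approximating_exists:
 assumes dense: "!!fi dl. continuous_on X fi ==> 0 < dl ==> \<exists>u. Q u \<and> (\<forall>x\<in>X. \<bar>fi x - u x\<bar> < dl)" and e: "0 < e"
 shows "\<exists>u. Q u \<and> limsup (%n. ereal (1 / real n) * (SUP x\<in>X. ereal \<bar>Ph n x - birkhoff_sum f n u x\<bar>)) < ereal e"
proof -
 obtain N where N: "real N > 4 * C / e" using reals_Archimedean2 by blast
 define N' where "N' = Suc N"
 have N': "N' >= 1" "C / N' <= e / 4"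
 proof -
  have "4 * C / e < real N'" using N by (simp add: N'_def)
  then show "C / N' <= e / 4" using e by (simp add: N'_def field_simps)
 qed (simp add: N'_def)
 have "continuous_on X (%x. Ph N' x / N')" using N'(1) by (intro continuous_intros potential_cont) auto
 then obtain u where u: "Q u" "!!x. x \<in> X ==> \<bar>Ph N' x / N' - u x\<bar> < e / 4"
  using dense[of "%x. Ph N' x / N'" "e / 4"] e by auto
 define R where "R = C + 2 * (N' * B)"
 have "\<forall>\<^sub>F n in sequentially. R <= real n * (e / 4)" using e by real_asymp
 then have "\<forall>\<^sub>F n in sequentially.
   ereal (1 / real n) * (SUP x\<in>X. ereal \<bar>Ph n x - birkhoff_sum f n u x\<bar>) <= ereal (3 / 4 * e)"
  using eventually_ge_at_top[of 1]
 proof eventually_elim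
  case (elim n)
  have "\<bar>Ph n x - birkhoff_sum f n u x\<bar> <= n * (3 / 4 * e)" if x: "x \<in> X" for x
  proof -
   have "\<bar>(\<Sum>j<n. Ph N' ((f ^^ j) x) / N') - birkhoff_sum f n u x\<bar> <= (\<Sum>j<n. e / 4)"
    unfolding birkhoff_sum_def sum_subtractf[symmetric]
    by (intro order_trans[OF sum_abs] sum_mono less_imp_le[OF u(2)] funpow_X x)
   moreover have "\<bar>(\<Sum>j<n. Ph N' ((f ^^ j) x) / N') - Ph n x\<bar> <= n * (C / N') + R"
   proof -
    have "(\<Sum>j<n. Ph N' ((f ^^ j) x) / N') - Ph n x = ((\<Sum>j<n. Ph N' ((f ^^ j) x)) - N' * Ph n x) / N'"
     using N'(1) by (simp add: sum_divide_distrib[symmetric] field_simps)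
    moreover have "n * (C / N') + R = (n * C + N' * R) / N'" using N'(1) by (simp add: field_simps)
    ultimately show ?thesis
     using telescope_bound[OF elim(2) N'(1) x] unfolding R_def
     by (simp only: abs_divide abs_of_nat divide_right_mono of_nat_0_le_iff)
   qed
   moreover have "n * (C / N') <= n * (e / 4)" by (intro mult_left_mono N') simp
   moreover have "(\<Sum>j<n. e / 4) = n * (e / 4)" by simp
   ultimately have "\<bar>Ph n x - birkhoff_sum f n u x\<bar> <= n * (e / 4) + n * (e / 4) + n * (e / 4)"
    using elim(1) by linarith
   then show ?thesis by (simp add: algebra_simps)
  qed
  then have "(SUP x\<in>X. ereal \<bar>Ph n x - birkhoff_sum f n u x\<bar>) <= ereal (n * (3 / 4 * e))" by (intro SUP_least) simp
  then have "ereal (1 / real n) * (SUP x\<in>X. ereal \<bar>Ph n x - birkhoff_sum f n u x\<bar>) <= ereal (1 / real n) * ereal (n * (3 / 4 * e))"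
   by (rule ereal_mult_left_mono) simp
  then show ?case using elim(2) by simp
 qed
 from Limsup_bounded[OF this] have "limsup (%n. ereal (1 / real n) * (SUP x\<in>X. ereal \<bar>Ph n x - birkhoff_sum f n u x\<bar>)) <= ereal (3 / 4 * e)" .
 also have "\<dots> < ereal e" using e by simp
 finally show ?thesis using u(1) by blast
qed

end

text \<open>Invariance cancels the coboundary; two invariant measures with different integrals thus
  certify that a function is not of this form.\<close>

lemma coboundary_integral:
 assumes "expanding_map X rh f e0" and h: "coboundary_plus_constant f X h"
 obtains k where "!!nu. nu \<in> invariant_measures f X ==> (\<integral>x. h x \<partial>nu) = k"
proof -
 interpret expanding_map X rh f e0 by (rule assms(1))
 obtain u k where u: "continuous_on X u" "!!x. x \<in> X ==> h x = u (f x) - u x + k"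
  using h unfolding coboundary_plus_constant_def by blast
 show ?thesis
 proof (rule that[of k])
  fix nu assume nu: "nu \<in> invariant_measures f X"
  note p = invariant_prob_on[OF nu]
  interpret invariant_prob nu f by (rule invariant_prob[OF nu])
  have i: "integrable nu u" by (rule continuous_integrable[OF p u(1)])
  have i': "integrable nu (%x. u (f x))" "(\<integral>x. u (f x) \<partial>nu) = (\<integral>x. u x \<partial>nu)"
   using integrable_funpow[OF i, of 1] integral_funpow[OF borel_measurable_integrable[OF i], of 1] by simp_all
  have "(\<integral>x. h x \<partial>nu) = (\<integral>x. u (f x) - u x + k \<partial>nu)"
   by (rule Bochner_Integration.integral_cong) (use u(2) prob_onD(2)[OF p] in auto)
  then show "(\<integral>x. h x \<partial>nu) = k" using i i' by (simp add: prob_space)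
 qed
qed

section \<open>The large deviations principle\<close>

text \<open>From here on the Riemannian distance enters only through two properties of its Hoelder
  functions, continuity and uniform density.\<close>

locale holder_setting = gibbs_family X rh f e0 Ph Ps ep C K B P mu
 for X :: "'m::{t2_space, second_countable_topology} set" and rh f e0 Ph Ps ep C K B P mu +
 fixes d :: "'m => 'm => ennreal" and al :: real
 assumes holder_cont: "holder_on d al X u ==> continuous_on X u"
  and dense: "continuous_on X fi ==> 0 < dl ==> \<exists>u. holder_on d al X u \<and> (\<forall>x\<in>X. \<bar>fi x - u x\<bar> < dl)"
begin

lemma approximating_meanD:
 assumes "0 < e" "e < 1" "nu \<in> inv_meas"
 shows "approximating_family al d f X Ph G ==> integrable nu (G e) \<and> \<bar>(\<integral>x. G e x \<partial>nu) - mphi nu\<bar> <= e"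
  and "approximating_family al d f X Ps G ==> integrable nu (G e) \<and> \<bar>(\<integral>x. G e x \<partial>nu) - mpsi nu\<bar> <= e"
proof -
 have "continuous_on X (G e)" if "approximating_family al d f X F G" for F
  using that assms by (intro holder_cont) (simp add: approximating_family_def)
 then show "approximating_family al d f X Ph G ==> integrable nu (G e) \<and> \<bar>(\<integral>x. G e x \<partial>nu) - mphi nu\<bar> <= e"
  "approximating_family al d f X Ps G ==> integrable nu (G e) \<and> \<bar>(\<integral>x. G e x \<partial>nu) - mpsi nu\<bar> <= e"
  using Ph.approximating_mean Ps.approximating_mean assms by blast+
qed

text \<open>
 If two slopes differ, some continuous function separates two invariant measures; adding a small
 multiple of it before approximating gives Hoelder functions that are not coboundaries.
\<close>

lemma dense_not_coboundary:
 assumes ab: "slope a < slope b" and fi: "continuous_on X fi" and dl: "0 < dl"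
 shows "\<exists>u. (holder_on d al X u \<and> \<not> coboundary_plus_constant f X u) \<and> (\<forall>x\<in>X. \<bar>fi x - u x\<bar> < dl)"
proof -
 note inv = mu_t_inv[of a] mu_t_inv[of b]
 note pa = Ph.invariant_prob_on[OF inv(1)] and pb = Ph.invariant_prob_on[OF inv(2)]
 interpret a: prob_space "mu a" using Ph.prob_onD(1)[OF pa] .
 interpret b: prob_space "mu b" using Ph.prob_onD(1)[OF pb] .
 \<comment> \<open>The integral of \<open>Ps N\<close> differs from \<open>N\<close> times the slope
   by at most \<open>C\<close>, so for this \<open>N\<close> the two measures integrate the single
   function \<open>Ps N\<close> differently.\<close>
 obtain n where n: "2 * C / (slope b - slope a) < real n" using reals_Archimedean2 by blast
 define N where "N = Suc n"
 have N: "N >= 1" "2 * C < N * (slope b - slope a)"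
 proof -
  have "2 * C / (slope b - slope a) < real N" using n by (simp add: N_def)
  then show "2 * C < N * (slope b - slope a)" using ab by (simp add: field_simps)
 qed (simp add: N_def)
 have vne: "(\<integral>x. Ps N x \<partial>mu a) \<noteq> (\<integral>x. Ps N x \<partial>mu b)"
  using Ps.mean_value_bound(2)[OF inv(1) N(1)] Ps.mean_value_bound(2)[OF inv(2) N(1)] N(2)
  by (simp add: algebra_simps abs_le_iff)
 note vc = Ps.potential_cont[OF N(1)]
 obtain M where M: "!!x. x \<in> X ==> \<bar>Ps N x\<bar> <= M" using Ps.bounded[OF N(1)] by blast
 have int: "integrable (mu a) h" "integrable (mu b) h" if "continuous_on X h" for h :: "'m => real"
  using Ph.continuous_integrable[OF pa that] Ph.continuous_integrable[OF pb that] by auto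
 obtain fi' where fi': "continuous_on X fi'" "!!x. x \<in> X ==> \<bar>fi x - fi' x\<bar> <= dl / 2" "(\<integral>x. fi' x \<partial>mu a) \<noteq> (\<integral>x. fi' x \<partial>mu b)"
 proof (cases "(\<integral>x. fi x \<partial>mu a) = (\<integral>x. fi x \<partial>mu b)")
  case False then show ?thesis using fi dl by (intro that[of fi]) auto
 next
  case True
  define r where "r = dl / (2 * (\<bar>M\<bar> + 1))"
  have r: "r > 0" using dl by (simp add: r_def)
  show ?thesis
  proof (rule that[of "%x. fi x + r * Ps N x"])
   show "continuous_on X (%x. fi x + r * Ps N x)" by (intro continuous_intros fi vc)
   show "\<bar>fi x - (fi x + r * Ps N x)\<bar> <= dl / 2" if "x \<in> X" for x
   proof -
    have "r * \<bar>Ps N x\<bar> <= r * (\<bar>M\<bar> + 1)" using M[OF that] r by (intro mult_left_mono) auto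
    also have "\<dots> = dl / 2" by (simp add: r_def field_simps)
    finally show ?thesis using r by (simp add: abs_mult)
   qed
   show "(\<integral>x. fi x + r * Ps N x \<partial>mu a) \<noteq> (\<integral>x. fi x + r * Ps N x \<partial>mu b)"
    using True vne r int[OF fi] int[OF vc] by simp
  qed
 qed
 define D where "D = \<bar>(\<integral>x. fi' x \<partial>mu a) - (\<integral>x. fi' x \<partial>mu b)\<bar>"
 have D: "D > 0" using fi'(3) by (simp add: D_def)
 obtain u where u: "holder_on d al X u" "!!x. x \<in> X ==> \<bar>fi' x - u x\<bar> < min (dl / 2) (D / 3)"
  using dense[OF fi'(1), of "min (dl / 2) (D / 3)"] dl D by auto
 note uc = holder_cont[OF u(1)]
 have near: "\<bar>(\<integral>x. fi' x \<partial>mu t) - (\<integral>x. u x \<partial>mu t)\<bar> <= D / 3" for t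
 proof -
  note pt = Ph.invariant_prob_on[OF mu_t_inv[of t]]
  interpret t: prob_space "mu t" using Ph.prob_onD(1)[OF pt] .
  note i = Ph.continuous_integrable[OF pt fi'(1)] Ph.continuous_integrable[OF pt uc]
  have "\<bar>\<integral>x. fi' x - u x \<partial>mu t\<bar> <= (\<integral>x. \<bar>fi' x - u x\<bar> \<partial>mu t)" by (rule integral_abs_bound)
  also have "\<dots> <= (\<integral>x. D / 3 \<partial>mu t)"
   using i u(2) Ph.prob_onD(2)[OF pt] by (intro integral_mono) (auto intro: less_imp_le)
  finally show ?thesis using i by (simp add: t.prob_space)
 qed
 have "\<not> coboundary_plus_constant f X u"
 proof
  assume "coboundary_plus_constant f X u"
  then obtain k where k: "!!nu. nu \<in> inv_meas ==> (\<integral>x. u x \<partial>nu) = k"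
   by (rule coboundary_integral[OF Ph.expanding_map_axioms]) blast
  have "\<bar>(\<integral>x. fi' x \<partial>mu a) - (\<integral>x. fi' x \<partial>mu b)\<bar> <= D / 3 + D / 3"
   using near[of a] near[of b] unfolding k[OF inv(1)] k[OF inv(2)] by linarith
  then show False using D by (simp add: D_def[symmetric])
 qed
 moreover have "\<bar>fi x - u x\<bar> < dl" if "x \<in> X" for x using fi'(2)[OF that] u(2)[OF that] by linarith
 ultimately show ?thesis using u(1) by blast
qed

text \<open>All members with parameter in the unit interval are chosen outside the coboundaries plus
  constants, so the families are admissible in either case of the definition.\<close>

lemma admissible_exists:
 assumes ab: "slope a < slope b"
 obtains F G where "admissible_family al d f X Ph F" "admissible_family al d f X Ps G"
proof -
 let ?Q = "%u. holder_on d al X u \<and> \<not> coboundary_plus_constant f X u"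
 have "\<forall>e\<in>{0<..<1}. \<exists>u. ?Q u \<and> limsup (%n. ereal (1 / real n) * (SUP x\<in>X. ereal \<bar>Ph n x - birkhoff_sum f n u x\<bar>)) < ereal e"
  using Ph.approximating_exists[of ?Q, OF dense_not_coboundary[OF ab]] by simp
 then obtain F where F: "\<forall>e\<in>{0<..<1}. ?Q (F e) \<and> limsup (%n. ereal (1 / real n) * (SUP x\<in>X. ereal \<bar>Ph n x - birkhoff_sum f n (F e) x\<bar>)) < ereal e"
  by (rule bchoice[THEN exE])
 have "\<forall>e\<in>{0<..<1}. \<exists>u. ?Q u \<and> limsup (%n. ereal (1 / real n) * (SUP x\<in>X. ereal \<bar>Ps n x - birkhoff_sum f n u x\<bar>)) < ereal e"
  using Ps.approximating_exists[of ?Q, OF dense_not_coboundary[OF ab]] by simp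
 then obtain G where G: "\<forall>e\<in>{0<..<1}. ?Q (G e) \<and> limsup (%n. ereal (1 / real n) * (SUP x\<in>X. ereal \<bar>Ps n x - birkhoff_sum f n (G e) x\<bar>)) < ereal e"
  by (rule bchoice[THEN exE])
 have ev: "\<forall>\<^sub>F e in at_right 0. \<not> coboundary_plus_constant f X (H e)" if "!!e. e \<in> {0<..<1} ==> ?Q (H e)" for H :: "real => 'm => real"
  using that by (auto simp: eventually_at_right_field intro!: exI[of _ 1])
 show ?thesis
  using F G ev[of F] ev[of G] by (intro that[of F G]) (simp_all add: admissible_family_def approximating_family_def)
qed

text \<open>All admissible families have the same limit by \<open>function_rate_tendsto\<close>; the
  existence of one pair of families makes the definite description unique.\<close>

lemma rate_function_slope:
 assumes s: "s \<in> rate_interval f X Ph Ps" and t: "slope t = s"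
 shows "rate_function al d f X Ph Ps s = ereal (t * s - (P t - P 0))"
proof -
 obtain a b where ab: "slope a < s" "s < slope b" using s rate_interval_slopes by blast
 have lim: "((%e. function_rate f X (F e) (G e) s) \<longlongrightarrow> ereal (t * s - (P t - P 0))) (at_right 0)"
  if "admissible_family al d f X Ph F" "admissible_family al d f X Ps G" for F G
  using that by (intro function_rate_tendsto[OF _ _ ab t] approximating_meanD) (auto simp: admissible_family_def)
 obtain F G where FG: "admissible_family al d f X Ph F" "admissible_family al d f X Ps G"
  by (rule admissible_exists[OF less_trans[OF ab]])
 have "(THE L. \<forall>F G. admissible_family al d f X Ph F \<and> admissible_family al d f X Ps G -->
   ((%e. function_rate f X (F e) (G e) s) \<longlongrightarrow> L) (at_right 0)) = ereal (t * s - (P t - P 0))"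
 proof (rule the_equality)
  fix L assume "\<forall>F G. admissible_family al d f X Ph F \<and> admissible_family al d f X Ps G -->
   ((%e. function_rate f X (F e) (G e) s) \<longlongrightarrow> L) (at_right 0)"
  then have "((%e. function_rate f X (F e) (G e) s) \<longlongrightarrow> L) (at_right 0)" using FG by blast
  from tendsto_unique[OF trivial_limit_at_right_real this lim[OF FG]] show "L = ereal (t * s - (P t - P 0))" .
 qed (use lim in blast)
 then show ?thesis using s by (simp add: rate_function_def)
qed

text \<open>Outside the interval all slopes lie weakly on one side of \<open>s\<close>; the sign
  lets both sides be treated at once.\<close>

lemma outside_sign:
 assumes "s \<notin> rate_interval f X Ph Ps"
 obtains sg where "sg = 1 \<or> sg = - 1" "!!t. sg * slope t <= sg * s"
proof (cases "\<exists>a. slope a < s")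
 case True
 then have "!!t. 1 * slope t <= 1 * s" using assms unfolding rate_interval_slopes by (auto simp: not_less)
 then show ?thesis by (intro that[of 1]) auto
next
 case False
 then have "!!t. - 1 * slope t <= - 1 * s" by (auto simp: not_less)
 then show ?thesis by (intro that[of "- 1"]) auto
qed

lemma rate_outside:
 "s \<notin> rate_interval f X Ph Ps ==> rate_function al d f X Ph Ps s =
  (INF nu\<in>{nu \<in> inv_meas. mpsi nu = s}. ereal (P 0 - Ph.ent nu - mphi nu))"
 by (simp add: rate_function_def variational_rate)

text \<open>In contrapositive form this feeds \<open>ldp_upper\<close>: where the rate exceeds a
  number, some tilt beats that number. Between two slopes the transform is attained, at an endpoint
  \<open>endpoint_measure\<close> supplies a measure of sufficiently small cost.\<close>

lemma rate_le_legendre: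
 assumes R: "!!w. w * s - (P w - P 0) <= R"
 shows "rate_function al d f X Ph Ps s <= ereal R"
proof (cases "s \<in> rate_interval f X Ph Ps")
 case True
 then obtain a b where ab: "slope a < s" "s < slope b" using rate_interval_slopes by blast
 obtain t where t: "slope t = s" by (rule slope_surj[OF ab])
 show ?thesis unfolding rate_function_slope[OF True t] using R[of t] by simp
next
 case False
 obtain sg where sg: "sg = 1 \<or> sg = - 1" "!!t. sg * slope t <= sg * s" by (rule outside_sign[OF False], rule that)
 obtain nu where "nu \<in> inv_meas" "mpsi nu = s" "P 0 - Ph.ent nu - mphi nu <= R"
  by (rule endpoint_measure[OF sg R], rule that)
 then show ?thesis unfolding rate_outside[OF False] by (intro INF_lower2[of nu]) auto
qed

text \<open>Reduces the lower bound at an arbitrary point of \<open>E\<close> to one at a slope,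
  where \<open>ldp_lower\<close> applies; at an endpoint the slopes only approach \<open>s\<close>,
  which is why \<open>E\<close> has to be open.\<close>

lemma rate_less_slope:
 assumes E: "open E" "s \<in> E" and c: "rate_function al d f X Ph Ps s < ereal c"
 obtains t where "slope t \<in> E" "t * slope t - (P t - P 0) < c"
proof (cases "s \<in> rate_interval f X Ph Ps")
 case True
 then obtain a b where ab: "slope a < s" "s < slope b" using rate_interval_slopes by blast
 obtain t where t: "slope t = s" by (rule slope_surj[OF ab])
 show ?thesis using c E(2) unfolding rate_function_slope[OF True t] by (intro that[of t]) (simp_all add: t)
next
 case False
 obtain sg where sg: "sg = 1 \<or> sg = - 1" "!!t. sg * slope t <= sg * s" by (rule outside_sign[OF False], rule that)
 obtain nu where nu: "nu \<in> inv_meas" "mpsi nu = s" "P 0 - Ph.ent nu - mphi nu < c"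
  using c unfolding rate_outside[OF False] by (auto simp: INF_less_iff)
 obtain t where "slope t \<in> E" "t * slope t - (P t - P 0) <= P 0 - Ph.ent nu - mphi nu"
  by (rule outside_slope[OF sg nu(1,2) E], rule that)
 then show ?thesis using nu(3) by (intro that[of t]) auto
qed

lemma scaled_log:
 fixes n :: nat
 assumes "n >= 1" "m > 0"
 shows "ereal (1 / n) * log_ereal m = ereal (ln m / n)"
 using assms by (simp add: log_ereal_def)

lemma upper_bound:
 assumes F: "closed F"
 shows "limsup (%n. ereal (1 / real n) * log_ereal (measure (mu 0) {x \<in> X. Ps n x / real n \<in> F}))
   <= - (INF s\<in>F. rate_function al d f X Ph Ps s)" (is "limsup ?l <= - ?I")
proof (rule ccontr)
 assume "\<not> ?thesis"
 then obtain z where z: "- ?I < ereal z" "ereal z < limsup ?l" using ereal_dense2 by (meson not_le)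
 then have zI: "ereal (- z) < ?I" using ereal_uminus_less_reorder[of ?I "ereal z"] by simp
 have "\<exists>w. w * b - (P w - P 0) > - z" if b: "b \<in> F" for b
 proof (rule ccontr)
  assume "\<not> ?thesis"
  then have "rate_function al d f X Ph Ps b <= ereal (- z)" by (intro rate_le_legendre) (auto simp: not_less)
  moreover have "?I <= rate_function al d f X Ph Ps b" using b by (rule INF_lower)
  ultimately show False using zI by (meson leD order_trans)
 qed
 from ldp_upper[OF F this] obtain D where D: "D > 0" "!!n. n >= 1 ==> measure (mu 0) {x \<in> X. Ps n x / n \<in> F} <= D * exp (- (n * - z))"
  by blast
 have "?l n <= ereal (ln D / n + z)" if n: "n >= 1" for n
 proof (cases "measure (mu 0) {x \<in> X. Ps n x / n \<in> F} = 0")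
  case True then show ?thesis using n by (simp add: log_ereal_def)
 next
  case False
  let ?m = "measure (mu 0) {x \<in> X. Ps n x / n \<in> F}"
  have m: "?m > 0" using False measure_nonneg[of "mu 0" "{x \<in> X. Ps n x / n \<in> F}"] by linarith
  have "ln ?m <= ln (D * exp (- (n * - z)))" using D(2)[OF n] m by (intro ln_mono) (use D(1) in auto)
  also have "\<dots> = ln D + n * z" using D(1) by (simp add: ln_mult)
  finally have "ln ?m / n <= ln D / n + z" using n by (simp add: field_simps)
  then show ?thesis unfolding scaled_log[OF n m] by simp
 qed
 then have "limsup ?l <= limsup (%n. ereal (ln D / n + z))"
  by (intro Limsup_mono) (auto simp: eventually_sequentially intro!: exI[of _ 1])
 also have "\<dots> = ereal z"
 proof (rule lim_imp_Limsup)
  have "(%n. ln D / real n + z) \<longlonglongrightarrow> 0 + z" by (intro tendsto_intros lim_const_over_n)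
  then show "(%n. ereal (ln D / real n + z)) \<longlonglongrightarrow> ereal z" by simp
 qed simp
 finally show False using z(2) by simp
qed

lemma lower_bound:
 assumes E: "open E"
 shows "- (INF s\<in>E. rate_function al d f X Ph Ps s)
   <= liminf (%n. ereal (1 / real n) * log_ereal (measure (mu 0) {x \<in> X. Ps n x / real n \<in> E}))" (is "- ?I <= liminf ?l")
proof (rule ccontr)
 assume "\<not> ?thesis"
 then obtain z where z: "liminf ?l < ereal z" "ereal z < - ?I" using ereal_dense2 by (meson not_le)
 then have "?I < ereal (- z)" using ereal_less_uminus_reorder[of "ereal z" ?I] by simp
 then obtain s where s: "s \<in> E" "rate_function al d f X Ph Ps s < ereal (- z)" by (auto simp: INF_less_iff)
 obtain t where t: "slope t \<in> E" "t * slope t - (P t - P 0) < - z" by (rule rate_less_slope[OF E s])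
 have "\<forall>\<^sub>F n in sequentially. ereal z <= ?l n"
  using ldp_lower[OF E t] eventually_ge_at_top[of 1]
 proof eventually_elim
  case (elim n)
  let ?m = "measure (mu 0) {x \<in> X. Ps n x / n \<in> E}"
  have m: "?m > 0" using elim(1) exp_gt_zero less_le_trans by blast
  have "ln (exp (- (n * - z))) <= ln ?m" using elim(1) m by (intro ln_mono) auto
  then have "z <= ln ?m / n" using elim(2) by (simp add: field_simps)
  then show ?case unfolding scaled_log[OF elim(2) m] by simp
 qed
 from Liminf_bounded[OF this] show False using z(1) by simp
qed

end

text \<open>The conclusion holds for all larger constants and smaller scales, so that the two given
  sequences can be placed in one setting with common parameters.\<close>

lemma (in expanding_map) almost_additive_potential:
 assumes aa: "almost_additive f X Ph"
  and dis: "!!n x y. n >= 1 ==> x \<in> X ==> y \<in> X ==> (\<forall>j\<le>n. rh ((f ^^ j) x) ((f ^^ j) y) <= r) ==> \<bar>Ph n x - Ph n y\<bar> <= K"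
  and K: "K > 0"
 obtains C B where "!!ep C' K' B'. 0 < ep ==> ep <= r ==> 2 * ep <= e0 ==> C <= C' ==> K <= K' ==> B <= B' ==> potential X rh f e0 Ph ep C' K' B'"
proof -
 obtain C where C: "C > 0" "!!m n x. m >= 1 ==> n >= 1 ==> x \<in> X ==>
   Ph m x + Ph n ((f ^^ m) x) - C <= Ph (m + n) x \<and> Ph (m + n) x <= Ph m x + Ph n ((f ^^ m) x) + C"
  and cont: "!!n. n >= 1 ==> continuous_on X (Ph n)"
  using aa unfolding almost_additive_def by blast
 obtain M where M: "!!x. x \<in> X ==> \<bar>Ph 1 x\<bar> <= M" using continuous_bounded[OF cont[of 1]] by auto
 obtain x0 where "x0 \<in> X" using X_nonempty by blast
 then have M0: "M >= 0" using M abs_ge_zero order_trans by blast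
 have bd: "\<bar>Ph (Suc n) x\<bar> <= Suc n * (M + C)" if "x \<in> X" for n x
  using that
 proof (induction n arbitrary: x)
  case 0 then show ?case using M[of x] C(1) by simp
 next
  case (Suc n)
  have "\<bar>Ph (Suc n) (f x)\<bar> <= Suc n * (M + C)" using Suc.IH[of "f x"] Suc.prems f_onto by blast
  then have "\<bar>Ph (1 + Suc n) x\<bar> <= M + C + Suc n * (M + C)"
   using C(2)[of 1 "Suc n" x] M[OF Suc.prems] Suc.prems unfolding abs_le_iff by simp
  then show ?case by (simp add: algebra_simps)
 qed
 show ?thesis
 proof (rule that[of C "M + C"])
  fix ep C' K' B' :: real
  assume h: "0 < ep" "ep <= r" "2 * ep <= e0" "C <= C'" "K <= K'" "M + C <= B'"
  show "potential X rh f e0 Ph ep C' K' B'"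
  proof
   show "\<bar>Ph (m + n) x - Ph m x - Ph n ((f ^^ m) x)\<bar> <= C'" if "m >= 1" "n >= 1" "x \<in> X" for m n x
    using C(2)[OF that] h(4) by (simp add: abs_le_iff)
   show "\<bar>Ph n x - Ph n y\<bar> <= K'" if "n >= 1" "x \<in> X" "y \<in> bowen x n ep" for n x y
   proof -
    have "y \<in> X" "\<forall>j\<le>n. rh ((f ^^ j) x) ((f ^^ j) y) <= r" using that(3) h(2) by (auto simp: bowen_def intro: order_trans)
    from dis[OF that(1,2) this] show ?thesis using h(5) by linarith
   qed
   show "\<bar>Ph n x\<bar> <= n * B'" if "n >= 1" "x \<in> X" for n x
   proof -
    obtain k where k: "n = Suc k" using \<open>n >= 1\<close> by (cases n) auto
    have "n * (M + C) <= n * B'" using h(6) by (intro mult_left_mono) auto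
    then show ?thesis using bd[OF that(2), of k, folded k] by linarith
   qed
  qed (use h cont C(1) K M0 in auto)
 qed
qed

theorem corollary1:
  fixes A :: "('m::{t2_space, second_countable_topology}, 'e::euclidean_space) chart set"
    and g :: "('m, 'e) chart \<Rightarrow> 'm \<Rightarrow> 'e \<Rightarrow> 'e \<Rightarrow> real"
    and f :: "'m \<Rightarrow> 'm"
    and \<Lambda> :: "'m set"
    and \<Phi> \<Psi> :: "nat \<Rightarrow> 'm \<Rightarrow> real"
    and \<alpha> :: real
  assumes "riemannian_manifold A g"
    and "C1_map A f"
    and "isolated_repeller A g f \<Lambda>"
    and "topologically_mixing_on \<Lambda> f"
    and "almost_additive f \<Lambda> \<Phi>"
    and "bounded_distortion (riemannian_dist A g) f \<Lambda> \<Phi>"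
    and "almost_additive f \<Lambda> \<Psi>"
    and "bounded_distortion (riemannian_dist A g) f \<Lambda> \<Psi>"
    and "0 < \<alpha>" and "\<alpha> < 1"
  shows "(\<forall>F::real set. closed F \<longrightarrow>
            limsup (\<lambda>n. ereal (1 / real n) *
                log_ereal (measure (the_equilibrium_state f \<Lambda> \<Phi>) {x\<in>\<Lambda>. \<Psi> n x / real n \<in> F}))
              \<le> - (INF s\<in>F. rate_function \<alpha> (riemannian_dist A g) f \<Lambda> \<Phi> \<Psi> s))
       \<and> (\<forall>E::real set. open E \<longrightarrow>
            liminf (\<lambda>n. ereal (1 / real n) *
                log_ereal (measure (the_equilibrium_state f \<Lambda> \<Phi>) {x\<in>\<Lambda>. \<Psi> n x / real n \<in> E}))
              \<ge> - (INF s\<in>E. rate_function \<alpha> (riemannian_dist A g) f \<Lambda> \<Phi> \<Psi> s))"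
proof -
  interpret riemannian_manifold A g by (rule assms(1))
  note rep = repellerD[OF assms(3)]
  obtain U where U: "finite U" "\<And>u. u \<in> U \<Longrightarrow> lipschitz_function u"
    "\<And>y z. y \<in> \<Lambda> \<Longrightarrow> (\<And>u. u \<in> U \<Longrightarrow> u y = u z) \<Longrightarrow> y = z"
    by (rule separating_family[OF rep(2)]) (use that in blast)
  define \<rho> where "\<rho> x y = (\<Sum>u\<in>U. \<bar>u x - u y\<bar>)" for x y
  have \<rho>: "compact_metric \<Lambda> \<rho>"
    unfolding \<rho>_def[abs_def] using U(2,3)
    by (intro separating_compact_metric[OF rep(2,1) U(1)]) (auto simp: lipschitz_function_def)
  obtain e0 where em: "expanding_map \<Lambda> \<rho> f e0" by (rule repeller_expanding_map[OF assms(2-4) \<rho>])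
  interpret expanding_map \<Lambda> \<rho> f e0 by (rule em)
  obtain K1 r1 where d1: "K1 > 0" "r1 > 0" "\<And>n x y. n \<ge> 1 \<Longrightarrow> x \<in> \<Lambda> \<Longrightarrow> y \<in> \<Lambda> \<Longrightarrow>
      (\<forall>j\<le>n. \<rho> ((f ^^ j) x) ((f ^^ j) y) \<le> r1) \<Longrightarrow> \<bar>\<Phi> n x - \<Phi> n y\<bar> \<le> K1"
    by (rule distortion_rho[OF \<rho> rep(3) assms(6)], rule that)
  obtain K2 r2 where d2: "K2 > 0" "r2 > 0" "\<And>n x y. n \<ge> 1 \<Longrightarrow> x \<in> \<Lambda> \<Longrightarrow> y \<in> \<Lambda> \<Longrightarrow>
      (\<forall>j\<le>n. \<rho> ((f ^^ j) x) ((f ^^ j) y) \<le> r2) \<Longrightarrow> \<bar>\<Psi> n x - \<Psi> n y\<bar> \<le> K2"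
    by (rule distortion_rho[OF \<rho> rep(3) assms(8)], rule that)
  obtain C1 B1 where p1: "\<And>\<epsilon> C' K' B'. 0 < \<epsilon> \<Longrightarrow> \<epsilon> \<le> r1 \<Longrightarrow> 2 * \<epsilon> \<le> e0 \<Longrightarrow> C1 \<le> C' \<Longrightarrow> K1 \<le> K' \<Longrightarrow> B1 \<le> B' \<Longrightarrow>
      potential \<Lambda> \<rho> f e0 \<Phi> \<epsilon> C' K' B'"
    by (rule almost_additive_potential[OF assms(5) d1(3) d1(1)], assumption+, rule that)
  obtain C2 B2 where p2: "\<And>\<epsilon> C' K' B'. 0 < \<epsilon> \<Longrightarrow> \<epsilon> \<le> r2 \<Longrightarrow> 2 * \<epsilon> \<le> e0 \<Longrightarrow> C2 \<le> C' \<Longrightarrow> K2 \<le> K' \<Longrightarrow> B2 \<le> B' \<Longrightarrow>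
      potential \<Lambda> \<rho> f e0 \<Psi> \<epsilon> C' K' B'"
    by (rule almost_additive_potential[OF assms(7) d2(3) d2(1)], assumption+, rule that)
  define \<epsilon> where "\<epsilon> = min (e0 / 2) (min r1 r2)"
  have \<epsilon>: "0 < \<epsilon>" "\<epsilon> \<le> r1" "\<epsilon> \<le> r2" "2 * \<epsilon> \<le> e0" using e0_pos d1(2) d2(2) by (auto simp: \<epsilon>_def)
  have tp: "two_potentials \<Lambda> \<rho> f e0 \<Phi> \<Psi> \<epsilon> (max C1 C2) (max K1 K2) (max B1 B2)"
    unfolding two_potentials_def using p1[OF \<epsilon>(1,2,4)] p2[OF \<epsilon>(1,3,4)] by simp
  obtain P \<mu> where "\<forall>t. gibbs (\<epsilon> / 2) (seq_comb \<Phi> t \<Psi>) (P t) (\<mu> t)"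
    using two_potentials.gibbs_family_exists[OF tp] by blast
  then have gf: "gibbs_family \<Lambda> \<rho> f e0 \<Phi> \<Psi> \<epsilon> (max C1 C2) (max K1 K2) (max B1 B2) P \<mu>"
    using tp by (simp add: gibbs_family_def gibbs_family_axioms_def)
  have hs: "holder_setting \<Lambda> \<rho> f e0 \<Phi> \<Psi> \<epsilon> (max C1 C2) (max K1 K2) (max B1 B2) P \<mu> (riemannian_dist A g) \<alpha>"
    unfolding holder_setting_def holder_setting_axioms_def
    using gf holder_continuous[OF _ assms(9)] holder_dense[OF rep(2) assms(9,10)] by blast
  have "the_equilibrium_state f \<Lambda> \<Phi> = \<mu> 0"
    using gibbs_family.the_equilibrium_t[OF gf, of 0] by (simp only: gibbs_family.comb_0[OF gf])
  then show ?thesis using holder_setting.upper_bound[OF hs] holder_setting.lower_bound[OF hs] by simp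
qed

end
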